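(* There are a number $k\in\mathbb{Z}_+$, a continuously invertible operator $U=I+W\in B(\mathcal{H})$ with $W\in\mathfrak{S}_2(\mathcal{H},\mathcal{P})$, and an operator $V_0\in\mathfrak{S}_2(\mathcal{H},\mathcal{P})$ for which the subspaces $\mathcal{H}_{(k)}$ and $\mathcal{H}_\ell$, $|\ell|>k$, are invariant, such that $L$ is similar to $L_0-V_0$ with $LU=U(L_0-V_0)$ and $$\sigma(L)=\sigma_{(k)}\cup\Big(\bigcup_{|\ell|>k}\Big(\Big\{\frac{i2\pi\ell}{\omega}\Big\}+\sigma_\ell\Big)\Big),$$ where $\sigma_\ell=\sigma(V_{0,\ell})$ is the spectrum of the restriction $V_{0,\ell}$ of $V_0$ to $\mathcal{H}_\ell$, $|\ell|>k$, and $\sigma_{(k)}$ is the spectrum of the restriction of $L_0-V_0$ to $\mathcal{H}_{(k)}$, and such that the following holds. Let $\widetilde{P}_{(k)}=P(\sigma_{(k)},L)$ and $\widetilde{P}_\ell=P(\{\frac{i2\pi\ell}{\omega}\}+\sigma_\ell,L)$, $|\ell|>k$, be the spectral projections of $L$ corresponding to the sets $\sigma_{(k)}$ and $\{\frac{i2\pi\ell}{\omega}\}+\sigma_\ell$, $|\ell|>k$, respectively. Then $$\lim_{n\to\infty}\Big\|\widetilde{P}_{(k)}+\sum_{k<|\ell|\le n}\widetilde{P}_\ell-P_{(k)}-\sum_{k<|\ell|\le n}P_\ell\Big\|_{2,\mathcal{P}}=0.$$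
   Context: Setting. Let $\omega>0$, let $H$ be a complex Hilbert space, and let $\mathcal{H}=L^2=L^2([0,\omega],H)$ with inner product $\langle x,y\rangle=\frac1\omega\int_0^\omega\langle x(s),y(s)\rangle_H\,ds$. $W_2^1$ is the Sobolev space of continuous functions in $L^2$ with derivative in $L^2$. Let $\mathcal{V}:[0,\omega]\to B(H)$ be strongly measurable with $s\mapsto\mathcal{V}(s)x$ in $L^2$ for every $x\in H$, and let $\widehat{\mathcal{V}}(n)x=\frac1\omega\int_0^\omega\mathcal{V}(s)x\,e^{-i2\pi ns/\omega}ds$, $n\in\mathbb{Z}$. Assume $\sum_{n\in\mathbb{Z}}\|\widehat{\mathcal{V}}(n)\|^2<\infty$ and $\sum_{j,\ell\in\mathbb{Z}}\big\|\sum_{n\neq\ell}\frac{\widehat{\mathcal{V}}(j+n)\widehat{\mathcal{V}}(\ell+n)}{\ell-n}\big\|^2<\infty$. Let $L_0=\frac{d}{ds}$ with domain $D(L_0)=\{y\in W_2^1: y(0)=y(\omega)\}$, $(Vy)(s)=\mathcal{V}(s)y(\omega-s)$ for $y\in D(L_0)$, and $L=L_0-V$ with $D(L)=D(L_0)$. Projections. For $\ell\in\mathbb{Z}$ let $(P_\ell x)(s)=\widehat{x}(\ell)e^{i2\pi\ell s/\omega}$, $\widehat{x}(\ell)=\frac1\omega\int_0^\omega x(\tau)e^{-i2\pi\ell\tau/\omega}d\tau$ (the spectral projections of $L_0$), $\mathcal{H}_\ell=\mathrm{Im}\,P_\ell$, $\mathcal{P}=\{P_\ell:\ell\in\mathbb{Z}\}$,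 and for $m\in\mathbb{Z}_+=\mathbb{N}\cup\{0\}$ let $P_{(m)}=\sum_{|\ell|\le m}P_\ell$, $\mathcal{H}_{(m)}=\mathrm{Im}\,P_{(m)}$. $\mathfrak{S}_2(\mathcal{H},\mathcal{P})$ is the set of $X\in B(\mathcal{H})$ with $\|X\|_{2,\mathcal{P}}^2=\sum_{j,\ell\in\mathbb{Z}}\|P_jXP_\ell\|^2<\infty$ (operator norms inside the sum). Similarity of $L$ and $L_0-V_0$ with $LU=U(L_0-V_0)$ means that $U$ is continuously invertible, $UD(L_0-V_0)=D(L)$ and $LUx=U(L_0-V_0)x$ for $x\in D(L_0-V_0)=D(L_0)$.
   Formalization: The sets {i2πℓ/ω}+σ_ℓ, in the formula for σ(L) and in the spectral projections, are replaced by {i2πℓ/ω − μ : μ∈σ_ℓ}, since L is similar to L_0−V_0; with the plus sign the claim fails, e.g. for H=ℂ and 𝒱 a nonzero constant. *)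

theory Defs
  imports "HOL-Complex_Analysis.Complex_Analysis"
begin

section \<open>Complex Hilbert spaces\<close>

class complex_hilbert = banach +
  fixes scaleC :: "complex \<Rightarrow> 'a \<Rightarrow> 'a"  (infixr \<open>*\<^sub>C\<close> 75)
    and cinner :: "'a \<Rightarrow> 'a \<Rightarrow> complex"
  assumes scaleC_add_right: "c *\<^sub>C (x + y) = c *\<^sub>C x + c *\<^sub>C y"
    and scaleC_add_left: "(c + d) *\<^sub>C x = c *\<^sub>C x + d *\<^sub>C x"
    and scaleC_scaleC: "c *\<^sub>C (d *\<^sub>C x) = (c * d) *\<^sub>C x"
    and scaleC_of_real: "complex_of_real r *\<^sub>C x = r *\<^sub>R x"
    and cinner_commute: "cinner x y = cnj (cinner y x)"
    and cinner_add_left: "cinner (x + y) z = cinner x z + cinner y z"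
    and cinner_scaleC_left: "cinner (c *\<^sub>C x) y = c * cinner x y"
    and norm_eq_sqrt_cinner: "norm x = sqrt (Re (cinner x x))"

instantiation complex :: complex_hilbert
begin
definition scaleC_complex :: "complex \<Rightarrow> complex \<Rightarrow> complex" where "scaleC_complex c x = c * x"
definition cinner_complex :: "complex \<Rightarrow> complex \<Rightarrow> complex" where "cinner_complex x y = x * cnj y"
instance
  by standard
    (auto simp: scaleC_complex_def cinner_complex_def algebra_simps scaleR_conv_of_real
        cmod_def power2_eq_square)
end

definition complex_homogeneous :: "('a::complex_hilbert \<Rightarrow> 'a) \<Rightarrow> bool" where
  "complex_homogeneous f \<longleftrightarrow> (\<forall>c x. f (c *\<^sub>C x) = c *\<^sub>C f x)"


section \<open>The space \<open>L\<^sup>2([0,\<omega>],H)\<close>\<close>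

text \<open>
  Elements of \<open>L\<^sup>2\<close> are represented by functions on the real line whose values outside
  \<open>{0..\<omega>}\<close> are irrelevant; equality in \<open>L\<^sup>2\<close> is \<open>L2_eq\<close>.  The predicate \<open>measurable_on\<close>
  (a.e. limit of continuous functions) is strong measurability, and for \<open>H\<close>-valued
  functions the gauge integral extends the Bochner integral, so that no separability
  of \<open>H\<close> is needed.  All notions below (subspaces, operators, graphs) respect \<open>L2_eq\<close>.
\<close>

definition L2 :: "real \<Rightarrow> (real \<Rightarrow> 'h::complex_hilbert) set" where
  "L2 \<omega> = {f. f measurable_on {0..\<omega>} \<and> (\<lambda>s. (norm (f s))\<^sup>2) integrable_on {0..\<omega>}}"

definition L2_eq :: "real \<Rightarrow> (real \<Rightarrow> 'h::complex_hilbert) \<Rightarrow> (real \<Rightarrow> 'h) \<Rightarrow> bool" where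
  "L2_eq \<omega> f g \<longleftrightarrow> negligible {s \<in> {0..\<omega>}. f s \<noteq> g s}"

definition L2_inner :: "real \<Rightarrow> (real \<Rightarrow> 'h::complex_hilbert) \<Rightarrow> (real \<Rightarrow> 'h) \<Rightarrow> complex" where
  "L2_inner \<omega> f g = (1 / \<omega>) *\<^sub>R integral {0..\<omega>} (\<lambda>s. cinner (f s) (g s))"

definition L2_norm :: "real \<Rightarrow> (real \<Rightarrow> 'h::complex_hilbert) \<Rightarrow> real" where
  "L2_norm \<omega> f = sqrt (Re (L2_inner \<omega> f f))"


section \<open>Bounded operators on (subspaces of) \<open>L\<^sup>2\<close>\<close>

type_synonym 'h op = "(real \<Rightarrow> 'h) \<Rightarrow> (real \<Rightarrow> 'h)"

text \<open>
  \<open>E\<close> is a linear subspace of \<open>L2 \<omega>\<close> closed under \<open>L2_eq\<close>.  Linearity and boundedness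
  imply that the operator respects \<open>L2_eq\<close>.
\<close>

definition bounded_op :: "real \<Rightarrow> (real \<Rightarrow> 'h::complex_hilbert) set \<Rightarrow> 'h op \<Rightarrow> bool" where
  "bounded_op \<omega> E A \<longleftrightarrow>
     (\<forall>f\<in>E. A f \<in> E) \<and>
     (\<forall>f\<in>E. \<forall>g\<in>E. L2_eq \<omega> (A (\<lambda>s. f s + g s)) (\<lambda>s. A f s + A g s)) \<and>
     (\<forall>c. \<forall>f\<in>E. L2_eq \<omega> (A (\<lambda>s. c *\<^sub>C f s)) (\<lambda>s. c *\<^sub>C A f s)) \<and>
     (\<exists>C. \<forall>f\<in>E. L2_norm \<omega> (A f) \<le> C * L2_norm \<omega> f)"

definition op_norm :: "real \<Rightarrow> 'h::complex_hilbert op \<Rightarrow> real" where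
  "op_norm \<omega> A = (SUP f\<in>{f \<in> L2 \<omega>. L2_norm \<omega> f \<le> 1}. L2_norm \<omega> (A f))"

definition continuously_invertible :: "real \<Rightarrow> 'h::complex_hilbert op \<Rightarrow> bool" where
  "continuously_invertible \<omega> U \<longleftrightarrow> bounded_op \<omega> (L2 \<omega>) U \<and>
     (\<exists>U'. bounded_op \<omega> (L2 \<omega>) U' \<and>
        (\<forall>f\<in>L2 \<omega>. L2_eq \<omega> (U' (U f)) f \<and> L2_eq \<omega> (U (U' f)) f))"

definition L2_image :: "real \<Rightarrow> 'h::complex_hilbert op \<Rightarrow> (real \<Rightarrow> 'h) set \<Rightarrow> (real \<Rightarrow> 'h) set" where
  "L2_image \<omega> A E = {f \<in> L2 \<omega>. \<exists>x\<in>E. L2_eq \<omega> f (A x)}"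

definition invariant_subspace :: "'h op \<Rightarrow> (real \<Rightarrow> 'h) set \<Rightarrow> bool" where
  "invariant_subspace A E \<longleftrightarrow> (\<forall>f\<in>E. A f \<in> E)"


section \<open>Unbounded operators, spectrum and spectral projections\<close>

text \<open>
  An unbounded operator in \<open>L\<^sup>2\<close> is given by its graph, a set of pairs closed under
  \<open>L2_eq\<close> in both components; its domain is the \<open>Domain\<close> of the graph.
\<close>

type_synonym 'h graph = "((real \<Rightarrow> 'h) \<times> (real \<Rightarrow> 'h)) set"

definition op_graph :: "real \<Rightarrow> 'h::complex_hilbert op \<Rightarrow> 'h graph" where
  "op_graph \<omega> A = {(x, z). x \<in> L2 \<omega> \<and> z \<in> L2 \<omega> \<and> L2_eq \<omega> z (A x)}"

definition graph_diff :: "real \<Rightarrow> 'h::complex_hilbert graph \<Rightarrow> 'h graph \<Rightarrow> 'h graph" where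
  "graph_diff \<omega> S T =
     {(x, z). z \<in> L2 \<omega> \<and> (\<exists>a b. (x, a) \<in> S \<and> (x, b) \<in> T \<and> L2_eq \<omega> z (\<lambda>s. a s - b s))}"

definition restriction :: "'h graph \<Rightarrow> (real \<Rightarrow> 'h) set \<Rightarrow> 'h graph" where
  "restriction T E = T \<inter> (E \<times> E)"

text \<open>\<open>is_resolvent \<omega> E T z R\<close>: \<open>R\<close> is the bounded inverse of \<open>z I - T\<close> in the space \<open>E\<close>.\<close>

definition is_resolvent ::
  "real \<Rightarrow> (real \<Rightarrow> 'h::complex_hilbert) set \<Rightarrow> 'h graph \<Rightarrow> complex \<Rightarrow> 'h op \<Rightarrow> bool" where
  "is_resolvent \<omega> E T z R \<longleftrightarrow> bounded_op \<omega> E R \<and>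
     (\<forall>f\<in>E. (R f, \<lambda>s. z *\<^sub>C R f s - f s) \<in> T) \<and>
     (\<forall>(x, y)\<in>T. L2_eq \<omega> (R (\<lambda>s. z *\<^sub>C x s - y s)) x)"

definition spectrum :: "real \<Rightarrow> (real \<Rightarrow> 'h::complex_hilbert) set \<Rightarrow> 'h graph \<Rightarrow> complex set" where
  "spectrum \<omega> E T = {z. \<nexists>R. is_resolvent \<omega> E T z R}"

text \<open>
  \<open>Q = P(\<Delta>,T)\<close>, the Riesz projection of \<open>T\<close> for a compact isolated part \<open>\<Delta>\<close> of its spectrum:
  \<open>Q = (2\<pi>i)\<^sup>-\<^sup>1 \<integral> (z I - T)\<^sup>-\<^sup>1 dz\<close> over a cycle (a finite list of closed paths) in the resolvent
  set that winds once around \<open>\<Delta>\<close> and does not wind around the rest of the spectrum.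
  By Cauchy's theorem the choice of the cycle is immaterial.  The integral is taken
  weakly; it agrees with the norm integral because the resolvent is norm holomorphic.
\<close>

definition is_spectral_projection ::
  "real \<Rightarrow> 'h::complex_hilbert graph \<Rightarrow> complex set \<Rightarrow> 'h op \<Rightarrow> bool" where
  "is_spectral_projection \<omega> T \<Delta> Q \<longleftrightarrow>
     bounded_op \<omega> (L2 \<omega>) Q \<and>
     \<Delta> \<subseteq> spectrum \<omega> (L2 \<omega>) T \<and> compact \<Delta> \<and> closed (spectrum \<omega> (L2 \<omega>) T - \<Delta>) \<and>
     (\<exists>\<Gamma> R.
        (\<forall>\<gamma>\<in>set \<Gamma>. valid_path \<gamma> \<and> pathfinish \<gamma> = pathstart \<gamma> \<and>
            (\<forall>z\<in>path_image \<gamma>. is_resolvent \<omega> (L2 \<omega>) T z (R z))) \<and>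
        (\<forall>z\<in>\<Delta>. (\<Sum>\<gamma>\<leftarrow>\<Gamma>. winding_number \<gamma> z) = 1) \<and>
        (\<forall>z\<in>spectrum \<omega> (L2 \<omega>) T - \<Delta>. (\<Sum>\<gamma>\<leftarrow>\<Gamma>. winding_number \<gamma> z) = 0) \<and>
        (\<forall>f\<in>L2 \<omega>. \<forall>g\<in>L2 \<omega>. L2_inner \<omega> (Q f) g =
            1 / (2 * of_real pi * \<i>) *
              (\<Sum>\<gamma>\<leftarrow>\<Gamma>. contour_integral \<gamma> (\<lambda>z. L2_inner \<omega> (R z f) g))))"

text \<open>\<open>A U = U B\<close> with \<open>U D(B) = D(A)\<close>.\<close>

definition similar_via :: "real \<Rightarrow> 'h::complex_hilbert graph \<Rightarrow> 'h graph \<Rightarrow> 'h op \<Rightarrow> bool" where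
  "similar_via \<omega> A B U \<longleftrightarrow> continuously_invertible \<omega> U \<and>
     L2_image \<omega> U (Domain B) = Domain A \<and>
     (\<forall>(x, y)\<in>B. (U x, U y) \<in> A)"


section \<open>Fourier projections and the ideal \<open>S\<^sub>2(\<H>,\<P>)\<close>\<close>

definition fourier_coeff :: "real \<Rightarrow> (real \<Rightarrow> 'h::complex_hilbert) \<Rightarrow> int \<Rightarrow> 'h" where
  "fourier_coeff \<omega> x n =
     (1 / \<omega>) *\<^sub>R integral {0..\<omega>}
       (\<lambda>s. exp (- \<i> * of_real (2 * pi * of_int n * s / \<omega>)) *\<^sub>C x s)"

definition P_one :: "real \<Rightarrow> int \<Rightarrow> 'h::complex_hilbert op" where
  "P_one \<omega> l x = (\<lambda>s. exp (\<i> * of_real (2 * pi * of_int l * s / \<omega>)) *\<^sub>C fourier_coeff \<omega> x l)"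

definition P_upto :: "real \<Rightarrow> nat \<Rightarrow> 'h::complex_hilbert op" where
  "P_upto \<omega> m x = (\<lambda>s. \<Sum>l | \<bar>l\<bar> \<le> int m. P_one \<omega> l x s)"

definition H_sub :: "real \<Rightarrow> int \<Rightarrow> (real \<Rightarrow> 'h::complex_hilbert) set" where
  "H_sub \<omega> l = L2_image \<omega> (P_one \<omega> l) (L2 \<omega>)"

definition H_upto :: "real \<Rightarrow> nat \<Rightarrow> (real \<Rightarrow> 'h::complex_hilbert) set" where
  "H_upto \<omega> m = L2_image \<omega> (P_upto \<omega> m) (L2 \<omega>)"

definition S2 :: "real \<Rightarrow> 'h::complex_hilbert op set" where
  "S2 \<omega> = {X. bounded_op \<omega> (L2 \<omega>) X \<and>
     (\<lambda>(j, l). (op_norm \<omega> (P_one \<omega> j \<circ> X \<circ> P_one \<omega> l))\<^sup>2) summable_on UNIV}"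

definition S2_norm :: "real \<Rightarrow> 'h::complex_hilbert op \<Rightarrow> real" where
  "S2_norm \<omega> X = sqrt (\<Sum>\<^sub>\<infinity>(j, l). (op_norm \<omega> (P_one \<omega> j \<circ> X \<circ> P_one \<omega> l))\<^sup>2)"


section \<open>The differential operator with an involution\<close>

text \<open>
  \<open>W21 \<omega> y y'\<close>: \<open>y\<close> is (the continuous representative of) an element of \<open>W\<^sub>2\<^sup>1\<close> with
  derivative \<open>y'\<close> in \<open>L\<^sup>2\<close>, i.e. an indefinite integral of \<open>y'\<close>.
\<close>

definition W21 :: "real \<Rightarrow> (real \<Rightarrow> 'h::complex_hilbert) \<Rightarrow> (real \<Rightarrow> 'h) \<Rightarrow> bool" where
  "W21 \<omega> y y' \<longleftrightarrow> continuous_on {0..\<omega>} y \<and> y' \<in> L2 \<omega> \<and>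
     (\<forall>t\<in>{0..\<omega>}. (y' has_integral (y t - y 0)) {0..t})"

definition L0_graph :: "real \<Rightarrow> 'h::complex_hilbert graph" where
  "L0_graph \<omega> = {(x, z). x \<in> L2 \<omega> \<and> z \<in> L2 \<omega> \<and>
     (\<exists>y y'. W21 \<omega> y y' \<and> y 0 = y \<omega> \<and> L2_eq \<omega> x y \<and> L2_eq \<omega> z y')}"

definition V_graph :: "real \<Rightarrow> (real \<Rightarrow> 'h::complex_hilbert \<Rightarrow>\<^sub>L 'h) \<Rightarrow> 'h graph" where
  "V_graph \<omega> V = {(x, z). x \<in> L2 \<omega> \<and> z \<in> L2 \<omega> \<and>
     (\<exists>y y'. W21 \<omega> y y' \<and> y 0 = y \<omega> \<and> L2_eq \<omega> x y \<and>
        L2_eq \<omega> z (\<lambda>s. blinfun_apply (V s) (y (\<omega> - s))))}"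

definition L_graph :: "real \<Rightarrow> (real \<Rightarrow> 'h::complex_hilbert \<Rightarrow>\<^sub>L 'h) \<Rightarrow> 'h graph" where
  "L_graph \<omega> V = graph_diff \<omega> (L0_graph \<omega>) (V_graph \<omega> V)"

text \<open>
  \<open>Blinfun\<close> is applied to a map that is bounded, by the closed graph theorem, as soon as
  \<open>s \<mapsto> V s x\<close> is in \<open>L\<^sup>2\<close> for every \<open>x\<close>.
\<close>

definition V_hat :: "real \<Rightarrow> (real \<Rightarrow> 'h::complex_hilbert \<Rightarrow>\<^sub>L 'h) \<Rightarrow> int \<Rightarrow> 'h \<Rightarrow>\<^sub>L 'h" where
  "V_hat \<omega> V n = Blinfun (\<lambda>x. fourier_coeff \<omega> (\<lambda>s. blinfun_apply (V s) x) n)"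

end

theory Submission
  imports Defs
begin

text \<open>
  In the basis of exponentials \<open>L\<^sup>2([0,\<omega>],H)\<close> becomes \<open>\<ell>\<^sup>2(\<int>,H)\<close>, the operator \<open>L\<^sub>0\<close> becomes the diagonal
  operator \<open>\<Lambda>\<close> with entries \<open>i \<lambda>\<^sub>j\<close>, \<open>\<lambda>\<^sub>j = 2 \<pi> j / \<omega>\<close>, and \<open>V\<close>, which contains the reflection \<open>s \<mapsto> \<omega> - s\<close>,
  becomes the Hankel matrix with entries \<open>V_hat (j + l)\<close> (\<open>L_graph_eq\<close>).  An operator whose matrix has
  square-summable entries belongs to \<open>\<SS>\<^sub>2\<close>, with norm at most that of the matrix (\<open>S2_matrix\<close>).  The proof
  therefore takes place in the Banach algebra of square-summable operator matrices.

  The Hankel matrix is not square-summable.  But if \<open>\<Gamma>\<close> divides the entries outside the diagonal blocks by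
  \<open>i (\<lambda>\<^sub>j - \<lambda>\<^sub>l)\<close> and kills the others, then \<open>\<Gamma>V\<close> is square-summable because \<open>V_hat\<close> is, and \<open>V\<Gamma>V\<close> is
  square-summable by hypothesis.  Since \<open>\<Lambda>(\<Gamma>V) - (\<Gamma>V)\<Lambda> = V - JV\<close>, where \<open>J\<close> keeps the diagonal blocks,
  conjugation with \<open>I + \<Gamma>V\<close> turns \<open>\<Lambda> - V\<close> into \<open>\<Lambda> - B\<close> with a square-summable \<open>B\<close>
  (\<open>first_similarity\<close>); for a large central block \<open>{j. |j| \<le> k}\<close> the norm of \<open>\<Gamma>V\<close> is less than 1.  A second
  similarity \<open>I + Y\<close>, in which \<open>Y\<close> is the fixed point of a contraction once the central block is large, turns
  \<open>\<Lambda> - B\<close> into \<open>\<Lambda> - D\<close> with \<open>D\<close> block diagonal (\<open>riccati\<close>, \<open>second_similarity\<close>).  Both similarities preserve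
  the domain of \<open>\<Lambda>\<close> (\<open>dom_invariant\<close>), and both have inverses of the form identity plus square-summable
  (\<open>matrix_neumann\<close>).

  The matrix \<open>D\<close> is small compared with the gaps between the blocks.  Hence disjoint discs around the
  blocks contain the spectra of the blocks, the spectrum of \<open>\<Lambda> - D\<close> is their union (\<open>gspec_blocks\<close>), and the
  Riesz integral over the circle of one block is the coordinate projection of that block
  (\<open>block_contour_integral\<close>).  With \<open>I + W = (I + \<Gamma>V)(I + Y)\<close>, the spectral projections of \<open>L\<close> are the conjugates
  of the coordinate projections by \<open>I + W\<close> (\<open>spectral_projection\<close>).  A sum of them differs from the
  corresponding sum \<open>P\<close> of coordinate projections by \<open>(W P - P W) (I + W)\<^sup>-\<^sup>1\<close>.  The entries of the commutator are
  dominated by those of \<open>W\<close>, and each of them vanishes as soon as \<open>P\<close> covers its row and its column, so the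
  difference tends to zero by dominated convergence (\<open>commutator_matrix_tendsto_0\<close>).

  The passage to Fourier coefficients is the other half of the work.  For strongly measurable functions with
  values in \<open>H\<close>, the coefficients determine the function almost everywhere (\<open>zero_coeffs_imp_zero\<close>) and
  every square-summable family occurs (\<open>riesz_fischer\<close>).  Functions in the domain of \<open>L\<^sub>0\<close> have absolutely
  convergent Fourier series, which may be multiplied by the potential term by term
  (\<open>multiplication_coefficients\<close>); Baire's theorem makes the Fourier coefficients of the potential bounded
  operators (\<open>square_mean_bounded\<close>).
\<close>

section \<open>Square-summable families in a Banach space\<close>

text \<open>
  The same type serves for the vectors \<open>\<ell>\<^sup>2(\<int>,H)\<close> (values in \<open>H\<close>) and for the operator matrices
  of \<open>\<SS>\<^sub>2\<close> (index set \<open>\<int> \<times> \<int>\<close>, values in \<open>B(H)\<close>), so that completeness is proved only once.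
\<close>

typedef (overloaded) ('i, 'e::real_normed_vector) ell2 =
  "{x :: 'i \<Rightarrow> 'e. (\<lambda>i. (norm (x i))\<^sup>2) summable_on UNIV}"
  morphisms cf Ell2
  by (rule exI[of _ "\<lambda>_. 0"]) auto

lemma square_summableI:
  fixes x :: "'i \<Rightarrow> 'e::real_normed_vector"
  assumes "\<And>F. finite F \<Longrightarrow> L2_set (\<lambda>i. norm (x i)) F \<le> C"
  shows "(\<lambda>i. (norm (x i))\<^sup>2) summable_on UNIV" "sqrt (\<Sum>\<^sub>\<infinity>i. (norm (x i))\<^sup>2) \<le> C"
proof -
  have C: "C \<ge> 0" using assms[of "{}"] by simp
  have fin: "(\<Sum>i\<in>F. (norm (x i))\<^sup>2) \<le> C\<^sup>2" if "finite F" for F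
    using assms[OF that] C unfolding L2_set_def
    by (metis real_sqrt_le_iff real_sqrt_unique)
  show s: "(\<lambda>i. (norm (x i))\<^sup>2) summable_on UNIV"
    by (rule nonneg_bdd_above_summable_on) (auto intro!: bdd_aboveI[of _ "C\<^sup>2"] fin)
  have "(\<Sum>\<^sub>\<infinity>i. (norm (x i))\<^sup>2) \<le> C\<^sup>2"
    by (rule infsum_le_finite_sums[OF s]) (auto intro: fin)
  then show "sqrt (\<Sum>\<^sub>\<infinity>i. (norm (x i))\<^sup>2) \<le> C"
    using C real_le_lsqrt by (simp add: real_le_lsqrt infsum_nonneg)
qed

lemma L2_set_le_sqrt_infsum:
  fixes x :: "'i \<Rightarrow> 'e::real_normed_vector"
  assumes "(\<lambda>i. (norm (x i))\<^sup>2) summable_on UNIV" "finite F"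
  shows "L2_set (\<lambda>i. norm (x i)) F \<le> sqrt (\<Sum>\<^sub>\<infinity>i. (norm (x i))\<^sup>2)"
  unfolding L2_set_def by (intro real_sqrt_le_mono finite_sum_le_infsum assms) auto

lemma L2_set_norm_triangle:
  fixes x y :: "'i \<Rightarrow> 'e::real_normed_vector"
  shows "L2_set (\<lambda>i. norm (x i + y i)) F \<le> L2_set (\<lambda>i. norm (x i)) F + L2_set (\<lambda>i. norm (y i)) F"
  by (rule order_trans[OF L2_set_mono L2_set_triangle_ineq]) (auto simp: norm_triangle_ineq)

lemma square_summable_add:
  fixes x y :: "'i \<Rightarrow> 'e::real_normed_vector"
  assumes "(\<lambda>i. (norm (x i))\<^sup>2) summable_on UNIV" "(\<lambda>i. (norm (y i))\<^sup>2) summable_on UNIV"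
  shows "(\<lambda>i. (norm (x i + y i))\<^sup>2) summable_on UNIV"
    and "sqrt (\<Sum>\<^sub>\<infinity>i. (norm (x i + y i))\<^sup>2) \<le> sqrt (\<Sum>\<^sub>\<infinity>i. (norm (x i))\<^sup>2) + sqrt (\<Sum>\<^sub>\<infinity>i. (norm (y i))\<^sup>2)"
proof -
  have *: "L2_set (\<lambda>i. norm (x i + y i)) F \<le> sqrt (\<Sum>\<^sub>\<infinity>i. (norm (x i))\<^sup>2) + sqrt (\<Sum>\<^sub>\<infinity>i. (norm (y i))\<^sup>2)"
    if "finite F" for F
    using L2_set_norm_triangle[of x y F] L2_set_le_sqrt_infsum[OF assms(1) that]
      L2_set_le_sqrt_infsum[OF assms(2) that] by linarith
  show "(\<lambda>i. (norm (x i + y i))\<^sup>2) summable_on UNIV"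
    "sqrt (\<Sum>\<^sub>\<infinity>i. (norm (x i + y i))\<^sup>2) \<le> sqrt (\<Sum>\<^sub>\<infinity>i. (norm (x i))\<^sup>2) + sqrt (\<Sum>\<^sub>\<infinity>i. (norm (y i))\<^sup>2)"
    using square_summableI[of "\<lambda>i. x i + y i", OF *] by blast+
qed

lemma square_summable_scaleR:
  fixes x :: "'i \<Rightarrow> 'e::real_normed_vector"
  assumes "(\<lambda>i. (norm (x i))\<^sup>2) summable_on UNIV"
  shows "(\<lambda>i. (norm (r *\<^sub>R x i))\<^sup>2) summable_on UNIV"
  using summable_on_cmult_right[OF assms, of "r\<^sup>2"] by (simp add: power_mult_distrib)

lemma square_summable_diff:
  fixes x y :: "'i \<Rightarrow> 'e::real_normed_vector"
  assumes "(\<lambda>i. (norm (x i))\<^sup>2) summable_on UNIV" "(\<lambda>i. (norm (y i))\<^sup>2) summable_on UNIV"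
  shows "(\<lambda>i. (norm (x i - y i))\<^sup>2) summable_on UNIV"
  using square_summable_add(1)[OF assms(1) square_summable_scaleR[OF assms(2), of "-1"]] by simp

instantiation ell2 :: (type, real_normed_vector) real_normed_vector
begin
definition zero_ell2 :: "('a, 'b) ell2" where "zero_ell2 = Ell2 (\<lambda>_. 0)"
definition plus_ell2 :: "('a, 'b) ell2 \<Rightarrow> ('a, 'b) ell2 \<Rightarrow> ('a, 'b) ell2"
  where "plus_ell2 x y = Ell2 (\<lambda>i. cf x i + cf y i)"
definition minus_ell2 :: "('a, 'b) ell2 \<Rightarrow> ('a, 'b) ell2 \<Rightarrow> ('a, 'b) ell2"
  where "minus_ell2 x y = Ell2 (\<lambda>i. cf x i - cf y i)"
definition uminus_ell2 :: "('a, 'b) ell2 \<Rightarrow> ('a, 'b) ell2"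
  where "uminus_ell2 x = Ell2 (\<lambda>i. - cf x i)"
definition scaleR_ell2 :: "real \<Rightarrow> ('a, 'b) ell2 \<Rightarrow> ('a, 'b) ell2"
  where "scaleR_ell2 r x = Ell2 (\<lambda>i. r *\<^sub>R cf x i)"
definition norm_ell2 :: "('a, 'b) ell2 \<Rightarrow> real"
  where "norm_ell2 x = sqrt (\<Sum>\<^sub>\<infinity>i. (norm (cf x i))\<^sup>2)"
definition dist_ell2 :: "('a, 'b) ell2 \<Rightarrow> ('a, 'b) ell2 \<Rightarrow> real"
  where "dist_ell2 x y = norm (x - y)"
definition sgn_ell2 :: "('a, 'b) ell2 \<Rightarrow> ('a, 'b) ell2"
  where "sgn_ell2 x = scaleR (inverse (norm x)) x"
definition uniformity_ell2 :: "(('a, 'b) ell2 \<times> ('a, 'b) ell2) filter"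
  where "uniformity_ell2 = (INF e\<in>{0<..}. principal {(x, y). dist x y < e})"
definition open_ell2 :: "('a, 'b) ell2 set \<Rightarrow> bool"
  where "open_ell2 U = (\<forall>x\<in>U. eventually (\<lambda>(x', y). x' = x \<longrightarrow> y \<in> U) uniformity)"

lemma cf_square_summable: "(\<lambda>i. (norm (cf (x :: ('a, 'b) ell2) i))\<^sup>2) summable_on UNIV"
  using cf[of x] by simp

lemma cf_Ell2: "(\<lambda>i. (norm (x i))\<^sup>2) summable_on UNIV \<Longrightarrow> cf (Ell2 x :: ('a, 'b) ell2) = x"
  by (simp add: Ell2_inverse)

lemma cf_zero: "cf (0 :: ('a, 'b) ell2) = (\<lambda>_. 0)"
  by (simp add: zero_ell2_def cf_Ell2)
lemma cf_add: "cf (x + y :: ('a, 'b) ell2) = (\<lambda>i. cf x i + cf y i)"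
  unfolding plus_ell2_def by (intro cf_Ell2 square_summable_add cf_square_summable)
lemma cf_diff: "cf (x - y :: ('a, 'b) ell2) = (\<lambda>i. cf x i - cf y i)"
  unfolding minus_ell2_def by (intro cf_Ell2 square_summable_diff cf_square_summable)
lemma cf_uminus: "cf (- x :: ('a, 'b) ell2) = (\<lambda>i. - cf x i)"
  unfolding uminus_ell2_def by (intro cf_Ell2) (simp add: cf_square_summable)
lemma cf_scaleR: "cf (r *\<^sub>R x :: ('a, 'b) ell2) = (\<lambda>i. r *\<^sub>R cf x i)"
  unfolding scaleR_ell2_def by (intro cf_Ell2 square_summable_scaleR cf_square_summable)

instance
proof
  fix x y z :: "('a, 'b) ell2" and a b :: real
  note cfs = cf_add cf_diff cf_uminus cf_scaleR cf_zero
  show "x + y + z = x + (y + z)" "x + y = y + x" "0 + x = x" "- x + x = 0" "x - y = x + - y"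
    "a *\<^sub>R (x + y) = a *\<^sub>R x + a *\<^sub>R y" "(a + b) *\<^sub>R x = a *\<^sub>R x + b *\<^sub>R x"
    "a *\<^sub>R b *\<^sub>R x = (a * b) *\<^sub>R x" "1 *\<^sub>R x = x"
    by (simp_all add: cf_inject[symmetric] cfs algebra_simps)
  show "dist x y = norm (x - y)" by (rule dist_ell2_def)
  show "sgn x = scaleR (inverse (norm x)) x" by (rule sgn_ell2_def)
  show "(uniformity :: (('a, 'b) ell2 \<times> ('a, 'b) ell2) filter)
      = (INF e\<in>{0<..}. principal {(x, y). dist x y < e})" by (rule uniformity_ell2_def)
  show "open U = (\<forall>x\<in>U. eventually (\<lambda>(x', y). x' = x \<longrightarrow> y \<in> U) uniformity)"
    for U :: "('a, 'b) ell2 set" by (rule open_ell2_def)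
  show "norm (x + y) \<le> norm x + norm y"
    unfolding norm_ell2_def cf_add by (intro square_summable_add cf_square_summable)
  show "norm (a *\<^sub>R x) = \<bar>a\<bar> * norm x"
    unfolding norm_ell2_def cf_scaleR
    by (simp add: power_mult_distrib infsum_cmult_right' real_sqrt_mult)
  show "(norm x = 0) = (x = 0)"
  proof
    assume "norm x = 0"
    then have "(norm (cf x i))\<^sup>2 = 0" for i
      unfolding norm_ell2_def
      using nonneg_infsum_le_0D[OF _ cf_square_summable, of x i] by simp
    then show "x = 0" by (simp add: cf_inject[symmetric] cfs fun_eq_iff)
  qed (simp add: norm_ell2_def cf_zero)
qed
end

lemmas cf_simps [simp] = cf_add cf_diff cf_uminus cf_scaleR cf_zero

lemma ell2_eqI: "(\<And>i. cf x i = cf y i) \<Longrightarrow> x = y"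
  by (simp add: cf_inject[symmetric] fun_eq_iff)

lemma L2_set_cf_le: "finite F \<Longrightarrow> L2_set (\<lambda>i. norm (cf x i)) F \<le> norm x"
  unfolding norm_ell2_def by (intro L2_set_le_sqrt_infsum cf_square_summable)

lemma norm_ell2_leI: "(\<And>F. finite F \<Longrightarrow> L2_set (\<lambda>i. norm (cf x i)) F \<le> C) \<Longrightarrow> norm x \<le> C"
  unfolding norm_ell2_def by (intro square_summableI(2))

lemma norm_ell2_square: "(norm x)\<^sup>2 = (\<Sum>\<^sub>\<infinity>i. (norm (cf x i))\<^sup>2)"
  unfolding norm_ell2_def by (simp add: infsum_nonneg)

lemma norm_cf_le: "norm (cf x i) \<le> norm x"
  using L2_set_cf_le[of "{i}" x] by simp

lemma Ell2_bounded:
  assumes "\<And>F. finite F \<Longrightarrow> L2_set (\<lambda>i. norm (x i)) F \<le> C"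
  shows "cf (Ell2 x) = x" "norm (Ell2 x) \<le> C"
proof -
  show *: "cf (Ell2 x) = x" by (intro cf_Ell2 square_summableI[of _ C] assms)
  show "norm (Ell2 x) \<le> C" by (rule norm_ell2_leI) (simp add: * assms)
qed

lemma Ell2_dominated:
  fixes y :: "'i \<Rightarrow> 'e::real_normed_vector" and x :: "('i, 'f::real_normed_vector) ell2"
  assumes "\<And>i. norm (y i) \<le> C * norm (cf x i)"
  shows "cf (Ell2 y) = y" "norm (Ell2 y) \<le> \<bar>C\<bar> * norm x"
proof -
  have *: "L2_set (\<lambda>i. norm (y i)) F \<le> \<bar>C\<bar> * norm x" if "finite F" for F
  proof -
    have "L2_set (\<lambda>i. norm (y i)) F \<le> L2_set (\<lambda>i. \<bar>C\<bar> * norm (cf x i)) F"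
      by (rule L2_set_mono) (auto intro!: order_trans[OF assms] mult_right_mono)
    also have "\<dots> = \<bar>C\<bar> * L2_set (\<lambda>i. norm (cf x i)) F" by (simp add: L2_set_right_distrib)
    also have "\<dots> \<le> \<bar>C\<bar> * norm x" by (intro mult_left_mono L2_set_cf_le that) auto
    finally show ?thesis .
  qed
  show "cf (Ell2 y) = y" "norm (Ell2 y) \<le> \<bar>C\<bar> * norm x" using Ell2_bounded[OF *] by blast+
qed

lemma norm_ell2_mono:
  assumes "\<And>i. norm (cf x i) \<le> norm (cf y i)"
  shows "norm x \<le> norm y"
  using Ell2_dominated(2)[of "cf x" 1 y] assms by (simp add: cf_inverse)

lemma bounded_linear_cf: "bounded_linear (\<lambda>x. cf x i)"
  by (rule bounded_linear_intro[where K = 1]) (auto simp: norm_cf_le)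

lemmas tendsto_cf = bounded_linear.tendsto[OF bounded_linear_cf]

instance ell2 :: (type, banach) banach
proof
  fix X :: "nat \<Rightarrow> ('a, 'b) ell2"
  assume X: "Cauchy X"
  have "Cauchy (\<lambda>n. cf (X n) i)" for i
    by (rule bounded_linear.Cauchy[OF bounded_linear_cf X])
  then have "\<forall>i. \<exists>l. (\<lambda>n. cf (X n) i) \<longlonglongrightarrow> l"
    unfolding Cauchy_convergent_iff convergent_def by blast
  then have "\<exists>L. \<forall>i. (\<lambda>n. cf (X n) i) \<longlonglongrightarrow> L i" by (rule choice)
  then obtain L where L: "\<And>i. (\<lambda>n. cf (X n) i) \<longlonglongrightarrow> L i" by blast
  have close: "\<exists>N. \<forall>n\<ge>N. \<forall>F. finite F \<longrightarrow> L2_set (\<lambda>i. norm (cf (X n) i - L i)) F \<le> e"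
    if e: "e > 0" for e
  proof -
    obtain N where N: "\<And>m n. m \<ge> N \<Longrightarrow> n \<ge> N \<Longrightarrow> norm (X n - X m) < e"
      using CauchyD[OF X e] by blast
    have "L2_set (\<lambda>i. norm (cf (X n) i - L i)) F \<le> e" if "n \<ge> N" "finite F" for n F
    proof (rule tendsto_upperbound)
      show "(\<lambda>m. L2_set (\<lambda>i. norm (cf (X n) i - cf (X m) i)) F)
          \<longlonglongrightarrow> L2_set (\<lambda>i. norm (cf (X n) i - L i)) F"
        unfolding L2_set_def by (intro tendsto_intros L)
      show "\<forall>\<^sub>F m in sequentially. L2_set (\<lambda>i. norm (cf (X n) i - cf (X m) i)) F \<le> e"
        using L2_set_cf_le[OF that(2), of "X n - X _"] N[OF _ that(1)]
        by (auto simp: eventually_sequentially intro!: exI[of _ N])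
           (meson less_imp_le order_trans)
    qed simp
    then show ?thesis by blast
  qed
  obtain N where N: "\<And>F. finite F \<Longrightarrow> L2_set (\<lambda>i. norm (cf (X N) i - L i)) F \<le> 1"
    using close[of 1] by auto
  have "(\<lambda>i. (norm (cf (X N) i - (cf (X N) i - L i)))\<^sup>2) summable_on UNIV"
    by (intro square_summable_diff cf_square_summable square_summableI[OF N])
  then have cfL: "cf (Ell2 L) = L" by (simp add: cf_Ell2)
  have "X \<longlonglongrightarrow> Ell2 L"
  proof (rule LIMSEQ_I)
    fix r :: real assume "r > 0"
    then obtain N where "\<forall>n\<ge>N. \<forall>F. finite F \<longrightarrow> L2_set (\<lambda>i. norm (cf (X n) i - L i)) F \<le> r / 2"
      using close[of "r / 2"] by auto
    then have "\<forall>n\<ge>N. norm (X n - Ell2 L) \<le> r / 2"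
      by (intro allI impI norm_ell2_leI) (simp add: cfL)
    then show "\<exists>N. \<forall>n\<ge>N. norm (X n - Ell2 L) < r"
      using \<open>r > 0\<close> by (intro exI[of _ N]) (auto intro: le_less_trans)
  qed
  then show "convergent X" by (auto simp: convergent_def)
qed

lemma cauchy_schwarz_finite:
  assumes "finite F"
  shows "(\<Sum>i\<in>F. norm (cf x i) * norm (cf y i)) \<le> norm x * norm y"
proof -
  have "(\<Sum>i\<in>F. norm (cf x i) * norm (cf y i)) \<le> L2_set (\<lambda>i. norm (cf x i)) F * L2_set (\<lambda>i. norm (cf y i)) F"
    using L2_set_mult_ineq[of "\<lambda>i. norm (cf x i)" "\<lambda>i. norm (cf y i)" F] by simp
  also have "\<dots> \<le> norm x * norm y"
    by (intro mult_mono L2_set_cf_le assms) auto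
  finally show ?thesis .
qed

lemma cauchy_schwarz_summable: "(\<lambda>i. norm (cf x i) * norm (cf y i)) summable_on UNIV"
  by (rule nonneg_bdd_above_summable_on)
     (auto intro!: bdd_aboveI[of _ "norm x * norm y"] cauchy_schwarz_finite)

lemma cauchy_schwarz_infsum: "(\<Sum>\<^sub>\<infinity>i. norm (cf x i) * norm (cf y i)) \<le> norm x * norm y"
  by (rule infsum_le_finite_sums[OF cauchy_schwarz_summable]) (auto intro: cauchy_schwarz_finite)

text \<open>Dominated convergence in \<open>\<ell>\<^sup>2\<close>.  Every smallness statement of the perturbation argument has this source:
  the weights tend to zero entry by entry, as the central block grows or as a shift tends to infinity.\<close>

lemma ell2_dominated_tendsto_0:
  fixes X :: "nat \<Rightarrow> ('i, 'e::real_normed_vector) ell2" and Y :: "('i, 'f::real_normed_vector) ell2"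
  assumes dom: "\<And>k i. norm (cf (X k) i) \<le> a k i * norm (cf Y i)"
    and a_bound: "\<And>k i. 0 \<le> a k i \<and> a k i \<le> C"
    and lim: "\<And>i. (\<lambda>k. a k i) \<longlonglongrightarrow> 0"
  shows "X \<longlonglongrightarrow> 0"
proof (rule LIMSEQ_I)
  fix r :: real assume r: "r > 0"
  define C' where "C' = C\<^sup>2 + 1"
  have C': "C' > 0" by (simp add: C'_def add_nonneg_pos)
  define y where "y = (\<lambda>i. (norm (cf Y i))\<^sup>2)"
  have y: "y summable_on UNIV" unfolding y_def by (rule cf_square_summable)
  obtain F where F: "finite F" "norm (sum y F - infsum y UNIV) \<le> r\<^sup>2 / (4 * C')"
    using infsum_finite_approximation[OF y, of "r\<^sup>2 / (4 * C')"] r C' unfolding dist_norm by auto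
  have tail: "sum y G \<le> r\<^sup>2 / (4 * C')" if "finite G" "G \<inter> F = {}" for G
  proof -
    have "sum y F + sum y G = sum y (F \<union> G)" using that F by (simp add: sum.union_disjoint Int_commute)
    also have "\<dots> \<le> infsum y UNIV" using that F by (intro finite_sum_le_infsum[OF y]) (auto simp: y_def)
    finally show ?thesis using F(2) by (auto simp: abs_le_iff)
  qed
  have "(\<lambda>k. \<Sum>i\<in>F. (a k i * norm (cf Y i))\<^sup>2) \<longlonglongrightarrow> (\<Sum>i\<in>F. (0 * norm (cf Y i))\<^sup>2)"
    by (intro tendsto_intros lim)
  then have "\<forall>\<^sub>F k in sequentially. (\<Sum>i\<in>F. (a k i * norm (cf Y i))\<^sup>2) < r\<^sup>2 / 4"
    by (rule order_tendstoD) (use r in auto)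
  then obtain N where N: "\<And>k. k \<ge> N \<Longrightarrow> (\<Sum>i\<in>F. (a k i * norm (cf Y i))\<^sup>2) < r\<^sup>2 / 4"
    by (auto simp: eventually_sequentially)
  have "norm (X k) \<le> sqrt (r\<^sup>2 / 2)" if k: "k \<ge> N" for k
  proof (rule norm_ell2_leI)
    fix G :: "'i set" assume G: "finite G"
    have sq: "(norm (cf (X k) i))\<^sup>2 \<le> (a k i * norm (cf Y i))\<^sup>2" for i
      by (intro power_mono dom) auto
    have sqC: "(norm (cf (X k) i))\<^sup>2 \<le> C' * y i" for i
    proof -
      have "(norm (cf (X k) i))\<^sup>2 \<le> (a k i)\<^sup>2 * y i" using sq[of i] by (simp add: y_def power_mult_distrib)
      also have "\<dots> \<le> C' * y i"
      proof (rule mult_right_mono)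
        have "(a k i)\<^sup>2 \<le> C\<^sup>2" by (rule power_mono) (use a_bound in auto)
        then show "(a k i)\<^sup>2 \<le> C'" by (simp add: C'_def)
      qed (simp add: y_def)
      finally show ?thesis .
    qed
    have "(\<Sum>i\<in>G. (norm (cf (X k) i))\<^sup>2) = (\<Sum>i\<in>G \<inter> F. (norm (cf (X k) i))\<^sup>2) + (\<Sum>i\<in>G - F. (norm (cf (X k) i))\<^sup>2)"
      using G by (rule sum.Int_Diff)
    also have "(\<Sum>i\<in>G \<inter> F. (norm (cf (X k) i))\<^sup>2) \<le> (\<Sum>i\<in>F. (a k i * norm (cf Y i))\<^sup>2)"
      by (rule order_trans[OF sum_mono[OF sq] sum_mono2]) (use F in auto)
    also have "\<dots> \<le> r\<^sup>2 / 4" using N[OF k] by simp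
    also have "(\<Sum>i\<in>G - F. (norm (cf (X k) i))\<^sup>2) \<le> C' * sum y (G - F)"
      unfolding sum_distrib_left by (rule sum_mono[OF sqC])
    also have "\<dots> \<le> C' * (r\<^sup>2 / (4 * C'))"
      using C' G by (intro mult_left_mono tail) auto
    also have "\<dots> = r\<^sup>2 / 4" using C' by simp
    finally show "L2_set (\<lambda>i. norm (cf (X k) i)) G \<le> sqrt (r\<^sup>2 / 2)"
      unfolding L2_set_def by (intro real_sqrt_le_mono) simp
  qed
  moreover have "sqrt (r\<^sup>2 / 2) < r" using r by (intro real_less_lsqrt) (auto simp: field_simps)
  ultimately show "\<exists>N. \<forall>k\<ge>N. norm (X k - 0) < r" by (intro exI[of _ N]) (auto intro: le_less_trans)
qed

section \<open>Matrix products\<close>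

text \<open>One pairing yields the inner product of \<open>\<ell>\<^sup>2\<close>, the action of a matrix row on a vector and the entry of a
  matrix product, according to the bilinear map on the entries; the Cauchy--Schwarz inequality is all that the
  three cases share.\<close>

definition dot :: "('a \<Rightarrow> 'b \<Rightarrow> 'c) \<Rightarrow> ('n, 'a::real_normed_vector) ell2 \<Rightarrow> ('n, 'b::real_normed_vector) ell2 \<Rightarrow> 'c::{comm_monoid_add, t2_space}"
  where "dot prd a b = (\<Sum>\<^sub>\<infinity>n. prd (cf a n) (cf b n))"

locale contractive_bilinear = bounded_bilinear prd
  for prd :: "'a::real_normed_vector \<Rightarrow> 'b::real_normed_vector \<Rightarrow> 'c::banach" +
  assumes norm_prd_le: "norm (prd a b) \<le> norm a * norm b"
begin

lemma dot_abs_summable: "(\<lambda>n. norm (prd (cf a n) (cf b n))) summable_on UNIV"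
  by (rule summable_on_comparison_test[OF cauchy_schwarz_summable[of a b]]) (auto simp: norm_prd_le)

lemma dot_summable: "(\<lambda>n. prd (cf a n) (cf b n)) summable_on UNIV"
  using abs_summable_summable[OF dot_abs_summable] .

lemma norm_dot_le: "norm (dot prd a b) \<le> norm a * norm b"
proof -
  have "norm (dot prd a b) \<le> (\<Sum>\<^sub>\<infinity>n. norm (prd (cf a n) (cf b n)))"
    unfolding dot_def by (rule norm_infsum_bound[OF dot_abs_summable])
  also have "\<dots> \<le> (\<Sum>\<^sub>\<infinity>n. norm (cf a n) * norm (cf b n))"
    by (intro infsum_mono dot_abs_summable cauchy_schwarz_summable norm_prd_le)
  finally show ?thesis using cauchy_schwarz_infsum[of a b] by linarith
qed

lemma bounded_bilinear_dot: "bounded_bilinear (dot prd)"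
proof
  fix a a' :: "('d, 'a) ell2" and b b' :: "('d, 'b) ell2" and r :: real
  show "dot prd (a + a') b = dot prd a b + dot prd a' b" "dot prd a (b + b') = dot prd a b + dot prd a b'"
    by (simp_all add: dot_def add_left add_right infsum_add dot_summable)
  show "dot prd (r *\<^sub>R a) b = r *\<^sub>R dot prd a b" "dot prd a (r *\<^sub>R b) = r *\<^sub>R dot prd a b"
    by (simp_all add: dot_def scaleR_left scaleR_right infsum_scaleR_right)
  show "\<exists>K. \<forall>(a::('d, 'a) ell2) b. norm (dot prd a b) \<le> norm a * norm b * K"
    by (rule exI[of _ 1]) (auto simp: norm_dot_le)
qed

end

interpretation apply_cb: contractive_bilinear "blinfun_apply :: ('a::real_normed_vector \<Rightarrow>\<^sub>L 'b::banach) \<Rightarrow> _"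
  unfolding contractive_bilinear_def contractive_bilinear_axioms_def
  using bounded_bilinear_blinfun_apply by (auto simp: norm_blinfun)

interpretation compose_cb: contractive_bilinear
  "blinfun_compose :: ('b::real_normed_vector \<Rightarrow>\<^sub>L 'c::banach) \<Rightarrow> ('a::real_normed_vector \<Rightarrow>\<^sub>L 'b) \<Rightarrow> _"
  unfolding contractive_bilinear_def contractive_bilinear_axioms_def
  using bounded_bilinear_blinfun_compose by (auto simp: norm_blinfun_compose)

definition mrow :: "('i \<times> 'n, 'e::real_normed_vector) ell2 \<Rightarrow> 'i \<Rightarrow> ('n, 'e) ell2"
  where "mrow X i = Ell2 (\<lambda>n. cf X (i, n))"
definition mcol :: "('n \<times> 'l, 'e::real_normed_vector) ell2 \<Rightarrow> 'l \<Rightarrow> ('n, 'e) ell2"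
  where "mcol X l = Ell2 (\<lambda>n. cf X (n, l))"

lemma cf_mrow [simp]: "cf (mrow X i) n = cf X (i, n)"
proof -
  have "L2_set (\<lambda>n. norm (cf X (i, n))) F \<le> norm X" if "finite F" for F
    using L2_set_cf_le[of "Pair i ` F" X] that by (simp add: L2_set_def sum.reindex inj_on_def)
  from Ell2_bounded(1)[OF this] show ?thesis by (simp add: mrow_def)
qed

lemma cf_mcol [simp]: "cf (mcol X l) n = cf X (n, l)"
proof -
  have "L2_set (\<lambda>n. norm (cf X (n, l))) F \<le> norm X" if "finite F" for F
    using L2_set_cf_le[of "(\<lambda>n. (n, l)) ` F" X] that by (simp add: L2_set_def sum.reindex inj_on_def)
  from Ell2_bounded(1)[OF this] show ?thesis by (simp add: mcol_def)
qed

lemma L2_set_mrow_le: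
  assumes "finite F"
  shows "L2_set (\<lambda>i. norm (mrow X i)) F \<le> norm X"
proof -
  have s: "(\<lambda>p. (norm (cf X p))\<^sup>2) summable_on A" for A
    by (rule summable_on_subset[OF cf_square_summable]) auto
  have "(\<Sum>i\<in>F. (norm (mrow X i))\<^sup>2) = (\<Sum>\<^sub>\<infinity>i\<in>F. \<Sum>\<^sub>\<infinity>n. (norm (cf X (i, n)))\<^sup>2)"
    using assms by (simp add: norm_ell2_square)
  also have "\<dots> = (\<Sum>\<^sub>\<infinity>p\<in>F \<times> UNIV. (norm (cf X p))\<^sup>2)"
    using infsum_Sigma'_banach[of "\<lambda>i n. (norm (cf X (i, n)))\<^sup>2" F "\<lambda>_. UNIV"] s
    by (simp add: split_def)
  also have "\<dots> \<le> (norm X)\<^sup>2"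
    unfolding norm_ell2_square by (rule infsum_mono_neutral) (auto simp: s)
  finally show ?thesis unfolding L2_set_def by (simp add: real_le_lsqrt sum_nonneg)
qed

lemma L2_set_mcol_le:
  assumes "finite F"
  shows "L2_set (\<lambda>l. norm (mcol X l)) F \<le> norm X"
proof -
  define X' where "X' = Ell2 (\<lambda>(l, n). cf X (n, l))"
  have "L2_set (\<lambda>p. norm (case p of (l, n) \<Rightarrow> cf X (n, l))) G \<le> norm X" if "finite G" for G
  proof -
    have "L2_set (\<lambda>p. norm (cf X p)) (prod.swap ` G) = L2_set (\<lambda>p. norm (case p of (l, n) \<Rightarrow> cf X (n, l))) G"
      by (simp add: L2_set_def sum.reindex split_def)
         (simp add: prod.swap_def)
    then show ?thesis using L2_set_cf_le[of "prod.swap ` G" X] that by simp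
  qed
  from Ell2_bounded[OF this] have X': "cf X' = (\<lambda>(l, n). cf X (n, l))" "norm X' \<le> norm X"
    by (simp_all add: X'_def)
  have "mrow X' l = mcol X l" for l by (rule ell2_eqI) (simp add: X')
  then show ?thesis using L2_set_mrow_le[OF assms, of X'] X'(2) by simp
qed

definition mv :: "('i \<times> 'n, 'a::real_normed_vector \<Rightarrow>\<^sub>L 'b::banach) ell2 \<Rightarrow> ('n, 'a) ell2 \<Rightarrow> ('i, 'b) ell2"
  where "mv X x = Ell2 (\<lambda>i. dot blinfun_apply (mrow X i) x)"

definition mm :: "('i \<times> 'n, 'b::real_normed_vector \<Rightarrow>\<^sub>L 'c::banach) ell2 \<Rightarrow> ('n \<times> 'l, 'a::real_normed_vector \<Rightarrow>\<^sub>L 'b) ell2 \<Rightarrow> ('i \<times> 'l, 'a \<Rightarrow>\<^sub>L 'c) ell2"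
  where "mm X Y = Ell2 (\<lambda>(i, l). dot blinfun_compose (mrow X i) (mcol Y l))"

lemma mv_bounds:
  shows cf_mv: "cf (mv X x) i = dot blinfun_apply (mrow X i) x"
    and norm_mv_le: "norm (mv X x) \<le> norm X * norm x"
proof -
  have "L2_set (\<lambda>i. norm (dot blinfun_apply (mrow X i) x)) F \<le> norm X * norm x" if "finite F" for F
  proof -
    have "L2_set (\<lambda>i. norm (dot blinfun_apply (mrow X i) x)) F \<le> L2_set (\<lambda>i. norm (mrow X i) * norm x) F"
      by (rule L2_set_mono) (auto simp: apply_cb.norm_dot_le)
    also have "\<dots> = L2_set (\<lambda>i. norm (mrow X i)) F * norm x"
      by (simp add: L2_set_left_distrib)
    also have "\<dots> \<le> norm X * norm x" by (intro mult_right_mono L2_set_mrow_le that) auto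
    finally show ?thesis .
  qed
  from Ell2_bounded[OF this] show "cf (mv X x) i = dot blinfun_apply (mrow X i) x"
    "norm (mv X x) \<le> norm X * norm x" by (simp_all add: mv_def)
qed

lemma mm_bounds:
  shows cf_mm: "cf (mm X Y) (i, l) = dot blinfun_compose (mrow X i) (mcol Y l)"
    and norm_mm_le: "norm (mm X Y) \<le> norm X * norm Y"
proof -
  have "L2_set (\<lambda>p. norm (case p of (i, l) \<Rightarrow> dot blinfun_compose (mrow X i) (mcol Y l))) F \<le> norm X * norm Y"
    if F: "finite F" for F
  proof -
    let ?A = "fst ` F" and ?B = "snd ` F"
    have fin: "finite ?A" "finite ?B" using F by auto
    have "L2_set (\<lambda>p. norm (case p of (i, l) \<Rightarrow> dot blinfun_compose (mrow X i) (mcol Y l))) F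
      \<le> L2_set (\<lambda>(i, l). norm (mrow X i) * norm (mcol Y l)) F"
      by (rule L2_set_mono) (auto simp: compose_cb.norm_dot_le)
    also have "\<dots> \<le> L2_set (\<lambda>(i, l). norm (mrow X i) * norm (mcol Y l)) (?A \<times> ?B)"
      unfolding L2_set_def
      by (intro real_sqrt_le_mono sum_mono2 subset_fst_snd) (use fin in auto)
    also have "\<dots> = L2_set (\<lambda>i. norm (mrow X i)) ?A * L2_set (\<lambda>l. norm (mcol Y l)) ?B"
      unfolding L2_set_def
      by (simp add: real_sqrt_mult[symmetric] sum_product sum.cartesian_product power_mult_distrib split_def)
    also have "\<dots> \<le> norm X * norm Y"
      by (intro mult_mono L2_set_mrow_le L2_set_mcol_le fin) auto
    finally show ?thesis .
  qed
  from Ell2_bounded[OF this] show "cf (mm X Y) (i, l) = dot blinfun_compose (mrow X i) (mcol Y l)"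
    "norm (mm X Y) \<le> norm X * norm Y" by (simp_all add: mm_def)
qed

lemma mrow_linear [simp]: "mrow (X + Y) i = mrow X i + mrow Y i" "mrow (X - Y) i = mrow X i - mrow Y i"
    "mrow (- X) i = - mrow X i" "mrow (r *\<^sub>R X) i = r *\<^sub>R mrow X i" "mrow 0 i = 0"
  by (auto intro: ell2_eqI)
lemma mcol_linear [simp]: "mcol (X + Y) i = mcol X i + mcol Y i" "mcol (X - Y) i = mcol X i - mcol Y i"
    "mcol (- X) i = - mcol X i" "mcol (r *\<^sub>R X) i = r *\<^sub>R mcol X i" "mcol 0 i = 0"
  by (auto intro: ell2_eqI)

interpretation apply_dot: bounded_bilinear "dot (blinfun_apply :: ('a::real_normed_vector \<Rightarrow>\<^sub>L 'b::banach) \<Rightarrow> _)"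
  by (rule apply_cb.bounded_bilinear_dot)
interpretation compose_dot: bounded_bilinear
  "dot (blinfun_compose :: ('b::real_normed_vector \<Rightarrow>\<^sub>L 'c::banach) \<Rightarrow> ('a::real_normed_vector \<Rightarrow>\<^sub>L 'b) \<Rightarrow> _)"
  by (rule compose_cb.bounded_bilinear_dot)

interpretation mv: bounded_bilinear "mv :: ('i \<times> 'n, 'a::real_normed_vector \<Rightarrow>\<^sub>L 'b::banach) ell2 \<Rightarrow> _"
proof
  fix X X' :: "('i \<times> 'n, 'a \<Rightarrow>\<^sub>L 'b) ell2" and x x' :: "('n, 'a) ell2" and r :: real
  show "mv (X + X') x = mv X x + mv X' x" "mv X (x + x') = mv X x + mv X x'"
    "mv (r *\<^sub>R X) x = r *\<^sub>R mv X x" "mv X (r *\<^sub>R x) = r *\<^sub>R mv X x"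
    by (auto intro!: ell2_eqI simp: cf_mv apply_dot.add_left apply_dot.add_right
        apply_dot.scaleR_left apply_dot.scaleR_right)
  show "\<exists>K. \<forall>(X :: ('i \<times> 'n, 'a \<Rightarrow>\<^sub>L 'b) ell2) x. norm (mv X x) \<le> norm X * norm x * K"
    by (rule exI[of _ 1]) (auto simp: norm_mv_le)
qed

interpretation mm: bounded_bilinear
  "mm :: ('i \<times> 'n, 'b::real_normed_vector \<Rightarrow>\<^sub>L 'c::banach) ell2 \<Rightarrow> ('n \<times> 'l, 'a::real_normed_vector \<Rightarrow>\<^sub>L 'b) ell2 \<Rightarrow> _"
proof
  fix X X' :: "('i \<times> 'n, 'b \<Rightarrow>\<^sub>L 'c) ell2" and Y Y' :: "('n \<times> 'l, 'a \<Rightarrow>\<^sub>L 'b) ell2" and r :: real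
  show "mm (X + X') Y = mm X Y + mm X' Y" "mm X (Y + Y') = mm X Y + mm X Y'"
    "mm (r *\<^sub>R X) Y = r *\<^sub>R mm X Y" "mm X (r *\<^sub>R Y) = r *\<^sub>R mm X Y"
    by (auto intro!: ell2_eqI simp: cf_mm compose_dot.add_left compose_dot.add_right
        compose_dot.scaleR_left compose_dot.scaleR_right)
  show "\<exists>K. \<forall>(X :: ('i \<times> 'n, 'b \<Rightarrow>\<^sub>L 'c) ell2) (Y :: ('n \<times> 'l, 'a \<Rightarrow>\<^sub>L 'b) ell2). norm (mm X Y) \<le> norm X * norm Y * K"
    by (rule exI[of _ 1]) (auto simp: norm_mm_le)
qed

section \<open>Complex Hilbert spaces and complex-linear matrices\<close>

lemma scaleC_one [simp]: "1 *\<^sub>C x = (x :: 'a::complex_hilbert)"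
  using scaleC_of_real[of 1 x] by simp

lemma scaleC_zero_left [simp]: "0 *\<^sub>C x = (0 :: 'a::complex_hilbert)"
  using scaleC_of_real[of 0 x] by simp

lemma scaleC_zero_right [simp]: "c *\<^sub>C (0 :: 'a::complex_hilbert) = 0"
  using scaleC_add_right[of c 0 "0 :: 'a"] by simp

lemma scaleC_scaleR_commute: "c *\<^sub>C (r *\<^sub>R x) = r *\<^sub>R (c *\<^sub>C (x :: 'a::complex_hilbert))"
  by (simp add: scaleC_of_real[symmetric] scaleC_scaleC mult.commute)

lemma cinner_zero_left [simp]: "cinner 0 (x :: 'a::complex_hilbert) = 0"
  using cinner_add_left[of 0 "0::'a" x] by simp

lemma cinner_add_right: "cinner x (y + z :: 'a::complex_hilbert) = cinner x y + cinner x z"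
  by (metis cinner_add_left cinner_commute complex_cnj_add)

lemma cinner_scaleC_right: "cinner x (c *\<^sub>C (y :: 'a::complex_hilbert)) = cnj c * cinner x y"
  by (metis cinner_scaleC_left cinner_commute complex_cnj_mult)

lemma cinner_scaleR_left: "cinner (r *\<^sub>R x) (y :: 'a::complex_hilbert) = r *\<^sub>R cinner x y"
  using cinner_scaleC_left[of "of_real r" x y] by (simp add: scaleC_of_real scaleR_conv_of_real)

lemma cinner_scaleR_right: "cinner x (r *\<^sub>R (y :: 'a::complex_hilbert)) = r *\<^sub>R cinner x y"
  using cinner_scaleC_right[of x "of_real r" y] by (simp add: scaleC_of_real scaleR_conv_of_real)

lemma cinner_self: "cinner x (x :: 'a::complex_hilbert) = of_real ((norm x)\<^sup>2)"
proof -
  have "Im (cinner x x) = 0" using cinner_commute[of x x] by (simp add: complex_eq_iff)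
  moreover have "0 \<le> Re (cinner x x)"
    using norm_eq_sqrt_cinner[of x] norm_ge_zero[of x] by simp
  then have "Re (cinner x x) = (norm x)\<^sup>2" by (simp add: norm_eq_sqrt_cinner)
  ultimately show ?thesis by (simp add: complex_eq_iff)
qed

lemma norm_scaleC: "norm (c *\<^sub>C (x :: 'a::complex_hilbert)) = cmod c * norm x"
proof -
  have "complex_of_real ((norm (c *\<^sub>C x))\<^sup>2) = c * cnj c * cinner x x"
    by (simp only: cinner_self[symmetric] cinner_scaleC_left cinner_scaleC_right mult_ac)
  also have "\<dots> = of_real ((cmod c * norm x)\<^sup>2)"
    by (simp only: complex_norm_square[symmetric] cinner_self power_mult_distrib of_real_mult)
  finally have "complex_of_real ((norm (c *\<^sub>C x))\<^sup>2) = of_real ((cmod c * norm x)\<^sup>2)" .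
  then have "(norm (c *\<^sub>C x))\<^sup>2 = (cmod c * norm x)\<^sup>2" by (simp only: of_real_eq_iff)
  then show ?thesis by (simp add: power2_eq_iff_nonneg)
qed

lemma norm_cinner_le: "cmod (cinner x y) \<le> norm x * norm (y :: 'a::complex_hilbert)"
proof (cases "y = 0")
  case True
  then show ?thesis using cinner_commute[of x y] by simp
next
  case False
  define c where "c = cinner x y / of_real ((norm y)\<^sup>2)"
  have y: "(norm y)\<^sup>2 > 0" using False by simp
  have diff: "x - c *\<^sub>C y = x + (- c) *\<^sub>C y"
    using scaleC_add_left[of c "- c" y] by (simp add: algebra_simps add_eq_0_iff)
  have cy: "cnj c * cinner x y = of_real ((cmod (cinner x y))\<^sup>2 / (norm y)\<^sup>2)"
  proof -
    have "cnj c * cinner x y = cinner x y * cnj (cinner x y) / of_real ((norm y)\<^sup>2)"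
      by (simp add: c_def mult.commute)
    then show ?thesis by (simp only: complex_norm_square[symmetric] of_real_divide)
  qed
  have "cinner (x - c *\<^sub>C y) (x - c *\<^sub>C y)
      = cinner x x - cnj c * cinner x y - c * cnj (cinner x y) + c * cnj c * cinner y y"
    unfolding diff
    by (simp add: cinner_add_left cinner_add_right cinner_scaleC_left cinner_scaleC_right
        cinner_commute[of y x] algebra_simps)
  also have "c * cnj c * cinner y y = cnj c * cinner x y"
  proof -
    have "c * cinner y y = cinner x y" using y by (simp add: c_def cinner_self)
    then show ?thesis by (metis mult.assoc mult.commute)
  qed
  also have "c * cnj (cinner x y) = cnj (cnj c * cinner x y)" by simp
  finally have "of_real ((norm (x - c *\<^sub>C y))\<^sup>2) = (of_real ((norm x)\<^sup>2 - (cmod (cinner x y))\<^sup>2 / (norm y)\<^sup>2) :: complex)"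
    unfolding cinner_self cy by simp
  then have "(norm (x - c *\<^sub>C y))\<^sup>2 = (norm x)\<^sup>2 - (cmod (cinner x y))\<^sup>2 / (norm y)\<^sup>2"
    by (simp only: of_real_eq_iff)
  then have "(cmod (cinner x y))\<^sup>2 / (norm y)\<^sup>2 \<le> (norm x)\<^sup>2"
    using zero_le_power2[of "norm (x - c *\<^sub>C y)"] by linarith
  then have "(cmod (cinner x y))\<^sup>2 \<le> (norm x * norm y)\<^sup>2"
    using y by (simp add: power_mult_distrib divide_le_eq)
  then show ?thesis by (rule power2_le_imp_le) simp
qed

lemma bounded_bilinear_scaleC: "bounded_bilinear (scaleC :: complex \<Rightarrow> 'a \<Rightarrow> 'a::complex_hilbert)"
proof
  fix a b :: complex and x y :: 'a and r :: real
  show "(a + b) *\<^sub>C x = a *\<^sub>C x + b *\<^sub>C x" "a *\<^sub>C (x + y) = a *\<^sub>C x + a *\<^sub>C y"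
    by (simp_all add: scaleC_add_left scaleC_add_right)
  show "(r *\<^sub>R a) *\<^sub>C x = r *\<^sub>R a *\<^sub>C x" "a *\<^sub>C r *\<^sub>R x = r *\<^sub>R a *\<^sub>C x"
    by (simp_all add: scaleC_scaleR_commute scaleR_conv_of_real scaleC_of_real flip: scaleC_scaleC)
  show "\<exists>K. \<forall>a (x::'a). norm (a *\<^sub>C x) \<le> norm a * norm x * K"
    by (rule exI[of _ 1]) (simp add: norm_scaleC)
qed

interpretation scaleC: bounded_bilinear "scaleC :: complex \<Rightarrow> 'a \<Rightarrow> 'a::complex_hilbert"
  by (rule bounded_bilinear_scaleC)

interpretation cinner_cb: contractive_bilinear "cinner :: 'a::complex_hilbert \<Rightarrow> 'a \<Rightarrow> complex"
proof
  fix a b x y :: 'a and r :: real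
  show "cinner (a + b) x = cinner a x + cinner b x" "cinner a (x + y) = cinner a x + cinner a y"
    "cinner (r *\<^sub>R a) x = r *\<^sub>R cinner a x" "cinner a (r *\<^sub>R x) = r *\<^sub>R cinner a x"
    by (simp_all add: cinner_add_left cinner_add_right cinner_scaleR_left cinner_scaleR_right)
  show "\<exists>K. \<forall>(a::'a) x. norm (cinner a x) \<le> norm a * norm x * K"
    by (rule exI[of _ 1]) (simp add: norm_cinner_le)
  show "norm (cinner a b) \<le> norm a * norm b" by (rule norm_cinner_le)
qed

lemma scaleC_square_summable:
  fixes x :: "('i, 'h::complex_hilbert) ell2"
  shows "(\<lambda>i. (norm (c *\<^sub>C cf x i))\<^sup>2) summable_on UNIV"
  using summable_on_cmult_right[OF cf_square_summable[of x], of "(cmod c)\<^sup>2"]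
  by (simp add: norm_scaleC power_mult_distrib)

instantiation ell2 :: (type, complex_hilbert) complex_hilbert
begin
definition scaleC_ell2 :: "complex \<Rightarrow> ('a, 'b) ell2 \<Rightarrow> ('a, 'b) ell2"
  where "scaleC_ell2 c x = Ell2 (\<lambda>i. c *\<^sub>C cf x i)"
definition cinner_ell2 :: "('a, 'b) ell2 \<Rightarrow> ('a, 'b) ell2 \<Rightarrow> complex"
  where "cinner_ell2 x y = dot cinner x y"

lemma cf_scaleC: "cf (c *\<^sub>C x :: ('a, 'b) ell2) = (\<lambda>i. c *\<^sub>C cf x i)"
  unfolding scaleC_ell2_def by (intro cf_Ell2 scaleC_square_summable)

instance
proof
  fix x y z :: "('a, 'b) ell2" and c d :: complex and r :: real
  show "c *\<^sub>C (x + y) = c *\<^sub>C x + c *\<^sub>C y" "(c + d) *\<^sub>C x = c *\<^sub>C x + d *\<^sub>C x"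
    "c *\<^sub>C d *\<^sub>C x = (c * d) *\<^sub>C x" "complex_of_real r *\<^sub>C x = r *\<^sub>R x"
    by (auto intro!: ell2_eqI simp: cf_scaleC scaleC_add_left scaleC_add_right scaleC_scaleC scaleC_of_real)
  interpret D: bounded_bilinear "dot cinner :: ('a, 'b) ell2 \<Rightarrow> _"
    by (rule cinner_cb.bounded_bilinear_dot)
  show "cinner (x + y) z = cinner x z + cinner y z"
    by (simp add: cinner_ell2_def D.add_left)
  show "cinner x y = cnj (cinner y x)"
  proof -
    have "cinner x y = (\<Sum>\<^sub>\<infinity>i. cnj (cinner (cf y i) (cf x i)))"
      unfolding cinner_ell2_def dot_def by (subst cinner_commute) simp
    then show ?thesis by (simp add: cinner_ell2_def dot_def)
  qed
  show "cinner (c *\<^sub>C x) y = c * cinner x y"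
    by (simp add: cinner_ell2_def dot_def cf_scaleC cinner_scaleC_left infsum_cmult_right')
  have "Re (cinner x x) = (\<Sum>\<^sub>\<infinity>i. Re (cinner (cf x i) (cf x i)))"
    unfolding cinner_ell2_def dot_def by (rule infsum_Re[OF cinner_cb.dot_summable, symmetric])
  then show "norm x = sqrt (Re (cinner x x))"
    by (simp add: norm_ell2_def cinner_self)
qed
end

declare cf_scaleC [simp]

lemma bounded_linear_scaleC: "bounded_linear (\<lambda>x. c *\<^sub>C x :: 'a::complex_hilbert)"
  by (rule scaleC.bounded_linear_right)

definition scalar_blinfun :: "complex \<Rightarrow> 'h::complex_hilbert \<Rightarrow>\<^sub>L 'h"
  where "scalar_blinfun c = Blinfun (\<lambda>x. c *\<^sub>C x)"

lemma scalar_blinfun_apply [simp]: "blinfun_apply (scalar_blinfun c) x = c *\<^sub>C x"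
  unfolding scalar_blinfun_def by (subst bounded_linear_Blinfun_apply[OF bounded_linear_scaleC]) simp

lemma norm_scalar_blinfun: "norm (scalar_blinfun c) \<le> cmod c"
  by (rule norm_blinfun_bound) (auto simp: norm_scaleC)

text \<open>Meaningful for bounded symbols: otherwise the new family need not be square-summable, and the value of
  \<open>Ell2\<close> is arbitrary.\<close>

definition wt :: "('i \<Rightarrow> complex) \<Rightarrow> ('i, 'a::real_normed_vector \<Rightarrow>\<^sub>L 'h::complex_hilbert) ell2 \<Rightarrow> ('i, 'a \<Rightarrow>\<^sub>L 'h) ell2"
  where "wt a X = Ell2 (\<lambda>p. scalar_blinfun (a p) o\<^sub>L cf X p)"

definition bounded_symbol :: "('i \<Rightarrow> complex) \<Rightarrow> bool"
  where "bounded_symbol a \<longleftrightarrow> (\<exists>C. \<forall>p. cmod (a p) \<le> C)"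

lemma bounded_symbolI: "(\<And>p. cmod (a p) \<le> C) \<Longrightarrow> bounded_symbol a"
  by (auto simp: bounded_symbol_def)

lemma norm_scalar_compose_le: "norm (scalar_blinfun c o\<^sub>L A) \<le> cmod c * norm A"
  by (rule order_trans[OF norm_blinfun_compose]) (intro mult_right_mono norm_scalar_blinfun, simp)

lemma cf_wt:
  assumes "bounded_symbol a"
  shows "cf (wt a X) p = scalar_blinfun (a p) o\<^sub>L cf X p"
proof -
  obtain C where C: "\<And>p. cmod (a p) \<le> C" using assms by (auto simp: bounded_symbol_def)
  have "norm (scalar_blinfun (a p) o\<^sub>L cf X p) \<le> C * norm (cf X p)" for p
    by (rule order_trans[OF norm_scalar_compose_le]) (intro mult_right_mono C, simp)
  from Ell2_dominated(1)[of _ _ X, OF this] show ?thesis by (simp add: wt_def)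
qed

lemma norm_cf_wt_le:
  assumes "bounded_symbol a" shows "norm (cf (wt a X) p) \<le> cmod (a p) * norm (cf X p)"
  by (simp add: cf_wt assms norm_scalar_compose_le)

lemma norm_wt_le:
  assumes "\<And>p. cmod (a p) \<le> C"
  shows "norm (wt a X) \<le> C * norm X"
proof -
  have "norm (scalar_blinfun (a p) o\<^sub>L cf X p) \<le> C * norm (cf X p)" for p
    by (rule order_trans[OF norm_scalar_compose_le]) (intro mult_right_mono assms, simp)
  from Ell2_dominated(2)[of _ _ X, OF this] show ?thesis
    using order_trans[OF norm_ge_zero assms] by (simp add: wt_def)
qed

lemma wt_linear:
  assumes "bounded_symbol a"
  shows "wt a (X + Y) = wt a X + wt a Y" "wt a (X - Y) = wt a X - wt a Y"
  by (auto intro!: ell2_eqI simp: cf_wt assms bounded_bilinear.add_right[OF bounded_bilinear_blinfun_compose]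
      bounded_bilinear.diff_right[OF bounded_bilinear_blinfun_compose])

text \<open>The weighted norms measure the smallness of a perturbation relative to the spectral gaps.  A product
  inherits a row weight from its left factor and a column weight from its right factor.\<close>

definition rw :: "('i \<Rightarrow> real) \<Rightarrow> ('i \<times> 'l, 'e::real_normed_vector) ell2 \<Rightarrow> ('i \<times> 'l, 'e) ell2"
  where "rw a X = Ell2 (\<lambda>p. a (fst p) *\<^sub>R cf X p)"
definition cw :: "('l \<Rightarrow> real) \<Rightarrow> ('i \<times> 'l, 'e::real_normed_vector) ell2 \<Rightarrow> ('i \<times> 'l, 'e) ell2"
  where "cw a X = Ell2 (\<lambda>p. a (snd p) *\<^sub>R cf X p)"

lemma cf_rw: assumes "\<And>i. \<bar>a i\<bar> \<le> C" shows "cf (rw a X) (i, l) = a i *\<^sub>R cf X (i, l)"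
  unfolding rw_def by (subst Ell2_dominated(1)[of _ C X]) (auto intro!: mult_right_mono assms)
lemma cf_cw: assumes "\<And>i. \<bar>a i\<bar> \<le> C" shows "cf (cw a X) (i, l) = a l *\<^sub>R cf X (i, l)"
  unfolding cw_def by (subst Ell2_dominated(1)[of _ C X]) (auto intro!: mult_right_mono assms)

lemma mm_rw: assumes "\<And>i. \<bar>a i\<bar> \<le> C" shows "mm (rw a X) Y = rw a (mm X Y)"
proof (rule ell2_eqI, clarify)
  fix i l
  have "mrow (rw a X) i = a i *\<^sub>R mrow X i" by (rule ell2_eqI) (simp add: cf_rw[OF assms])
  then show "cf (mm (rw a X) Y) (i, l) = cf (rw a (mm X Y)) (i, l)"
    by (simp add: cf_mm cf_rw[OF assms] bounded_bilinear.scaleR_left[OF compose_cb.bounded_bilinear_dot])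
qed

lemma mm_cw: assumes "\<And>i. \<bar>a i\<bar> \<le> C" shows "mm X (cw a Y) = cw a (mm X Y)"
proof (rule ell2_eqI, clarify)
  fix i l
  have "mcol (cw a Y) l = a l *\<^sub>R mcol Y l" by (rule ell2_eqI) (simp add: cf_cw[OF assms])
  then show "cf (mm X (cw a Y)) (i, l) = cf (cw a (mm X Y)) (i, l)"
    by (simp add: cf_mm cf_cw[OF assms] bounded_bilinear.scaleR_right[OF compose_cb.bounded_bilinear_dot])
qed

definition dg :: "('i \<Rightarrow> complex) \<Rightarrow> ('i, 'h::complex_hilbert) ell2 \<Rightarrow> ('i, 'h) ell2"
  where "dg a x = Ell2 (\<lambda>i. a i *\<^sub>C cf x i)"

lemma cf_dg: assumes "bounded_symbol a" shows "cf (dg a x) i = a i *\<^sub>C cf x i"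
proof -
  obtain C where C: "\<And>p. cmod (a p) \<le> C" using assms by (auto simp: bounded_symbol_def)
  have "norm (a i *\<^sub>C cf x i) \<le> C * norm (cf x i)" for i
    by (simp add: norm_scaleC mult_right_mono C)
  from Ell2_dominated(1)[of _ _ x, OF this] show ?thesis by (simp add: dg_def)
qed

lemma norm_dg_le:
  assumes "\<And>p. cmod (a p) \<le> C" shows "norm (dg a x) \<le> C * norm x"
proof -
  have "norm (a i *\<^sub>C cf x i) \<le> C * norm (cf x i)" for i
    by (simp add: norm_scaleC mult_right_mono assms)
  from Ell2_dominated(2)[of _ _ x, OF this] show ?thesis
    using order_trans[OF norm_ge_zero assms] by (simp add: dg_def)
qed

lemma bounded_linear_dg:
  assumes "bounded_symbol a" shows "bounded_linear (dg a :: ('i, 'h::complex_hilbert) ell2 \<Rightarrow> _)"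
proof -
  obtain C where C: "\<And>p. cmod (a p) \<le> C" using assms by (auto simp: bounded_symbol_def)
  show ?thesis
    by (rule bounded_linear_intro[where K = C])
       (auto intro!: ell2_eqI simp: cf_dg assms scaleC_add_right scaleC_scaleR_commute
          norm_dg_le[OF C] mult.commute[of _ C])
qed

lemma complex_homogeneous_dg:
  assumes "bounded_symbol a" shows "complex_homogeneous (dg a)"
  unfolding complex_homogeneous_def
  by (auto intro!: ell2_eqI simp: cf_dg assms scaleC_scaleC mult.commute)

subsection \<open>Associativity\<close>

definition vm :: "('n, 'b::real_normed_vector \<Rightarrow>\<^sub>L 'c::banach) ell2 \<Rightarrow> ('n \<times> 'l, 'a::real_normed_vector \<Rightarrow>\<^sub>L 'b) ell2 \<Rightarrow> ('l, 'a \<Rightarrow>\<^sub>L 'c) ell2"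
  where "vm r M = Ell2 (\<lambda>l. dot blinfun_compose r (mcol M l))"

lemma cf_vm: "cf (vm r M) l = dot blinfun_compose r (mcol M l)"
proof -
  have "L2_set (\<lambda>l. norm (dot blinfun_compose r (mcol M l))) F \<le> norm r * norm M" if "finite F" for F
  proof -
    have "L2_set (\<lambda>l. norm (dot blinfun_compose r (mcol M l))) F \<le> L2_set (\<lambda>l. norm r * norm (mcol M l)) F"
      by (rule L2_set_mono) (auto simp: compose_cb.norm_dot_le)
    also have "\<dots> = norm r * L2_set (\<lambda>l. norm (mcol M l)) F" by (simp add: L2_set_right_distrib)
    also have "\<dots> \<le> norm r * norm M" by (intro mult_left_mono L2_set_mcol_le that) auto
    finally show ?thesis .
  qed
  from Ell2_bounded(1)[OF this] show ?thesis by (simp add: vm_def)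
qed

lemma mrow_mm: "mrow (mm X Y) i = vm (mrow X i) Y"
  by (rule ell2_eqI) (simp add: cf_vm cf_mm)

definition tensor :: "('m, 'a::real_normed_vector) ell2 \<Rightarrow> ('n, 'b::real_normed_vector) ell2 \<Rightarrow> ('m \<times> 'n, real) ell2"
  where "tensor x y = Ell2 (\<lambda>(m, n). norm (cf x m) * norm (cf y n))"

lemma cf_tensor: "cf (tensor x y) (m, n) = norm (cf x m) * norm (cf y n)"
proof -
  have "L2_set (\<lambda>p. norm (case p of (m, n) \<Rightarrow> norm (cf x m) * norm (cf y n))) F \<le> norm x * norm y"
    if F: "finite F" for F
  proof -
    have fin: "finite (fst ` F)" "finite (snd ` F)" using F by auto
    have "L2_set (\<lambda>p. norm (case p of (m, n) \<Rightarrow> norm (cf x m) * norm (cf y n))) F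
      \<le> L2_set (\<lambda>(m, n). norm (cf x m) * norm (cf y n)) (fst ` F \<times> snd ` F)"
      unfolding L2_set_def by (intro real_sqrt_le_mono order_trans[OF _ sum_mono2[OF _ subset_fst_snd]])
        (use fin in \<open>auto simp: split_def\<close>)
    also have "\<dots> = L2_set (\<lambda>m. norm (cf x m)) (fst ` F) * L2_set (\<lambda>n. norm (cf y n)) (snd ` F)"
      unfolding L2_set_def
      by (simp add: real_sqrt_mult[symmetric] sum_product sum.cartesian_product power_mult_distrib split_def)
    also have "\<dots> \<le> norm x * norm y" by (intro mult_mono L2_set_cf_le fin) auto
    finally show ?thesis .
  qed
  from Ell2_bounded(1)[OF this] show ?thesis by (simp add: tensor_def)
qed

text \<open>The double series \<open>\<Sum> r\<^sub>m M\<^sub>m\<^sub>n x\<^sub>n\<close> converges absolutely because \<open>(\<parallel>r\<^sub>m\<parallel> \<parallel>x\<^sub>n\<parallel>)\<close> and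
  \<open>(\<parallel>M\<^sub>m\<^sub>n\<parallel>)\<close> are both square-summable.\<close>

lemma dot_vm:
  fixes r :: "('n, 'b::banach \<Rightarrow>\<^sub>L 'c::banach) ell2"
    and M :: "('n \<times> 'l, 'a::real_normed_vector \<Rightarrow>\<^sub>L 'b::banach) ell2"
  shows "dot blinfun_apply (vm r M) x = dot blinfun_apply r (mv M x)"
proof -
  define t where "t = tensor r x"
  have t: "cf t (m, n) = norm (cf r m) * norm (cf x n)" for m n by (simp add: t_def cf_tensor)
  have "(\<lambda>(m, n). cf r m (cf M (m, n) (cf x n))) summable_on UNIV"
  proof (rule abs_summable_summable, rule summable_on_comparison_test[OF cauchy_schwarz_summable[of t M]])
    fix p :: "'n \<times> 'l"
    obtain m n where p: "p = (m, n)" by (cases p)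
    have "norm (cf r m (cf M (m, n) (cf x n))) \<le> norm (cf r m) * (norm (cf M (m, n)) * norm (cf x n))"
      by (rule order_trans[OF norm_blinfun mult_left_mono[OF norm_blinfun]]) simp
    then show "norm (case p of (m, n) \<Rightarrow> cf r m (cf M (m, n) (cf x n))) \<le> norm (cf t p) * norm (cf M p)"
      by (simp add: p t mult_ac)
  qed auto
  then have s: "(\<lambda>(m, n). cf r m (cf M (m, n) (cf x n))) summable_on UNIV \<times> UNIV" by simp
  have "dot blinfun_apply (vm r M) x = (\<Sum>\<^sub>\<infinity>n. (\<Sum>\<^sub>\<infinity>m. cf r m (cf M (m, n) (cf x n))))"
    unfolding dot_def[of blinfun_apply "vm r M"]
  proof (rule infsum_cong)
    fix n
    have *: "(\<lambda>m. cf r m o\<^sub>L cf M (m, n)) summable_on UNIV"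
      using compose_cb.dot_summable[of r "mcol M n"] by simp
    have "cf (vm r M) n (cf x n) = (\<Sum>\<^sub>\<infinity>m. (cf r m o\<^sub>L cf M (m, n)) (cf x n))"
      using has_sum_bounded_linear[OF blinfun.bounded_linear_left has_sum_infsum[OF *], of "cf x n"]
      by (simp add: cf_vm dot_def infsumI)
    then show "cf (vm r M) n (cf x n) = (\<Sum>\<^sub>\<infinity>m. cf r m (cf M (m, n) (cf x n)))" by simp
  qed
  also have "\<dots> = (\<Sum>\<^sub>\<infinity>m. (\<Sum>\<^sub>\<infinity>n. cf r m (cf M (m, n) (cf x n))))"
    by (rule infsum_swap_banach[OF s, symmetric])
  also have "\<dots> = dot blinfun_apply r (mv M x)"
    unfolding dot_def[of blinfun_apply r]
  proof (rule infsum_cong)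
    fix m
    have *: "(\<lambda>n. cf M (m, n) (cf x n)) summable_on UNIV"
      using apply_cb.dot_summable[of "mrow M m" x] by simp
    show "(\<Sum>\<^sub>\<infinity>n. cf r m (cf M (m, n) (cf x n))) = cf r m (cf (mv M x) m)"
      using has_sum_bounded_linear[OF blinfun.bounded_linear_right has_sum_infsum[OF *], of "cf r m"]
      by (simp add: cf_mv dot_def infsumI)
  qed
  finally show ?thesis .
qed

lemma mv_mm: "mv (mm X Y) x = mv X (mv Y x)"
  by (rule ell2_eqI) (simp add: cf_mv mrow_mm dot_vm)

definition single :: "'i \<Rightarrow> 'e::real_normed_vector \<Rightarrow> ('i, 'e) ell2"
  where "single l h = Ell2 (\<lambda>i. if i = l then h else 0)"

lemma cf_single: "cf (single l h) i = (if i = l then h else 0)"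
proof -
  have "L2_set (\<lambda>i. norm (if i = l then h else 0)) F \<le> norm h" if "finite F" for F
  proof -
    have "(\<Sum>i\<in>F. (norm (if i = l then h else 0))\<^sup>2) = (\<Sum>i\<in>F. if i = l then (norm h)\<^sup>2 else 0)"
      by (rule sum.cong) auto
    then show ?thesis using that by (simp add: L2_set_def sum.delta)
  qed
  from Ell2_bounded(1)[OF this] show ?thesis by (simp add: single_def)
qed

lemma cf_mv_single: "cf (mv M (single l h)) j = cf M (j, l) h"
proof -
  have "cf (mv M (single l h)) j = (\<Sum>\<^sub>\<infinity>n. cf M (j, n) (cf (single l h) n))"
    by (simp add: cf_mv dot_def)
  also have "\<dots> = (\<Sum>\<^sub>\<infinity>n\<in>{l}. cf M (j, n) h)"
    by (rule infsum_cong_neutral) (auto simp: cf_single)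
  finally show ?thesis by simp
qed

subsection \<open>Complex-linear matrices\<close>

text \<open>The type of bounded operators on \<open>H\<close> knows only real linearity, so complex linearity is carried along as a
  separate property of matrices.\<close>

definition clinear_matrix :: "('i, 'h::complex_hilbert \<Rightarrow>\<^sub>L 'h) ell2 \<Rightarrow> bool"
  where "clinear_matrix M \<longleftrightarrow> (\<forall>p. complex_homogeneous (blinfun_apply (cf M p)))"

lemma complex_homogeneousD: "complex_homogeneous f \<Longrightarrow> f (c *\<^sub>C x) = c *\<^sub>C f x"
  by (simp add: complex_homogeneous_def)

lemma infsum_scaleC:
  fixes f :: "'i \<Rightarrow> 'h::complex_hilbert"
  assumes "f summable_on A"
  shows "(\<Sum>\<^sub>\<infinity>i\<in>A. c *\<^sub>C f i) = c *\<^sub>C infsum f A"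
  by (rule infsumI, rule has_sum_bounded_linear[OF bounded_linear_scaleC]) (use assms in simp)

lemma clinear_matrix_iff: "clinear_matrix M \<longleftrightarrow> complex_homogeneous (mv M)"
  for M :: "('i \<times> 'i, 'h::complex_hilbert \<Rightarrow>\<^sub>L 'h) ell2"
proof
  assume M: "clinear_matrix M"
  show "complex_homogeneous (mv M)"
    unfolding complex_homogeneous_def
  proof (intro allI ell2_eqI)
    fix c and x :: "('i, 'h) ell2" and i
    have "cf (mv M (c *\<^sub>C x)) i = (\<Sum>\<^sub>\<infinity>n. c *\<^sub>C cf M (i, n) (cf x n))"
      using M by (simp add: cf_mv dot_def clinear_matrix_def complex_homogeneous_def)
    also have "\<dots> = c *\<^sub>C cf (mv M x) i"
      using infsum_scaleC[OF apply_cb.dot_summable[of "mrow M i" x], of c] by (simp add: cf_mv dot_def)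
    finally show "cf (mv M (c *\<^sub>C x)) i = cf (c *\<^sub>C mv M x) i" by simp
  qed
next
  assume M: "complex_homogeneous (mv M)"
  have "cf M (j, l) (c *\<^sub>C h) = c *\<^sub>C cf M (j, l) h" for j l c h
  proof -
    have "single l (c *\<^sub>C h) = c *\<^sub>C single l h" by (rule ell2_eqI) (simp add: cf_single)
    then show ?thesis
      using complex_homogeneousD[OF M, of c "single l h"] by (metis cf_mv_single cf_scaleC)
  qed
  then show "clinear_matrix M" by (auto simp: clinear_matrix_def complex_homogeneous_def)
qed

lemma clinear_matrix_add: "clinear_matrix M \<Longrightarrow> clinear_matrix N \<Longrightarrow> clinear_matrix (M + N)"
  and clinear_matrix_diff: "clinear_matrix M \<Longrightarrow> clinear_matrix N \<Longrightarrow> clinear_matrix (M - N)"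
  by (auto simp: clinear_matrix_def complex_homogeneous_def plus_blinfun.rep_eq minus_blinfun.rep_eq
      scaleC_add_right scaleC.diff_right)

lemma clinear_matrix_wt:
  assumes "bounded_symbol a" "clinear_matrix M" shows "clinear_matrix (wt a M)"
  using assms(2) by (auto simp: clinear_matrix_def complex_homogeneous_def cf_wt[OF assms(1)] scaleC_scaleC mult.commute)

lemma clinear_matrix_mm: "clinear_matrix M \<Longrightarrow> clinear_matrix N \<Longrightarrow> clinear_matrix (mm M N)"
  for M N :: "('i \<times> 'i, 'h::complex_hilbert \<Rightarrow>\<^sub>L 'h) ell2"
  unfolding clinear_matrix_iff complex_homogeneous_def mv_mm by simp

lemma closed_clinear_matrix: "closed {M :: ('i, 'h::complex_hilbert \<Rightarrow>\<^sub>L 'h) ell2. clinear_matrix M}"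
  unfolding closed_sequential_limits
proof (intro allI impI)
  fix X and M :: "('i, 'h \<Rightarrow>\<^sub>L 'h) ell2"
  assume X: "(\<forall>n. X n \<in> {M. clinear_matrix M}) \<and> X \<longlonglongrightarrow> M"
  have "cf M p (c *\<^sub>C h) = c *\<^sub>C cf M p h" for p c h
  proof -
    have l: "(\<lambda>n. cf (X n) p) \<longlonglongrightarrow> cf M p" using X by (intro tendsto_cf) auto
    have "(\<lambda>n. cf (X n) p (c *\<^sub>C h)) \<longlonglongrightarrow> cf M p (c *\<^sub>C h)"
      by (intro blinfun.tendsto l tendsto_const)
    moreover have "(\<lambda>n. c *\<^sub>C cf (X n) p h) \<longlonglongrightarrow> c *\<^sub>C cf M p h"
      by (intro scaleC.tendsto blinfun.tendsto l tendsto_const)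
    moreover have "cf (X n) p (c *\<^sub>C h) = c *\<^sub>C cf (X n) p h" for n
      using X by (auto simp: clinear_matrix_def complex_homogeneous_def)
    ultimately show ?thesis using LIMSEQ_unique by simp
  qed
  then show "M \<in> {M. clinear_matrix M}" by (auto simp: clinear_matrix_def complex_homogeneous_def)
qed

subsection \<open>Inverses of perturbations of the identity\<close>

text \<open>The Neumann series, obtained by solving \<open>u = x - N u\<close> with Banach's fixed-point theorem.\<close>

lemma neumann_inverse:
  fixes N :: "'a::banach \<Rightarrow> 'a"
  assumes lin: "bounded_linear N" and q: "\<And>x. norm (N x) \<le> q * norm x" "0 \<le> q" "q < 1"
  obtains M where "bounded_linear M" "\<And>x. M x + N (M x) = x" "\<And>x. M (x + N x) = x"
    "\<And>x. norm (M x) \<le> norm x / (1 - q)"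
proof -
  interpret N: bounded_linear N by (rule lin)
  have uniq: "u = v" if "u + N u = v + N v" for u v
  proof -
    have "u - v = (u + N u) - (v + N u)" by simp
    also have "\<dots> = N (v - u)" unfolding that by (simp add: N.diff)
    finally have "norm (u - v) = norm (N (v - u))" by simp
    also have "\<dots> \<le> q * norm (u - v)" using q(1)[of "v - u"] by (simp add: norm_minus_commute)
    finally have "(1 - q) * norm (u - v) \<le> 0" by (simp add: algebra_simps)
    then show ?thesis using q by (simp add: mult_le_0_iff)
  qed
  have "\<exists>u. u + N u = x" for x
  proof -
    have "\<exists>!u. x - N u = u"
    proof (rule banach_fix_type[OF q(2,3)], intro allI)
      fix u v show "dist (x - N u) (x - N v) \<le> q * dist u v"
        using q(1)[of "v - u"] by (simp add: dist_norm N.diff norm_minus_commute)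
    qed
    then obtain u where "x - N u = u" by blast
    then show ?thesis by (metis diff_add_cancel)
  qed
  then obtain M where M: "\<And>x. M x + N (M x) = x" by metis
  have bound: "norm (M x) \<le> norm x / (1 - q)" for x
  proof -
    have "norm (M x) \<le> norm x + norm (N (M x))" using norm_triangle_ineq4[of x "N (M x)"] M[of x]
      by (metis add_diff_cancel_right')
    then have "(1 - q) * norm (M x) \<le> norm x" using q(1)[of "M x"] by (simp add: algebra_simps)
    then show ?thesis using q by (simp add: pos_le_divide_eq mult.commute)
  qed
  have "bounded_linear M"
  proof (rule bounded_linear_intro)
    fix x y r
    show "M (x + y) = M x + M y"
      by (rule uniq) (use M[of x] M[of y] M[of "x + y"] in \<open>simp add: N.add algebra_simps\<close>)
    have "r *\<^sub>R M x + N (r *\<^sub>R M x) = r *\<^sub>R (M x + N (M x))" by (simp add: N.scaleR scaleR_right_distrib)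
    then show "M (r *\<^sub>R x) = r *\<^sub>R M x" by (subst uniq[of "M (r *\<^sub>R x)" "r *\<^sub>R M x"]) (simp_all add: M)
    show "norm (M x) \<le> norm x * (1 / (1 - q))" using bound[of x] by simp
  qed
  moreover have "M (x + N x) = x" for x by (rule uniq) (rule M)
  ultimately show ?thesis using that M bound by blast
qed

lemma neumann_inverse_homogeneous:
  fixes N :: "'a::complex_hilbert \<Rightarrow> 'a"
  assumes "complex_homogeneous N" "\<And>x. M x + N (M x) = x" "\<And>x. M (x + N x) = x"
  shows "complex_homogeneous M"
  unfolding complex_homogeneous_def
proof (intro allI)
  fix c x
  have "c *\<^sub>C x = c *\<^sub>C M x + N (c *\<^sub>C M x)"
    by (metis assms(1,2) complex_homogeneousD scaleC_add_right)
  then show "M (c *\<^sub>C x) = c *\<^sub>C M x" using assms(3) by metis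
qed

text \<open>\<open>\<SS>\<^sub>2\<close> is inverse closed for small perturbations: \<open>(I + K)\<^sup>-\<^sup>1 = I + K'\<close> with \<open>K'\<close> again a
  square-summable matrix, because \<open>K' + K K' = - K\<close> can be solved within \<open>\<SS>\<^sub>2\<close>.\<close>

lemma matrix_neumann:
  fixes K :: "('i \<times> 'i, 'h::complex_hilbert \<Rightarrow>\<^sub>L 'h) ell2"
  assumes K: "norm K < 1" "clinear_matrix K"
  obtains K' where "clinear_matrix K'"
    "\<And>x. (x + mv K' x) + mv K (x + mv K' x) = x" "\<And>x. (x + mv K x) + mv K' (x + mv K x) = x"
proof -
  have lin: "bounded_linear (mm K :: ('i \<times> 'i, 'h \<Rightarrow>\<^sub>L 'h) ell2 \<Rightarrow> _)" by (rule mm.bounded_linear_right)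
  obtain M0 where "\<And>X :: ('i \<times> 'i, 'h \<Rightarrow>\<^sub>L 'h) ell2. M0 X + mm K (M0 X) = X"
    using neumann_inverse[OF lin norm_mm_le norm_ge_zero K(1)] by metis
  then obtain K' where K': "K' + mm K K' = - K" by metis
  obtain M where M: "\<And>x. M x + mv K (M x) = x" "\<And>x. M (x + mv K x) = x"
    using neumann_inverse[OF mv.bounded_linear_right[of K] norm_mv_le norm_ge_zero K(1)] by metis
  have a: "(x + mv K' x) + mv K (x + mv K' x) = x" for x
  proof -
    have "(x + mv K' x) + mv K (x + mv K' x) = x + mv K x + mv (K' + mm K K') x"
      by (simp add: mv.add_left mv.add_right mv_mm)
    then show ?thesis by (simp add: K' mv.minus_left)
  qed
  then have Mx: "M x = x + mv K' x" for x using M(2) by metis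
  have "complex_homogeneous M"
    by (rule neumann_inverse_homogeneous[OF _ M]) (use K(2) clinear_matrix_iff in blast)
  moreover have "mv K' = (\<lambda>x. M x - x)" by (simp add: Mx)
  ultimately have "clinear_matrix K'"
    unfolding clinear_matrix_iff by (simp add: complex_homogeneous_def scaleC.diff_right)
  moreover have "(x + mv K x) + mv K' (x + mv K x) = x" for x using M(2) Mx by metis
  ultimately show ?thesis using that a by blast
qed

section \<open>Commutators with the diagonal operator\<close>

definition lam :: "real \<Rightarrow> int \<Rightarrow> real" where "lam r j = r * of_int j"

definition in_dom :: "real \<Rightarrow> (int, 'h::complex_hilbert) ell2 \<Rightarrow> bool"
  where "in_dom r x \<longleftrightarrow> (\<lambda>j. (norm ((\<i> * of_real (lam r j)) *\<^sub>C cf x j))\<^sup>2) summable_on UNIV"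

text \<open>\<open>in_dom\<close> is membership in the domain of \<open>\<Lambda> = diag(i \<lambda>\<^sub>j)\<close>, and \<open>has_commutator K E\<close> says that the
  formal commutator \<open>\<Lambda> K - K \<Lambda>\<close> has the rows \<open>E j\<close>; the rows are square-summable although the
  whole commutator need not be.\<close>

definition has_commutator :: "real \<Rightarrow> (int \<times> int, 'h::complex_hilbert \<Rightarrow>\<^sub>L 'h) ell2 \<Rightarrow> (int \<Rightarrow> (int, 'h \<Rightarrow>\<^sub>L 'h) ell2) \<Rightarrow> bool"
  where "has_commutator r K E \<longleftrightarrow>
    (\<forall>j l. cf (E j) l = scalar_blinfun (\<i> * of_real (lam r j - lam r l)) o\<^sub>L cf K (j, l))"

text \<open>The identity \<open>K \<Lambda> x = \<Lambda> K x - [\<Lambda>, K] x\<close> row by row, for a vector \<open>y = \<Lambda> x - z\<close>: the single rows make sense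
  although \<open>\<Lambda> K x\<close> need not be square-summable.\<close>

lemma intertwine:
  assumes K: "clinear_matrix K" and E: "has_commutator r K E"
    and y: "\<And>j. cf y j = (\<i> * of_real (lam r j)) *\<^sub>C cf x j - cf z j"
  shows "cf (mv K y) j = (\<i> * of_real (lam r j)) *\<^sub>C cf (mv K x) j - dot blinfun_apply (E j) x - cf (mv K z) j"
proof -
  let ?c = "\<i> * of_real (lam r j)"
  have t: "cf K (j, n) (cf y n) = ?c *\<^sub>C cf K (j, n) (cf x n) - cf (E j) n (cf x n) - cf K (j, n) (cf z n)" for n
  proof -
    have "cf K (j, n) (cf y n) = (\<i> * of_real (lam r n)) *\<^sub>C cf K (j, n) (cf x n) - cf K (j, n) (cf z n)"
      using K by (simp add: y blinfun.diff_right clinear_matrix_def complex_homogeneous_def)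
    moreover have "?c *\<^sub>C cf K (j, n) (cf x n) - cf (E j) n (cf x n) = (\<i> * of_real (lam r n)) *\<^sub>C cf K (j, n) (cf x n)"
      using E by (simp add: has_commutator_def right_diff_distrib scaleC.diff_left)
    ultimately show ?thesis by simp
  qed
  have "((\<lambda>n. ?c *\<^sub>C cf K (j, n) (cf x n) - cf (E j) n (cf x n) - cf K (j, n) (cf z n)) has_sum
      (?c *\<^sub>C dot blinfun_apply (mrow K j) x - dot blinfun_apply (E j) x - dot blinfun_apply (mrow K j) z)) UNIV"
  proof -
    have s: "((\<lambda>n. cf A n (cf w n)) has_sum dot blinfun_apply A w) UNIV"
      for A :: "(int, 'a \<Rightarrow>\<^sub>L 'a) ell2" and w
      unfolding dot_def by (rule has_sum_infsum) (rule apply_cb.dot_summable)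
    have s1: "((\<lambda>n. ?c *\<^sub>C cf K (j, n) (cf x n)) has_sum ?c *\<^sub>C dot blinfun_apply (mrow K j) x) UNIV"
      using has_sum_bounded_linear[OF bounded_linear_scaleC s[of "mrow K j" x], of ?c] by simp
    have s3: "((\<lambda>n. cf K (j, n) (cf z n)) has_sum dot blinfun_apply (mrow K j) z) UNIV"
      using s[of "mrow K j" z] by simp
    have "((\<lambda>n. ?c *\<^sub>C cf K (j, n) (cf x n) + (- cf (E j) n (cf x n)) + (- cf K (j, n) (cf z n))) has_sum
      (?c *\<^sub>C dot blinfun_apply (mrow K j) x + (- dot blinfun_apply (E j) x) + (- dot blinfun_apply (mrow K j) z))) UNIV"
      by (intro has_sum_add s1) (use s[of "E j" x] s3 in \<open>simp_all add: has_sum_uminus\<close>)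
    then show ?thesis by simp
  qed
  then show ?thesis
    unfolding cf_mv by (subst (1) dot_def) (simp add: t infsumI)
qed

lemma lam_real_c:
  fixes c :: real assumes "c > 0"
  shows "cmod (1 / (\<i> * of_real t + of_real c)) \<le> 1 / c" and "\<i> * of_real t + of_real c \<noteq> 0"
proof -
  have "c \<le> cmod (\<i> * of_real t + of_real c)"
    using complex_Re_le_cmod[of "\<i> * of_real t + of_real c"] by simp
  then show "cmod (1 / (\<i> * of_real t + of_real c)) \<le> 1 / c" "\<i> * of_real t + of_real c \<noteq> 0"
    using assms by (auto simp: norm_divide intro!: divide_left_mono mult_pos_pos)
qed

lemma in_dom_iff_dg:
  assumes c: "c > 0"
  shows "in_dom r x \<longleftrightarrow> (\<exists>u. x = dg (\<lambda>l. 1 / (\<i> * of_real (lam r l) + of_real c)) u)"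
proof
  let ?a = "\<lambda>l. 1 / (\<i> * of_real (lam r l) + of_real c)"
  have b: "bounded_symbol ?a" using lam_real_c[OF c] by (intro bounded_symbolI)
  assume "in_dom r x"
  then have "(\<lambda>j. (norm ((\<i> * of_real (lam r j)) *\<^sub>C cf x j + c *\<^sub>R cf x j))\<^sup>2) summable_on UNIV"
    unfolding in_dom_def
    by (intro square_summable_add square_summable_scaleR cf_square_summable)
  then have u: "cf (Ell2 (\<lambda>j. (\<i> * of_real (lam r j)) *\<^sub>C cf x j + c *\<^sub>R cf x j))
      = (\<lambda>j. (\<i> * of_real (lam r j) + of_real c) *\<^sub>C cf x j)"
    by (subst cf_Ell2) (auto simp: scaleC_add_left scaleC_of_real)
  show "\<exists>u. x = dg ?a u"
    by (rule exI[of _ "Ell2 (\<lambda>j. (\<i> * of_real (lam r j)) *\<^sub>C cf x j + c *\<^sub>R cf x j)"], rule ell2_eqI)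
       (simp add: cf_dg[OF b] u scaleC_scaleC lam_real_c[OF c])
next
  let ?a = "\<lambda>l. 1 / (\<i> * of_real (lam r l) + of_real c)"
  have b: "bounded_symbol ?a" using lam_real_c[OF c] by (intro bounded_symbolI)
  assume "\<exists>u. x = dg ?a u"
  then obtain u where x: "x = dg ?a u" by blast
  have "(\<i> * of_real (lam r j)) *\<^sub>C cf x j = cf u j - c *\<^sub>R cf x j" for j
  proof -
    have "(\<i> * of_real (lam r j) + of_real c) *\<^sub>C cf x j = cf u j"
      by (simp add: x cf_dg[OF b] scaleC_scaleC lam_real_c[OF c])
    then show ?thesis by (simp add: scaleC_add_left scaleC_of_real algebra_simps)
  qed
  then show "in_dom r x" unfolding in_dom_def
    by (simp only:) (intro square_summable_diff square_summable_scaleR cf_square_summable)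
qed

text \<open>A similarity \<open>I + K\<close> preserves the domain of \<open>\<Lambda>\<close>: conjugating with \<open>\<Lambda> + c\<close> turns \<open>K\<close> into
  \<open>K + [\<Lambda>, K] (\<Lambda> + c)\<^sup>-\<^sup>1\<close>, and the correction becomes small in \<open>\<SS>\<^sub>2\<close> as \<open>c \<rightarrow> \<infinity>\<close>, so the conjugated
  operator is invertible as well.\<close>

lemma dom_invariant:
  assumes K: "clinear_matrix K" "norm K < 1" and E: "has_commutator r K E"
    and sq: "(\<lambda>(j, l). (norm (cf (E j) l) / cmod (\<i> * of_real (lam r l) + 1))\<^sup>2) summable_on UNIV"
  shows "in_dom r (x + mv K x) \<longleftrightarrow> in_dom r x"
proof -
  define a where "a = (\<lambda>(n::nat) l. 1 / (\<i> * of_real (lam r l) + of_real (real n + 1)))"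
  have pos: "real n + 1 > 0" for n :: nat by simp
  have a_le: "cmod (a n l) \<le> cmod (a 0 l)" for n l
  proof -
    have "cmod (\<i> * of_real (lam r l) + of_real (real 0 + 1)) \<le> cmod (\<i> * of_real (lam r l) + of_real (real n + 1))"
      by (simp add: cmod_def power_mono)
    then show ?thesis
      unfolding a_def norm_divide
      by (intro divide_left_mono mult_pos_pos) (use lam_real_c(2)[of "real n + 1" "lam r l"] lam_real_c(2)[of 1 "lam r l"] in auto)
  qed
  have a_lim: "(\<lambda>n. cmod (a n l)) \<longlonglongrightarrow> 0" for l
  proof (rule tendsto_sandwich[OF _ _ tendsto_const])
    show "\<forall>\<^sub>F n in sequentially. 0 \<le> cmod (a n l)" by simp
    show "\<forall>\<^sub>F n in sequentially. cmod (a n l) \<le> 1 / (real n + 1)"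
      using lam_real_c(1)[OF pos] by (auto simp: a_def)
    show "(\<lambda>n. 1 / (real n + 1)) \<longlonglongrightarrow> 0"
      using LIMSEQ_inverse_real_of_nat by (simp add: inverse_eq_divide add.commute)
  qed
  define Y :: "(int \<times> int, real) ell2" where "Y = Ell2 (\<lambda>(j, l). norm (cf (E j) l) * cmod (a 0 l))"
  have Y: "cf Y (j, l) = norm (cf (E j) l) * cmod (a 0 l)" for j l
  proof -
    have "(\<lambda>p. (norm (case p of (j, l) \<Rightarrow> norm (cf (E j) l) * cmod (a 0 l)))\<^sup>2)
      = (\<lambda>(j, l). (norm (cf (E j) l) / cmod (\<i> * of_real (lam r l) + 1))\<^sup>2)"
      by (auto simp: a_def norm_divide fun_eq_iff)
    then show ?thesis using sq unfolding Y_def by (subst cf_Ell2) auto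
  qed
  define X where "X = (\<lambda>n. Ell2 (\<lambda>(j, l). scalar_blinfun (a n l) o\<^sub>L cf (E j) l))"
  have X: "cf (X n) (j, l) = scalar_blinfun (a n l) o\<^sub>L cf (E j) l" for n j l
  proof -
    have "norm (case p of (j, l) \<Rightarrow> scalar_blinfun (a n l) o\<^sub>L cf (E j) l) \<le> 1 * norm (cf Y p)" for p
    proof -
      obtain j l where p: "p = (j, l)" by (cases p)
      have "norm (scalar_blinfun (a n l) o\<^sub>L cf (E j) l) \<le> cmod (a n l) * norm (cf (E j) l)"
        by (rule norm_scalar_compose_le)
      also have "\<dots> \<le> cmod (a 0 l) * norm (cf (E j) l)" by (intro mult_right_mono a_le) auto
      finally show ?thesis by (simp add: p Y mult.commute)
    qed
    from Ell2_dominated(1)[of _ _ Y, OF this] show ?thesis by (simp add: X_def)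
  qed
  have "X \<longlonglongrightarrow> 0"
  proof (rule ell2_dominated_tendsto_0[where Y = Y and C = 1 and a = "\<lambda>n p. cmod (a n (snd p)) / cmod (a 0 (snd p))"])
    fix n and p :: "int \<times> int"
    obtain j l where p: "p = (j, l)" by (cases p)
    have nz: "cmod (a 0 l) > 0" using lam_real_c(2)[of 1 "lam r l"] by (simp add: a_def)
    show "norm (cf (X n) p) \<le> cmod (a n (snd p)) / cmod (a 0 (snd p)) * norm (cf Y p)"
      using nz norm_scalar_compose_le[of "a n l" "cf (E j) l"] by (simp add: p X Y)
    show "0 \<le> cmod (a n (snd p)) / cmod (a 0 (snd p)) \<and> cmod (a n (snd p)) / cmod (a 0 (snd p)) \<le> 1"
      using nz a_le[of n l] by (simp add: p)
  next
    fix p :: "int \<times> int"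
    show "(\<lambda>n. cmod (a n (snd p)) / cmod (a 0 (snd p))) \<longlonglongrightarrow> 0"
      using tendsto_divide_zero[OF a_lim[of "snd p"], of "cmod (a 0 (snd p))"] by simp
  qed
  then have "(\<lambda>n. norm (K + X n)) \<longlonglongrightarrow> norm (K + 0)" by (intro tendsto_intros)
  then have "\<forall>\<^sub>F n in sequentially. norm (K + X n) < 1" using K(2) by (intro order_tendstoD) auto
  then obtain n where n: "norm (K + X n) < 1" using eventually_happens'[OF sequentially_bot] by blast
  define c where "c = real n + 1"
  have c: "c > 0" by (simp add: c_def)
  have an: "a n = (\<lambda>l. 1 / (\<i> * of_real (lam r l) + of_real c))" by (simp add: a_def c_def)
  have b: "bounded_symbol (a n)" unfolding an using lam_real_c[OF c] by (intro bounded_symbolI)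
  have Ehom: "cf (E j) l (s *\<^sub>C h) = s *\<^sub>C cf (E j) l h" for j l s h
    using E K(1) by (simp add: has_commutator_def clinear_matrix_def complex_homogeneous_def scaleC_scaleC mult.commute)
  have KX: "clinear_matrix (K + X n)"
    by (intro clinear_matrix_add K)
       (auto simp: clinear_matrix_def complex_homogeneous_def X Ehom scaleC_scaleC mult.commute)
  have conj: "dg (a n) u + mv K (dg (a n) u) = dg (a n) (u + mv (K + X n) u)" for u
  proof (rule ell2_eqI)
    fix j
    let ?cj = "\<i> * of_real (lam r j) + of_real c" and ?cl = "\<lambda>l. \<i> * of_real (lam r l) + of_real c"
    have t: "?cj *\<^sub>C cf K (j, l) (cf (dg (a n) u) l) = cf (K + X n) (j, l) (cf u l)" for l
    proof -
      have "?cj *\<^sub>C cf K (j, l) (cf (dg (a n) u) l) = (?cj * a n l) *\<^sub>C cf K (j, l) (cf u l)"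
        using K(1) by (simp add: cf_dg[OF b] clinear_matrix_def complex_homogeneous_def scaleC_scaleC)
      also have "?cj * a n l = 1 + a n l * (\<i> * of_real (lam r j - lam r l))"
        using lam_real_c(2)[OF c, of "lam r l"] by (simp add: an field_simps)
      also have "\<dots> *\<^sub>C cf K (j, l) (cf u l) = cf (K + X n) (j, l) (cf u l)"
        using E by (simp add: scaleC_add_left X has_commutator_def blinfun.add_left scaleC_scaleC)
      finally show ?thesis .
    qed
    have "?cj *\<^sub>C cf (mv K (dg (a n) u)) j = (\<Sum>\<^sub>\<infinity>l. ?cj *\<^sub>C cf K (j, l) (cf (dg (a n) u) l))"
      using infsum_scaleC[OF apply_cb.dot_summable[of "mrow K j" "dg (a n) u"], of ?cj] by (simp add: cf_mv dot_def)
    also have "\<dots> = cf (mv (K + X n) u) j" by (simp only: t) (simp add: cf_mv dot_def)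
    finally have *: "?cj *\<^sub>C cf (mv K (dg (a n) u)) j = cf (mv (K + X n) u) j" .
    have "cf (mv K (dg (a n) u)) j = a n j *\<^sub>C cf (mv (K + X n) u) j"
      using lam_real_c(2)[OF c, of "lam r j"] by (simp add: *[symmetric] scaleC_scaleC an)
    then show "cf (dg (a n) u + mv K (dg (a n) u)) j = cf (dg (a n) (u + mv (K + X n) u)) j"
      by (simp add: cf_dg[OF b] scaleC_add_right)
  qed
  obtain K' where K': "\<And>x. (x + mv K' x) + mv K (x + mv K' x) = x" "\<And>x. (x + mv K x) + mv K' (x + mv K x) = x"
    using matrix_neumann[OF K(2,1)] by metis
  obtain Z where Z: "\<And>x. (x + mv Z x) + mv (K + X n) (x + mv Z x) = x"
    using matrix_neumann[OF n KX] by metis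
  show ?thesis
  proof
    assume "in_dom r x"
    then obtain u where "x = dg (a n) u" unfolding in_dom_iff_dg[OF c] an by blast
    then show "in_dom r (x + mv K x)" unfolding in_dom_iff_dg[OF c] using conj an by metis
  next
    assume "in_dom r (x + mv K x)"
    then obtain w where w: "x + mv K x = dg (a n) w" unfolding in_dom_iff_dg[OF c] an by blast
    define u where "u = dg (a n) (w + mv Z w)"
    have "u + mv K u = x + mv K x" unfolding u_def conj Z w ..
    then have "x = u" using K'(2) by metis
    then show "in_dom r x" unfolding in_dom_iff_dg[OF c] u_def an by blast
  qed
qed

section \<open>Block-diagonal and off-diagonal parts\<close>

text \<open>The blocks of the partition of \<open>\<int>\<close> into \<open>{j. |j| \<le> k}\<close> and singletons, labelled by \<open>0\<close> and by the
  element itself.\<close>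

definition blk :: "nat \<Rightarrow> int \<Rightarrow> int" where "blk k j = (if \<bar>j\<bar> \<le> int k then 0 else j)"

text \<open>\<open>gam\<close> is the symbol of the right inverse of \<open>X \<mapsto> \<Lambda> X - X \<Lambda>\<close> on off-diagonal matrices, \<open>jay\<close> that of
  the projection onto block-diagonal ones.\<close>

definition gam :: "real \<Rightarrow> nat \<Rightarrow> int \<times> int \<Rightarrow> complex"
  where "gam r k = (\<lambda>(j, l). if blk k j = blk k l then 0 else 1 / (\<i> * of_real (lam r j - lam r l)))"

definition jay :: "nat \<Rightarrow> int \<times> int \<Rightarrow> complex"
  where "jay k = (\<lambda>(j, l). if blk k j = blk k l then 1 else 0)"

text \<open>\<open>wa k j\<close> bounds, up to the factor \<open>r\<close>, the inverse distance from \<open>i \<lambda>\<^sub>j\<close> to the eigenvalues in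
  other blocks and to the contours that are drawn around the blocks; \<open>1/3\<close> leaves room between
  the contours.\<close>

definition wa :: "nat \<Rightarrow> int \<Rightarrow> real"
  where "wa k j = (if \<bar>j\<bar> \<le> int k then 1 / (real k + 1/3 - of_int \<bar>j\<bar>) else 3)"

lemma of_int_abs_le: "\<bar>j\<bar> \<le> int k \<Longrightarrow> \<bar>real_of_int j\<bar> \<le> real k"
  by (metis of_int_abs of_int_le_iff of_int_of_nat_eq)

lemma wa_bounds: "0 \<le> wa k j" "\<bar>wa k j\<bar> \<le> 3"
proof -
  have "real k + 1/3 - of_int \<bar>j\<bar> \<ge> 1/3" if "\<bar>j\<bar> \<le> int k" using of_int_abs_le[OF that] by simp
  then have "\<bar>j\<bar> \<le> int k \<Longrightarrow> 0 \<le> 1 / (real k + 1/3 - of_int \<bar>j\<bar>) \<and> 1 / (real k + 1/3 - of_int \<bar>j\<bar>) \<le> 3"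
    by (fastforce simp: field_simps)
  then show "0 \<le> wa k j" "\<bar>wa k j\<bar> \<le> 3" by (auto simp: wa_def)
qed

lemma wa_tendsto: "(\<lambda>k. wa k j) \<longlonglongrightarrow> 0"
proof -
  have "filterlim (\<lambda>k. (1/3 - of_int \<bar>j\<bar>) + real k) at_top sequentially"
    by (rule filterlim_tendsto_add_at_top[OF tendsto_const filterlim_real_sequentially])
  then have "(\<lambda>k. 1 / ((1/3 - of_int \<bar>j\<bar>) + real k)) \<longlonglongrightarrow> 0"
    using tendsto_inverse_0_at_top by (simp add: inverse_eq_divide)
  moreover have "\<forall>\<^sub>F k in sequentially. 1 / ((1/3 - of_int \<bar>j\<bar>) + real k) = wa k j"
    by (rule eventually_sequentiallyI[of "nat \<bar>j\<bar>"]) (auto simp: wa_def algebra_simps)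
  ultimately show ?thesis by (rule Lim_transform_eventually)
qed

lemma gam_le_wa:
  assumes "r > 0" shows "cmod (gam r k (j, l)) \<le> wa k j / r"
proof (cases "blk k j = blk k l")
  case True then show ?thesis using assms wa_bounds by (simp add: gam_def)
next
  case False
  then have jl: "j \<noteq> l" by auto
  have *: "1 \<le> wa k j * \<bar>real_of_int (j - l)\<bar>"
  proof (cases "\<bar>j\<bar> \<le> int k")
    case True
    with False have "\<bar>l\<bar> \<ge> int k + 1" by (auto simp: blk_def split: if_splits)
    then have "int k + 1 - \<bar>j\<bar> \<le> \<bar>j - l\<bar>" by linarith
    then have "real k + 1 - of_int \<bar>j\<bar> \<le> \<bar>real_of_int (j - l)\<bar>"
      by (metis (mono_tags, opaque_lifting) of_int_1 of_int_abs of_int_add of_int_diff of_int_le_iff of_int_of_nat_eq)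
    then show ?thesis using True of_int_abs_le[OF True] by (simp add: wa_def field_simps)
  next
    case nk: False
    have "1 \<le> \<bar>j - l\<bar>" using jl by linarith
    then have "1 \<le> \<bar>real_of_int (j - l)\<bar>" by (metis of_int_1_le_iff of_int_abs)
    then show ?thesis using nk by (auto simp: wa_def)
  qed
  have pos: "\<bar>real_of_int (j - l)\<bar> > 0" using jl by simp
  have "cmod (gam r k (j, l)) = 1 / (r * \<bar>real_of_int (j - l)\<bar>)"
    using False assms by (simp add: gam_def norm_divide norm_mult lam_def abs_mult flip: right_diff_distrib of_real_diff)
  also have "\<dots> \<le> wa k j / r" using * pos assms by (simp add: field_simps)
  finally show ?thesis .
qed

lemma gam_le_wa': "r > 0 \<Longrightarrow> cmod (gam r k (j, l)) \<le> wa k l / r"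
  using gam_le_wa[of r k l j] by (auto simp: gam_def norm_divide norm_mult abs_minus_commute[of "lam r j" "lam r l"] simp flip: of_real_diff)

lemma gam_le: "r > 0 \<Longrightarrow> cmod (gam r k p) \<le> 3 / r"
  using order_trans[OF gam_le_wa[of r k "fst p" "snd p"], of "3 / r"] wa_bounds[of k "fst p"]
  by (simp add: divide_right_mono)

lemma bounded_symbol_gam: "r > 0 \<Longrightarrow> bounded_symbol (gam r k)"
  using gam_le by (intro bounded_symbolI)

lemma jay_le: "cmod (jay k p) \<le> 1" by (cases p) (auto simp: jay_def)
lemma bounded_symbol_jay: "bounded_symbol (jay k)"
  using jay_le by (intro bounded_symbolI)

lemma gam_commutator:
  "r > 0 \<Longrightarrow> \<i> * of_real (lam r j - lam r l) * gam r k (j, l) = 1 - jay k (j, l)"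
  by (auto simp: gam_def jay_def lam_def blk_def)

lemma norm_rw_le_weight:
  assumes "\<And>i. \<bar>a i\<bar> \<le> C" "\<And>p. norm (cf Y p) \<le> norm (cf X p)" shows "norm (rw a Y) \<le> norm (rw a X)"
  by (rule norm_ell2_mono, clarify) (simp add: cf_rw[OF assms(1)] mult_left_mono assms(2))
lemma norm_cw_le_weight:
  assumes "\<And>i. \<bar>a i\<bar> \<le> C" "\<And>p. norm (cf Y p) \<le> norm (cf X p)" shows "norm (cw a Y) \<le> norm (cw a X)"
  by (rule norm_ell2_mono, clarify) (simp add: cf_cw[OF assms(1)] mult_left_mono assms(2))

lemma norm_cf_jay_le: "norm (cf (wt (jay k) X) p) \<le> norm (cf X p)"
  using norm_cf_wt_le[OF bounded_symbol_jay, of k X p] jay_le[of k p]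
  by (meson mult_left_le_one_le norm_ge_zero order_trans)

lemma norm_gam_rw:
  assumes r: "r > 0" shows "norm (wt (gam r k) X) \<le> norm (rw (wa k) X) / r"
proof -
  have "norm (cf (wt (gam r k) X) p) \<le> 1 / r * norm (cf (rw (wa k) X) p)" for p
  proof -
    obtain j l where p: "p = (j, l)" by (cases p)
    have "norm (cf (wt (gam r k) X) p) \<le> wa k j / r * norm (cf X p)"
      unfolding p by (rule order_trans[OF norm_cf_wt_le[OF bounded_symbol_gam[OF r]] mult_right_mono[OF gam_le_wa[OF r]]]) simp
    then show ?thesis using wa_bounds by (simp add: p cf_rw[OF wa_bounds(2)])
  qed
  from Ell2_dominated(2)[of "cf (wt (gam r k) X)" "1 / r" "rw (wa k) X", OF this] r show ?thesis
    by (simp add: cf_inverse)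
qed

lemma norm_gam_cw:
  assumes r: "r > 0" shows "norm (wt (gam r k) X) \<le> norm (cw (wa k) X) / r"
proof -
  have "norm (cf (wt (gam r k) X) p) \<le> 1 / r * norm (cf (cw (wa k) X) p)" for p
  proof -
    obtain j l where p: "p = (j, l)" by (cases p)
    have "norm (cf (wt (gam r k) X) p) \<le> wa k l / r * norm (cf X p)"
      unfolding p by (rule order_trans[OF norm_cf_wt_le[OF bounded_symbol_gam[OF r]] mult_right_mono[OF gam_le_wa'[OF r]]]) simp
    then show ?thesis using wa_bounds by (simp add: p cf_cw[OF wa_bounds(2)])
  qed
  from Ell2_dominated(2)[of "cf (wt (gam r k) X)" "1 / r" "cw (wa k) X", OF this] r show ?thesis
    by (simp add: cf_inverse)
qed

lemma rw_wa_tendsto: "(\<lambda>k. rw (wa k) X) \<longlonglongrightarrow> 0"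
  by (rule ell2_dominated_tendsto_0[where a = "\<lambda>k p. wa k (fst p)" and C = 3 and Y = X])
     (auto simp: cf_rw[OF wa_bounds(2)] wa_bounds wa_tendsto order_trans[OF abs_ge_self wa_bounds(2)])
lemma cw_wa_tendsto: "(\<lambda>k. cw (wa k) X) \<longlonglongrightarrow> 0"
  by (rule ell2_dominated_tendsto_0[where a = "\<lambda>k p. wa k (snd p)" and C = 3 and Y = X])
     (auto simp: cf_cw[OF wa_bounds(2)] wa_bounds wa_tendsto order_trans[OF abs_ge_self wa_bounds(2)])

section \<open>Block diagonalisation of a perturbation from \<open>\<SS>\<^sub>2\<close>\<close>

text \<open>The equation \<open>(\<Lambda> - B)(I + Y) = (I + Y)(\<Lambda> - D)\<close> with \<open>D\<close> block diagonal and \<open>Y\<close> off-diagonal is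
  equivalent to \<open>D = J(B + BY)\<close> and \<open>Y = \<Gamma>(B + BY - YD)\<close>.  The Lipschitz constant of the right-hand side
  is small for large \<open>k\<close>: an entry of \<open>\<Gamma>(B Y)\<close> can be large only if its row index is far from \<open>0\<close>, where
  the rows of \<open>B\<close> are small, and similarly for the columns in \<open>\<Gamma>(Y J B)\<close>.  The term that is quadratic in \<open>Y\<close> is
  controlled by the radius \<open>\<rho>\<close> of the ball in which the fixed point is sought.\<close>

lemma riccati:
  fixes B :: "(int \<times> int, 'h::complex_hilbert \<Rightarrow>\<^sub>L 'h) ell2"
  assumes r: "r > 0" and B: "clinear_matrix B"
  obtains k Y where "clinear_matrix Y" "norm Y < 1"
    "Y = wt (gam r k) (B + mm B Y - mm Y (wt (jay k) (B + mm B Y)))"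
    "norm (rw (wa k) (B + mm B Y)) \<le> r / 2"
proof -
  define b where "b = norm B"
  have b: "b \<ge> 0" by (simp add: b_def)
  define \<rho> where "\<rho> = min (1/2) (r / (24 * (b + 1)))"
  have \<rho>: "\<rho> > 0" using r b by (simp add: \<rho>_def)
  have \<rho>2: "\<rho> \<le> 1/2" unfolding \<rho>_def by (rule min.cobounded1)
  note \<rho> = \<rho> \<rho>2
  have b\<rho>: "3 / r * (b * \<rho>) \<le> 1/8"
  proof -
    have "\<rho> \<le> r / (24 * (b + 1))" by (simp add: \<rho>_def)
    then have "b * \<rho> \<le> b * (r / (24 * (b + 1)))" using b by (rule mult_left_mono)
    also have "\<dots> \<le> r / 24" using b r by (simp add: field_simps)
    finally show ?thesis using r by (simp add: field_simps)
  qed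
  \<comment> \<open>The choice of \<open>\<rho>\<close> bounds each of the two increments of the quadratic term by \<open>1/8\<close> of the distance, and
    that of \<open>\<alpha>\<close> each of the two linear terms.\<close>
  define \<alpha> where "\<alpha> = r * \<rho> / 4"
  have \<alpha>: "\<alpha> > 0" "\<alpha> / r = \<rho> / 4" using r \<rho> by (auto simp: \<alpha>_def)
  have "\<forall>\<^sub>F k in sequentially. norm (rw (wa k) B) < \<alpha>" "\<forall>\<^sub>F k in sequentially. norm (cw (wa k) B) < \<alpha>"
    using tendsto_norm_zero[OF rw_wa_tendsto] tendsto_norm_zero[OF cw_wa_tendsto] \<alpha>(1)
    by (auto dest: order_tendstoD(2))
  then have "\<forall>\<^sub>F k in sequentially. norm (rw (wa k) B) < \<alpha> \<and> norm (cw (wa k) B) < \<alpha>"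
    by (rule eventually_conj)
  then obtain k where k: "norm (rw (wa k) B) < \<alpha>" "norm (cw (wa k) B) < \<alpha>"
    using eventually_happens'[OF sequentially_bot] by blast
  let ?G = "wt (gam r k) :: (int \<times> int, 'h \<Rightarrow>\<^sub>L 'h) ell2 \<Rightarrow> _" and ?J = "wt (jay k) :: (int \<times> int, 'h \<Rightarrow>\<^sub>L 'h) ell2 \<Rightarrow> _"
  note Glin = wt_linear[OF bounded_symbol_gam[OF r, of k]] and Jlin = wt_linear[OF bounded_symbol_jay[of k]]
  have g1: "norm (?G (mm B Y)) \<le> \<alpha> / r * norm Y" for Y
  proof -
    have "norm (?G (mm B Y)) \<le> norm (mm (rw (wa k) B) Y) / r"
      using norm_gam_rw[OF r, of k "mm B Y"] by (simp add: mm_rw[OF wa_bounds(2)])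
    also have "\<dots> \<le> \<alpha> * norm Y / r"
      using r k(1) by (intro divide_right_mono order_trans[OF norm_mm_le] mult_right_mono) auto
    finally show ?thesis by simp
  qed
  have g2: "norm (?G (mm Y (?J B))) \<le> \<alpha> / r * norm Y" for Y
  proof -
    have "norm (?G (mm Y (?J B))) \<le> norm (mm Y (cw (wa k) (?J B))) / r"
      using norm_gam_cw[OF r, of k "mm Y (?J B)"] by (simp add: mm_cw[OF wa_bounds(2)])
    also have "\<dots> \<le> norm Y * \<alpha> / r"
      using r k(2) norm_cw_le_weight[where a = "wa k", OF wa_bounds(2) norm_cf_jay_le[of k B]]
      by (intro divide_right_mono order_trans[OF norm_mm_le] mult_left_mono) auto
    finally show ?thesis by (simp add: mult.commute)
  qed
  have g3: "norm (?G (mm Y (?J (mm B Z)))) \<le> 3 / r * b * norm Y * norm Z" for Y Z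
  proof -
    have "norm (?G (mm Y (?J (mm B Z)))) \<le> 3 / r * norm (mm Y (?J (mm B Z)))"
      by (rule norm_wt_le) (rule gam_le[OF r])
    also have "norm (?J (mm B Z)) \<le> b * norm Z"
      using norm_wt_le[of "jay k" 1 "mm B Z", OF jay_le] norm_mm_le[of B Z] by (simp add: b_def)
    then have "3 / r * norm (mm Y (?J (mm B Z))) \<le> 3 / r * (norm Y * (b * norm Z))"
      using r by (intro mult_left_mono order_trans[OF norm_mm_le]) auto
    finally show ?thesis by (simp add: mult_ac)
  qed
  define F where "F = (\<lambda>Y. ?G (B + mm B Y - mm Y (?J (B + mm B Y))))"
  have F: "F Y = ?G B + ?G (mm B Y) - ?G (mm Y (?J B)) - ?G (mm Y (?J (mm B Y)))" for Y
    by (simp add: F_def Glin Jlin mm.add_right algebra_simps)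
  define s where "s = {Y :: (int \<times> int, 'h \<Rightarrow>\<^sub>L 'h) ell2. clinear_matrix Y} \<inter> cball 0 \<rho>"
  have sN: "norm Y \<le> \<rho>" if "Y \<in> s" for Y using that by (simp add: s_def)
  have "\<exists>!Y\<in>s. F Y = Y"
  proof (rule Banach_fix)
    show "complete s" unfolding s_def complete_eq_closed by (intro closed_Int closed_clinear_matrix closed_cball)
    have "0 \<in> s" using \<rho> by (simp add: s_def clinear_matrix_def complex_homogeneous_def)
    then show "s \<noteq> {}" by blast
    show "(0::real) \<le> 1/2" "1/2 < (1::real)" by auto
    show "F ` s \<subseteq> s"
    proof safe
      fix Y assume Y: "Y \<in> s"
      then have cl: "clinear_matrix Y" by (simp add: s_def)
      have "norm (?G B) \<le> \<rho> / 4"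
        using norm_gam_rw[OF r, of k B] k(1) r \<alpha>(2) divide_right_mono[of "norm (rw (wa k) B)" \<alpha> r] by linarith
      moreover have "\<alpha> / r * norm Y \<le> \<rho> / 8"
        using mult_mono[of "\<rho> / 4" "1/8" "norm Y" \<rho>] sN[OF Y] \<rho> by (simp add: \<alpha>)
      moreover have "3 / r * b * norm Y * norm Y \<le> \<rho> / 8"
      proof -
        have "3 / r * b * norm Y * norm Y \<le> 3 / r * b * \<rho> * \<rho>"
          using sN[OF Y] r b \<rho> by (intro mult_mono) auto
        also have "\<dots> \<le> 1/8 * \<rho>" using b\<rho> \<rho> by (intro mult_right_mono) (auto simp: mult_ac)
        finally show ?thesis by simp
      qed
      ultimately have "norm (F Y) \<le> \<rho>"
        unfolding F using g1[of Y] g2[of Y] g3[of Y Y]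
          norm_triangle_ineq4[of "?G B + ?G (mm B Y) - ?G (mm Y (?J B))" "?G (mm Y (?J (mm B Y)))"]
          norm_triangle_ineq4[of "?G B + ?G (mm B Y)" "?G (mm Y (?J B))"]
          norm_triangle_ineq[of "?G B" "?G (mm B Y)"] \<rho> by linarith
      moreover have "clinear_matrix (F Y)"
        unfolding F_def
        by (intro clinear_matrix_wt clinear_matrix_diff clinear_matrix_add clinear_matrix_mm B cl
            bounded_symbol_gam bounded_symbol_jay r)
      ultimately show "F Y \<in> s" by (simp add: s_def)
    qed
    show "dist (F Y) (F Z) \<le> 1/2 * dist Y Z" if YZ: "Y \<in> s" "Z \<in> s" for Y Z
    proof -
      have "F Y - F Z = ?G (mm B (Y - Z)) - ?G (mm (Y - Z) (?J B)) - ?G (mm (Y - Z) (?J (mm B Y)))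
          - ?G (mm Z (?J (mm B (Y - Z))))"
        by (simp add: F Glin Jlin mm.diff_left mm.diff_right algebra_simps)
      then have "norm (F Y - F Z) \<le> norm (?G (mm B (Y - Z))) + norm (?G (mm (Y - Z) (?J B)))
          + norm (?G (mm (Y - Z) (?J (mm B Y)))) + norm (?G (mm Z (?J (mm B (Y - Z)))))"
        by (metis (no_types, lifting) add_mono norm_triangle_ineq4 norm_triangle_le_diff order_refl)
      also have "\<dots> \<le> \<alpha> / r * norm (Y - Z) + \<alpha> / r * norm (Y - Z)
          + 3 / r * b * norm (Y - Z) * norm Y + 3 / r * b * norm Z * norm (Y - Z)"
        by (intro add_mono g1 g2 g3)
      also have "\<dots> \<le> 1/8 * norm (Y - Z) + 1/8 * norm (Y - Z) + 1/8 * norm (Y - Z) + 1/8 * norm (Y - Z)"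
      proof -
        have aa: "\<alpha> / r * norm (Y - Z) \<le> 1/8 * norm (Y - Z)"
          unfolding \<alpha>(2) by (intro mult_right_mono; use \<rho> in simp)
        have bb: "3 / r * b * norm X \<le> 1/8" if "X \<in> s" for X
        proof -
          have "3 / r * b * norm X \<le> 3 / r * b * \<rho>" using sN[OF that] r b by (intro mult_left_mono) auto
          also have "\<dots> = 3 / r * (b * \<rho>)" by simp
          finally show ?thesis using b\<rho> by linarith
        qed
        have "3 / r * b * norm Z * norm (Y - Z) \<le> 1/8 * norm (Y - Z)"
          by (intro mult_right_mono bb YZ) auto
        moreover have "3 / r * b * norm (Y - Z) * norm Y \<le> 1/8 * norm (Y - Z)"
          using mult_right_mono[OF bb[OF YZ(1)], of "norm (Y - Z)"] by (simp add: mult_ac)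
        ultimately show ?thesis using aa by linarith
      qed
      finally show ?thesis by (simp add: dist_norm)
    qed
  qed
  then obtain Y where Y: "Y \<in> s" "F Y = Y" by blast
  show ?thesis
  proof (rule that)
    show "clinear_matrix Y" "norm Y < 1" using Y(1) sN[OF Y(1)] \<rho> by (auto simp: s_def)
    show "Y = wt (gam r k) (B + mm B Y - mm Y (wt (jay k) (B + mm B Y)))" using Y(2) by (simp add: F_def)
    have "rw (wa k) (B + mm B Y) = rw (wa k) B + mm (rw (wa k) B) Y"
      by (rule ell2_eqI, clarify) (simp add: mm_rw[OF wa_bounds(2)] cf_rw[OF wa_bounds(2)] scaleR_add_right)
    then have "norm (rw (wa k) (B + mm B Y)) \<le> \<alpha> + \<alpha> * \<rho>"
      using norm_triangle_ineq[of "rw (wa k) B" "mm (rw (wa k) B) Y"] k(1)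
        norm_mm_le[of "rw (wa k) B" Y] mult_mono[of "norm (rw (wa k) B)" \<alpha> "norm Y" \<rho>] sN[OF Y(1)] \<alpha>
      by simp
    also have "\<dots> \<le> r * (1/2) / 4 + r * (1/2) / 4 * 1"
      using \<rho> r by (intro add_mono mult_mono) (auto simp: \<alpha>_def intro!: divide_right_mono mult_left_mono)
    also have "\<dots> \<le> r / 2" using r by simp
    finally show "norm (rw (wa k) (B + mm B Y)) \<le> r / 2" .
  qed
qed

text \<open>The graph of \<open>\<Lambda> - M\<close> for an operator \<open>M\<close> whose values need not be square-summable.\<close>

definition diag_minus :: "real \<Rightarrow> ((int, 'h::complex_hilbert) ell2 \<Rightarrow> int \<Rightarrow> 'h) \<Rightarrow> ((int, 'h) ell2 \<times> (int, 'h) ell2) set"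
  where "diag_minus r M = {(x, y). \<forall>j. cf y j = (\<i> * of_real (lam r j)) *\<^sub>C cf x j - M x j}"

section \<open>Reduction of the involution perturbation to \<open>\<SS>\<^sub>2\<close>\<close>

lemma Ell2_reindex:
  fixes x :: "('i, 'e::real_normed_vector) ell2"
  assumes "inj f" shows "cf (Ell2 (\<lambda>p. cf x (f p))) p = cf x (f p)"
proof -
  have "L2_set (\<lambda>p. norm (cf x (f p))) F \<le> norm x" if "finite F" for F
  proof -
    have "L2_set (\<lambda>p. norm (cf x (f p))) F = L2_set (\<lambda>i. norm (cf x i)) (f ` F)"
      using assms by (simp add: L2_set_def sum.reindex inj_on_subset[OF assms])
    then show ?thesis using that by (simp add: L2_set_cf_le)
  qed
  from Ell2_bounded(1)[OF this] show ?thesis by simp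
qed

lemma summable_inverse_square_int: "(\<lambda>m::int. (1 / real_of_int m)\<^sup>2) summable_on UNIV"
proof -
  have nat: "(\<lambda>n::nat. (1 / real n)\<^sup>2) summable_on UNIV"
    by (subst summable_on_UNIV_nonneg_real_iff)
       (use inverse_power_summable[of 2, where 'a = real] in \<open>auto simp: power_one_over inverse_eq_divide\<close>)
  have "(\<lambda>m::int. (1 / real_of_int m)\<^sup>2) summable_on range int"
    by (subst summable_on_reindex) (use nat in \<open>auto simp: o_def inj_on_def\<close>)
  moreover have "(\<lambda>m::int. (1 / real_of_int m)\<^sup>2) summable_on range (\<lambda>n. - int n)"
    by (subst summable_on_reindex) (use nat in \<open>auto simp: o_def inj_on_def\<close>)
  ultimately have "(\<lambda>m::int. (1 / real_of_int m)\<^sup>2) summable_on (range int \<union> range (\<lambda>n. - int n))"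
    by (rule summable_on_union)
  also have "range int \<union> range (\<lambda>n. - int n) = UNIV"
    by (metis (mono_tags, lifting) UNIV_eq_I UnI1 UnI2 int_cases2 rangeI)
  finally show ?thesis .
qed

definition recip :: "(int, real) ell2" where "recip = Ell2 (\<lambda>m. 1 / real_of_int m)"

lemma cf_recip: "cf recip m = 1 / real_of_int m"
  unfolding recip_def by (subst cf_Ell2) (use summable_inverse_square_int in \<open>auto simp: power_divide\<close>)

lemma summable_resolvent_square:
  assumes "r > 0" shows "(\<lambda>l. (1 / cmod (\<i> * of_real (lam r l) + 1))\<^sup>2) summable_on UNIV"
proof (rule summable_on_comparison_test)
  let ?g = "\<lambda>l. (1 / cmod (\<i> * of_real (lam r l) + 1))\<^sup>2"
  have "(\<lambda>m::int. (1 / real_of_int m)\<^sup>2) summable_on - {0}"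
    by (rule summable_on_subset[OF summable_inverse_square_int]) auto
  then have "(\<lambda>m::int. (1 / r)\<^sup>2 * (1 / real_of_int m)\<^sup>2) summable_on - {0}"
    by (rule summable_on_cmult_right)
  then have "(\<lambda>m. if m = 0 then ?g 0 else (1 / r)\<^sup>2 * (1 / real_of_int m)\<^sup>2) summable_on - {0}"
    by (rule summable_on_cong[THEN iffD1, rotated]) auto
  moreover have "(\<lambda>m. if m = 0 then ?g 0 else (1 / r)\<^sup>2 * (1 / real_of_int m)\<^sup>2) summable_on {0}" by simp
  ultimately have "(\<lambda>m. if m = 0 then ?g 0 else (1 / r)\<^sup>2 * (1 / real_of_int m)\<^sup>2) summable_on (- {0} \<union> {0})"
    by (rule summable_on_union)
  moreover have "- {0} \<union> {0} = (UNIV :: int set)" by auto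
  ultimately show "(\<lambda>m. if m = 0 then ?g 0 else (1 / r)\<^sup>2 * (1 / real_of_int m)\<^sup>2) summable_on UNIV"
    by simp
  fix l :: int
  show "?g l \<le> (if l = 0 then ?g 0 else (1 / r)\<^sup>2 * (1 / real_of_int l)\<^sup>2)"
  proof (cases "l = 0")
    case False
    have "\<bar>lam r l\<bar> \<le> cmod (\<i> * of_real (lam r l) + 1)"
      using abs_Im_le_cmod[of "\<i> * of_real (lam r l) + 1"] by simp
    moreover have "\<bar>lam r l\<bar> > 0" using assms False by (simp add: lam_def)
    ultimately have "1 / cmod (\<i> * of_real (lam r l) + 1) \<le> 1 / \<bar>lam r l\<bar>"
      by (intro frac_le) auto
    then have "?g l \<le> (1 / \<bar>lam r l\<bar>)\<^sup>2" by (intro power_mono) auto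
    then show ?thesis using False assms by (simp add: lam_def power_mult_distrib power_divide)
  qed simp
qed auto

text \<open>The data of the problem in Fourier coordinates: \<open>v n\<close> is the \<open>n\<close>-th Fourier coefficient of the
  potential; in the basis of exponentials the potential combined with the reflection has the Hankel matrix
  \<open>(v (j + l))\<close>.\<close>

locale hankel_potential =
  fixes r :: real and v :: "int \<Rightarrow> ('h::complex_hilbert \<Rightarrow>\<^sub>L 'h)"
  assumes r_pos: "r > 0"
    and v_hom: "\<And>n. complex_homogeneous (blinfun_apply (v n))"
    and v_sq: "(\<lambda>n. (norm (v n))\<^sup>2) summable_on UNIV"
    and v_prod: "(\<lambda>(j, l). (norm (\<Sum>\<^sub>\<infinity>n\<in>UNIV - {l}. (1 / real_of_int (l - n)) *\<^sub>R (v (j + n) o\<^sub>L v (l + n))))\<^sup>2)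
         summable_on UNIV"
begin

definition vv :: "(int, 'h \<Rightarrow>\<^sub>L 'h) ell2" where "vv = Ell2 v"
definition vrow :: "int \<Rightarrow> (int, 'h \<Rightarrow>\<^sub>L 'h) ell2" where "vrow j = Ell2 (\<lambda>n. v (j + n))"

lemma cf_vv: "cf vv n = v n" unfolding vv_def by (subst cf_Ell2) (use v_sq in auto)

lemma cf_vrow [simp]: "cf (vrow j) n = v (j + n)"
  using Ell2_reindex[of "\<lambda>n. j + n" vv n] by (simp add: vrow_def cf_vv)

text \<open>The matrix \<open>\<Gamma>\<^sub>0 V\<close>.  It is square-summable because after the change of indices \<open>(j + l, j - l)\<close> its entries
  are dominated, up to the factor \<open>1 / r\<close>, by the products of \<open>\<parallel>v m\<parallel>\<close> and \<open>1 / |n|\<close>.\<close>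

definition G0 :: "(int \<times> int, 'h \<Rightarrow>\<^sub>L 'h) ell2"
  where "G0 = Ell2 (\<lambda>(j, l). scalar_blinfun (gam r 0 (j, l)) o\<^sub>L v (j + l))"

lemma blk_0 [simp]: "blk 0 j = j" by (simp add: blk_def)

lemma cf_G0: "cf G0 (j, l) = scalar_blinfun (gam r 0 (j, l)) o\<^sub>L v (j + l)"
proof -
  define T where "T = Ell2 (\<lambda>p. cf (tensor vv recip) (fst p + snd p, fst p - snd p))"
  have T: "cf T (j, l) = norm (v (j + l)) * \<bar>1 / real_of_int (j - l)\<bar>" for j l
    unfolding T_def by (subst Ell2_reindex) (auto simp: inj_def cf_tensor cf_vv cf_recip)
  have "norm (case p of (j, l) \<Rightarrow> scalar_blinfun (gam r 0 (j, l)) o\<^sub>L v (j + l)) \<le> 1 / r * norm (cf T p)" for p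
  proof -
    obtain j l where p: "p = (j, l)" by (cases p)
    have "cmod (gam r 0 (j, l)) \<le> 1 / r * \<bar>1 / real_of_int (j - l)\<bar>"
      using r_pos by (auto simp: gam_def norm_divide norm_mult lam_def abs_mult simp flip: right_diff_distrib of_real_diff of_int_diff)
    then have "norm (scalar_blinfun (gam r 0 (j, l)) o\<^sub>L v (j + l)) \<le> 1 / r * \<bar>1 / real_of_int (j - l)\<bar> * norm (v (j + l))"
      by (rule order_trans[OF norm_scalar_compose_le mult_right_mono]) simp
    then show ?thesis by (simp add: p T mult_ac)
  qed
  from Ell2_dominated(1)[of _ _ T, OF this] show ?thesis by (simp add: G0_def)
qed

lemma clinear_G0: "clinear_matrix G0"
  using v_hom by (auto simp: clinear_matrix_def complex_homogeneous_def cf_G0 scaleC_scaleC mult.commute)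

definition off :: "nat \<Rightarrow> int \<times> int \<Rightarrow> complex" where "off k p = 1 - jay k p"

lemma bounded_symbol_off: "bounded_symbol (off k)"
  by (rule bounded_symbolI[of _ 1]) (auto simp: off_def jay_def)

text \<open>Enlarging the central block only deletes entries of \<open>\<Gamma>\<^sub>0 V\<close>, which is why \<open>\<Gamma>\<^sub>k V\<close> becomes small.\<close>

definition Gk :: "nat \<Rightarrow> (int \<times> int, 'h \<Rightarrow>\<^sub>L 'h) ell2" where "Gk k = wt (off k) G0"

lemma cf_Gk: "cf (Gk k) (j, l) = scalar_blinfun (gam r k (j, l)) o\<^sub>L v (j + l)"
proof -
  have "off k (j, l) * gam r 0 (j, l) = gam r k (j, l)"
    by (auto simp: off_def jay_def gam_def)
  then show ?thesis
    by (intro blinfun_eqI) (simp add: Gk_def cf_wt[OF bounded_symbol_off] cf_G0 scaleC_scaleC)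
qed

lemma Gk_tendsto: "Gk \<longlonglongrightarrow> 0"
proof (rule ell2_dominated_tendsto_0[where Y = G0 and C = 1 and a = "\<lambda>k p. cmod (off k p)"])
  fix p :: "int \<times> int"
  obtain j l where p: "p = (j, l)" by (cases p)
  show "(\<lambda>k. cmod (off k p)) \<longlonglongrightarrow> 0"
    by (rule tendsto_eventually, rule eventually_sequentiallyI[of "nat (max \<bar>j\<bar> \<bar>l\<bar>)"])
       (auto simp: off_def jay_def p blk_def)
  fix k
  show "norm (cf (Gk k) p) \<le> cmod (off k p) * norm (cf G0 p)"
    unfolding Gk_def by (rule norm_cf_wt_le[OF bounded_symbol_off])
  show "0 \<le> cmod (off k p) \<and> cmod (off k p) \<le> 1" by (simp add: off_def jay_def p)
qed

text \<open>Block-diagonal part of the Hankel matrix: apart from a finite block it consists of the diagonal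
  entries \<open>v (2 j)\<close>.\<close>

lemma jay_hankel_square_summable:
  "(\<lambda>(j, l). (norm (scalar_blinfun (jay k (j, l)) o\<^sub>L v (j + l)))\<^sup>2) summable_on UNIV"
proof -
  let ?f = "\<lambda>(j, l). (norm (scalar_blinfun (jay k (j, l)) o\<^sub>L v (j + l)))\<^sup>2"
  have "?f summable_on ({- int k..int k} \<times> {- int k..int k})" by simp
  moreover have "?f summable_on range (\<lambda>j. (j, j))"
  proof (subst summable_on_reindex)
    show "inj (\<lambda>j::int. (j, j))" by (auto simp: inj_on_def)
    have "(\<lambda>j. (norm (v (2 * j)))\<^sup>2) summable_on UNIV"
      using cf_square_summable[of "Ell2 (\<lambda>j. cf vv (2 * j))"] by (subst (asm) Ell2_reindex) (auto simp: inj_def cf_vv)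
    then have "(\<lambda>j. (norm (scalar_blinfun 1 o\<^sub>L v (2 * j)))\<^sup>2) summable_on UNIV"
      by (rule summable_on_comparison_test)
         (use norm_scalar_compose_le[of 1] in \<open>auto intro!: power_mono\<close>)
    then show "(?f \<circ> (\<lambda>j. (j, j))) summable_on UNIV" by (simp add: o_def jay_def)
  qed
  ultimately have "?f summable_on ({- int k..int k} \<times> {- int k..int k} \<union> range (\<lambda>j. (j, j)))"
    by (rule summable_on_union)
  then show ?thesis
  proof (rule summable_on_cong_neutral[THEN iffD1, rotated -1])
    fix p assume "p \<in> UNIV - ({- int k..int k} \<times> {- int k..int k} \<union> range (\<lambda>j. (j, j)))"
    moreover obtain j l where p: "p = (j, l)" by (cases p)
    ultimately have "j \<noteq> l" "\<not> (\<bar>j\<bar> \<le> int k \<and> \<bar>l\<bar> \<le> int k)" by auto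
    then have "jay k (j, l) = 0" by (auto simp: jay_def blk_def split: if_splits)
    then have "scalar_blinfun (jay k (j, l)) o\<^sub>L v (j + l) = 0" by (intro blinfun_eqI) simp
    then show "?f p = 0" by (simp add: p)
  qed auto
qed

definition JV :: "nat \<Rightarrow> (int \<times> int, 'h \<Rightarrow>\<^sub>L 'h) ell2"
  where "JV k = Ell2 (\<lambda>(j, l). scalar_blinfun (jay k (j, l)) o\<^sub>L v (j + l))"

lemma cf_JV: "cf (JV k) (j, l) = scalar_blinfun (jay k (j, l)) o\<^sub>L v (j + l)"
  unfolding JV_def by (subst cf_Ell2) (use jay_hankel_square_summable[of k] in \<open>auto simp: split_def\<close>)

lemma clinear_JV: "clinear_matrix (JV k)"
  using v_hom by (auto simp: clinear_matrix_def complex_homogeneous_def cf_JV scaleC_scaleC mult.commute)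

text \<open>The product \<open>V \<Gamma>\<^sub>k V\<close>: for \<open>k = 0\<close> its square summability is a hypothesis, and \<open>\<Gamma>\<^sub>0 V - \<Gamma>\<^sub>k V\<close> has
  finitely many nonzero entries, all in rows with \<open>|n| \<le> k\<close>.\<close>

lemma hankel_G0_square_summable:
  "(\<lambda>(j, l). (norm (dot blinfun_compose (vrow j) (mcol G0 l)))\<^sup>2) summable_on UNIV"
proof -
  let ?h = "\<lambda>j l. \<Sum>\<^sub>\<infinity>n\<in>UNIV - {l}. (1 / real_of_int (l - n)) *\<^sub>R (v (j + n) o\<^sub>L v (l + n))"
  have eq: "scalar_blinfun (\<i> / of_real r) o\<^sub>L ?h j l = dot blinfun_compose (vrow j) (mcol G0 l)" for j l
  proof -
    have t: "v (j + n) o\<^sub>L cf G0 (n, l)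
      = scalar_blinfun (\<i> / of_real r) o\<^sub>L ((1 / real_of_int (l - n)) *\<^sub>R (v (j + n) o\<^sub>L v (l + n)))" for n
    proof (rule blinfun_eqI)
      fix x
      have g: "gam r 0 (n, l) = (\<i> / of_real r) * of_real (1 / real_of_int (l - n))"
      proof (cases "n = l")
        case False
        then have "(of_int n :: complex) - of_int l \<noteq> 0" by simp
        then show ?thesis using False r_pos
          by (simp add: gam_def lam_def field_simps)
      qed (simp add: gam_def)
      have "(v (j + n) o\<^sub>L cf G0 (n, l)) x = gam r 0 (n, l) *\<^sub>C v (j + n) (v (l + n) x)"
        using v_hom[of "j + n"] by (simp add: cf_G0 complex_homogeneous_def add.commute)
      also have "\<dots> = (\<i> / of_real r) *\<^sub>C ((1 / real_of_int (l - n)) *\<^sub>R v (j + n) (v (l + n) x))"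
        unfolding g scaleC_of_real[symmetric] scaleC_scaleC ..
      finally show "(v (j + n) o\<^sub>L cf G0 (n, l)) x = (scalar_blinfun (\<i> / of_real r) o\<^sub>L ((1 / real_of_int (l - n)) *\<^sub>R (v (j + n) o\<^sub>L v (l + n)))) x"
        by (simp add: blinfun.scaleR_left)
    qed
    have s: "(\<lambda>n. (1 / real_of_int (l - n)) *\<^sub>R (v (j + n) o\<^sub>L v (l + n))) summable_on UNIV"
    proof (rule abs_summable_summable, rule summable_on_comparison_test[OF cauchy_schwarz_summable[of "vrow j" "vrow l"]])
      fix n
      have "\<bar>1 / real_of_int (l - n)\<bar> \<le> 1"
      proof (cases "l = n")
        case False
        then have "1 \<le> \<bar>l - n\<bar>" by simp
        then have "1 \<le> \<bar>real_of_int (l - n)\<bar>" by (metis of_int_1_le_iff of_int_abs)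
        then show ?thesis by (simp add: divide_le_eq_1)
      qed simp
      then show "norm ((1 / real_of_int (l - n)) *\<^sub>R (v (j + n) o\<^sub>L v (l + n))) \<le> norm (cf (vrow j) n) * norm (cf (vrow l) n)"
        using mult_mono[OF _ norm_blinfun_compose[of "v (j + n)" "v (l + n)"], of "\<bar>1 / real_of_int (l - n)\<bar>" 1] by simp
    qed auto
    have "?h j l = (\<Sum>\<^sub>\<infinity>n. (1 / real_of_int (l - n)) *\<^sub>R (v (j + n) o\<^sub>L v (l + n)))"
      by (rule infsum_cong_neutral) auto
    then show ?thesis
      using has_sum_bounded_linear[OF bounded_bilinear.bounded_linear_right[OF bounded_bilinear_blinfun_compose]
          has_sum_infsum[OF s], of "scalar_blinfun (\<i> / of_real r)"]
      by (simp add: dot_def t infsumI)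
  qed
  have "(\<lambda>p. (cmod (\<i> / of_real r))\<^sup>2 * (case p of (j, l) \<Rightarrow> (norm (?h j l))\<^sup>2)) summable_on UNIV"
    by (intro summable_on_cmult_right) (use v_prod in \<open>simp add: split_def\<close>)
  then show ?thesis
    by (rule summable_on_comparison_test)
       (auto simp: eq[symmetric] power_mult_distrib[symmetric] intro!: power_mono norm_scalar_compose_le)
qed

lemma hankel_Gk_square_summable:
  "(\<lambda>(j, l). (norm (dot blinfun_compose (vrow j) (mcol (Gk k) l)))\<^sup>2) summable_on UNIV"
proof -
  let ?F = "G0 - Gk k" and ?I = "{- int k..int k}"
  have F0: "cf ?F (n, l) = 0" if "n \<notin> ?I" for n l
  proof -
    have "gam r 0 (n, l) = gam r k (n, l)" using that by (auto simp: gam_def blk_def split: if_splits)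
    then show ?thesis by (simp add: cf_G0 cf_Gk)
  qed
  have fin: "dot blinfun_compose (vrow j) (mcol ?F l) = (\<Sum>n\<in>?I. v (j + n) o\<^sub>L cf ?F (n, l))" for j l
  proof -
    have "dot blinfun_compose (vrow j) (mcol ?F l) = (\<Sum>\<^sub>\<infinity>n\<in>?I. v (j + n) o\<^sub>L cf ?F (n, l))"
      unfolding dot_def by (rule infsum_cong_neutral) (auto simp: F0 simp del: cf_diff mcol_linear)
    then show ?thesis by simp
  qed
  have "(\<lambda>p. (norm (\<Sum>n\<in>I. v (fst p + n) o\<^sub>L cf ?F (n, snd p)))\<^sup>2) summable_on UNIV" if "finite I" for I
    using that
  proof induction
    case (insert n I)
    have "(\<lambda>p. (norm (v (fst p + n) o\<^sub>L cf ?F (n, snd p)))\<^sup>2) summable_on UNIV"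
    proof (rule summable_on_comparison_test[OF cf_square_summable[of "tensor (vrow n) (mrow ?F n)"]])
      fix p :: "int \<times> int"
      obtain j l where p: "p = (j, l)" by (cases p)
      show "(norm (v (fst p + n) o\<^sub>L cf ?F (n, snd p)))\<^sup>2 \<le> (norm (cf (tensor (vrow n) (mrow ?F n)) p))\<^sup>2"
        unfolding p by (rule power_mono) (auto simp: cf_tensor add.commute norm_blinfun_compose simp del: cf_diff mrow_linear)
    qed auto
    from square_summable_add(1)[OF this insert.IH] show ?case using insert.hyps by simp
  qed simp
  from this[of ?I] have "(\<lambda>(j, l). (norm (dot blinfun_compose (vrow j) (mcol ?F l)))\<^sup>2) summable_on UNIV"
    unfolding fin by (simp add: split_def)
  from square_summable_diff[of "\<lambda>(j, l). dot blinfun_compose (vrow j) (mcol G0 l)" "\<lambda>(j, l). dot blinfun_compose (vrow j) (mcol ?F l)"]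
    hankel_G0_square_summable this
  show ?thesis
    by (simp add: split_def compose_dot.diff_right)
qed

text \<open>First similarity: \<open>(\<Lambda> - V)(I + \<Gamma>V) = (I + \<Gamma>V)(\<Lambda> - B)\<close> with \<open>(I + \<Gamma>V) B = JV + V\<Gamma>V\<close>, which replaces the
  unbounded perturbation by one from \<open>\<SS>\<^sub>2\<close>.\<close>

lemma first_similarity:
  obtains G B where "clinear_matrix G" "norm G < 1" "clinear_matrix B"
    "\<forall>(x, y) \<in> diag_minus r (\<lambda>x. cf (mv B x)). (x + mv G x, y + mv G y) \<in> diag_minus r (\<lambda>x j. dot blinfun_apply (vrow j) x)"
    "\<forall>x. in_dom r (x + mv G x) \<longleftrightarrow> in_dom r x"
proof -
  have "(\<lambda>k. norm (Gk k)) \<longlonglongrightarrow> 0" by (rule tendsto_norm_zero[OF Gk_tendsto])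
  then have "\<forall>\<^sub>F k in sequentially. norm (Gk k) < 1" by (rule order_tendstoD) simp
  then obtain k where k: "norm (Gk k) < 1" using eventually_happens'[OF sequentially_bot] by blast
  define G where "G = Gk k"
  have G: "norm G < 1" "clinear_matrix G"
    using k clinear_matrix_wt[OF bounded_symbol_off clinear_G0] by (auto simp: G_def Gk_def)
  define S where "S = Ell2 (\<lambda>(j, l). cf (JV k) (j, l) + dot blinfun_compose (vrow j) (mcol G l))"
  have "(\<lambda>p. (norm (cf (JV k) p + (case p of (j, l) \<Rightarrow> dot blinfun_compose (vrow j) (mcol G l))))\<^sup>2) summable_on UNIV"
    by (intro square_summable_add cf_square_summable)
       (use hankel_Gk_square_summable[of k] in \<open>simp add: split_def G_def\<close>)
  then have S: "cf S (j, l) = cf (JV k) (j, l) + dot blinfun_compose (vrow j) (mcol G l)" for j l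
    unfolding S_def by (subst cf_Ell2) (auto simp: split_def)
  have S_row: "mrow S j = mrow (JV k) j + vm (vrow j) G" for j
    by (rule ell2_eqI) (simp add: S cf_vm)
  have Sx: "cf (mv S x) j = dot blinfun_apply (mrow (JV k) j) x + dot blinfun_apply (vrow j) (mv G x)" for x j
    by (simp add: cf_mv S_row apply_dot.add_left dot_vm)
  have vrow_hom: "dot blinfun_apply (vrow j) (c *\<^sub>C x) = c *\<^sub>C dot blinfun_apply (vrow j) x" for j c x
    using infsum_scaleC[OF apply_cb.dot_summable[of "vrow j" x], of c] v_hom
    by (simp add: dot_def complex_homogeneous_def)
  have S_lin: "clinear_matrix S"
    unfolding clinear_matrix_iff complex_homogeneous_def
  proof (intro allI ell2_eqI)
    fix c x j
    have h: "mv G (c *\<^sub>C x) = c *\<^sub>C mv G x" "mv (JV k) (c *\<^sub>C x) = c *\<^sub>C mv (JV k) x"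
      using G(2) clinear_JV[of k] unfolding clinear_matrix_iff by (auto dest: complex_homogeneousD)
    have "cf (mv S (c *\<^sub>C x)) j = cf (mv (JV k) (c *\<^sub>C x)) j + dot blinfun_apply (vrow j) (mv G (c *\<^sub>C x))"
      by (simp only: Sx cf_mv[of "JV k"])
    then show "cf (mv S (c *\<^sub>C x)) j = cf (c *\<^sub>C mv S x) j"
      by (simp add: h vrow_hom Sx cf_mv[of "JV k", symmetric] scaleC_add_right)
  qed
  obtain G' where G': "clinear_matrix G'" "\<And>x. (x + mv G' x) + mv G (x + mv G' x) = x"
    using matrix_neumann[OF G] by metis
  define B where "B = S + mm G' S"
  have B: "clinear_matrix B" unfolding B_def by (intro clinear_matrix_add clinear_matrix_mm S_lin G')
  have GB: "mv B x + mv G (mv B x) = mv S x" for x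
    using G'(2)[of "mv S x"] by (simp add: B_def mv.add_left mv_mm)
  define E where "E = (\<lambda>j. vrow j - mrow (JV k) j)"
  have E: "has_commutator r G E"
    unfolding has_commutator_def
  proof (intro allI blinfun_eqI)
    fix j l x
    have "(scalar_blinfun (\<i> * of_real (lam r j - lam r l)) o\<^sub>L cf G (j, l)) x
        = (\<i> * of_real (lam r j - lam r l) * gam r k (j, l)) *\<^sub>C v (j + l) x"
      by (simp add: G_def cf_Gk scaleC_scaleC)
    also have "\<dots> = cf (E j) l x"
      unfolding gam_commutator[OF r_pos] by (simp add: E_def cf_JV blinfun.diff_left scaleC.diff_left)
    finally show "cf (E j) l x = (scalar_blinfun (\<i> * of_real (lam r j - lam r l)) o\<^sub>L cf G (j, l)) x" ..
  qed
  have E_le: "norm (cf (E j) l) \<le> norm (v (j + l))" for j l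
  proof -
    have "cf (E j) l = (if blk k j = blk k l then 0 else v (j + l))"
      by (rule blinfun_eqI) (auto simp: E_def cf_JV jay_def blinfun.diff_left)
    then show ?thesis by simp
  qed
  show ?thesis
  proof (rule that[OF G(2,1) B])
    have "cf (y + mv G y) j = (\<i> * of_real (lam r j)) *\<^sub>C cf (x + mv G x) j - dot blinfun_apply (vrow j) (x + mv G x)"
      if y: "\<And>j. cf y j = (\<i> * of_real (lam r j)) *\<^sub>C cf x j - cf (mv B x) j" for x y j
    proof -
    have "cf (y + mv G y) j = (\<i> * of_real (lam r j)) *\<^sub>C cf (x + mv G x) j
        - dot blinfun_apply (E j) x - cf (mv B x + mv G (mv B x)) j"
      using y intertwine[OF G(2) E y, of j] by (simp add: scaleC_add_right)
    then show ?thesis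
      unfolding GB Sx by (simp add: E_def apply_dot.diff_left apply_dot.add_right)
    qed
    then show "\<forall>(x, y) \<in> diag_minus r (\<lambda>x. cf (mv B x)). (x + mv G x, y + mv G y) \<in> diag_minus r (\<lambda>x j. dot blinfun_apply (vrow j) x)"
      unfolding diag_minus_def by blast
  next
    define q where "q = Ell2 (\<lambda>l. 1 / cmod (\<i> * of_real (lam r l) + 1))"
    have q: "cf q l = 1 / cmod (\<i> * of_real (lam r l) + 1)" for l
      unfolding q_def by (subst cf_Ell2) (use summable_resolvent_square[OF r_pos] in auto)
    define T where "T = Ell2 (\<lambda>p. cf (tensor vv q) (fst p + snd p, snd p))"
    have T: "cf T (j, l) = norm (v (j + l)) / cmod (\<i> * of_real (lam r l) + 1)" for j l
      unfolding T_def by (subst Ell2_reindex) (auto simp: inj_def cf_tensor cf_vv q)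
    have "(\<lambda>(j, l). (norm (cf (E j) l) / cmod (\<i> * of_real (lam r l) + 1))\<^sup>2) summable_on UNIV"
      by (rule summable_on_comparison_test[OF cf_square_summable[of T]])
         (auto simp: T intro!: power_mono divide_right_mono E_le)
    then show "\<forall>x. in_dom r (x + mv G x) \<longleftrightarrow> in_dom r x"
      using dom_invariant[OF G(2,1) E] by blast
  qed
qed

text \<open>The Riccati equation says that the off-diagonal part of \<open>B + B Y - Y D\<close> is the commutator of \<open>\<Lambda>\<close> with \<open>Y\<close>;
  the block-diagonal part of \<open>B + B Y\<close> is what remains of the perturbation.\<close>

lemma second_similarity:
  fixes B :: "(int \<times> int, 'h \<Rightarrow>\<^sub>L 'h) ell2"
  assumes B: "clinear_matrix B"
  obtains k Y D where "clinear_matrix Y" "norm Y < 1" "clinear_matrix D"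
    "\<And>j l. blk k j \<noteq> blk k l \<Longrightarrow> cf D (j, l) = 0" "norm (rw (wa k) D) \<le> r / 2"
    "\<forall>(x, y) \<in> diag_minus r (\<lambda>x. cf (mv D x)). (x + mv Y x, y + mv Y y) \<in> diag_minus r (\<lambda>x. cf (mv B x))"
    "\<forall>x. in_dom r (x + mv Y x) \<longleftrightarrow> in_dom r x"
proof -
  obtain k Y where Y: "clinear_matrix Y" "norm Y < 1"
    and Yeq: "Y = wt (gam r k) (B + mm B Y - mm Y (wt (jay k) (B + mm B Y)))"
    and small: "norm (rw (wa k) (B + mm B Y)) \<le> r / 2"
    using riccati[OF r_pos B] by metis
  define D where "D = wt (jay k) (B + mm B Y)"
  have D: "clinear_matrix D"
    unfolding D_def by (intro clinear_matrix_wt clinear_matrix_add clinear_matrix_mm B Y bounded_symbol_jay)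
  have D0: "cf D (j, l) = 0" if "blk k j \<noteq> blk k l" for j l
  proof -
    have "jay k (j, l) = 0" using that by (simp add: jay_def)
    then show ?thesis by (intro blinfun_eqI) (simp add: D_def cf_wt[OF bounded_symbol_jay])
  qed
  have Y0: "cf Y (j, l) = 0" if "blk k j = blk k l" for j l
  proof -
    have "gam r k (j, l) = 0" using that by (simp add: gam_def)
    then show ?thesis by (subst Yeq, intro blinfun_eqI) (simp add: cf_wt[OF bounded_symbol_gam[OF r_pos]])
  qed
  define C where "C = B + mm B Y - D - mm Y D"
  have YD0: "cf (mm Y D) (j, l) = 0" if "blk k j = blk k l" for j l
  proof -
    have "cf Y (j, n) o\<^sub>L cf D (n, l) = 0" for n
      using Y0[of j n] D0[of n l] that by (cases "blk k j = blk k n") auto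
    then show ?thesis by (simp add: cf_mm dot_def)
  qed
  have E: "has_commutator r Y (mrow C)"
    unfolding has_commutator_def
  proof (intro allI blinfun_eqI)
    fix j l x
    have "(scalar_blinfun (\<i> * of_real (lam r j - lam r l)) o\<^sub>L cf Y (j, l)) x
        = (\<i> * of_real (lam r j - lam r l) * gam r k (j, l)) *\<^sub>C cf (B + mm B Y - mm Y D) (j, l) x"
      by (subst Yeq) (simp add: cf_wt[OF bounded_symbol_gam[OF r_pos]] scaleC_scaleC D_def del: cf_add cf_diff)
    also have "\<dots> = cf C (j, l) x"
    proof (cases "blk k j = blk k l")
      case True
      then have jay1: "jay k (j, l) = 1" by (simp add: jay_def)
      then have "cf D (j, l) x = cf (B + mm B Y) (j, l) x"
        by (simp add: D_def cf_wt[OF bounded_symbol_jay] del: cf_add)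
      then show ?thesis unfolding gam_commutator[OF r_pos]
        using jay1 YD0[OF True] by (simp add: C_def blinfun.diff_left blinfun.add_left)
    next
      case False
      then show ?thesis unfolding gam_commutator[OF r_pos]
        using D0[OF False] by (simp add: jay_def C_def)
    qed
    finally show "cf (mrow C j) l x = (scalar_blinfun (\<i> * of_real (lam r j - lam r l)) o\<^sub>L cf Y (j, l)) x" by simp
  qed
  show ?thesis
  proof (rule that[OF Y D D0])
    show "norm (rw (wa k) D) \<le> r / 2"
      using norm_rw_le_weight[where a = "wa k", OF wa_bounds(2) norm_cf_jay_le[of k "B + mm B Y"]] small
      unfolding D_def by linarith
  next
    have "cf (y + mv Y y) j = (\<i> * of_real (lam r j)) *\<^sub>C cf (x + mv Y x) j - cf (mv B (x + mv Y x)) j"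
      if y: "\<And>j. cf y j = (\<i> * of_real (lam r j)) *\<^sub>C cf x j - cf (mv D x) j" for x y j
    proof -
    have "cf (y + mv Y y) j = (\<i> * of_real (lam r j)) *\<^sub>C cf (x + mv Y x) j
        - (cf (mv C x) j + cf (mv D x) j + cf (mv Y (mv D x)) j)"
      using y intertwine[OF Y(1) E y, of j] by (simp add: scaleC_add_right cf_mv[symmetric])
    then show ?thesis
      by (simp add: C_def mv.add_left mv.diff_left mv.add_right mv_mm)
    qed
    then show "\<forall>(x, y) \<in> diag_minus r (\<lambda>x. cf (mv D x)). (x + mv Y x, y + mv Y y) \<in> diag_minus r (\<lambda>x. cf (mv B x))"
      unfolding diag_minus_def by blast
  next
    have "(\<lambda>(j, l). (norm (cf (mrow C j) l) / cmod (\<i> * of_real (lam r l) + 1))\<^sup>2) summable_on UNIV"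
    proof (rule summable_on_comparison_test[OF cf_square_summable[of C]])
      fix p :: "int \<times> int"
      obtain j l where p: "p = (j, l)" by (cases p)
      have "1 \<le> cmod (\<i> * of_real (lam r l) + 1)"
        using complex_Re_le_cmod[of "\<i> * of_real (lam r l) + 1"] by simp
      then have "norm (cf (mrow C j) l) / cmod (\<i> * of_real (lam r l) + 1) \<le> norm (cf C (j, l))"
        by (simp add: divide_le_eq mult_le_cancel_left1)
      then show "(case p of (j, l) \<Rightarrow> (norm (cf (mrow C j) l) / cmod (\<i> * of_real (lam r l) + 1))\<^sup>2) \<le> (norm (cf C p))\<^sup>2"
        by (simp add: p power_mono)
    qed auto
    then show "\<forall>x. in_dom r (x + mv Y x) \<longleftrightarrow> in_dom r x"
      using dom_invariant[OF Y E] by blast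
  qed
qed

text \<open>The composition of the two similarities.  Square-summable matrices are closed under products, so both the
  similarity and its inverse are again of the form identity plus square-summable.\<close>

theorem block_diagonalization:
  obtains k W W' D where "clinear_matrix W" "clinear_matrix W'" "clinear_matrix D"
    "\<And>x. (x + mv W' x) + mv W (x + mv W' x) = x" "\<And>x. (x + mv W x) + mv W' (x + mv W x) = x"
    "\<And>j l. blk k j \<noteq> blk k l \<Longrightarrow> cf D (j, l) = 0" "norm (rw (wa k) D) \<le> r / 2"
    "\<forall>(x, y) \<in> diag_minus r (\<lambda>x. cf (mv D x)). (x + mv W x, y + mv W y) \<in> diag_minus r (\<lambda>x j. dot blinfun_apply (vrow j) x)"
    "\<forall>x. in_dom r (x + mv W x) \<longleftrightarrow> in_dom r x"
proof -
  obtain G B where G: "clinear_matrix G" "norm G < 1" and B: "clinear_matrix B"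
    and G_sim: "\<forall>(x, y) \<in> diag_minus r (\<lambda>x. cf (mv B x)). (x + mv G x, y + mv G y) \<in> diag_minus r (\<lambda>x j. dot blinfun_apply (vrow j) x)"
    and G_dom: "\<forall>x. in_dom r (x + mv G x) \<longleftrightarrow> in_dom r x"
    by (rule first_similarity, rule that; assumption)
  obtain k Y D where Y: "clinear_matrix Y" "norm Y < 1" and D: "clinear_matrix D"
    "\<And>j l. blk k j \<noteq> blk k l \<Longrightarrow> cf D (j, l) = 0" "norm (rw (wa k) D) \<le> r / 2"
    and Y_sim: "\<forall>(x, y) \<in> diag_minus r (\<lambda>x. cf (mv D x)). (x + mv Y x, y + mv Y y) \<in> diag_minus r (\<lambda>x. cf (mv B x))"
    and Y_dom: "\<forall>x. in_dom r (x + mv Y x) \<longleftrightarrow> in_dom r x"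
    by (rule second_similarity[OF B], rule that; assumption)
  obtain G' where G': "clinear_matrix G'" "\<And>x. (x + mv G' x) + mv G (x + mv G' x) = x"
    "\<And>x. (x + mv G x) + mv G' (x + mv G x) = x" using matrix_neumann[OF G(2,1)] by metis
  obtain Y' where Y': "clinear_matrix Y'" "\<And>x. (x + mv Y' x) + mv Y (x + mv Y' x) = x"
    "\<And>x. (x + mv Y x) + mv Y' (x + mv Y x) = x" using matrix_neumann[OF Y(2,1)] by metis
  define W where "W = G + Y + mm G Y"
  define W' where "W' = Y' + G' + mm Y' G'"
  have W: "x + mv W x = (x + mv Y x) + mv G (x + mv Y x)" for x
    by (simp add: W_def mv.add_left mv.add_right mv_mm)
  have W': "x + mv W' x = (x + mv G' x) + mv Y' (x + mv G' x)" for x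
    by (simp add: W'_def mv.add_left mv.add_right mv_mm)
  show ?thesis
  proof (rule that[OF _ _ D(1) _ _ D(2,3)])
    show "clinear_matrix W" "clinear_matrix W'"
      unfolding W_def W'_def by (intro clinear_matrix_add clinear_matrix_mm G Y G' Y')+
    show "(x + mv W' x) + mv W (x + mv W' x) = x" for x unfolding W W' Y'(2) G'(2) ..
    show "(x + mv W x) + mv W' (x + mv W x) = x" for x unfolding W W' Y'(3) G'(3) ..
    show "\<forall>x. in_dom r (x + mv W x) \<longleftrightarrow> in_dom r x" unfolding W using G_dom Y_dom by simp
    show "\<forall>(x, y) \<in> diag_minus r (\<lambda>x. cf (mv D x)). (x + mv W x, y + mv W y) \<in> diag_minus r (\<lambda>x j. dot blinfun_apply (vrow j) x)"
      unfolding W using G_sim Y_sim by fastforce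
  qed
qed

end

section \<open>Contour integrals around the exterior of a disc\<close>

text \<open>With \<open>w = 1 / (z - c)\<close> the circle becomes a circle about \<open>0\<close>, the exterior becomes a punctured disc,
  and \<open>(z - c) h(z)\<close> extends holomorphically over the puncture with value \<open>L\<close>.\<close>

lemma exterior_contour_integral:
  fixes h :: "complex \<Rightarrow> complex"
  assumes \<rho>: "\<rho> > 0" and hol: "h holomorphic_on {z. \<rho> \<le> cmod (z - c)}"
    and lim: "((\<lambda>z. (z - c) * h z) \<longlongrightarrow> L) at_infinity"
  shows "(h has_contour_integral (2 * of_real pi * \<i> * L)) (circlepath c \<rho>)"
proof -
  define g where "g = (\<lambda>w. if w = 0 then L else h (c + 1 / w) / w)"
  let ?B = "cball 0 (1 / \<rho>) :: complex set"
  have im: "c + 1 / w \<in> {z. \<rho> \<le> cmod (z - c)}" if "w \<in> ?B - {0}" for w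
    using that \<rho> by (auto simp: norm_divide field_simps)
  have hol0: "(\<lambda>w. h (c + 1 / w) / w) holomorphic_on ?B - {0}"
  proof (intro holomorphic_on_divide)
    have "(h \<circ> (\<lambda>w. c + 1 / w)) holomorphic_on ?B - {0}"
      by (rule holomorphic_on_compose_gen[OF _ hol]) (use im in \<open>auto intro!: holomorphic_intros\<close>)
    then show "(\<lambda>w. h (c + 1 / w)) holomorphic_on ?B - {0}" by (simp add: o_def)
  qed (auto intro: holomorphic_intros)
  then have holg: "g holomorphic_on ?B - {0}"
    by (rule holomorphic_transform) (auto simp: g_def)
  have "filterlim (\<lambda>w. c + inverse w) at_infinity (at (0::complex))"
    by (rule tendsto_add_filterlim_at_infinity[OF tendsto_const filterlim_inverse_at_infinity])
  from filterlim_compose[OF lim this]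
  have "((\<lambda>w. inverse w * h (c + inverse w)) \<longlongrightarrow> L) (at 0)" by simp
  then have g0: "(g \<longlongrightarrow> L) (at 0)"
    by (rule Lim_transform_eventually) (auto simp: g_def eventually_at_filter inverse_eq_divide)
  have contg: "continuous_on ?B g"
    unfolding continuous_on_eq_continuous_within
  proof
    fix w assume w: "w \<in> ?B"
    show "continuous (at w within ?B) g"
    proof (cases "w = 0")
      case True
      then show ?thesis unfolding continuous_within using g0 by (auto simp: g_def intro: Lim_at_imp_Lim_at_within)
    next
      case False
      have "continuous (at w within ?B - {0}) g"
        using holomorphic_on_imp_continuous_on[OF holg] w False by (auto simp: continuous_on_eq_continuous_within)
      moreover have "at w within ?B = at w within ?B - {0}"
        by (rule at_within_nhd[of w "- {0}"]) (use False in auto)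
      ultimately show ?thesis by (simp add: continuous_within)
    qed
  qed
  have "g holomorphic_on ball 0 (1 / \<rho>)"
    by (rule no_isolated_singularity[of _ _ "{0}"])
       (use contg holg in \<open>auto intro: continuous_on_subset holomorphic_on_subset\<close>)
  with contg have "((\<lambda>u. g u / (u - 0)) has_contour_integral (2 * of_real pi * \<i> * g 0)) (circlepath 0 (1 / \<rho>))"
    by (intro Cauchy_integral_circlepath) (use \<rho> in auto)
  then have "((\<lambda>t. g (of_real (1 / \<rho>) * cis t) * \<i>) has_integral (2 * of_real pi * \<i> * L)) {0..2*pi}"
    unfolding circlepath_def has_contour_integral_part_circlepath_iff[OF mult_pos_pos[OF zero_less_numeral pi_gt_zero]]
    using \<rho> by (simp add: g_def cong: if_cong)
  then have "((\<lambda>t. g (of_real (1 / \<rho>) * cis (- t + 2 * pi)) * \<i>) has_integral (2 * of_real pi * \<i> * L)) ((\<lambda>x. - x + 2 * pi) ` {0..2*pi})"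
    using has_integral_affinity[of "\<lambda>t. g (of_real (1 / \<rho>) * cis t) * \<i>" _ 0 "2 * pi" "-1" "2 * pi"] by (simp add: o_def)
  also have "(\<lambda>x. - x + 2 * pi) ` {0..2*pi} = {0..2*pi}"
    by (auto simp: image_iff intro!: bexI[of _ "2 * pi - _"])
  finally have *: "((\<lambda>t. g (of_real (1 / \<rho>) * cis (- t + 2 * pi)) * \<i>) has_integral (2 * of_real pi * \<i> * L)) {0..2*pi}" .
  have "((\<lambda>t. h (c + of_real \<rho> * cis t) * of_real \<rho> * \<i> * cis t) has_integral (2 * of_real pi * \<i> * L)) {0..2*pi}"
  proof (rule has_integral_eq[OF _ *])
    fix t :: real
    have cis: "cis (- t + 2 * pi) = 1 / cis t"
    proof -
      have "cis (- t + 2 * pi) = cis (- t)" by (simp only: cis_mult[symmetric] cis_2pi mult_1_right)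
      then show ?thesis by (metis cis_inverse inverse_eq_divide)
    qed
    show "g (of_real (1 / \<rho>) * cis (- t + 2 * pi)) * \<i> = h (c + of_real \<rho> * cis t) * of_real \<rho> * \<i> * cis t"
      unfolding cis using \<rho> by (simp add: g_def field_simps)
  qed
  then show ?thesis
    unfolding circlepath_def has_contour_integral_part_circlepath_iff[OF mult_pos_pos[OF zero_less_numeral pi_gt_zero]] .
qed

text \<open>By the resolvent identity the difference quotient of \<open>\<phi> (R z x)\<close> at \<open>w\<close> is \<open>- \<phi> (R z (R w x))\<close>, and by the
  same identity and the uniform bound this is continuous at \<open>z = w\<close>.\<close>

lemma pseudo_resolvent_holomorphic:
  fixes R :: "complex \<Rightarrow> 'a::complex_hilbert \<Rightarrow> 'a" and \<phi> :: "'a \<Rightarrow> complex"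
  assumes bound: "\<And>z x. z \<in> Z \<Longrightarrow> norm (R z x) \<le> K * norm x"
    and identity: "\<And>z w x. z \<in> Z \<Longrightarrow> w \<in> Z \<Longrightarrow> R z x - R w x = (w - z) *\<^sub>C R z (R w x)"
    and \<phi>: "bounded_linear \<phi>" "\<And>c x. \<phi> (c *\<^sub>C x) = c * \<phi> x"
  shows "(\<lambda>z. \<phi> (R z x)) holomorphic_on Z"
proof -
  interpret \<phi>: bounded_linear \<phi> by fact
  obtain C where C: "C \<ge> 0" "\<And>x. norm (\<phi> x) \<le> norm x * C" using \<phi>.nonneg_bounded by blast
  show ?thesis
    unfolding holomorphic_on_def field_differentiable_def
  proof (intro ballI exI)
    fix w assume w: "w \<in> Z"
    let ?u = "R w x"
    have "((\<lambda>z. - \<phi> (R z ?u)) \<longlongrightarrow> - \<phi> (R w ?u)) (at w within Z)"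
    proof (intro tendsto_minus, rule Lim_null[THEN iffD2], rule Lim_null_comparison)
      show "\<forall>\<^sub>F z in at w within Z. norm (\<phi> (R z ?u) - \<phi> (R w ?u)) \<le> cmod (w - z) * (K * norm (R w ?u) * C)"
        unfolding eventually_at_filter
      proof (rule always_eventually, intro allI impI)
        fix z assume z: "z \<noteq> w" "z \<in> Z"
        have "\<phi> (R z ?u) - \<phi> (R w ?u) = (w - z) * \<phi> (R z (R w ?u))"
          by (simp add: \<phi>.diff[symmetric] identity[OF z(2) w] \<phi>(2))
        moreover have "norm (\<phi> (R z (R w ?u))) \<le> K * norm (R w ?u) * C"
          using C(2)[of "R z (R w ?u)"] mult_right_mono[OF bound[OF z(2), of "R w ?u"] C(1)] by linarith
        ultimately show "norm (\<phi> (R z ?u) - \<phi> (R w ?u)) \<le> cmod (w - z) * (K * norm (R w ?u) * C)"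
          by (simp add: norm_mult mult_left_mono)
      qed
      have "((\<lambda>z. cmod (w - z) * (K * norm (R w ?u) * C)) \<longlongrightarrow> cmod (w - w) * (K * norm (R w ?u) * C)) (at w within Z)"
        by (intro tendsto_intros)
      then show "((\<lambda>z. cmod (w - z) * (K * norm (R w ?u) * C)) \<longlongrightarrow> 0) (at w within Z)" by simp
    qed
    moreover have "\<forall>\<^sub>F z in at w within Z. - \<phi> (R z ?u) = (\<phi> (R z x) - \<phi> (R w x)) / (z - w)"
      unfolding eventually_at_filter
    proof (rule always_eventually, intro allI impI)
      fix z assume z: "z \<noteq> w" "z \<in> Z"
      have "\<phi> (R z x) - \<phi> (R w x) = (w - z) * \<phi> (R z ?u)"
        by (simp add: \<phi>.diff[symmetric] identity[OF z(2) w] \<phi>(2))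
      also have "\<dots> = - \<phi> (R z ?u) * (z - w)" by (simp add: algebra_simps)
      finally show "- \<phi> (R z ?u) = (\<phi> (R z x) - \<phi> (R w x)) / (z - w)" using z by simp
    qed
    ultimately have "((\<lambda>z. (\<phi> (R z x) - \<phi> (R w x)) / (z - w)) \<longlongrightarrow> - \<phi> (R w ?u)) (at w within Z)"
      by (rule Lim_transform_eventually)
    then show "((\<lambda>z. \<phi> (R z x)) has_field_derivative - \<phi> (R w ?u)) (at w within Z)"
      by (simp add: has_field_derivative_iff)
  qed
qed

section \<open>Resolvents and spectra in \<open>\<ell>\<^sup>2(\<int>,H)\<close>\<close>

definition supp :: "int set \<Rightarrow> (int, 'h::complex_hilbert) ell2 set"
  where "supp S = {x. \<forall>j. j \<notin> S \<longrightarrow> cf x j = 0}"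

definition pr :: "int set \<Rightarrow> (int, 'h::complex_hilbert) ell2 \<Rightarrow> (int, 'h) ell2"
  where "pr S = dg (\<lambda>j. if j \<in> S then 1 else 0)"

text \<open>The resolvent at \<open>z\<close> of the part in \<open>supp S\<close> of the operator with graph \<open>g\<close>.  The map \<open>A\<close> is defined on the whole
  space, but only its values on \<open>supp S\<close> are determined.\<close>

definition gres :: "int set \<Rightarrow> ((int, 'h::complex_hilbert) ell2 \<times> (int, 'h) ell2) set \<Rightarrow> complex \<Rightarrow> ((int, 'h) ell2 \<Rightarrow> (int, 'h) ell2) \<Rightarrow> bool"
  where "gres S g z A \<longleftrightarrow> bounded_linear A \<and> complex_homogeneous A \<and>
    (\<forall>x\<in>supp S. A x \<in> supp S \<and> (A x, z *\<^sub>C A x - x) \<in> g) \<and>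
    (\<forall>(x, y)\<in>g. x \<in> supp S \<longrightarrow> y \<in> supp S \<longrightarrow> A (z *\<^sub>C x - y) = x)"

lemma gresD: "gres S g z A \<Longrightarrow> (x, y) \<in> g \<Longrightarrow> x \<in> supp S \<Longrightarrow> y \<in> supp S \<Longrightarrow> A (z *\<^sub>C x - y) = x"
  unfolding gres_def by (elim conjE) (drule bspec[where x = "(x, y)"], assumption, simp)

definition gspec :: "int set \<Rightarrow> ((int, 'h::complex_hilbert) ell2 \<times> (int, 'h) ell2) set \<Rightarrow> complex set"
  where "gspec S g = {z. \<nexists>A. gres S g z A}"

lemma bounded_symbol_indicator: "bounded_symbol (\<lambda>j. if j \<in> S then 1 else 0)"
  by (rule bounded_symbolI[of _ 1]) auto

lemma cf_pr [simp]: "cf (pr S x) j = (if j \<in> S then cf x j else 0)"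
  by (simp add: pr_def cf_dg[OF bounded_symbol_indicator])

lemma bounded_linear_pr: "bounded_linear (pr S)"
  unfolding pr_def by (rule bounded_linear_dg[OF bounded_symbol_indicator])
lemma complex_homogeneous_pr: "complex_homogeneous (pr S)"
  unfolding pr_def by (rule complex_homogeneous_dg[OF bounded_symbol_indicator])

lemma pr_in_supp [simp]: "pr S x \<in> supp S" by (simp add: supp_def)
lemma pr_supp: "x \<in> supp S \<Longrightarrow> pr S x = x" by (rule ell2_eqI) (auto simp: supp_def)
lemma supp_UNIV [simp]: "supp UNIV = UNIV" by (simp add: supp_def)
lemma pr_add_compl: "pr S x + pr (- S) x = x" by (rule ell2_eqI) simp

lemma sum_pr_singletons:
  assumes "finite F" shows "(\<Sum>l\<in>F. pr {l} x) = pr F x"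
proof (rule ell2_eqI)
  fix j
  have "cf (\<Sum>l\<in>G. pr {l} x) j = (\<Sum>l\<in>G. if j = l then cf x j else 0)" if "finite G" for G
    using that by (induction G) auto
  from this[OF assms] show "cf (\<Sum>l\<in>F. pr {l} x) j = cf (pr F x) j"
    using assms by (simp add: sum.delta')
qed

lemma supp_diff: "x \<in> supp S \<Longrightarrow> y \<in> supp S \<Longrightarrow> x - y \<in> supp S"
  and supp_add: "x \<in> supp S \<Longrightarrow> y \<in> supp S \<Longrightarrow> x + y \<in> supp S"
  and supp_scaleC: "x \<in> supp S \<Longrightarrow> c *\<^sub>C x \<in> supp S"
  by (simp_all add: supp_def)

lemma complex_homogeneous_add:
  "complex_homogeneous f \<Longrightarrow> complex_homogeneous g \<Longrightarrow> complex_homogeneous (\<lambda>x. f x + g x)"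
  and complex_homogeneous_compose:
  "complex_homogeneous f \<Longrightarrow> complex_homogeneous g \<Longrightarrow> complex_homogeneous (\<lambda>x. f (g x))"
  by (auto simp: complex_homogeneous_def scaleC_add_right)

text \<open>If \<open>A\<close> is the resolvent at \<open>z\<close>, then \<open>A (I + (z' - z) A)\<^sup>-\<^sup>1\<close> is the resolvent at nearby points \<open>z'\<close>.\<close>

lemma closed_gspec: "closed (gspec UNIV (g :: ((int, 'h::complex_hilbert) ell2 \<times> _) set))"
proof -
  have "open (- gspec UNIV g)"
    unfolding open_contains_ball
  proof
    fix z assume "z \<in> - gspec UNIV g"
    then obtain A where "gres UNIV g z A" by (auto simp: gspec_def)
    then have A: "bounded_linear A" "complex_homogeneous A"
      "\<And>x. (A x, z *\<^sub>C A x - x) \<in> g" "\<And>x y. (x, y) \<in> g \<Longrightarrow> A (z *\<^sub>C x - y) = x"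
      by (auto simp: gres_def)
    obtain K where K: "K > 0" "\<And>x. norm (A x) \<le> norm x * K"
      using bounded_linear.pos_bounded[OF A(1)] by blast
    have "z' \<in> - gspec UNIV g" if z': "z' \<in> ball z (1 / (2 * K))" for z'
    proof -
      define N where "N = (\<lambda>x. (z' - z) *\<^sub>C A x)"
      have N: "bounded_linear N"
        unfolding N_def by (rule bounded_linear_compose[OF bounded_linear_scaleC A(1)])
      have q: "norm (N x) \<le> 1/2 * norm x" for x
      proof -
        have "cmod (z' - z) \<le> 1 / (2 * K)" using z' by (simp add: dist_norm norm_minus_commute)
        then have "norm (N x) \<le> 1 / (2 * K) * (norm x * K)"
          unfolding N_def norm_scaleC by (intro mult_mono K(2)) (use K in auto)
        then show ?thesis using K by simp
      qed
      obtain M where M: "bounded_linear M" "\<And>x. M x + N (M x) = x" "\<And>x. M (x + N x) = x"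
        by (rule neumann_inverse[OF N q]) (simp_all add: that)
      have "complex_homogeneous N"
        using A(2) by (simp add: N_def complex_homogeneous_def scaleC_scaleC mult.commute)
      then have Mh: "complex_homogeneous M" using M neumann_inverse_homogeneous by blast
      have "gres UNIV g z' (\<lambda>x. A (M x))"
        unfolding gres_def
      proof (intro conjI ballI)
        show "bounded_linear (\<lambda>x. A (M x))" by (rule bounded_linear_compose[OF A(1) M(1)])
        show "complex_homogeneous (\<lambda>x. A (M x))" by (rule complex_homogeneous_compose[OF A(2) Mh])
        fix x :: "(int, 'h) ell2"
        have "x = M x + (z' *\<^sub>C A (M x) - z *\<^sub>C A (M x))"
          using M(2)[of x] by (simp add: N_def scaleC.diff_left)
        then have "z' *\<^sub>C A (M x) - x = z *\<^sub>C A (M x) - M x" by (simp add: algebra_simps)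
        then show "(A (M x), z' *\<^sub>C A (M x) - x) \<in> g" using A(3) by simp
      next
        fix p assume p: "p \<in> g"
        obtain x y where xy: "p = (x, y)" by (cases p)
        let ?u = "z *\<^sub>C x - y"
        have "A ?u = x" using A(4) p xy by simp
        then have e: "z' *\<^sub>C x - y = ?u + N ?u" by (simp add: N_def scaleC.diff_left)
        have "A (M (z' *\<^sub>C x - y)) = x" unfolding e M(3) by fact
        then show "case p of (x, y) \<Rightarrow> x \<in> supp UNIV \<longrightarrow> y \<in> supp UNIV \<longrightarrow> A (M (z' *\<^sub>C x - y)) = x"
          by (simp add: xy)
      qed auto
      then show ?thesis by (auto simp: gspec_def)
    qed
    then show "\<exists>e>0. ball z e \<subseteq> - gspec UNIV g" using K(1) by (intro exI[of _ "1 / (2 * K)"]) auto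
  qed
  then show ?thesis by (simp add: closed_def)
qed

lemma gres_similarity:
  assumes U: "bounded_linear U" "complex_homogeneous U" and U': "bounded_linear U'" "complex_homogeneous U'"
    and inv: "\<And>x. U' (U x) = x" "\<And>x. U (U' x) = x"
    and A: "gres UNIV g z A"
  shows "gres UNIV ((\<lambda>(x, y). (U x, U y)) ` g) z (\<lambda>x. U (A (U' x)))"
proof -
  interpret U: bounded_linear U by fact
  interpret U': bounded_linear U' by fact
  note Ac = complex_homogeneousD[OF U(2)] complex_homogeneousD[OF U'(2)]
  have A': "bounded_linear A" "complex_homogeneous A" "\<And>x. (A x, z *\<^sub>C A x - x) \<in> g"
    "\<And>x y. (x, y) \<in> g \<Longrightarrow> A (z *\<^sub>C x - y) = x" using A by (auto simp: gres_def)
  show ?thesis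
    unfolding gres_def
  proof (intro conjI ballI)
    show "bounded_linear (\<lambda>x. U (A (U' x)))"
      by (intro bounded_linear_compose[OF U(1)] bounded_linear_compose[OF A'(1)] U'(1))
    show "complex_homogeneous (\<lambda>x. U (A (U' x)))"
      by (intro complex_homogeneous_compose[OF U(2)] complex_homogeneous_compose[OF A'(2)] U'(2))
    fix x
    show "(U (A (U' x)), z *\<^sub>C U (A (U' x)) - x) \<in> (\<lambda>(x, y). (U x, U y)) ` g"
      using A'(3)[of "U' x"] by (force simp: image_iff U.diff Ac inv)
  next
    fix p assume "p \<in> (\<lambda>(x, y). (U x, U y)) ` g"
    then obtain x y where p: "p = (U x, U y)" "(x, y) \<in> g" by auto
    have "U' (z *\<^sub>C U x - U y) = z *\<^sub>C x - y" by (simp add: U'.diff Ac inv)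
    then show "case p of (x, y) \<Rightarrow> x \<in> supp UNIV \<longrightarrow> y \<in> supp UNIV \<longrightarrow> U (A (U' (z *\<^sub>C x - y))) = x"
      using A'(4)[OF p(2)] by (simp add: p)
  qed auto
qed

lemma gspec_similarity:
  assumes U: "bounded_linear U" "complex_homogeneous U" and U': "bounded_linear U'" "complex_homogeneous U'"
    and inv: "\<And>x. U' (U x) = x" "\<And>x. U (U' x) = x"
  shows "gspec UNIV ((\<lambda>(x, y). (U x, U y)) ` g) = gspec UNIV g"
proof -
  have "(\<lambda>(x, y). (U' x, U' y)) ` (\<lambda>(x, y). (U x, U y)) ` g = g"
    by (force simp: image_image inv split_def)
  then show ?thesis
    using gres_similarity[OF U U' inv, of g] gres_similarity[OF U' U inv(2,1), of "(\<lambda>(x, y). (U x, U y)) ` g"]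
    unfolding gspec_def by (metis (no_types, lifting))
qed

section \<open>The spectrum of the block-diagonal operator\<close>

text \<open>The smallness of \<open>D\<close> is calibrated such that outside the disc with centre \<open>ctr b\<close> and radius \<open>rad b\<close> the
  resolvent of the block \<open>b\<close> is given by a Neumann series with ratio \<open>1/2\<close>.  Distinct discs are at least \<open>r / 3\<close> apart.\<close>

locale block_operator =
  fixes r :: real and k :: nat and D :: "(int \<times> int, 'h::complex_hilbert \<Rightarrow>\<^sub>L 'h) ell2"
  assumes r_pos: "r > 0" and D_lin: "clinear_matrix D"
    and D_block: "\<And>j l. blk k j \<noteq> blk k l \<Longrightarrow> cf D (j, l) = 0"
    and D_small: "norm (rw (wa k) D) \<le> r / 2"
begin

definition gD :: "((int, 'h) ell2 \<times> (int, 'h) ell2) set" where "gD = diag_minus r (\<lambda>x. cf (mv D x))"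

definition Sb :: "int \<Rightarrow> int set" where "Sb b = {j. blk k j = b}"
definition blocks :: "int set" where "blocks = {b. b = 0 \<or> \<bar>b\<bar> > int k}"
definition ctr :: "int \<Rightarrow> complex" where "ctr b = \<i> * of_real (lam r b)"
definition rad :: "int \<Rightarrow> real" where "rad b = (if b = 0 then r * (real k + 1/3) else r / 3)"

text \<open>Unions of blocks: the coordinate subspaces that \<open>D\<close> maps into themselves.\<close>

definition saturated :: "int set \<Rightarrow> bool"
  where "saturated S \<longleftrightarrow> (\<forall>j l. blk k j = blk k l \<longrightarrow> j \<in> S \<longrightarrow> l \<in> S)"

text \<open>\<open>good S z\<close>: the point \<open>z\<close> is far enough from the eigenvalues \<open>i \<lambda>\<^sub>j\<close>, \<open>j \<in> S\<close>, for the perturbation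
  argument on the blocks in \<open>S\<close>.\<close>

definition good :: "int set \<Rightarrow> complex \<Rightarrow> bool"
  where "good S z \<longleftrightarrow> (\<forall>j\<in>S. z \<noteq> \<i> * of_real (lam r j) \<and> cmod (1 / (z - \<i> * of_real (lam r j))) \<le> wa k j / r)"

lemma rad_pos: "rad b > 0" using r_pos by (simp add: rad_def add_nonneg_pos)

lemma saturated_Sb: "saturated (Sb b)" by (simp add: saturated_def Sb_def)
lemma saturated_compl: "saturated S \<Longrightarrow> saturated (- S)" unfolding saturated_def by (metis ComplD ComplI)
lemma saturated_UNIV: "saturated UNIV" by (simp add: saturated_def)

lemma goodI:
  assumes "\<And>j. j \<in> S \<Longrightarrow> \<bar>j\<bar> \<le> int k \<Longrightarrow> r * (real k + 1/3 - of_int \<bar>j\<bar>) \<le> cmod (z - \<i> * of_real (lam r j))"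
    and "\<And>j. j \<in> S \<Longrightarrow> \<not> \<bar>j\<bar> \<le> int k \<Longrightarrow> r / 3 \<le> cmod (z - \<i> * of_real (lam r j))"
  shows "good S z"
  unfolding good_def
proof
  fix j assume j: "j \<in> S"
  define d where "d = (if \<bar>j\<bar> \<le> int k then real k + 1/3 - of_int \<bar>j\<bar> else 1/3)"
  have d: "d > 0" "wa k j = 1 / d" using of_int_abs_le[of j k] by (auto simp: d_def wa_def)
  have le: "r * d \<le> cmod (z - \<i> * of_real (lam r j))" using assms[OF j] by (auto simp: d_def)
  then have "cmod (z - \<i> * of_real (lam r j)) > 0" using d r_pos by (meson less_le_trans mult_pos_pos)
  moreover from this have "cmod (1 / (z - \<i> * of_real (lam r j))) \<le> 1 / (r * d)"
    using le d r_pos by (simp add: norm_divide frac_le)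
  ultimately show "z \<noteq> \<i> * of_real (lam r j) \<and> cmod (1 / (z - \<i> * of_real (lam r j))) \<le> wa k j / r"
    by (simp add: d mult.commute)
qed

lemma good_mono: "good S z \<Longrightarrow> T \<subseteq> S \<Longrightarrow> good T z" by (auto simp: good_def)

lemma cmod_ctr_diff: "cmod (ctr a - \<i> * of_real (lam r j)) = r * \<bar>real_of_int (a - j)\<bar>"
proof -
  have "ctr a - \<i> * of_real (lam r j) = \<i> * of_real (r * real_of_int (a - j))"
    by (simp add: ctr_def lam_def algebra_simps)
  then show ?thesis using r_pos by (simp only: norm_mult norm_ii norm_of_real) (simp add: abs_mult)
qed

lemma good_outside:
  assumes b: "b \<in> blocks" and z: "rad b \<le> cmod (z - ctr b)"
  shows "good (Sb b) z"
proof (rule goodI)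
  fix j assume j: "j \<in> Sb b" "\<bar>j\<bar> \<le> int k"
  then have b0: "b = 0" by (simp add: Sb_def blk_def)
  have "cmod (z - ctr b) \<le> cmod (z - \<i> * of_real (lam r j)) + cmod (ctr b - \<i> * of_real (lam r j))"
    using norm_triangle_ineq4[of "z - \<i> * of_real (lam r j)" "ctr b - \<i> * of_real (lam r j)"] by simp
  then show "r * (real k + 1/3 - of_int \<bar>j\<bar>) \<le> cmod (z - \<i> * of_real (lam r j))"
    using z unfolding cmod_ctr_diff by (simp add: b0 rad_def algebra_simps)
next
  fix j assume j: "j \<in> Sb b" "\<not> \<bar>j\<bar> \<le> int k"
  then have "j = b" "b \<noteq> 0" by (auto simp: Sb_def blk_def)
  then show "r / 3 \<le> cmod (z - \<i> * of_real (lam r j))" using z by (simp add: rad_def ctr_def)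
qed

lemma good_inside:
  assumes b: "b \<in> blocks" and z: "cmod (z - ctr b) \<le> rad b + r / 3"
  shows "good (- Sb b) z"
proof -
  have tri: "r * \<bar>real_of_int (b - j)\<bar> - rad b - r / 3 \<le> cmod (z - \<i> * of_real (lam r j))" for j
  proof -
    have "cmod (ctr b - \<i> * of_real (lam r j)) \<le> cmod (z - \<i> * of_real (lam r j)) + cmod (z - ctr b)"
      using norm_triangle_ineq4[of "z - \<i> * of_real (lam r j)" "z - ctr b"] by simp
    then show ?thesis using z unfolding cmod_ctr_diff by linarith
  qed
  show ?thesis
  proof (rule goodI)
    fix j assume j: "j \<in> - Sb b" "\<bar>j\<bar> \<le> int k"
    then have b0: "b \<noteq> 0" "\<bar>b\<bar> \<ge> int k + 1" using b by (auto simp: Sb_def blk_def blocks_def)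
    then have "int k + 1 - \<bar>j\<bar> \<le> \<bar>b - j\<bar>" by linarith
    then have "real k + 1 - of_int \<bar>j\<bar> \<le> \<bar>real_of_int (b - j)\<bar>"
      by (metis (mono_tags, opaque_lifting) of_int_1 of_int_abs of_int_add of_int_diff of_int_le_iff of_int_of_nat_eq)
    then have "r * (real k + 1 - of_int \<bar>j\<bar>) \<le> r * \<bar>real_of_int (b - j)\<bar>" using r_pos by simp
    then show "r * (real k + 1/3 - of_int \<bar>j\<bar>) \<le> cmod (z - \<i> * of_real (lam r j))"
      using tri[of j] b0 by (simp add: rad_def algebra_simps)
  next
    fix j assume j: "j \<in> - Sb b" "\<not> \<bar>j\<bar> \<le> int k"
    show "r / 3 \<le> cmod (z - \<i> * of_real (lam r j))"
    proof (cases "b = 0")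
      case True
      have "int k + 1 \<le> \<bar>b - j\<bar>" using j True by simp
      then have "real k + 1 \<le> \<bar>real_of_int (b - j)\<bar>"
        by (metis (mono_tags, opaque_lifting) of_int_1 of_int_abs of_int_add of_int_le_iff of_int_of_nat_eq)
      then have "r * (real k + 1) \<le> r * \<bar>real_of_int (b - j)\<bar>" using r_pos by simp
      then show ?thesis using tri[of j] True by (simp add: rad_def algebra_simps)
    next
      case False
      have "j \<noteq> b" using j by (auto simp: Sb_def blk_def)
      then have "1 \<le> \<bar>b - j\<bar>" by linarith
      then have "1 \<le> \<bar>real_of_int (b - j)\<bar>" by (metis of_int_1_le_iff of_int_abs)
      then have "r * 1 \<le> r * \<bar>real_of_int (b - j)\<bar>" using r_pos by (intro mult_left_mono) auto
      then show ?thesis using tri[of j] False by (simp add: rad_def)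
    qed
  qed
qed

lemma mv_D_supp:
  assumes "saturated S" "x \<in> supp S" shows "mv D x \<in> supp S"
proof -
  have "cf (mv D x) j = 0" if "j \<notin> S" for j
  proof -
    have "cf D (j, n) (cf x n) = 0" for n
    proof (cases "n \<in> S")
      case True
      then have "blk k j \<noteq> blk k n" using assms(1) that unfolding saturated_def by metis
      then show ?thesis by (simp add: D_block)
    qed (use assms(2) in \<open>simp add: supp_def\<close>)
    then show ?thesis by (simp add: cf_mv dot_def)
  qed
  then show ?thesis by (simp add: supp_def)
qed

lemma mv_D_pr:
  assumes "saturated S" shows "mv D (pr S x) = pr S (mv D x)"
proof -
  have "mv D x = mv D (pr S x) + mv D (pr (- S) x)"
    by (simp add: mv.add_right[symmetric] pr_add_compl)
  moreover have "pr S (mv D (pr S x)) = mv D (pr S x)"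
    by (intro pr_supp mv_D_supp assms pr_in_supp)
  moreover have "pr S (mv D (pr (- S) x)) = 0"
    using mv_D_supp[OF saturated_compl[OF assms] pr_in_supp, of x] by (intro ell2_eqI) (auto simp: supp_def)
  moreover have "pr S (u + w) = pr S u + pr S w" for u w :: "(int, 'h) ell2" by (rule ell2_eqI) simp
  ultimately show ?thesis by simp
qed

text \<open>On \<open>supp S\<close> the equation \<open>(z - \<Lambda> + D) u = x\<close> reads \<open>u + (z - \<Lambda>)\<^sup>-\<^sup>1 D u = (z - \<Lambda>)\<^sup>-\<^sup>1 x\<close>, and at a good point the
  matrix \<open>(z - \<Lambda>)\<^sup>-\<^sup>1 D\<close> has norm at most \<open>1/2\<close>.\<close>

lemma resolvent_exists:
  assumes S: "saturated S" and z: "good S z"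
  shows "\<exists>A. bounded_linear A \<and> complex_homogeneous A \<and> (\<forall>x. norm (A x) \<le> 6 / r * norm x) \<and>
    (\<forall>x. A x \<in> supp S) \<and>
    (\<forall>x. \<forall>j\<in>S. (z - \<i> * of_real (lam r j)) *\<^sub>C cf (A x) j + cf (mv D (A x)) j = cf x j) \<and>
    (\<forall>x. \<forall>u\<in>supp S. (\<forall>j\<in>S. (z - \<i> * of_real (lam r j)) *\<^sub>C cf u j + cf (mv D u) j = cf x j) \<longrightarrow> u = A x)"
proof -
  define a where "a = (\<lambda>j. if j \<in> S then 1 / (z - \<i> * of_real (lam r j)) else 0)"
  have a_le: "cmod (a j) \<le> wa k j / r" for j
    using z r_pos wa_bounds(1)[of k j] by (auto simp: a_def good_def)
  then have a3: "cmod (a j) \<le> 3 / r" for j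
    using wa_bounds[of k j] r_pos divide_right_mono[of "wa k j" 3 r] by (smt (verit))
  have ba: "bounded_symbol a" "bounded_symbol (\<lambda>p. a (fst p) :: complex)" using a3 by (auto intro: bounded_symbolI)
  define N where "N = wt (\<lambda>p. a (fst p)) D"
  have cfN: "cf N p = scalar_blinfun (a (fst p)) o\<^sub>L cf D p" for p by (simp add: N_def cf_wt[OF ba(2)])
  have mvN: "cf (mv N u) j = a j *\<^sub>C cf (mv D u) j" for u j
    using infsum_scaleC[OF apply_cb.dot_summable[of "mrow D j" u], of "a j"] by (simp add: cf_mv dot_def cfN)
  have "norm (cf N p) \<le> 1 / r * norm (cf (rw (wa k) D) p)" for p
  proof -
    have "norm (cf N p) \<le> cmod (a (fst p)) * norm (cf D p)" unfolding cfN by (rule norm_scalar_compose_le)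
    also have "\<dots> \<le> wa k (fst p) / r * norm (cf D p)" by (intro mult_right_mono a_le) auto
    finally show ?thesis using wa_bounds(1) by (cases p) (simp add: cf_rw[OF wa_bounds(2)])
  qed
  from Ell2_dominated(2)[of "cf N" "1 / r" "rw (wa k) D", OF this]
  have "norm N \<le> norm (rw (wa k) D) / r" using r_pos by (simp add: cf_inverse)
  also have "\<dots> \<le> 1 / 2" using D_small r_pos by (simp add: divide_le_eq)
  finally have N: "norm N \<le> 1 / 2" .
  have q: "norm (mv N x) \<le> 1 / 2 * norm x" for x
    using norm_mv_le[of N x] mult_right_mono[OF N norm_ge_zero[of x]] by linarith
  obtain M where M: "bounded_linear M" "\<And>x. M x + mv N (M x) = x" "\<And>x. M (x + mv N x) = x"
    "\<And>x. norm (M x) \<le> norm x / (1 - 1 / 2)"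
    by (rule neumann_inverse[OF mv.bounded_linear_right[of N] q]) (simp_all add: that)
  have "clinear_matrix N" unfolding N_def by (rule clinear_matrix_wt[OF ba(2) D_lin])
  then have Mh: "complex_homogeneous M"
    using neumann_inverse_homogeneous[OF _ M(2,3)] clinear_matrix_iff by blast
  define A where "A = (\<lambda>x. M (dg a x))"
  show ?thesis
  proof (intro exI[of _ A] conjI allI ballI impI)
    show "bounded_linear A" unfolding A_def by (rule bounded_linear_compose[OF M(1) bounded_linear_dg[OF ba(1)]])
    show "complex_homogeneous A"
      unfolding A_def by (rule complex_homogeneous_compose[OF Mh complex_homogeneous_dg[OF ba(1)]])
    show "norm (A x) \<le> 6 / r * norm x" for x
      using M(4)[of "dg a x"] norm_dg_le[of a "3 / r" x, OF a3] by (simp add: A_def)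
    have Aj: "cf (A x) j + a j *\<^sub>C cf (mv D (A x)) j = a j *\<^sub>C cf x j" for x j
      using arg_cong[OF M(2)[of "dg a x"], of "\<lambda>u. cf u j"] by (simp add: A_def mvN cf_dg[OF ba(1)])
    show "A x \<in> supp S" for x unfolding supp_def
    proof safe
      fix j assume "j \<notin> S" then show "cf (A x) j = 0" using Aj[of x j] by (simp add: a_def)
    qed
    fix x
    show "(z - \<i> * of_real (lam r j)) *\<^sub>C cf (A x) j + cf (mv D (A x)) j = cf x j" if "j \<in> S" for j
    proof -
      have nz: "z - \<i> * of_real (lam r j) \<noteq> 0" using z that by (auto simp: good_def)
      then have "(z - \<i> * of_real (lam r j)) * a j = 1" using that by (simp add: a_def)
      then have "(z - \<i> * of_real (lam r j)) *\<^sub>C (cf (A x) j + a j *\<^sub>C cf (mv D (A x)) j)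
          = (z - \<i> * of_real (lam r j)) *\<^sub>C cf (A x) j + cf (mv D (A x)) j"
        "(z - \<i> * of_real (lam r j)) *\<^sub>C (a j *\<^sub>C cf x j) = cf x j"
        by (simp_all add: scaleC_add_right scaleC_scaleC)
      then show ?thesis using Aj by metis
    qed
    fix u assume u: "u \<in> supp S" "\<forall>j\<in>S. (z - \<i> * of_real (lam r j)) *\<^sub>C cf u j + cf (mv D u) j = cf x j"
    have "u + mv N u = dg a x"
    proof (rule ell2_eqI)
      fix j show "cf (u + mv N u) j = cf (dg a x) j"
      proof (cases "j \<in> S")
        case True
        have nz: "z - \<i> * of_real (lam r j) \<noteq> 0" using z True by (auto simp: good_def)
        then have "a j * (z - \<i> * of_real (lam r j)) = 1" using True by (simp add: a_def)
        then have "a j *\<^sub>C ((z - \<i> * of_real (lam r j)) *\<^sub>C cf u j + cf (mv D u) j) = cf u j + a j *\<^sub>C cf (mv D u) j"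
          by (simp only: scaleC_add_right scaleC_scaleC scaleC_one)
        then have "a j *\<^sub>C cf x j = cf u j + a j *\<^sub>C cf (mv D u) j"
          using u(2) True by simp
        then show ?thesis by (simp add: mvN cf_dg[OF ba(1)])
      next
        case False
        then have "a j = 0" by (simp add: a_def)
        with False show ?thesis using u(1) by (simp add: mvN cf_dg[OF ba(1)] supp_def)
      qed
    qed
    then show "u = A x" unfolding A_def using M(3) by metis
  qed
qed

definition Res :: "int set \<Rightarrow> complex \<Rightarrow> (int, 'h) ell2 \<Rightarrow> (int, 'h) ell2" where
  "Res S z = (SOME A. bounded_linear A \<and> complex_homogeneous A \<and> (\<forall>x. norm (A x) \<le> 6 / r * norm x) \<and>
    (\<forall>x. A x \<in> supp S) \<and>
    (\<forall>x. \<forall>j\<in>S. (z - \<i> * of_real (lam r j)) *\<^sub>C cf (A x) j + cf (mv D (A x)) j = cf x j) \<and>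
    (\<forall>x. \<forall>u\<in>supp S. (\<forall>j\<in>S. (z - \<i> * of_real (lam r j)) *\<^sub>C cf u j + cf (mv D u) j = cf x j) \<longrightarrow> u = A x))"

lemma Res:
  assumes "saturated S" "good S z"
  shows "bounded_linear (Res S z)" "complex_homogeneous (Res S z)" "norm (Res S z x) \<le> 6 / r * norm x"
    "Res S z x \<in> supp S"
    "j \<in> S \<Longrightarrow> (z - \<i> * of_real (lam r j)) *\<^sub>C cf (Res S z x) j + cf (mv D (Res S z x)) j = cf x j"
    "u \<in> supp S \<Longrightarrow> (\<And>j. j \<in> S \<Longrightarrow> (z - \<i> * of_real (lam r j)) *\<^sub>C cf u j + cf (mv D u) j = cf x j) \<Longrightarrow> u = Res S z x"
  using someI_ex[OF resolvent_exists[OF assms]] unfolding Res_def[symmetric] by blast+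

lemma Res_identity:
  assumes S: "saturated S" and z: "good S z" and w: "good S w"
  shows "Res S z x - Res S w x = (w - z) *\<^sub>C Res S z (Res S w x)"
proof -
  let ?u = "Res S w x + (w - z) *\<^sub>C Res S z (Res S w x)"
  have "?u = Res S z x"
  proof (rule Res(6)[OF S z])
    show "?u \<in> supp S" by (intro supp_add supp_scaleC Res(4) S z w)
    fix j assume j: "j \<in> S"
    let ?c = "\<i> * of_real (lam r j)" and ?v = "Res S w x"
    have hom: "mv D (c *\<^sub>C y) = c *\<^sub>C mv D y" for c y
      using D_lin unfolding clinear_matrix_iff by (rule complex_homogeneousD)
    have e1: "(w - ?c) *\<^sub>C cf ?v j + cf (mv D ?v) j = cf x j" by (rule Res(5)[OF S w j])
    have e2: "(z - ?c) *\<^sub>C cf (Res S z ?v) j + cf (mv D (Res S z ?v)) j = cf ?v j" by (rule Res(5)[OF S z j])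
    have "(z - ?c) *\<^sub>C cf ?u j + cf (mv D ?u) j = ((z - ?c) *\<^sub>C cf ?v j + cf (mv D ?v) j)
        + (w - z) *\<^sub>C ((z - ?c) *\<^sub>C cf (Res S z ?v) j + cf (mv D (Res S z ?v)) j)"
      by (simp add: mv.add_right hom scaleC_add_right scaleC_scaleC mult.commute)
    also have "\<dots> = (w - ?c) *\<^sub>C cf ?v j + cf (mv D ?v) j"
      unfolding e2 by (simp add: scaleC.diff_left)
    finally show "(z - ?c) *\<^sub>C cf ?u j + cf (mv D ?u) j = cf x j" using e1 by simp
  qed
  then show ?thesis by (metis add_diff_cancel_left')
qed

lemma gD_iff: "(x, y) \<in> gD \<longleftrightarrow> (\<forall>j. cf y j = (\<i> * of_real (lam r j)) *\<^sub>C cf x j - cf (mv D x) j)"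
  by (simp add: gD_def diag_minus_def)

lemma gD_add: "(x, y) \<in> gD \<Longrightarrow> (x', y') \<in> gD \<Longrightarrow> (x + x', y + y') \<in> gD"
  by (simp add: gD_iff mv.add_right scaleC_add_right)

lemma gD_pr: "saturated S \<Longrightarrow> (x, y) \<in> gD \<Longrightarrow> (pr S x, pr S y) \<in> gD"
  by (simp add: gD_iff mv_D_pr)

lemma pr_diff: "pr S (x - y) = pr S x - pr S y" and pr_scaleC: "pr S (c *\<^sub>C x) = c *\<^sub>C pr S x"
  by (auto intro!: ell2_eqI)

lemma gres_Res:
  assumes S: "saturated S" and z: "good S z"
  shows "gres S gD z (Res S z)"
  unfolding gres_def
proof (intro conjI ballI)
  fix x :: "(int, 'h) ell2" assume x: "x \<in> supp S"
  have "cf (z *\<^sub>C Res S z x - x) j = (\<i> * of_real (lam r j)) *\<^sub>C cf (Res S z x) j - cf (mv D (Res S z x)) j" for j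
  proof (cases "j \<in> S")
    case True
    show ?thesis using Res(5)[OF S z True, of x] by (simp add: scaleC.diff_left algebra_simps)
  next
    case False
    then show ?thesis
      using x Res(4)[OF S z, of x] mv_D_supp[OF S Res(4)[OF S z, of x]] by (simp add: supp_def)
  qed
  then show "(Res S z x, z *\<^sub>C Res S z x - x) \<in> gD" by (simp add: gD_iff)
next
  fix p assume p: "p \<in> gD"
  obtain x y where xy: "p = (x, y)" by (cases p)
  have "x = Res S z (z *\<^sub>C x - y)" if "x \<in> supp S"
    by (rule Res(6)[OF S z that]) (use p in \<open>simp add: xy gD_iff scaleC.diff_left\<close>)
  then show "case p of (x, y) \<Rightarrow> x \<in> supp S \<longrightarrow> y \<in> supp S \<longrightarrow> Res S z (z *\<^sub>C x - y) = x" by (simp add: xy)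
qed (use Res[OF S z] in auto)

text \<open>The projection \<open>pr S\<close> maps the graph into itself, so by uniqueness of the solution the resolvent commutes with
  it and leaves \<open>supp S\<close> invariant.\<close>

lemma gres_restrict:
  assumes S: "saturated S" and A: "gres UNIV gD z A" shows "gres S gD z A"
proof -
  have A': "bounded_linear A" "complex_homogeneous A" "\<And>x. (A x, z *\<^sub>C A x - x) \<in> gD"
    "\<And>x y. (x, y) \<in> gD \<Longrightarrow> A (z *\<^sub>C x - y) = x" using A by (auto simp: gres_def)
  have "A x \<in> supp S" if x: "x \<in> supp S" for x
  proof -
    have "(pr S (A x), z *\<^sub>C pr S (A x) - x) \<in> gD"
      using gD_pr[OF S A'(3)[of x]] by (simp add: pr_diff pr_scaleC pr_supp[OF x])
    from A'(4)[OF this] have "A x = pr S (A x)" by simp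
    then show ?thesis by (metis pr_in_supp)
  qed
  then show ?thesis using A' by (auto simp: gres_def)
qed

lemma gres_glue:
  assumes S: "saturated S" and A: "gres S gD z A" and A': "gres (- S) gD z A'"
  shows "gres UNIV gD z (\<lambda>x. A (pr S x) + A' (pr (- S) x))"
  unfolding gres_def
proof (intro conjI ballI)
  show "bounded_linear (\<lambda>x. A (pr S x) + A' (pr (- S) x))"
    using A A' unfolding gres_def by (intro bounded_linear_add bounded_linear_compose[OF _ bounded_linear_pr]) auto
  show "complex_homogeneous (\<lambda>x. A (pr S x) + A' (pr (- S) x))"
    using A A' unfolding gres_def
    by (intro complex_homogeneous_add complex_homogeneous_compose[OF _ complex_homogeneous_pr]) auto
  fix x
  have "(A (pr S x), z *\<^sub>C A (pr S x) - pr S x) \<in> gD" "(A' (pr (- S) x), z *\<^sub>C A' (pr (- S) x) - pr (- S) x) \<in> gD"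
    using A A' by (auto simp: gres_def)
  from gD_add[OF this] show "(A (pr S x) + A' (pr (- S) x), z *\<^sub>C (A (pr S x) + A' (pr (- S) x)) - x) \<in> gD"
    using pr_add_compl[of S x] by (simp add: scaleC_add_right algebra_simps)
next
  fix p assume p: "p \<in> gD"
  obtain x y where xy: "p = (x, y)" by (cases p)
  have "A (z *\<^sub>C pr S x - pr S y) = pr S x" "A' (z *\<^sub>C pr (- S) x - pr (- S) y) = pr (- S) x"
    using gresD[OF A gD_pr[OF S]] gresD[OF A' gD_pr[OF saturated_compl[OF S]]] p unfolding xy by simp_all
  then show "case p of (x, y) \<Rightarrow> x \<in> supp UNIV \<longrightarrow> y \<in> supp UNIV \<longrightarrow> A (pr S (z *\<^sub>C x - y)) + A' (pr (- S) (z *\<^sub>C x - y)) = x"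
    by (simp add: xy pr_diff pr_scaleC pr_add_compl)
qed auto

lemma blk_in_blocks: "blk k j \<in> blocks" by (auto simp: blk_def blocks_def)

lemma gspec_block_subset: "b \<in> blocks \<Longrightarrow> gspec (Sb b) gD \<subseteq> ball (ctr b) (rad b)"
  using gres_Res[OF saturated_Sb good_outside, of b] by (force simp: gspec_def dist_norm norm_minus_commute)

lemma gspec_other_block:
  assumes "b \<in> blocks" "b' \<in> blocks" "b' \<noteq> b" "z \<in> cball (ctr b) (rad b)" shows "z \<notin> gspec (Sb b') gD"
proof -
  have "good (- Sb b) z"
    by (rule good_inside[OF assms(1)]) (use assms(4) r_pos in \<open>simp add: dist_norm norm_minus_commute\<close>)
  then have "good (Sb b') z" by (rule good_mono) (use assms(3) in \<open>auto simp: Sb_def\<close>)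
  then show ?thesis using gres_Res[OF saturated_Sb] by (auto simp: gspec_def)
qed

text \<open>Infinitely many resolvents of single blocks cannot be glued without a uniform bound.  But a point lies in
  the disc of at most one block, and all the other blocks together have a resolvent there by the perturbation
  argument, so only two resolvents have to be glued.\<close>

lemma gspec_blocks: "gspec UNIV gD = (\<Union>b\<in>blocks. gspec (Sb b) gD)"
proof
  show "(\<Union>b\<in>blocks. gspec (Sb b) gD) \<subseteq> gspec UNIV gD"
    using gres_restrict[OF saturated_Sb] by (auto simp: gspec_def)
  show "gspec UNIV gD \<subseteq> (\<Union>b\<in>blocks. gspec (Sb b) gD)"
  proof (rule subsetI, rule ccontr)
    fix z assume z: "z \<in> gspec UNIV gD" "z \<notin> (\<Union>b\<in>blocks. gspec (Sb b) gD)"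
    show False
    proof (cases "\<exists>b\<in>blocks. cmod (z - ctr b) < rad b")
      case True
      then obtain b where b: "b \<in> blocks" "cmod (z - ctr b) < rad b" by blast
      obtain A where A: "gres (Sb b) gD z A" using z(2) b(1) by (auto simp: gspec_def)
      have A': "gres (- Sb b) gD z (Res (- Sb b) z)"
        by (intro gres_Res saturated_compl saturated_Sb good_inside b) (use b r_pos in simp)
      from gres_glue[OF saturated_Sb A A'] show False using z(1) unfolding gspec_def by blast
    next
      case False
      have "good UNIV z" unfolding good_def
      proof
        fix j
        have "good (Sb (blk k j)) z" by (rule good_outside[OF blk_in_blocks]) (use False blk_in_blocks[of j] in \<open>meson not_less\<close>)
        then show "z \<noteq> \<i> * of_real (lam r j) \<and> cmod (1 / (z - \<i> * of_real (lam r j))) \<le> wa k j / r"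
          by (auto simp: good_def Sb_def)
      qed
      then show False using gres_Res[OF saturated_UNIV] z(1) by (auto simp: gspec_def)
    qed
  qed
qed

lemma gspec_block_eq: "b \<in> blocks \<Longrightarrow> gspec (Sb b) gD = gspec UNIV gD \<inter> cball (ctr b) (rad b)"
  using gspec_block_subset[of b] gspec_other_block[of b] unfolding gspec_blocks by fastforce

lemma compact_gspec_block: "b \<in> blocks \<Longrightarrow> compact (gspec (Sb b) gD)"
  by (simp add: gspec_block_eq closed_gspec closed_Int_compact)

lemma closed_gspec_rest:
  assumes "b \<in> blocks" shows "closed (gspec UNIV gD - gspec (Sb b) gD)"
proof -
  have "gspec UNIV gD - gspec (Sb b) gD = gspec UNIV gD - ball (ctr b) (rad b)"
    using gspec_block_subset[OF assms] gspec_block_eq[OF assms] by auto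
  then show ?thesis by (simp add: closed_Diff closed_gspec)
qed

lemma good_on_circle:
  assumes b: "b \<in> blocks" and z: "cmod (z - ctr b) = rad b" shows "good UNIV z"
proof -
  have "good (Sb b) z" "good (- Sb b) z" using good_outside[OF b] good_inside[OF b] z r_pos by auto
  then show ?thesis unfolding good_def by blast
qed

lemma Res_split:
  assumes S: "saturated S" and z: "good UNIV z"
  shows "Res UNIV z x = Res S z x + Res (- S) z x"
proof (rule Res(6)[OF saturated_UNIV z, symmetric])
  note zS = good_mono[OF z, of S, simplified] and zS' = good_mono[OF z, of "- S", simplified]
  let ?u = "Res S z x" and ?v = "Res (- S) z x"
  have u: "?u \<in> supp S" "mv D ?u \<in> supp S" "?v \<in> supp (- S)" "mv D ?v \<in> supp (- S)"
    by (intro Res mv_D_supp S zS zS' saturated_compl)+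
  fix j
  show "(z - \<i> * of_real (lam r j)) *\<^sub>C cf (?u + ?v) j + cf (mv D (?u + ?v)) j = cf x j"
  proof (cases "j \<in> S")
    case True
    then show ?thesis using u(3,4) Res(5)[OF S zS True, of x] by (simp add: supp_def mv.add_right)
  next
    case False
    then show ?thesis using u(1,2) Res(5)[OF saturated_compl[OF S] zS', of j x] by (simp add: supp_def mv.add_right)
  qed
qed simp

text \<open>The Riesz projection of the block-diagonal operator for one block is the coordinate projection: the
  other blocks contribute a holomorphic function inside the circle, and the resolvent on the block itself
  is holomorphic outside the circle and asymptotic to \<open>1 / (z - c)\<close>.\<close>

lemma block_contour_integral:
  assumes b: "b \<in> blocks" and \<phi>: "bounded_linear \<phi>" "\<And>c x. \<phi> (c *\<^sub>C x) = c * \<phi> x"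
  shows "((\<lambda>z. \<phi> (Res UNIV z x)) has_contour_integral (2 * of_real pi * \<i> * \<phi> (pr (Sb b) x))) (circlepath (ctr b) (rad b))"
proof -
  let ?S = "Sb b" and ?c = "ctr b" and ?\<rho> = "rad b"
  have sat: "saturated ?S" "saturated (- ?S)" by (intro saturated_Sb saturated_compl)+
  have inner: "((\<lambda>z. \<phi> (Res (- ?S) z x)) has_contour_integral 0) (circlepath ?c ?\<rho>)"
  proof (rule Cauchy_theorem_disc_simple[where a = ?c and e = "?\<rho> + r / 3"])
    show "(\<lambda>z. \<phi> (Res (- ?S) z x)) holomorphic_on ball ?c (?\<rho> + r / 3)"
    proof (rule pseudo_resolvent_holomorphic[OF _ _ \<phi>])
      fix z w x assume "z \<in> ball ?c (?\<rho> + r / 3)"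
      then have z: "good (- ?S) z" by (intro good_inside[OF b]) (simp add: dist_norm norm_minus_commute)
      show "norm (Res (- ?S) z x) \<le> 6 / r * norm x" by (rule Res(3)[OF sat(2) z])
      assume "w \<in> ball ?c (?\<rho> + r / 3)"
      then have w: "good (- ?S) w" by (intro good_inside[OF b]) (simp add: dist_norm norm_minus_commute)
      show "Res (- ?S) z x - Res (- ?S) w x = (w - z) *\<^sub>C Res (- ?S) z (Res (- ?S) w x)"
        by (rule Res_identity[OF sat(2) z w])
    qed
  qed (use rad_pos[of b] r_pos in auto)
  have outer: "((\<lambda>z. \<phi> (Res ?S z x)) has_contour_integral (2 * of_real pi * \<i> * \<phi> (pr ?S x))) (circlepath ?c ?\<rho>)"
  proof (rule exterior_contour_integral[OF rad_pos])
    have good: "good ?S z" if "?\<rho> \<le> cmod (z - ?c)" for z by (rule good_outside[OF b that])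
    show "(\<lambda>z. \<phi> (Res ?S z x)) holomorphic_on {z. ?\<rho> \<le> cmod (z - ?c)}"
      by (rule pseudo_resolvent_holomorphic[OF _ _ \<phi>, where K = "6 / r"])
         (use good Res(3)[OF sat(1)] Res_identity[OF sat(1)] in auto)
    interpret \<phi>: bounded_linear \<phi> by fact
    obtain C where C: "C \<ge> 0" "\<And>x. norm (\<phi> x) \<le> norm x * C" using \<phi>.nonneg_bounded by blast
    define E where "E = norm D + r * real k"
    have E: "E \<ge> 0" using r_pos by (simp add: E_def)
    \<comment> \<open>On the block, \<open>(z - c) R(z) x = P x + O(\<parallel>R(z) x\<parallel>)\<close>.\<close>
    have close: "norm ((z - ?c) *\<^sub>C Res ?S z x - pr ?S x) \<le> E * norm (Res ?S z x)" if z: "?\<rho> \<le> cmod (z - ?c)" for z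
    proof -
      let ?y = "Res ?S z x"
      define s where "s = (\<lambda>j. if j \<in> ?S then \<i> * of_real (lam r j) - ?c else 0)"
      have s: "cmod (s j) \<le> r * real k" for j
      proof (cases "j \<in> ?S")
        case True
        then have "\<bar>real_of_int (b - j)\<bar> \<le> real k"
          using of_int_abs_le[of j k] by (auto simp: Sb_def blk_def split: if_splits)
        then have "r * \<bar>real_of_int (b - j)\<bar> \<le> r * real k" using r_pos by (intro mult_left_mono) auto
        then show ?thesis using True cmod_ctr_diff[of b j] by (simp add: s_def norm_minus_commute)
      qed (use r_pos in \<open>simp add: s_def\<close>)
      have e: "(z - ?c) *\<^sub>C ?y - pr ?S x = dg s ?y - mv D ?y"
      proof (rule ell2_eqI)
        fix j
        show "cf ((z - ?c) *\<^sub>C ?y - pr ?S x) j = cf (dg s ?y - mv D ?y) j"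
        proof (cases "j \<in> ?S")
          case True
          show ?thesis
            using Res(5)[OF sat(1) good[OF z] True, of x, symmetric] True bounded_symbolI[of s, OF s]
            by (simp add: cf_dg s_def scaleC.diff_left algebra_simps)
        next
          case False
          then show ?thesis
            using Res(4)[OF sat(1) good[OF z], of x] mv_D_supp[OF sat(1) Res(4)[OF sat(1) good[OF z], of x]] bounded_symbolI[of s, OF s]
            by (simp add: supp_def cf_dg s_def)
        qed
      qed
      show ?thesis unfolding e
        using norm_triangle_ineq4[of "dg s ?y" "mv D ?y"] norm_dg_le[of s "r * real k" ?y, OF s] norm_mv_le[of D ?y]
        by (simp add: E_def algebra_simps)
    qed
    have small: "norm ((z - ?c) *\<^sub>C Res ?S z x - pr ?S x) \<le> E * (6 / r * norm x)" if "?\<rho> \<le> cmod (z - ?c)" for z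
      using close[OF that] mult_left_mono[OF Res(3)[OF sat(1) good[OF that], of x] E] by linarith
    have decay: "norm (Res ?S z x) \<le> (norm (pr ?S x) + E * (6 / r * norm x)) / cmod (z - ?c)" if z: "?\<rho> \<le> cmod (z - ?c)" for z
    proof -
      have "cmod (z - ?c) * norm (Res ?S z x) = norm ((z - ?c) *\<^sub>C Res ?S z x)" by (simp add: norm_scaleC)
      also have "\<dots> \<le> norm (pr ?S x) + E * (6 / r * norm x)"
        using norm_triangle_ineq[of "(z - ?c) *\<^sub>C Res ?S z x - pr ?S x" "pr ?S x"] small[OF z] by simp
      finally have le: "cmod (z - ?c) * norm (Res ?S z x) \<le> norm (pr ?S x) + E * (6 / r * norm x)" .
      have "cmod (z - ?c) > 0" using z rad_pos[of b] by linarith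
      then show ?thesis using le by (simp only: pos_le_divide_eq mult.commute[of "norm (Res ?S z x)"])
    qed
    define Q where "Q = E * (norm (pr ?S x) + E * (6 / r * norm x)) * C"
    have far: "\<forall>\<^sub>F z in at_infinity. ?\<rho> \<le> cmod (z - ?c)"
      unfolding eventually_at_infinity
    proof (intro exI[of _ "?\<rho> + cmod ?c"] allI impI)
      fix z assume "?\<rho> + cmod ?c \<le> cmod z"
      then show "?\<rho> \<le> cmod (z - ?c)" using norm_triangle_ineq2[of z ?c] by linarith
    qed
    show "((\<lambda>z. (z - ?c) * \<phi> (Res ?S z x)) \<longlongrightarrow> \<phi> (pr ?S x)) at_infinity"
    proof (rule Lim_null[THEN iffD2], rule Lim_null_comparison)
      show "\<forall>\<^sub>F z in at_infinity. norm ((z - ?c) * \<phi> (Res ?S z x) - \<phi> (pr ?S x)) \<le> Q * cmod (inverse (z - ?c))"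
        using far
      proof eventually_elim
        fix z assume z: "?\<rho> \<le> cmod (z - ?c)"
        have "(z - ?c) * \<phi> (Res ?S z x) - \<phi> (pr ?S x) = \<phi> ((z - ?c) *\<^sub>C Res ?S z x - pr ?S x)"
          by (simp add: \<phi>.diff \<phi>(2))
        also have "norm \<dots> \<le> E * norm (Res ?S z x) * C"
          by (rule order_trans[OF C(2)]) (intro mult_right_mono close z C)
        also have "\<dots> \<le> E * ((norm (pr ?S x) + E * (6 / r * norm x)) / cmod (z - ?c)) * C"
          by (intro mult_right_mono mult_left_mono decay z C E)
        finally show "norm ((z - ?c) * \<phi> (Res ?S z x) - \<phi> (pr ?S x)) \<le> Q * cmod (inverse (z - ?c))"
          by (simp add: Q_def norm_inverse divide_inverse mult_ac)
      qed
      have "filterlim (\<lambda>z. - ?c + z) at_infinity at_infinity"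
        by (rule tendsto_add_filterlim_at_infinity[OF tendsto_const filterlim_ident])
      then have "filterlim (\<lambda>z. z - ?c) at_infinity at_infinity" by simp
      from tendsto_compose_filtermap[THEN iffD2] filterlim_compose[OF tendsto_inverse_0 this]
      have "((\<lambda>z. inverse (z - ?c)) \<longlongrightarrow> 0) at_infinity" by simp
      then show "((\<lambda>z. Q * cmod (inverse (z - ?c))) \<longlongrightarrow> 0) at_infinity"
        by (intro tendsto_mult_right_zero tendsto_norm_zero)
    qed
  qed
  have sum: "((\<lambda>z. \<phi> (Res ?S z x) + \<phi> (Res (- ?S) z x)) has_contour_integral (2 * of_real pi * \<i> * \<phi> (pr ?S x))) (circlepath ?c ?\<rho>)"
    using has_contour_integral_add[OF outer inner] by simp
  show ?thesis
  proof (rule has_contour_integral_eq[OF sum])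
    fix z assume "z \<in> path_image (circlepath ?c ?\<rho>)"
    then have "cmod (z - ?c) = ?\<rho>" using rad_pos[of b] by (auto simp: sphere_def dist_norm norm_minus_commute)
    then show "\<phi> (Res ?S z x) + \<phi> (Res (- ?S) z x) = \<phi> (Res UNIV z x)"
      using Res_split[OF sat(1) good_on_circle[OF b]] linear_add[OF bounded_linear.linear[OF \<phi>(1)]] by simp
  qed
qed

text \<open>On a block with a single index \<open>l\<close> the operator \<open>\<Lambda>\<close> is the scalar \<open>i \<lambda>\<^sub>l\<close>.\<close>

lemma gspec_singleton:
  assumes l: "\<bar>l\<bar> > int k"
  shows "gspec {l} gD = (\<lambda>\<mu>. \<i> * of_real (lam r l) - \<mu>) ` gspec {l} {(x, y). y = mv D x}"
proof -
  let ?c = "\<i> * of_real (lam r l)" and ?h = "{(x, y). y = mv D x}"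
  have sat: "saturated {l}"
    using saturated_Sb[of l] l by (auto simp: saturated_def Sb_def blk_def split: if_splits)
  have graph: "(x, y) \<in> gD \<longleftrightarrow> (x, ?c *\<^sub>C x - y) \<in> ?h" if "x \<in> supp {l}" "y \<in> supp {l}" for x y
  proof -
    have m: "mv D x \<in> supp {l}" by (rule mv_D_supp[OF sat that(1)])
    have "(x, y) \<in> gD \<longleftrightarrow> cf y l = ?c *\<^sub>C cf x l - cf (mv D x) l"
      using that m unfolding gD_iff supp_def by (auto simp: all_conj_distrib) (metis cf_zero diff_zero scaleC_zero_right)
    also have "\<dots> \<longleftrightarrow> ?c *\<^sub>C x - y = mv D x"
    proof
      assume e: "cf y l = ?c *\<^sub>C cf x l - cf (mv D x) l"
      show "?c *\<^sub>C x - y = mv D x"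
      proof (rule ell2_eqI)
        fix j show "cf (?c *\<^sub>C x - y) j = cf (mv D x) j"
          using that m e by (cases "j = l") (auto simp: supp_def)
      qed
    next
      assume "?c *\<^sub>C x - y = mv D x"
      then show "cf y l = ?c *\<^sub>C cf x l - cf (mv D x) l" by (metis add_diff_cancel_left' cf_diff cf_scaleC diff_add_cancel)
    qed
    finally show ?thesis by simp
  qed
  have neg_h: "complex_homogeneous (\<lambda>x. - A x)" if "complex_homogeneous A" for A :: "(int, 'h) ell2 \<Rightarrow> (int, 'h) ell2"
    using that by (simp add: complex_homogeneous_def scaleC.minus_right)
  have one: "gres {l} ?h (?c - z) (\<lambda>x. - A x)" if A: "gres {l} gD z A" for z A
    unfolding gres_def
  proof (intro conjI ballI)
    show "bounded_linear (\<lambda>x. - A x)" "complex_homogeneous (\<lambda>x. - A x)"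
      using A neg_h by (auto simp: gres_def bounded_linear_minus)
    fix x :: "(int, 'h) ell2" assume x: "x \<in> supp {l}"
    have Ax: "A x \<in> supp {l}" "(A x, z *\<^sub>C A x - x) \<in> gD" using A x by (auto simp: gres_def)
    show "- A x \<in> supp {l}" using Ax(1) by (simp add: supp_def)
    have "?c *\<^sub>C A x - (z *\<^sub>C A x - x) = mv D (A x)"
      using graph[OF Ax(1) supp_diff[OF supp_scaleC[OF Ax(1)] x], of z] Ax(2) by simp
    then show "(- A x, (?c - z) *\<^sub>C (- A x) - x) \<in> ?h"
      by (simp add: mv.minus_right scaleC.minus_right scaleC.diff_left algebra_simps)
  next
    fix p :: "(int, 'h) ell2 \<times> (int, 'h) ell2" assume p: "p \<in> ?h"
    obtain x y where xy: "p = (x, y)" by (cases p)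
    have "- A ((?c - z) *\<^sub>C x - y) = x" if s: "x \<in> supp {l}" "y \<in> supp {l}"
    proof -
      have "(x, ?c *\<^sub>C x - y) \<in> gD"
        using graph[OF s(1) supp_diff[OF supp_scaleC[OF s(1)] s(2)], of ?c] p by (simp add: xy)
      moreover have "?c *\<^sub>C x - y \<in> supp {l}" by (intro supp_diff supp_scaleC s)
      ultimately have "A (z *\<^sub>C x - (?c *\<^sub>C x - y)) = x" using gresD[OF A] s by blast
      moreover have "z *\<^sub>C x - (?c *\<^sub>C x - y) = - ((?c - z) *\<^sub>C x - y)" by (simp add: scaleC.diff_left)
      moreover have "A (- ((?c - z) *\<^sub>C x - y)) = - A ((?c - z) *\<^sub>C x - y)"
        using A linear_neg[OF bounded_linear.linear] unfolding gres_def by blast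
      ultimately show ?thesis by simp
    qed
    then show "case p of (x, y) \<Rightarrow> x \<in> supp {l} \<longrightarrow> y \<in> supp {l} \<longrightarrow> - A ((?c - z) *\<^sub>C x - y) = x" by (simp add: xy)
  qed
  have two: "gres {l} gD (?c - z) (\<lambda>x. - A x)" if A: "gres {l} ?h z A" for z A
    unfolding gres_def
  proof (intro conjI ballI)
    show "bounded_linear (\<lambda>x. - A x)" "complex_homogeneous (\<lambda>x. - A x)"
      using A neg_h by (auto simp: gres_def bounded_linear_minus)
    fix x :: "(int, 'h) ell2" assume x: "x \<in> supp {l}"
    have Ax: "A x \<in> supp {l}" "(A x, z *\<^sub>C A x - x) \<in> ?h" using A x by (auto simp: gres_def)
    show nAx: "- A x \<in> supp {l}" using Ax(1) by (simp add: supp_def)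
    have "?c *\<^sub>C (- A x) - ((?c - z) *\<^sub>C (- A x) - x) = mv D (- A x)"
      using Ax(2) by (simp add: mv.minus_right scaleC.minus_right scaleC.diff_left algebra_simps)
    then show "(- A x, (?c - z) *\<^sub>C (- A x) - x) \<in> gD"
      by (subst graph) (auto intro!: supp_diff supp_scaleC nAx x)
  next
    fix p assume p: "p \<in> gD"
    obtain x y where xy: "p = (x, y)" by (cases p)
    have "- A ((?c - z) *\<^sub>C x - y) = x" if s: "x \<in> supp {l}" "y \<in> supp {l}"
    proof -
      have "(x, ?c *\<^sub>C x - y) \<in> ?h" using graph[OF s] p by (simp add: xy)
      moreover have "?c *\<^sub>C x - y \<in> supp {l}" by (intro supp_diff supp_scaleC s)
      ultimately have "A (z *\<^sub>C x - (?c *\<^sub>C x - y)) = x" using gresD[OF A] s by blast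
      moreover have "z *\<^sub>C x - (?c *\<^sub>C x - y) = - ((?c - z) *\<^sub>C x - y)" by (simp add: scaleC.diff_left)
      moreover have "A (- ((?c - z) *\<^sub>C x - y)) = - A ((?c - z) *\<^sub>C x - y)"
        using A linear_neg[OF bounded_linear.linear] unfolding gres_def by blast
      ultimately show ?thesis by simp
    qed
    then show "case p of (x, y) \<Rightarrow> x \<in> supp {l} \<longrightarrow> y \<in> supp {l} \<longrightarrow> - A ((?c - z) *\<^sub>C x - y) = x" by (simp add: xy)
  qed
  have iff: "z \<in> gspec {l} gD \<longleftrightarrow> ?c - z \<in> gspec {l} ?h" for z
  proof -
    have "\<exists>A. gres {l} ?h (?c - z) A" if "gres {l} gD z A" for A by (rule exI[where x = "\<lambda>x. - A x"], rule one[OF that])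
    moreover have "\<exists>A. gres {l} gD z A" if "gres {l} ?h (?c - z) A" for A
      using two[OF that] by (intro exI[where x = "\<lambda>x. - A x"]) simp
    ultimately show ?thesis unfolding gspec_def mem_Collect_eq by blast
  qed
  show ?thesis
  proof (intro set_eqI iffI)
    fix z assume "z \<in> gspec {l} gD"
    then have "?c - z \<in> gspec {l} ?h" by (simp only: iff)
    moreover have "z = ?c - (?c - z)" by simp
    ultimately show "z \<in> (\<lambda>\<mu>. ?c - \<mu>) ` gspec {l} ?h" by (rule image_eqI[rotated])
  next
    fix z assume "z \<in> (\<lambda>\<mu>. ?c - \<mu>) ` gspec {l} ?h"
    then obtain \<mu> where m: "\<mu> \<in> gspec {l} ?h" "z = ?c - \<mu>" by blast
    have "?c - z = \<mu>" using m(2) by simp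
    then show "z \<in> gspec {l} gD" using m(1) by (simp only: iff)
  qed
qed

end

section \<open>Measure-theoretic preliminaries for Hilbert-space-valued functions\<close>

lemma AE_lebesgue_onI:
  assumes "S \<in> sets lebesgue" "negligible N" "\<And>s. s \<in> S - N \<Longrightarrow> P s"
  shows "AE s in lebesgue_on S. P s"
proof -
  have "N \<in> null_sets lebesgue" using assms(2) by (simp add: negligible_iff_null_sets)
  then have "AE s in lebesgue. s \<notin> N" by (rule AE_not_in)
  then have "AE s in lebesgue. s \<in> S \<longrightarrow> P s" by eventually_elim (use assms(3) in auto)
  then show ?thesis using assms(1) by (subst AE_restrict_space_iff) auto
qed

lemma negligible_AE_lebesgue_on:
  assumes "S \<in> sets lebesgue" "AE s in lebesgue_on S. P s"
  shows "negligible {s \<in> S. \<not> P s}"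
proof -
  have "AE s in lebesgue. s \<in> S \<longrightarrow> P s" using assms by (subst (asm) AE_restrict_space_iff) auto
  then obtain N where N: "N \<in> null_sets lebesgue" "{s \<in> space lebesgue. \<not> (s \<in> S \<longrightarrow> P s)} \<subseteq> N"
    unfolding eventually_ae_filter by blast
  have "negligible N" using N(1) negligible_iff_null_sets by blast
  moreover have "{s \<in> S. \<not> P s} \<subseteq> N" using N(2) by auto
  ultimately show ?thesis by (rule negligible_subset)
qed

lemma nonneg_integrable_lebesgue_on:
  fixes \<phi> :: "real \<Rightarrow> real"
  assumes "\<phi> integrable_on {a..b}" "\<And>s. s \<in> {a..b} \<Longrightarrow> 0 \<le> \<phi> s"
  shows "integrable (lebesgue_on {a..b}) \<phi>"
  by (intro absolutely_integrable_imp_integrable nonnegative_absolutely_integrable_1 assms) auto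

lemma integrable_dominated:
  fixes \<phi> w :: "real \<Rightarrow> real"
  assumes "\<phi> \<in> borel_measurable (lebesgue_on {a..b})" "w integrable_on {a..b}" "\<And>s. s \<in> {a..b} \<Longrightarrow> \<bar>\<phi> s\<bar> \<le> w s"
  shows "\<phi> integrable_on {a..b}"
  by (rule measurable_bounded_by_integrable_imp_integrable[OF assms(1,2)]) (use assms(3) in auto)

lemma dominated_integral_tendsto_0:
  fixes \<phi> :: "nat \<Rightarrow> real \<Rightarrow> real"
  assumes meas: "\<And>n. \<phi> n \<in> borel_measurable (lebesgue_on {a..b})"
    and w: "w integrable_on {a..b}" and le: "\<And>n s. s \<in> {a..b} \<Longrightarrow> 0 \<le> \<phi> n s \<and> \<phi> n s \<le> w s"
    and N: "negligible N" and lim: "\<And>s. s \<in> {a..b} - N \<Longrightarrow> (\<lambda>n. \<phi> n s) \<longlonglongrightarrow> 0"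
  shows "(\<lambda>n. integral {a..b} (\<phi> n)) \<longlonglongrightarrow> 0"
proof -
  let ?M = "lebesgue_on {a..b}"
  have int: "\<phi> n integrable_on {a..b}" for n by (rule integrable_dominated[OF meas w]) (use le in auto)
  have "0 \<le> w s" if "s \<in> {a..b}" for s using le[OF that, of 0] by linarith
  then have wM: "integrable ?M w" by (rule nonneg_integrable_lebesgue_on[OF w])
  have "(\<lambda>n. integral\<^sup>L ?M (\<phi> n)) \<longlonglongrightarrow> integral\<^sup>L ?M (\<lambda>_. 0)"
  proof (rule integral_dominated_convergence[OF _ meas wM])
    show "AE s in ?M. (\<lambda>n. \<phi> n s) \<longlonglongrightarrow> 0" by (rule AE_lebesgue_onI[OF _ N lim]) auto
    show "AE s in ?M. norm (\<phi> n s) \<le> w s" for n by (rule AE_I2) (use le in auto)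
  qed auto
  moreover have "integral\<^sup>L ?M (\<phi> n) = integral {a..b} (\<phi> n)" for n
    by (intro lebesgue_integral_eq_integral nonneg_integrable_lebesgue_on int) (use le in auto)
  ultimately show ?thesis by simp
qed

lemma fatou_integral:
  fixes \<phi> :: "nat \<Rightarrow> real \<Rightarrow> real"
  assumes int: "\<And>n. \<phi> n integrable_on {a..b}" and nonneg: "\<And>n s. s \<in> {a..b} \<Longrightarrow> 0 \<le> \<phi> n s"
    and C: "\<forall>\<^sub>F n in sequentially. integral {a..b} (\<phi> n) \<le> C"
    and \<psi>: "\<psi> \<in> borel_measurable (lebesgue_on {a..b})" "\<And>s. s \<in> {a..b} \<Longrightarrow> 0 \<le> \<psi> s"
    and N: "negligible N" and lim: "\<And>s. s \<in> {a..b} - N \<Longrightarrow> (\<lambda>n. \<phi> n s) \<longlonglongrightarrow> \<psi> s"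
  shows "\<psi> integrable_on {a..b}" "integral {a..b} \<psi> \<le> C"
proof -
  let ?M = "lebesgue_on {a..b}"
  have iM: "integrable ?M (\<phi> n)" for n by (rule nonneg_integrable_lebesgue_on[OF int nonneg])
  have eq: "integral\<^sup>N ?M (\<lambda>s. ennreal (\<phi> n s)) = ennreal (integral {a..b} (\<phi> n))" for n
  proof -
    have "integral\<^sup>N ?M (\<lambda>s. ennreal (\<phi> n s)) = ennreal (integral\<^sup>L ?M (\<phi> n))"
      by (rule nn_integral_eq_integral[OF iM AE_I2]) (use nonneg in auto)
    then show ?thesis using lebesgue_integral_eq_integral[OF iM] by simp
  qed
  obtain n0 where "integral {a..b} (\<phi> n0) \<le> C" using C by (metis eventually_happens' sequentially_bot)
  then have C0: "0 \<le> C" using integral_nonneg[OF int nonneg, of n0] by linarith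
  have "AE s in ?M. ennreal (\<psi> s) = liminf (\<lambda>n. ennreal (\<phi> n s))"
  proof (rule AE_lebesgue_onI[OF _ N])
    fix s assume "s \<in> {a..b} - N"
    then have "(\<lambda>n. ennreal (\<phi> n s)) \<longlonglongrightarrow> ennreal (\<psi> s)" by (intro tendsto_ennrealI lim)
    then show "ennreal (\<psi> s) = liminf (\<lambda>n. ennreal (\<phi> n s))" using lim_imp_Liminf[of sequentially] by force
  qed auto
  then have "integral\<^sup>N ?M (\<lambda>s. ennreal (\<psi> s)) = integral\<^sup>N ?M (\<lambda>s. liminf (\<lambda>n. ennreal (\<phi> n s)))"
    by (rule nn_integral_cong_AE)
  also have "\<dots> \<le> liminf (\<lambda>n. integral\<^sup>N ?M (\<lambda>s. ennreal (\<phi> n s)))"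
    by (rule nn_integral_liminf) (use iM in measurable)
  also have "\<dots> \<le> ennreal C"
  proof -
    have "liminf (\<lambda>n. ennreal (integral {a..b} (\<phi> n))) \<le> liminf (\<lambda>n. ennreal C)"
      by (rule Liminf_mono) (use C in \<open>auto elim!: eventually_mono intro: ennreal_leI\<close>)
    then show ?thesis by (simp add: eq Liminf_const)
  qed
  finally have le: "integral\<^sup>N ?M (\<lambda>s. ennreal (\<psi> s)) \<le> ennreal C" .
  have ae: "AE s in ?M. 0 \<le> \<psi> s" by (rule AE_I2) (use \<psi>(2) in auto)
  have "integrable ?M \<psi>"
    by (rule integrableI_nonneg[OF \<psi>(1) ae]) (use le in \<open>simp add: le_less_trans[OF le] less_top\<close>)
  then show "\<psi> integrable_on {a..b}" by (rule integrable_on_lebesgue_on) auto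
  have "integral {a..b} \<psi> = integral\<^sup>L ?M \<psi>"
    using lebesgue_integral_eq_integral[OF \<open>integrable ?M \<psi>\<close>] by simp
  moreover have "ennreal (integral\<^sup>L ?M \<psi>) \<le> ennreal C"
    using nn_integral_eq_integral[OF \<open>integrable ?M \<psi>\<close> ae] le by simp
  ultimately show "integral {a..b} \<psi> \<le> C" using C0 by simp
qed

lemma measurable_on_combine2:
  fixes f :: "real \<Rightarrow> 'a::real_normed_vector" and g :: "real \<Rightarrow> 'b::real_normed_vector"
    and h :: "'a \<times> 'b \<Rightarrow> 'c::real_normed_vector"
  assumes f: "f measurable_on S" and g: "g measurable_on S"
    and h: "continuous_on UNIV h" "h (0, 0) = 0"
  shows "(\<lambda>s. h (f s, g s)) measurable_on S"
proof -
  obtain N1 F where F: "negligible N1" "\<And>n. continuous_on UNIV (F n)"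
    "\<And>x. x \<notin> N1 \<Longrightarrow> (\<lambda>n. F n x) \<longlonglongrightarrow> (if x \<in> S then f x else 0)" using f unfolding measurable_on_def by blast
  obtain N2 G where G: "negligible N2" "\<And>n. continuous_on UNIV (G n)"
    "\<And>x. x \<notin> N2 \<Longrightarrow> (\<lambda>n. G n x) \<longlonglongrightarrow> (if x \<in> S then g x else 0)" using g unfolding measurable_on_def by blast
  have "(\<lambda>n. h (F n x, G n x)) \<longlonglongrightarrow> (if x \<in> S then h (f x, g x) else 0)" if "x \<notin> N1 \<union> N2" for x
  proof -
    have "(\<lambda>n. (F n x, G n x)) \<longlonglongrightarrow> (if x \<in> S then f x else 0, if x \<in> S then g x else 0)"
      using that by (intro tendsto_Pair F G) auto
    then have "(\<lambda>n. h (F n x, G n x)) \<longlonglongrightarrow> h (if x \<in> S then f x else 0, if x \<in> S then g x else 0)"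
      using h(1) by (intro isCont_tendsto_compose[of _ h]) (auto simp: continuous_on_eq_continuous_at)
    then show ?thesis using h(2) by (auto split: if_splits)
  qed
  moreover have "continuous_on UNIV (\<lambda>x. h (F n x, G n x))" for n
    by (rule continuous_on_compose2[OF h(1)]) (auto intro!: continuous_on_Pair F G)
  ultimately show ?thesis
    unfolding measurable_on_def using negligible_Un[OF F(1) G(1)]
    by (intro exI[of _ "N1 \<union> N2"] exI[of _ "\<lambda>n x. h (F n x, G n x)"]) auto
qed

text \<open>An almost everywhere limit of continuous functions on a closed set is strongly measurable; outside
  the set the approximating functions are cut off.\<close>

lemma measurable_on_limit_continuous:
  fixes g :: "nat \<Rightarrow> real \<Rightarrow> 'a::real_normed_vector"
  assumes S: "closed S" "S \<noteq> {}" and N: "negligible N" and g: "\<And>n. continuous_on UNIV (g n)"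
    and lim: "\<And>x. x \<in> S - N \<Longrightarrow> (\<lambda>n. g n x) \<longlonglongrightarrow> f x"
  shows "f measurable_on S"
proof -
  define ch where "ch = (\<lambda>(n::nat) x. max 0 (1 - real n * infdist x S))"
  have "(\<lambda>n. ch n x *\<^sub>R g n x) \<longlonglongrightarrow> (if x \<in> S then f x else 0)" if "x \<notin> N" for x
  proof (cases "x \<in> S")
    case True
    then have "ch n x = 1" for n using S by (simp add: ch_def)
    then show ?thesis using lim[of x] True that by simp
  next
    case False
    then have d: "infdist x S > 0" using S infdist_pos_not_in_closed by blast
    obtain n0 :: nat where n0: "1 / infdist x S < real n0" using reals_Archimedean2 by blast
    have "ch n x = 0" if "n \<ge> n0" for n
    proof -
      have "1 / infdist x S \<le> real n" using n0 that by linarith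
      then show ?thesis using d by (simp add: ch_def field_simps)
    qed
    then have "\<forall>\<^sub>F n in sequentially. ch n x *\<^sub>R g n x = 0" by (auto simp: eventually_sequentially)
    then show ?thesis using False by (simp add: tendsto_eventually)
  qed
  moreover have "continuous_on UNIV (\<lambda>x. ch n x *\<^sub>R g n x)" for n
    unfolding ch_def by (intro continuous_intros g)
  ultimately show ?thesis
    unfolding measurable_on_def using N
    by (intro exI[of _ N] exI[of _ "\<lambda>n x. ch n x *\<^sub>R g n x"]) auto
qed

lemma measurable_on_continuous:
  fixes f :: "real \<Rightarrow> 'a::real_normed_vector"
  assumes "continuous_on UNIV f" "a \<le> b" shows "f measurable_on {a..b}"
  by (rule measurable_on_limit_continuous[of _ "{}" "\<lambda>_. f"]) (use assms in auto)

lemma borel_measurable_norm_square: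
  fixes f :: "real \<Rightarrow> 'a::real_normed_vector"
  assumes "f measurable_on {a..b}" shows "(\<lambda>s. (norm (f s))\<^sup>2) \<in> borel_measurable (lebesgue_on {a..b})"
proof (rule measurable_on_imp_borel_measurable_lebesgue)
  show "(\<lambda>s. (norm (f s))\<^sup>2) measurable_on {a..b}"
    using measurable_on_combine2[OF assms assms, of "\<lambda>p. (norm (fst p))\<^sup>2"] by (simp add: continuous_intros)
qed auto

lemma measurable_on_plus:
  fixes f g :: "real \<Rightarrow> 'a::real_normed_vector"
  shows "f measurable_on S \<Longrightarrow> g measurable_on S \<Longrightarrow> (\<lambda>s. f s + g s) measurable_on S"
  using measurable_on_combine2[of f S g "\<lambda>p. fst p + snd p"] by (simp add: continuous_intros)

lemma measurable_on_minus2: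
  fixes f g :: "real \<Rightarrow> 'a::real_normed_vector"
  shows "f measurable_on S \<Longrightarrow> g measurable_on S \<Longrightarrow> (\<lambda>s. f s - g s) measurable_on S"
  using measurable_on_combine2[of f S g "\<lambda>p. fst p - snd p"] by (simp add: continuous_intros)

lemma measurable_on_scaleC:
  fixes c :: "real \<Rightarrow> complex" and f :: "real \<Rightarrow> 'h::complex_hilbert"
  assumes "c measurable_on S" "f measurable_on S" shows "(\<lambda>s. c s *\<^sub>C f s) measurable_on S"
  using measurable_on_combine2[OF assms, of "\<lambda>p. fst p *\<^sub>C snd p"]
  by (simp add: scaleC.continuous_on continuous_intros)

subsection \<open>Approximation by continuous functions and integrability\<close>

definition trunc :: "real \<Rightarrow> 'a::real_normed_vector \<Rightarrow> 'a" where "trunc M v = (M / max M (norm v)) *\<^sub>R v"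

lemma trunc:
  fixes v :: "'a::real_normed_vector"
  assumes "M > 0"
  shows "continuous_on UNIV (trunc M :: 'a \<Rightarrow> 'a)" "norm (trunc M v) \<le> M" "norm v \<le> M \<Longrightarrow> trunc M v = v"
    "norm (v - trunc M v) \<le> norm v" "trunc M (0 :: 'a) = 0"
proof -
  have nz: "max M (norm v) \<noteq> 0" for v :: 'a using assms by linarith
  show "continuous_on UNIV (trunc M :: 'a \<Rightarrow> 'a)"
    unfolding trunc_def by (intro continuous_intros ballI nz)
  show "norm (trunc M v) \<le> M"
  proof (cases "norm v \<le> M")
    case False
    then have "v \<noteq> 0" using assms by auto
    then show ?thesis using False assms by (simp add: trunc_def max_def)
  qed (use assms in \<open>simp add: trunc_def max_def\<close>)
  show "trunc M v = v" if "norm v \<le> M" using assms that by (simp add: trunc_def max_def)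
  have "v - trunc M v = (1 - M / max M (norm v)) *\<^sub>R v" by (simp add: trunc_def scaleR_diff_left)
  moreover have "\<bar>1 - M / max M (norm v)\<bar> \<le> 1"
  proof -
    have "max M (norm v) > 0" using assms by linarith
    then have "0 \<le> M / max M (norm v)" "M / max M (norm v) \<le> 1" using assms by (simp_all add: divide_le_eq)
    then show ?thesis by linarith
  qed
  ultimately show "norm (v - trunc M v) \<le> norm v"
    using mult_right_mono[of "\<bar>1 - M / max M (norm v)\<bar>" 1 "norm v"] by simp
  show "trunc M (0::'a) = 0" by (simp add: trunc_def)
qed

lemma square_norm_add_le: "(norm (u + v))\<^sup>2 \<le> 2 * (norm u)\<^sup>2 + 2 * (norm (v :: 'a::real_normed_vector))\<^sup>2"
proof -
  have "(norm (u + v))\<^sup>2 \<le> (norm u + norm v)\<^sup>2" by (intro power_mono norm_triangle_ineq) auto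
  also have "\<dots> \<le> 2 * (norm u)\<^sup>2 + 2 * (norm v)\<^sup>2"
    using zero_le_power2[of "norm u - norm v"] by (simp add: power2_eq_square algebra_simps)
  finally show ?thesis .
qed

text \<open>Truncation of the values of \<open>f\<close> reduces the assertion to bounded functions, by dominated convergence.  Strong
  measurability provides continuous functions that converge almost everywhere; truncated and cut off near the
  end points they stay bounded and still converge almost everywhere.\<close>

lemma continuous_square_approx:
  fixes f :: "real \<Rightarrow> 'a::real_normed_vector"
  assumes \<omega>: "\<omega> > 0" and f: "f measurable_on {0..\<omega>}" "(\<lambda>s. (norm (f s))\<^sup>2) integrable_on {0..\<omega>}" and e: "e > 0"
  obtains h where "continuous_on UNIV h" "h 0 = 0" "h \<omega> = 0"
    "(\<lambda>s. (norm (f s - h s))\<^sup>2) integrable_on {0..\<omega>}" "integral {0..\<omega>} (\<lambda>s. (norm (f s - h s))\<^sup>2) < e"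
proof -
  let ?I = "{0..\<omega>}"
  have tm: "(\<lambda>s. trunc M (f s)) measurable_on ?I" if "M > 0" for M
  proof -
    have "continuous_on UNIV (\<lambda>p :: 'a \<times> 'a. trunc M (fst p))"
      by (rule continuous_on_compose2[OF trunc(1)[OF that] continuous_on_fst[OF continuous_on_id]]) auto
    then show ?thesis
      using measurable_on_combine2[OF f(1) f(1), of "\<lambda>p. trunc M (fst p)"] trunc(5)[OF that] by simp
  qed
  have "(\<lambda>n. integral ?I (\<lambda>s. (norm (f s - trunc (real (Suc n)) (f s)))\<^sup>2)) \<longlonglongrightarrow> 0"
  proof (rule dominated_integral_tendsto_0[OF _ f(2) _ negligible_empty])
    show "(\<lambda>s. (norm (f s - trunc (real (Suc n)) (f s)))\<^sup>2) \<in> borel_measurable (lebesgue_on ?I)" for n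
      by (intro borel_measurable_norm_square measurable_on_minus2 f tm) simp
    show "0 \<le> (norm (f s - trunc (real (Suc n)) (f s)))\<^sup>2 \<and> (norm (f s - trunc (real (Suc n)) (f s)))\<^sup>2 \<le> (norm (f s))\<^sup>2" for n s
      by (auto intro!: power_mono trunc)
    fix s
    obtain n0 :: nat where n0: "norm (f s) < real n0" using reals_Archimedean2 by blast
    have "(norm (f s - trunc (real (Suc n)) (f s)))\<^sup>2 = 0" if "n \<ge> n0" for n
    proof -
      have "norm (f s) \<le> real (Suc n)" using n0 that by linarith
      then show ?thesis using trunc(3)[of "real (Suc n)" "f s"] by simp
    qed
    then show "(\<lambda>n. (norm (f s - trunc (real (Suc n)) (f s)))\<^sup>2) \<longlonglongrightarrow> 0"
      by (intro tendsto_eventually) (auto simp: eventually_sequentially)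
  qed
  then have "\<forall>\<^sub>F n in sequentially. integral ?I (\<lambda>s. (norm (f s - trunc (real (Suc n)) (f s)))\<^sup>2) < e / 4"
    by (rule order_tendstoD) (use e in simp)
  then obtain n where n: "integral ?I (\<lambda>s. (norm (f s - trunc (real (Suc n)) (f s)))\<^sup>2) < e / 4"
    using eventually_happens'[OF sequentially_bot] by blast
  define M where "M = real (Suc n)"
  have M: "M > 0" by (simp add: M_def)
  define T where "T = (\<lambda>s. trunc M (f s))"
  have T: "T measurable_on ?I" "\<And>s. norm (T s) \<le> M" unfolding T_def by (intro tm M trunc)+
  obtain N g where g: "negligible N" "\<And>n. continuous_on UNIV (g n)"
    "\<And>x. x \<notin> N \<Longrightarrow> (\<lambda>n. g n x) \<longlonglongrightarrow> (if x \<in> ?I then f x else 0)" using f(1) unfolding measurable_on_def by blast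
  define ch where "ch = (\<lambda>(n::nat) s. max 0 (min 1 (real n * min s (\<omega> - s))))"
  have ch: "0 \<le> ch n s" "ch n s \<le> 1" "continuous_on UNIV (ch n)" "ch n 0 = 0" "ch n \<omega> = 0" for n s
    using \<omega> unfolding ch_def by (auto intro!: continuous_intros)
  define h where "h = (\<lambda>n s. ch n s *\<^sub>R trunc M (g n s))"
  have hc: "continuous_on UNIV (h n)" for n
    unfolding h_def by (intro continuous_intros ch continuous_on_compose2[OF trunc(1)[OF M] g(2)]) auto
  have hM: "norm (h n s) \<le> M" for n s
    using mult_mono[OF ch(2)[of n s] trunc(2)[OF M, of "g n s"]] ch(1)[of n s] by (simp add: h_def)
  have Thm: "(\<lambda>s. (norm (T s - h n s))\<^sup>2) \<in> borel_measurable (lebesgue_on ?I)" for n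
    by (intro borel_measurable_norm_square measurable_on_minus2 T measurable_on_continuous hc) (use \<omega> in auto)
  have Thle: "0 \<le> (norm (T s - h n s))\<^sup>2 \<and> (norm (T s - h n s))\<^sup>2 \<le> (2 * M)\<^sup>2" for n s
  proof -
    have "norm (T s - h n s) \<le> 2 * M" using norm_triangle_ineq4[of "T s" "h n s"] T(2)[of s] hM[of n s] by linarith
    then show ?thesis by (intro conjI power_mono) auto
  qed
  have const: "(\<lambda>s. (2 * M)\<^sup>2) integrable_on ?I" by (rule integrable_const_ivl)
  have "(\<lambda>n. integral ?I (\<lambda>s. (norm (T s - h n s))\<^sup>2)) \<longlonglongrightarrow> 0"
  proof (rule dominated_integral_tendsto_0[OF Thm const Thle])
    show "negligible (N \<union> {0, \<omega>})" using g(1) by (simp add: negligible_Un)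
    fix s assume s: "s \<in> ?I - (N \<union> {0, \<omega>})"
    have "(\<lambda>n. g n s) \<longlonglongrightarrow> f s" using g(3)[of s] s by simp
    then have t: "(\<lambda>n. trunc M (g n s)) \<longlonglongrightarrow> T s"
      unfolding T_def using trunc(1)[OF M] by (intro isCont_tendsto_compose[of _ "trunc M"]) (auto simp: continuous_on_eq_continuous_at)
    have "\<forall>\<^sub>F n in sequentially. ch n s = 1"
    proof -
      have m: "min s (\<omega> - s) > 0" using s by auto
      obtain n0 :: nat where n0: "1 / min s (\<omega> - s) < real n0" using reals_Archimedean2 by blast
      have "ch n s = 1" if "n \<ge> n0" for n
      proof -
        have "1 / min s (\<omega> - s) \<le> real n" using n0 that by linarith
        then have "1 \<le> real n * min s (\<omega> - s)" using m by (simp only: pos_divide_le_eq)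
        then show ?thesis by (simp add: ch_def)
      qed
      then show ?thesis by (auto simp: eventually_sequentially)
    qed
    then have "(\<lambda>n. ch n s) \<longlonglongrightarrow> 1" by (rule tendsto_eventually)
    from tendsto_scaleR[OF this t] have "(\<lambda>n. h n s) \<longlonglongrightarrow> T s" by (simp add: h_def)
    then have "(\<lambda>n. (norm (T s - h n s))\<^sup>2) \<longlonglongrightarrow> (norm (T s - T s))\<^sup>2" by (intro tendsto_intros)
    then show "(\<lambda>n. (norm (T s - h n s))\<^sup>2) \<longlonglongrightarrow> 0" by simp
  qed
  then have "\<forall>\<^sub>F n in sequentially. integral ?I (\<lambda>s. (norm (T s - h n s))\<^sup>2) < e / 4"
    by (rule order_tendstoD) (use e in simp)
  then obtain m where m: "integral ?I (\<lambda>s. (norm (T s - h m s))\<^sup>2) < e / 4"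
    using eventually_happens'[OF sequentially_bot] by blast
  have i1: "(\<lambda>s. (norm (f s - T s))\<^sup>2) integrable_on ?I"
    by (rule integrable_dominated[OF _ f(2)])
       (auto simp: T_def intro!: borel_measurable_norm_square measurable_on_minus2 f tm M power_mono trunc)
  have i2: "(\<lambda>s. (norm (T s - h m s))\<^sup>2) integrable_on ?I"
    by (rule integrable_dominated[OF Thm const]) (use Thle in simp)
  have le: "(norm (f s - h m s))\<^sup>2 \<le> 2 * (norm (f s - T s))\<^sup>2 + 2 * (norm (T s - h m s))\<^sup>2" for s
    using square_norm_add_le[of "f s - T s" "T s - h m s"] by simp
  have i3: "(\<lambda>s. 2 * (norm (f s - T s))\<^sup>2 + 2 * (norm (T s - h m s))\<^sup>2) integrable_on ?I"
    by (intro integrable_add integrable_on_mult_right i1 i2)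
  have i4: "(\<lambda>s. (norm (f s - h m s))\<^sup>2) integrable_on ?I"
  proof (rule integrable_dominated[OF borel_measurable_norm_square i3])
    show "(\<lambda>s. f s - h m s) measurable_on ?I"
      by (rule measurable_on_minus2[OF f(1) measurable_on_continuous[OF hc]]) (use \<omega> in simp)
  qed (use le in simp)
  have "integral ?I (\<lambda>s. (norm (f s - h m s))\<^sup>2) \<le> integral ?I (\<lambda>s. 2 * (norm (f s - T s))\<^sup>2 + 2 * (norm (T s - h m s))\<^sup>2)"
    by (rule integral_le[OF i4 i3 le])
  also have "\<dots> = 2 * integral ?I (\<lambda>s. (norm (f s - T s))\<^sup>2) + 2 * integral ?I (\<lambda>s. (norm (T s - h m s))\<^sup>2)"
    by (simp add: integral_add integrable_on_mult_right i1 i2)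
  also have "\<dots> < e" using n m by (simp add: T_def M_def)
  finally show ?thesis using that[OF hc[of m] _ _ i4] ch(4,5) by (simp add: h_def)
qed

text \<open>Gauge integrability of a vector-valued function that is approximated in mean by integrable functions:
  Riemann sums of \<open>f\<close> and of \<open>h\<close> differ by at most the Riemann sum of \<open>\<parallel>f - h\<parallel>\<close>.\<close>

lemma integrable_mean_approx:
  fixes f :: "real \<Rightarrow> 'a::banach"
  assumes "\<And>e. e > 0 \<Longrightarrow> \<exists>h. h integrable_on {a..b} \<and> (\<lambda>s. norm (f s - h s)) integrable_on {a..b} \<and> integral {a..b} (\<lambda>s. norm (f s - h s)) < e"
  shows "f integrable_on {a..b}"
proof -
  have "\<exists>\<gamma>. gauge \<gamma> \<and> (\<forall>D1 D2. D1 tagged_division_of (cbox a b) \<and> \<gamma> fine D1 \<and>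
      D2 tagged_division_of (cbox a b) \<and> \<gamma> fine D2 \<longrightarrow>
      norm ((\<Sum>(x,K)\<in>D1. measure lborel K *\<^sub>R f x) - (\<Sum>(x,K)\<in>D2. measure lborel K *\<^sub>R f x)) < e)" if e: "e > 0" for e
  proof -
    obtain h where h: "h integrable_on {a..b}" "(\<lambda>s. norm (f s - h s)) integrable_on {a..b}"
      "integral {a..b} (\<lambda>s. norm (f s - h s)) < e / 6" using assms[of "e / 6"] e by auto
    let ?u = "\<lambda>s. norm (f s - h s)"
    have "(?u has_integral integral {a..b} ?u) (cbox a b)" using h(2) by (simp add: has_integral_integral)
    from this[unfolded has_integral, THEN spec, of "e / 6"] e
    have "\<exists>\<gamma>. gauge \<gamma> \<and> (\<forall>D. D tagged_division_of (cbox a b) \<and> \<gamma> fine D \<longrightarrow>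
        norm ((\<Sum>(x,K)\<in>D. measure lborel K *\<^sub>R ?u x) - integral {a..b} ?u) < e / 6)" by simp
    then obtain \<gamma>1 where g1: "gauge \<gamma>1 \<and> (\<forall>D. D tagged_division_of (cbox a b) \<and> \<gamma>1 fine D \<longrightarrow>
        norm ((\<Sum>(x,K)\<in>D. measure lborel K *\<^sub>R ?u x) - integral {a..b} ?u) < e / 6)" by (rule exE)
    note \<gamma>1 = g1[THEN conjunct1] g1[THEN conjunct2, rule_format, OF conjI]
    have "h integrable_on (cbox a b)" using h(1) by simp
    from this[unfolded integrable_Cauchy, THEN spec, of "e / 3"] e
    have "\<exists>\<gamma>. gauge \<gamma> \<and> (\<forall>D1 D2. D1 tagged_division_of (cbox a b) \<and> \<gamma> fine D1 \<and>
        D2 tagged_division_of (cbox a b) \<and> \<gamma> fine D2 \<longrightarrow>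
        norm ((\<Sum>(x,K)\<in>D1. measure lborel K *\<^sub>R h x) - (\<Sum>(x,K)\<in>D2. measure lborel K *\<^sub>R h x)) < e / 3)" by simp
    then obtain \<gamma>2 where g2: "gauge \<gamma>2 \<and> (\<forall>D1 D2. D1 tagged_division_of (cbox a b) \<and> \<gamma>2 fine D1 \<and>
        D2 tagged_division_of (cbox a b) \<and> \<gamma>2 fine D2 \<longrightarrow>
        norm ((\<Sum>(x,K)\<in>D1. measure lborel K *\<^sub>R h x) - (\<Sum>(x,K)\<in>D2. measure lborel K *\<^sub>R h x)) < e / 3)" by (rule exE)
    note \<gamma>2 = g2[THEN conjunct1] g2[THEN conjunct2, rule_format, OF conjI[OF _ conjI[OF _ conjI]]]
    have diff: "norm ((\<Sum>(x,K)\<in>D. measure lborel K *\<^sub>R f x) - (\<Sum>(x,K)\<in>D. measure lborel K *\<^sub>R h x)) < e / 3"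
      if D: "D tagged_division_of (cbox a b)" "\<gamma>1 fine D" for D
    proof -
      have "norm ((\<Sum>(x,K)\<in>D. measure lborel K *\<^sub>R f x) - (\<Sum>(x,K)\<in>D. measure lborel K *\<^sub>R h x))
          = norm (\<Sum>(x,K)\<in>D. measure lborel K *\<^sub>R (f x - h x))"
        by (simp add: sum_subtractf[symmetric] split_def scaleR_diff_right)
      also have "\<dots> \<le> (\<Sum>(x,K)\<in>D. measure lborel K *\<^sub>R ?u x)"
        by (rule sum_norm_le) (auto simp: split_def)
      also have "\<dots> < e / 3" using \<gamma>1(2)[OF D] h(3) unfolding real_norm_def by linarith
      finally show ?thesis .
    qed
    have three: "norm (p - q) < e" if "norm (p - p') < e / 3" "norm (q - q') < e / 3" "norm (p' - q') < e / 3" for p q p' q' :: 'a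
    proof -
      have "norm (p - q) = norm ((p - p') + (p' - q') - (q - q'))" by simp
      also have "\<dots> \<le> norm (p - p') + norm (p' - q') + norm (q - q')"
        by (meson add_mono norm_triangle_ineq norm_triangle_ineq4 order_refl order_trans)
      finally show ?thesis using that by linarith
    qed
    show ?thesis
    proof (intro exI[of _ "\<lambda>x. \<gamma>1 x \<inter> \<gamma>2 x"] conjI allI impI)
      show "gauge (\<lambda>x. \<gamma>1 x \<inter> \<gamma>2 x)" using \<gamma>1(1) \<gamma>2(1) by (rule gauge_Int)
      fix D1 D2
      assume D: "D1 tagged_division_of cbox a b \<and> (\<lambda>x. \<gamma>1 x \<inter> \<gamma>2 x) fine D1 \<and>
        D2 tagged_division_of cbox a b \<and> (\<lambda>x. \<gamma>1 x \<inter> \<gamma>2 x) fine D2"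
      then have fine: "\<gamma>1 fine D1" "\<gamma>2 fine D1" "\<gamma>1 fine D2" "\<gamma>2 fine D2" by (auto simp: fine_Int)
      let ?S = "\<lambda>D g. \<Sum>(x,K)\<in>D. measure lborel K *\<^sub>R g x :: 'a"
      have D': "D1 tagged_division_of cbox a b" "D2 tagged_division_of cbox a b" using D by blast+
      have "norm (?S D1 f - ?S D1 h) < e / 3" by (rule diff[OF D'(1) fine(1)])
      moreover have "norm (?S D2 f - ?S D2 h) < e / 3" by (rule diff[OF D'(2) fine(3)])
      moreover have "norm (?S D1 h - ?S D2 h) < e / 3" by (rule \<gamma>2(2)[OF D'(1) fine(2) D'(2) fine(4)])
      ultimately show "norm (?S D1 f - ?S D2 f) < e" by (rule three)
    qed
  qed
  then show ?thesis unfolding box_real(2)[symmetric] integrable_Cauchy by blast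
qed

lemma le_square_mean: "\<eta> > 0 \<Longrightarrow> a \<le> (\<eta> + a\<^sup>2 / \<eta>) / (2::real)"
  using zero_le_power2[of "a - \<eta>"] by (simp add: field_simps power2_eq_square)

text \<open>The second estimate is the Cauchy--Schwarz inequality in a linear form with a free parameter \<open>\<eta>\<close>.\<close>

lemma square_integrable_imp_norm_integrable:
  fixes u :: "real \<Rightarrow> 'a::real_normed_vector"
  assumes "u measurable_on {a..b}" "(\<lambda>s. (norm (u s))\<^sup>2) integrable_on {a..b}"
  shows "(\<lambda>s. norm (u s)) integrable_on {a..b}"
    and "\<eta> > 0 \<Longrightarrow> a \<le> b \<Longrightarrow> integral {a..b} (\<lambda>s. norm (u s)) \<le> (\<eta> * (b - a) + integral {a..b} (\<lambda>s. (norm (u s))\<^sup>2) / \<eta>) / 2"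
proof -
  have m: "(\<lambda>s. norm (u s)) \<in> borel_measurable (lebesgue_on {a..b})"
    using measurable_on_combine2[OF assms(1,1), of "\<lambda>p. norm (fst p)"]
    by (intro measurable_on_imp_borel_measurable_lebesgue) (auto simp: continuous_intros)
  have i: "(\<lambda>s. (\<eta> + (norm (u s))\<^sup>2 / \<eta>) / 2) integrable_on {a..b}" for \<eta>
    by (intro integrable_on_divide integrable_add assms integrable_const_ivl)
  show *: "(\<lambda>s. norm (u s)) integrable_on {a..b}"
    by (rule integrable_dominated[OF m i[of 1]]) (use le_square_mean[of 1] in auto)
  assume \<eta>: "\<eta> > 0" "a \<le> b"
  have "integral {a..b} (\<lambda>s. norm (u s)) \<le> integral {a..b} (\<lambda>s. (\<eta> + (norm (u s))\<^sup>2 / \<eta>) / 2)"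
    by (rule integral_le[OF * i]) (rule le_square_mean[OF \<eta>(1)])
  also have "\<dots> = (\<eta> * (b - a) + integral {a..b} (\<lambda>s. (norm (u s))\<^sup>2) / \<eta>) / 2"
    using \<eta> assms(2) by (simp add: integral_add integrable_on_divide integrable_const_ivl)
  finally show "integral {a..b} (\<lambda>s. norm (u s)) \<le> (\<eta> * (b - a) + integral {a..b} (\<lambda>s. (norm (u s))\<^sup>2) / \<eta>) / 2" .
qed

lemma square_integrable_imp_integrable:
  fixes f :: "real \<Rightarrow> 'a::banach"
  assumes \<omega>: "\<omega> > 0" and f: "f measurable_on {0..\<omega>}" "(\<lambda>s. (norm (f s))\<^sup>2) integrable_on {0..\<omega>}"
  shows "f integrable_on {0..\<omega>}"
proof (rule integrable_mean_approx)
  fix e :: real assume e: "e > 0"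
  define \<eta> where "\<eta> = e / (2 * \<omega>)"
  have \<eta>: "\<eta> > 0" using e \<omega> by (simp add: \<eta>_def)
  obtain h where h: "continuous_on UNIV h" "(\<lambda>s. (norm (f s - h s))\<^sup>2) integrable_on {0..\<omega>}"
    "integral {0..\<omega>} (\<lambda>s. (norm (f s - h s))\<^sup>2) < e * \<eta>"
    using continuous_square_approx[OF \<omega> f, of "e * \<eta>"] e \<eta> by auto
  have m: "(\<lambda>s. f s - h s) measurable_on {0..\<omega>}"
    using \<omega> by (intro measurable_on_minus2 f measurable_on_continuous h) auto
  have "integral {0..\<omega>} (\<lambda>s. norm (f s - h s)) \<le> (\<eta> * \<omega> + integral {0..\<omega>} (\<lambda>s. (norm (f s - h s))\<^sup>2) / \<eta>) / 2"
    using square_integrable_imp_norm_integrable(2)[OF m h(2) \<eta>] \<omega> by simp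
  also have "\<dots> < (\<eta> * \<omega> + e) / 2"
    using h(3) \<eta> by (simp add: divide_less_eq)
  also have "\<dots> \<le> e" using e \<omega> by (simp add: \<eta>_def)
  finally show "\<exists>h. h integrable_on {0..\<omega>} \<and> (\<lambda>s. norm (f s - h s)) integrable_on {0..\<omega>} \<and> integral {0..\<omega>} (\<lambda>s. norm (f s - h s)) < e"
    using square_integrable_imp_norm_integrable(1)[OF m h(2)] h(1)
    by (intro exI[of _ h]) (auto intro!: integrable_continuous_interval intro: continuous_on_subset)
qed

section \<open>Fourier series in \<open>L\<^sup>2([0,\<omega>],H)\<close>\<close>

lemma has_sum_symmetric_partial_sums:
  fixes g :: "int \<Rightarrow> 'a::{comm_monoid_add,topological_space}"
  assumes "(g has_sum a) UNIV" shows "(\<lambda>N. sum g {- int N..int N}) \<longlonglongrightarrow> a"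
proof -
  have "filterlim (\<lambda>N. {- int N..int N}) (finite_subsets_at_top UNIV) sequentially"
    unfolding filterlim_finite_subsets_at_top
  proof (intro allI impI)
    fix X :: "int set" assume X: "finite X \<and> X \<subseteq> UNIV"
    have "X \<subseteq> {- int N..int N}" if N: "N \<ge> nat (\<Sum>n\<in>X. \<bar>n\<bar>)" for N
    proof
      fix n assume "n \<in> X"
      then have "\<bar>n\<bar> \<le> (\<Sum>n\<in>X. \<bar>n\<bar>)" using X member_le_sum[of n X "\<lambda>n. \<bar>n\<bar>"] by auto
      then show "n \<in> {- int N..int N}" using N by auto
    qed
    then show "\<forall>\<^sub>F N in sequentially. finite {- int N..int N} \<and> X \<subseteq> {- int N..int N} \<and> {- int N..int N} \<subseteq> UNIV"
      by (auto simp: eventually_sequentially)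
  qed
  then show ?thesis using assms unfolding has_sum_def by (rule filterlim_compose[rotated])
qed

lemma L2D: "f \<in> L2 \<omega> \<Longrightarrow> f measurable_on {0..\<omega>}" "f \<in> L2 \<omega> \<Longrightarrow> (\<lambda>s. (norm (f s))\<^sup>2) integrable_on {0..\<omega>}"
  by (auto simp: L2_def)

lemma L2_bound:
  assumes "f measurable_on {0..\<omega>}" "w integrable_on {0..\<omega>}" "\<And>s. s \<in> {0..\<omega>} \<Longrightarrow> (norm (f s))\<^sup>2 \<le> w s"
  shows "f \<in> L2 \<omega>"
  unfolding L2_def using assms integrable_dominated[OF borel_measurable_norm_square[OF assms(1)] assms(2)] by auto

lemma L2_cong:
  assumes f: "f \<in> L2 \<omega>" and eq: "L2_eq \<omega> f g" shows "g \<in> L2 \<omega>"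
proof -
  let ?N = "{s \<in> {0..\<omega>}. f s \<noteq> g s}"
  have N: "negligible ?N" using eq by (simp add: L2_eq_def)
  have "g measurable_on {0..\<omega>}" by (rule measurable_on_spike[OF L2D(1)[OF f] N]) auto
  moreover have "(\<lambda>s. (norm (g s))\<^sup>2) integrable_on {0..\<omega>}" by (rule integrable_spike[OF L2D(2)[OF f] N]) auto
  ultimately show ?thesis by (simp add: L2_def)
qed

lemma L2_add: assumes "f \<in> L2 \<omega>" "g \<in> L2 \<omega>" shows "(\<lambda>s. f s + g s) \<in> L2 \<omega>"
proof (rule L2_bound)
  show "(\<lambda>s. 2 * (norm (f s))\<^sup>2 + 2 * (norm (g s))\<^sup>2) integrable_on {0..\<omega>}"
    by (intro integrable_add integrable_on_mult_right L2D(2) assms)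
qed (auto intro: measurable_on_plus L2D assms square_norm_add_le)

lemma L2_mult:
  assumes c: "continuous_on UNIV c" "\<And>s. cmod (c s) \<le> C" and f: "f \<in> L2 \<omega>" and \<omega>: "\<omega> > 0"
  shows "(\<lambda>s. c s *\<^sub>C f s) \<in> L2 \<omega>"
proof (rule L2_bound)
  show "(\<lambda>s. c s *\<^sub>C f s) measurable_on {0..\<omega>}"
    using \<omega> by (intro measurable_on_scaleC measurable_on_continuous c L2D f) auto
  show "(\<lambda>s. C\<^sup>2 * (norm (f s))\<^sup>2) integrable_on {0..\<omega>}" by (intro integrable_on_mult_right L2D f)
  show "(norm (c s *\<^sub>C f s))\<^sup>2 \<le> C\<^sup>2 * (norm (f s))\<^sup>2" for s
    by (auto simp: norm_scaleC power_mult_distrib intro!: mult_right_mono power_mono c)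
qed

lemma has_integral_zero_negligible:
  fixes \<phi> :: "real \<Rightarrow> real"
  assumes "\<phi> integrable_on {a..b}" "\<And>s. s \<in> {a..b} \<Longrightarrow> 0 \<le> \<phi> s" "integral {a..b} \<phi> \<le> 0"
  shows "negligible {s \<in> {a..b}. \<phi> s \<noteq> 0}"
proof -
  have i: "integrable (lebesgue_on {a..b}) \<phi>" by (rule nonneg_integrable_lebesgue_on[OF assms(1,2)])
  have "integral\<^sup>L (lebesgue_on {a..b}) \<phi> = 0"
    using lebesgue_integral_eq_integral[OF i] integral_nonneg[OF assms(1,2)] assms(3) by simp
  moreover have "AE s in lebesgue_on {a..b}. 0 \<le> \<phi> s" by (rule AE_I2) (use assms(2) in auto)
  ultimately have "AE s in lebesgue_on {a..b}. \<phi> s = 0" using integral_nonneg_eq_0_iff_AE[OF i] by blast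
  then show ?thesis by (intro negligible_AE_lebesgue_on) auto
qed

locale l2_interval =
  fixes \<omega> :: real assumes omega_pos: "\<omega> > 0"
begin

abbreviation "r0 \<equiv> 2 * pi / \<omega>"

definition ee :: "int \<Rightarrow> real \<Rightarrow> complex" where "ee n s = exp (\<i> * of_real (2 * pi * of_int n * s / \<omega>))"

lemma r0_pos: "r0 > 0" using omega_pos by simp

lemma ee_add: "ee (m + n) s = ee m s * ee n s"
  by (simp add: ee_def exp_add[symmetric] algebra_simps add_divide_distrib)
lemma ee_0 [simp]: "ee 0 s = 1" by (simp add: ee_def)
lemma ee_at_0 [simp]: "ee n 0 = 1" by (simp add: ee_def)
lemma cmod_ee [simp]: "cmod (ee n s) = 1" by (simp add: ee_def norm_exp_i_times)
lemma ee_at_omega [simp]: "ee n \<omega> = 1"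
proof -
  have "ee n \<omega> = exp (2 * of_int n * of_real pi * \<i>)" using omega_pos by (simp add: ee_def mult_ac)
  then show ?thesis using exp_integer_2pi[of "of_int n"] by (simp add: mult_ac)
qed
lemma cnj_ee: "cnj (ee n s) = ee (- n) s" by (simp add: ee_def exp_cnj)
lemma ee_reflect: "ee n (\<omega> - s) = ee (- n) s"
proof -
  have "2 * pi * of_int n * (\<omega> - s) / \<omega> = 2 * pi * of_int n * \<omega> / \<omega> + 2 * pi * of_int (- n) * s / \<omega>"
    using omega_pos by (simp add: field_simps)
  then have "ee n (\<omega> - s) = ee n \<omega> * ee (- n) s"
    unfolding ee_def exp_add[symmetric] distrib_left[symmetric] of_real_add[symmetric] by simp
  then show ?thesis by simp
qed
lemma continuous_ee [continuous_intros]: "continuous_on A (ee n)"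
  unfolding ee_def by (intro continuous_intros) (use omega_pos in auto)

lemma has_integral_ee:
  assumes "0 \<le> t"
  shows "(ee n has_integral (if n = 0 then of_real t else (ee n t - 1) / (\<i> * of_real (lam r0 n)))) {0..t}"
proof (cases "n = 0")
  case True
  have "ee 0 = (\<lambda>_. 1)" by (simp add: fun_eq_iff)
  then show ?thesis using True has_integral_const_real[of "1 :: complex" 0 t] assms by (simp add: scaleR_conv_of_real)
next
  case False
  define c where "c = \<i> * of_real (lam r0 n)"
  have c: "c \<noteq> 0" using False omega_pos by (simp add: c_def lam_def)
  have ec: "ee n s = exp (c * of_real s)" for s by (simp add: ee_def c_def lam_def mult_ac)
  have "((\<lambda>s. exp (c * of_real s)) has_integral (exp (c * of_real t) / c - exp (c * of_real 0) / c)) {0..t}"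
  proof (rule fundamental_theorem_of_calculus[OF assms])
    fix s :: real
    have "((\<lambda>z. exp (c * z) / c) has_field_derivative exp (c * of_real s)) (at (of_real s))"
      using c by (auto intro!: derivative_eq_intros)
    then show "((\<lambda>s. exp (c * of_real s) / c) has_vector_derivative exp (c * of_real s)) (at s within {0..t})"
      by (rule has_vector_derivative_real_field)
  qed
  then have "(ee n has_integral (ee n t / c - 1 / c)) {0..t}" unfolding ec by (simp add: ec[abs_def])
  then show ?thesis using False by (simp add: c_def diff_divide_distrib)
qed

lemma integral_ee: "integral {0..\<omega>} (ee n) = (if n = 0 then of_real \<omega> else 0)"
  using has_integral_ee[of \<omega> n] omega_pos by (auto dest!: integral_unique split: if_splits)

lemma L2_diff: "f \<in> L2 \<omega> \<Longrightarrow> g \<in> L2 \<omega> \<Longrightarrow> (\<lambda>s. f s - g s) \<in> L2 \<omega>"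
proof -
  assume f: "f \<in> L2 \<omega>" and g: "g \<in> L2 \<omega>"
  have "(\<lambda>s. (- 1) *\<^sub>C g s) \<in> L2 \<omega>" by (rule L2_mult[of _ 1]) (auto simp: g omega_pos)
  from L2_add[OF f this] show ?thesis by (simp add: scaleC.minus_left)
qed
lemma L2_scaleC: "f \<in> L2 \<omega> \<Longrightarrow> (\<lambda>s. c *\<^sub>C f s) \<in> L2 \<omega>"
  by (rule L2_mult[of _ "cmod c"]) (auto simp: omega_pos)
lemma L2_ee: "f \<in> L2 \<omega> \<Longrightarrow> (\<lambda>s. ee n s *\<^sub>C f s) \<in> L2 \<omega>"
  by (rule L2_mult[of _ 1]) (auto simp: omega_pos continuous_intros)
lemma L2_zero [simp]: "(\<lambda>s. 0) \<in> L2 \<omega>" by (simp add: L2_def integrable_0)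
lemma L2_sum: "(\<And>i. i \<in> F \<Longrightarrow> f i \<in> L2 \<omega>) \<Longrightarrow> (\<lambda>s. \<Sum>i\<in>F. f i s) \<in> L2 \<omega>"
  by (induction F rule: infinite_finite_induct) (auto intro: L2_add)
lemma L2_continuous:
  assumes "continuous_on UNIV f" shows "f \<in> L2 \<omega>"
proof -
  have "continuous_on {0..\<omega>} (\<lambda>s. (norm (f s))\<^sup>2)"
    by (intro continuous_intros continuous_on_subset[OF assms]) auto
  then show ?thesis unfolding L2_def using measurable_on_continuous[OF assms] omega_pos
    by (auto intro: integrable_continuous_interval)
qed

lemma L2_integrable: "f \<in> L2 \<omega> \<Longrightarrow> f integrable_on {0..\<omega>}"
  by (rule square_integrable_imp_integrable[OF omega_pos]) (auto dest: L2D)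

lemma L2_eq_refl [simp]: "L2_eq \<omega> f f" by (simp add: L2_eq_def)
lemma L2_eq_sym: assumes "L2_eq \<omega> f g" shows "L2_eq \<omega> g f"
proof -
  have "{s \<in> {0..\<omega>}. g s \<noteq> f s} = {s \<in> {0..\<omega>}. f s \<noteq> g s}" by auto
  then show ?thesis using assms by (simp only: L2_eq_def)
qed

definition nsq :: "(real \<Rightarrow> 'h::complex_hilbert) \<Rightarrow> real" where "nsq f = integral {0..\<omega>} (\<lambda>s. (norm (f s))\<^sup>2)"

lemma nsq_nonneg: "f \<in> L2 \<omega> \<Longrightarrow> nsq f \<ge> 0"
  unfolding nsq_def by (intro integral_nonneg L2D) auto

lemma L2_norm_eq: "f \<in> L2 \<omega> \<Longrightarrow> L2_norm \<omega> f = sqrt (nsq f / \<omega>)"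
proof -
  assume f: "f \<in> L2 \<omega>"
  have "((\<lambda>s. complex_of_real ((norm (f s))\<^sup>2)) has_integral of_real (nsq f)) {0..\<omega>}"
    unfolding nsq_def
    using has_integral_linear[OF integrable_integral[OF L2D(2)[OF f]] bounded_linear_of_real] by (simp add: o_def)
  then have "integral {0..\<omega>} (\<lambda>s. cinner (f s) (f s)) = of_real (nsq f)"
    by (simp add: cinner_self integral_unique)
  then show ?thesis by (simp add: L2_norm_def L2_inner_def)
qed

lemma inner_integrable:
  assumes "f \<in> L2 \<omega>" "g \<in> L2 \<omega>"
  shows "(\<lambda>s. cinner (f s) (g s)) integrable_on {0..\<omega>}"
proof (rule measurable_bounded_by_integrable_imp_integrable)
  have "continuous_on UNIV (\<lambda>p :: 'a \<times> 'a. cinner (fst p) (snd p))"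
    by (intro cinner_cb.continuous_on continuous_intros)
  then show "(\<lambda>s. cinner (f s) (g s)) \<in> borel_measurable (lebesgue_on {0..\<omega>})"
    using measurable_on_combine2[OF L2D(1)[OF assms(1)] L2D(1)[OF assms(2)], of "\<lambda>p. cinner (fst p) (snd p)"]
    by (intro measurable_on_imp_borel_measurable_lebesgue) auto
  show "(\<lambda>s. (norm (f s))\<^sup>2 + (norm (g s))\<^sup>2) integrable_on {0..\<omega>}" by (intro integrable_add L2D assms)
  show "cmod (cinner (f s) (g s)) \<le> (norm (f s))\<^sup>2 + (norm (g s))\<^sup>2" for s
  proof -
    have "2 * (norm (f s) * norm (g s)) \<le> (norm (f s))\<^sup>2 + (norm (g s))\<^sup>2"
      using zero_le_power2[of "norm (f s) - norm (g s)"] by (simp add: power2_eq_square algebra_simps)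
    moreover have "0 \<le> norm (f s) * norm (g s)" by simp
    ultimately show ?thesis using norm_cinner_le[of "f s" "g s"] by linarith
  qed
qed auto

abbreviation "fc \<equiv> fourier_coeff \<omega>"

lemma fc_eq: "fc f n = (1 / \<omega>) *\<^sub>R integral {0..\<omega>} (\<lambda>s. ee (- n) s *\<^sub>C f s)"
  by (simp add: fourier_coeff_def ee_def)

lemma fc_add: "f \<in> L2 \<omega> \<Longrightarrow> g \<in> L2 \<omega> \<Longrightarrow> fc (\<lambda>s. f s + g s) n = fc f n + fc g n"
  unfolding fc_eq by (simp add: scaleC_add_right integral_add L2_integrable[OF L2_ee] scaleR_add_right)
lemma fc_diff: "f \<in> L2 \<omega> \<Longrightarrow> g \<in> L2 \<omega> \<Longrightarrow> fc (\<lambda>s. f s - g s) n = fc f n - fc g n"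
  unfolding fc_eq by (simp add: scaleC.diff_right integral_diff L2_integrable[OF L2_ee] scaleR_diff_right)
lemma fc_scaleC:
  assumes "f \<in> L2 \<omega>" shows "fc (\<lambda>s. c *\<^sub>C f s) n = c *\<^sub>C fc f n"
proof -
  have "integral {0..\<omega>} (\<lambda>s. c *\<^sub>C (ee (- n) s *\<^sub>C f s)) = c *\<^sub>C integral {0..\<omega>} (\<lambda>s. ee (- n) s *\<^sub>C f s)"
    using integral_linear[OF L2_integrable[OF L2_ee[OF assms]] bounded_linear_scaleC, of c "- n"] by (simp add: o_def)
  then show ?thesis unfolding fc_eq by (simp add: scaleC_scaleC mult.commute scaleC_scaleR_commute)
qed
lemma fc_cong: "L2_eq \<omega> f g \<Longrightarrow> fc f n = fc g n"
  unfolding fc_eq L2_eq_def by (rule arg_cong[OF integral_spike]) auto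
lemma fc_zero [simp]: "fc (\<lambda>s. 0) n = 0" by (simp add: fc_eq)
lemma fc_sum: "(\<And>i. i \<in> F \<Longrightarrow> f i \<in> L2 \<omega>) \<Longrightarrow> fc (\<lambda>s. \<Sum>i\<in>F. f i s) n = (\<Sum>i\<in>F. fc (f i) n)"
  by (induction F rule: infinite_finite_induct) (auto simp: fc_add L2_sum)
lemma fc_ee: "fc (\<lambda>s. ee m s *\<^sub>C f s) n = fc f (n - m)"
  unfolding fc_eq by (simp add: scaleC_scaleC flip: ee_add)
lemma fc_const: "fc (\<lambda>s. x) n = (if n = 0 then x else 0)"
proof -
  have "ee (- n) integrable_on {0..\<omega>}" by (intro integrable_continuous_interval continuous_intros)
  from integral_linear[OF this scaleC.bounded_linear_left, of x]
  have "integral {0..\<omega>} (\<lambda>s. ee (- n) s *\<^sub>C x) = (if n = 0 then of_real \<omega> else 0) *\<^sub>C x"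
    by (simp add: o_def integral_ee)
  then show ?thesis unfolding fc_eq using omega_pos by (auto simp: scaleC_of_real)
qed

definition trig :: "int set \<Rightarrow> (int \<Rightarrow> 'h::complex_hilbert) \<Rightarrow> real \<Rightarrow> 'h"
  where "trig F x s = (\<Sum>n\<in>F. ee n s *\<^sub>C x n)"

lemma continuous_trig: "continuous_on A (trig F x)"
  unfolding trig_def by (intro continuous_intros scaleC.continuous_on)
lemma L2_trig [simp]: "trig F x \<in> L2 \<omega>" by (rule L2_continuous[OF continuous_trig])
lemma fc_trig: assumes "finite F" shows "fc (trig F x) n = (if n \<in> F then x n else 0)"
proof -
  have "fc (trig F x) n = (\<Sum>i\<in>F. fc (\<lambda>s. ee i s *\<^sub>C x i) n)"
    unfolding trig_def[abs_def] by (rule fc_sum) (intro L2_ee L2_continuous continuous_intros)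
  also have "\<dots> = (\<Sum>i\<in>F. if n = i then x i else 0)" by (simp add: fc_ee fc_const)
  finally show ?thesis using assms by simp
qed
lemma trig_diff: "finite F \<Longrightarrow> G \<subseteq> F \<Longrightarrow> trig F x s - trig G x s = trig (F - G) x s"
  by (simp add: trig_def sum_diff)

lemma integral_inner_trig:
  assumes f: "f \<in> L2 \<omega>" and F: "finite F"
  shows "integral {0..\<omega>} (\<lambda>s. cinner (f s) (trig F x s)) = \<omega> *\<^sub>R (\<Sum>n\<in>F. cinner (fc f n) (x n))"
proof -
  have 1: "((\<lambda>s. cinner (f s) (ee n s *\<^sub>C x n)) has_integral \<omega> *\<^sub>R cinner (fc f n) (x n)) {0..\<omega>}" for n
  proof -
    have "((\<lambda>s. ee (- n) s *\<^sub>C f s) has_integral \<omega> *\<^sub>R fc f n) {0..\<omega>}"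
      using integrable_integral[OF L2_integrable[OF L2_ee[OF f, of "- n"]]] omega_pos by (simp add: fc_eq)
    from has_integral_linear[OF this cinner_cb.bounded_linear_left, of "x n"]
    show ?thesis by (simp add: o_def cinner_scaleC_left cinner_scaleC_right cnj_ee cinner_scaleR_left)
  qed
  have "((\<lambda>s. \<Sum>n\<in>F. cinner (f s) (ee n s *\<^sub>C x n)) has_integral (\<Sum>n\<in>F. \<omega> *\<^sub>R cinner (fc f n) (x n))) {0..\<omega>}"
    by (rule has_integral_sum[OF F 1])
  then show ?thesis by (simp add: trig_def cinner_cb.sum_right scaleR_sum_right integral_unique)
qed

lemma norm_diff_square: "(norm (u - v))\<^sup>2 = (norm u)\<^sup>2 - 2 * Re (cinner u v) + (norm (v :: 'h::complex_hilbert))\<^sup>2"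
proof -
  have "complex_of_real ((norm (u - v))\<^sup>2) = cinner u u - cinner u v - cnj (cinner u v) + cinner v v"
    unfolding cinner_self[symmetric] by (simp add: cinner_cb.diff_left cinner_cb.diff_right flip: cinner_commute)
  then have "Re (complex_of_real ((norm (u - v))\<^sup>2)) = Re (cinner u u - cinner u v - cnj (cinner u v) + cinner v v)" by simp
  then show ?thesis by (simp add: cinner_self)
qed

lemma nsq_diff:
  assumes "f \<in> L2 \<omega>" "g \<in> L2 \<omega>"
  shows "nsq (\<lambda>s. f s - g s) = nsq f - 2 * Re (integral {0..\<omega>} (\<lambda>s. cinner (f s) (g s))) + nsq g"
proof -
  note i = L2D(2)[OF assms(1)] L2D(2)[OF assms(2)]
  have R: "((\<lambda>s. Re (cinner (f s) (g s))) has_integral Re (integral {0..\<omega>} (\<lambda>s. cinner (f s) (g s)))) {0..\<omega>}"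
    using has_integral_linear[OF integrable_integral[OF inner_integrable[OF assms]] bounded_linear_Re] by (simp add: o_def)
  have "((\<lambda>s. (norm (f s))\<^sup>2 - 2 * Re (cinner (f s) (g s)) + (norm (g s))\<^sup>2) has_integral
      nsq f - 2 * Re (integral {0..\<omega>} (\<lambda>s. cinner (f s) (g s))) + nsq g) {0..\<omega>}"
    unfolding nsq_def by (intro has_integral_add has_integral_diff has_integral_mult_right R integrable_integral i)
  then show ?thesis unfolding nsq_def norm_diff_square by (rule integral_unique)
qed

lemma nsq_trig: "finite F \<Longrightarrow> nsq (trig F x) = \<omega> * (\<Sum>n\<in>F. (norm (x n))\<^sup>2)"
proof -
  assume F: "finite F"
  have "integral {0..\<omega>} (\<lambda>s. cinner (trig F x s) (trig F x s)) = complex_of_real (nsq (trig F x))"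
    unfolding nsq_def cinner_self
    using integral_unique[OF has_integral_linear[OF integrable_integral[OF L2D(2)[OF L2_trig]] bounded_linear_of_real]] by (simp add: o_def)
  then have "complex_of_real (nsq (trig F x)) = \<omega> *\<^sub>R (\<Sum>n\<in>F. cinner (fc (trig F x) n) (x n))"
    using integral_inner_trig[OF L2_trig[of F x] F, of x] by simp
  also have "\<dots> = complex_of_real (\<omega> * (\<Sum>n\<in>F. (norm (x n))\<^sup>2))"
    by (simp add: fc_trig F cinner_self scaleR_conv_of_real)
  finally show ?thesis by (simp only: of_real_eq_iff)
qed

lemma pythagoras:
  assumes f: "f \<in> L2 \<omega>" and F: "finite F"
  shows "nsq (\<lambda>s. f s - trig F (fc f) s) = nsq f - \<omega> * (\<Sum>n\<in>F. (norm (fc f n))\<^sup>2)"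
  by (simp add: nsq_diff[OF f L2_trig] integral_inner_trig[OF f F] nsq_trig[OF F] cinner_self)

lemma bessel:
  assumes f: "f \<in> L2 \<omega>" and F: "finite F" shows "(\<Sum>n\<in>F. (norm (fc f n))\<^sup>2) \<le> nsq f / \<omega>"
  using nsq_nonneg[OF L2_diff[OF f L2_trig[of F "fc f"]]] pythagoras[OF f F] omega_pos by (simp add: pos_le_divide_eq mult.commute)

lemma fc_le: "f \<in> L2 \<omega> \<Longrightarrow> (norm (fc f n))\<^sup>2 \<le> nsq f / \<omega>" using bessel[of f "{n}"] by simp

definition hat :: "(real \<Rightarrow> 'h::complex_hilbert) \<Rightarrow> (int, 'h) ell2" where "hat f = Ell2 (fc f)"

lemma cf_hat: assumes "f \<in> L2 \<omega>" shows "cf (hat f) = fc f" "norm (hat f) \<le> sqrt (nsq f / \<omega>)"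
proof -
  have "L2_set (\<lambda>n. norm (fc f n)) F \<le> sqrt (nsq f / \<omega>)" if "finite F" for F
    unfolding L2_set_def by (intro real_sqrt_le_mono bessel assms that)
  from Ell2_bounded[OF this] show "cf (hat f) = fc f" "norm (hat f) \<le> sqrt (nsq f / \<omega>)" by (simp_all add: hat_def)
qed

text \<open>Riesz--Fischer.  Along a rapidly convergent subsequence of the partial sums, \<open>\<Sum> 2^k \<parallel>d\<^sub>k(s)\<parallel>\<^sup>2\<close> is finite for
  almost every \<open>s\<close>, where \<open>d\<^sub>k\<close> are the consecutive differences; hence \<open>\<Sum> \<parallel>d\<^sub>k(s)\<parallel>\<close> is dominated by a geometric
  series.\<close>

abbreviation "pN N \<equiv> {- int N..int N}"

lemma riesz_fischer:
  fixes x :: "(int, 'h::complex_hilbert) ell2"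
  obtains f where "f \<in> L2 \<omega>" "hat f = x" "nsq f = \<omega> * (norm x)\<^sup>2"
    "(\<lambda>N. nsq (\<lambda>s. f s - trig (pN N) (cf x) s)) \<longlonglongrightarrow> 0"
proof -
  define S where "S = (\<lambda>N. trig (pN N) (cf x))"
  define \<tau> where "\<tau> = (\<lambda>N. \<omega> * ((norm x)\<^sup>2 - (\<Sum>n\<in>pN N. (norm (cf x n))\<^sup>2)))"
  have part: "(\<lambda>N. \<Sum>n\<in>pN N. (norm (cf x n))\<^sup>2) \<longlonglongrightarrow> (norm x)\<^sup>2"
    unfolding norm_ell2_square by (intro has_sum_symmetric_partial_sums has_sum_infsum cf_square_summable)
  have "\<tau> \<longlonglongrightarrow> \<omega> * ((norm x)\<^sup>2 - (norm x)\<^sup>2)" unfolding \<tau>_def by (intro tendsto_intros part)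
  then have \<tau>0: "\<tau> \<longlonglongrightarrow> 0" by simp
  have fin_le: "(\<Sum>n\<in>F. (norm (cf x n))\<^sup>2) \<le> (norm x)\<^sup>2" if "finite F" for F
    unfolding norm_ell2_square by (intro finite_sum_le_infsum cf_square_summable that) auto
  have diff: "nsq (\<lambda>s. S M s - S N s) \<le> \<tau> N" if MN: "N \<le> M" for M N
  proof -
    have sub: "pN N \<subseteq> pN M" using MN by auto
    have "nsq (\<lambda>s. S M s - S N s) = nsq (trig (pN M - pN N) (cf x))"
      unfolding S_def using trig_diff[OF _ sub, of "cf x"] by simp
    also have "\<dots> = \<omega> * (\<Sum>n\<in>pN M - pN N. (norm (cf x n))\<^sup>2)" by (rule nsq_trig) simp
    also have "(\<Sum>n\<in>pN M - pN N. (norm (cf x n))\<^sup>2) = (\<Sum>n\<in>pN M. (norm (cf x n))\<^sup>2) - (\<Sum>n\<in>pN N. (norm (cf x n))\<^sup>2)"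
      by (rule sum_diff) (use sub in auto)
    also have "\<omega> * \<dots> \<le> \<tau> N" unfolding \<tau>_def using omega_pos fin_le[of "pN M"] by (intro mult_left_mono) auto
    finally show ?thesis .
  qed
  have "\<exists>N. \<forall>M\<ge>N. \<tau> M \<le> (1/4) ^ k" for k
  proof -
    have "\<forall>\<^sub>F M in sequentially. \<tau> M < (1/4) ^ k" by (rule order_tendstoD[OF \<tau>0]) simp
    then show ?thesis by (auto simp: eventually_sequentially intro: less_imp_le)
  qed
  then obtain \<nu> where \<nu>: "\<And>k M. M \<ge> \<nu> k \<Longrightarrow> \<tau> M \<le> (1/4) ^ k" by metis
  define N where "N = (\<lambda>k. k + (\<Sum>i\<le>k. \<nu> i))"
  have N\<nu>: "\<nu> k \<le> N k" for k unfolding N_def using member_le_sum[of k "{..k}" \<nu>] by auto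
  have Nk: "k \<le> N k" for k by (simp add: N_def)
  have Nmono: "N k \<le> N (Suc k)" for k by (simp add: N_def)
  define d where "d = (\<lambda>k s. S (N (Suc k)) s - S (N k) s)"
  have dL2: "d k \<in> L2 \<omega>" for k unfolding d_def S_def by (intro L2_diff L2_trig)
  have nd: "nsq (d k) \<le> (1/4) ^ k" for k
    unfolding d_def by (rule order_trans[OF diff[OF Nmono] \<nu>[OF N\<nu>]])
  let ?M = "lebesgue_on {0..\<omega>}"
  let ?u = "\<lambda>k s. ennreal (2 ^ k * (norm (d k s))\<^sup>2)"
  have um: "?u k \<in> borel_measurable ?M" for k
    using borel_measurable_norm_square[OF L2D(1)[OF dL2[of k]]] by measurable
  have ui: "integral\<^sup>N ?M (?u k) \<le> ennreal ((1/2) ^ k)" for k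
  proof -
    have io: "(\<lambda>s. 2 ^ k * (norm (d k s))\<^sup>2) integrable_on {0..\<omega>}" by (intro integrable_on_mult_right L2D dL2)
    have i: "integrable ?M (\<lambda>s. 2 ^ k * (norm (d k s))\<^sup>2)"
      by (rule nonneg_integrable_lebesgue_on[OF io]) auto
    have "integral\<^sup>N ?M (?u k) = ennreal (integral\<^sup>L ?M (\<lambda>s. 2 ^ k * (norm (d k s))\<^sup>2))"
      by (rule nn_integral_eq_integral[OF i]) auto
    also have "integral\<^sup>L ?M (\<lambda>s. 2 ^ k * (norm (d k s))\<^sup>2) = 2 ^ k * nsq (d k)"
      using lebesgue_integral_eq_integral[OF i] by (simp add: nsq_def)
    also have "2 ^ k * nsq (d k) \<le> 2 ^ k * (1/4) ^ k" using nd by (intro mult_left_mono) auto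
    also have "(2::real) ^ k * (1/4) ^ k = (1/2) ^ k" by (simp add: power_mult_distrib[symmetric])
    finally show ?thesis by (simp add: ennreal_leI)
  qed
  have "integral\<^sup>N ?M (\<lambda>s. \<Sum>k. ?u k s) = (\<Sum>k. integral\<^sup>N ?M (?u k))" by (rule nn_integral_suminf[OF um])
  also have "\<dots> \<le> (\<Sum>k. ennreal ((1/2) ^ k))" by (intro suminf_le ui) auto
  also have "\<dots> = ennreal (\<Sum>k. (1/2) ^ k)" by (rule suminf_ennreal2) (auto intro: summable_geometric)
  also have "\<dots> < \<infinity>" by simp
  finally have "AE s in ?M. (\<Sum>k. ?u k s) \<noteq> \<infinity>" by (intro nn_integral_PInf_AE) (use um in auto)
  then have neg: "negligible {s \<in> {0..\<omega>}. \<not> (\<Sum>k. ?u k s) \<noteq> \<infinity>}" by (intro negligible_AE_lebesgue_on) auto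
  define Z where "Z = {s \<in> {0..\<omega>}. \<not> (\<Sum>k. ?u k s) \<noteq> \<infinity>}"
  have Z: "negligible Z" "\<And>s. s \<in> {0..\<omega>} - Z \<Longrightarrow> (\<Sum>k. ?u k s) \<noteq> \<infinity>"
    using neg unfolding Z_def by blast+
  have conv: "convergent (\<lambda>k. S (N k) s)" if s: "s \<in> {0..\<omega>} - Z" for s
  proof -
    have sm: "summable (\<lambda>k. 2 ^ k * (norm (d k s))\<^sup>2)"
      by (rule summable_suminf_not_top) (use Z(2)[OF s] in auto)
    define C where "C = (\<Sum>k. 2 ^ k * (norm (d k s))\<^sup>2)"
    have dk: "norm (d k s) \<le> sqrt C * (sqrt (1/2)) ^ k" for k
    proof (rule power2_le_imp_le)
      have "2 ^ k * (norm (d k s))\<^sup>2 \<le> C"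
        unfolding C_def using sum_le_suminf[OF sm, of "{k}"] by simp
      then have "(norm (d k s))\<^sup>2 \<le> C * (1/2) ^ k" by (simp add: field_simps power_one_over)
      moreover have "C \<ge> 0" unfolding C_def by (intro suminf_nonneg sm) auto
      ultimately show "(norm (d k s))\<^sup>2 \<le> (sqrt C * (sqrt (1/2)) ^ k)\<^sup>2"
        by (simp add: power_mult_distrib power_mult[symmetric] mult.commute[of k] power_mult)
      show "0 \<le> sqrt C * (sqrt (1/2)) ^ k" using \<open>C \<ge> 0\<close> by simp
    qed
    have "summable (\<lambda>k. sqrt C * (sqrt (1/2)) ^ k)"
      by (intro summable_mult summable_geometric) (simp add: real_sqrt_lt_1_iff)
    then have "summable (\<lambda>k. d k s)" by (rule summable_comparison_test') (rule dk)
    then have "convergent (\<lambda>k. \<Sum>i<k. d i s)" by (simp add: summable_iff_convergent)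
    moreover have "(\<Sum>i<k. d i s) = S (N k) s - S (N 0) s" for k
      unfolding d_def by (rule sum_lessThan_telescope)
    ultimately have "convergent (\<lambda>k. S (N k) s - S (N 0) s)" by simp
    then have "convergent (\<lambda>k. (S (N k) s - S (N 0) s) + S (N 0) s)" by (intro convergent_add convergent_const)
    then show ?thesis by simp
  qed
  define f where "f = (\<lambda>s. lim (\<lambda>k. S (N k) s))"
  have lim: "(\<lambda>k. S (N k) s) \<longlonglongrightarrow> f s" if "s \<in> {0..\<omega>} - Z" for s
    unfolding f_def using conv[OF that] by (simp add: convergent_LIMSEQ_iff)
  have fm: "f measurable_on {0..\<omega>}"
    by (rule measurable_on_limit_continuous[OF _ _ Z(1) _ lim])
       (use omega_pos in \<open>auto simp: S_def intro: continuous_trig\<close>)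
  have fat: "(\<lambda>s. (norm (f s - S n s))\<^sup>2) integrable_on {0..\<omega>}" "integral {0..\<omega>} (\<lambda>s. (norm (f s - S n s))\<^sup>2) \<le> \<tau> n" for n
  proof -
    have "S n measurable_on {0..\<omega>}" unfolding S_def by (rule L2D[OF L2_trig])
    note m = borel_measurable_norm_square[OF measurable_on_minus2[OF fm this]]
    have "\<forall>\<^sub>F k in sequentially. integral {0..\<omega>} (\<lambda>s. (norm (S (N k) s - S n s))\<^sup>2) \<le> \<tau> n"
      by (rule eventually_sequentiallyI[of n]) (use diff[unfolded nsq_def] Nk order_trans in blast)
    note F = fatou_integral[OF _ _ this m _ Z(1)]
    have L: "(\<lambda>k. (norm (S (N k) s - S n s))\<^sup>2) \<longlonglongrightarrow> (norm (f s - S n s))\<^sup>2" if "s \<in> {0..\<omega>} - Z" for s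
      by (intro tendsto_intros lim that)
    have I: "(\<lambda>s. (norm (S (N k) s - S n s))\<^sup>2) integrable_on {0..\<omega>}" for k
      unfolding S_def by (rule L2D(2)[OF L2_diff]) auto
    show "(\<lambda>s. (norm (f s - S n s))\<^sup>2) integrable_on {0..\<omega>}" by (rule F(1)[OF I _ _ L]) auto
    show "integral {0..\<omega>} (\<lambda>s. (norm (f s - S n s))\<^sup>2) \<le> \<tau> n" by (rule F(2)[OF I _ _ L]) auto
  qed
  have fS: "(\<lambda>s. f s - S n s) \<in> L2 \<omega>" for n
    unfolding L2_def using fat(1) measurable_on_minus2[OF fm L2D(1)[OF L2_trig]] by (auto simp: S_def)
  have fL2: "f \<in> L2 \<omega>" using L2_add[OF fS[of 0] L2_trig[of "pN 0" "cf x"]] by (simp add: S_def)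
  have fcf: "fc f m = cf x m" for m
  proof -
    have "norm (fc f m - cf x m) \<le> 0"
    proof (rule tendsto_lowerbound)
      have "(\<lambda>n. sqrt (\<tau> n / \<omega>)) \<longlonglongrightarrow> sqrt (0 / \<omega>)" by (intro tendsto_intros \<tau>0) (use omega_pos in simp)
      then show "(\<lambda>n. sqrt (\<tau> n / \<omega>)) \<longlonglongrightarrow> 0" by simp
      show "\<forall>\<^sub>F n in sequentially. norm (fc f m - cf x m) \<le> sqrt (\<tau> n / \<omega>)"
      proof (rule eventually_sequentiallyI[of "nat \<bar>m\<bar>"])
        fix n assume n: "nat \<bar>m\<bar> \<le> n"
        have "fc (\<lambda>s. f s - S n s) m = fc f m - cf x m"
          using n by (auto simp: fc_diff[OF fL2] S_def fc_trig)
        then have "(norm (fc f m - cf x m))\<^sup>2 \<le> \<tau> n / \<omega>"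
          using fc_le[OF fS[of n], of m] fat(2)[of n] omega_pos
          by (simp add: nsq_def) (meson divide_right_mono less_imp_le order_trans)
        then show "norm (fc f m - cf x m) \<le> sqrt (\<tau> n / \<omega>)" by (rule real_le_rsqrt)
      qed
    qed simp
    then show ?thesis by simp
  qed
  have hat: "hat f = x" by (rule ell2_eqI) (simp add: cf_hat(1)[OF fL2] fcf)
  have e: "nsq (\<lambda>s. f s - S n s) \<le> \<tau> n" for n using fat(2) by (simp add: nsq_def)
  have to0: "(\<lambda>n. nsq (\<lambda>s. f s - S n s)) \<longlonglongrightarrow> 0"
    by (rule tendsto_sandwich[OF _ _ tendsto_const \<tau>0]) (use e nsq_nonneg[OF fS] in auto)
  have "nsq (\<lambda>s. f s - S n s) = nsq f - \<omega> * (\<Sum>i\<in>pN n. (norm (cf x i))\<^sup>2)" for n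
    using pythagoras[OF fL2, of "pN n"] fcf by (simp add: S_def fcf[abs_def])
  then have "(\<lambda>n. nsq f - \<omega> * (\<Sum>i\<in>pN n. (norm (cf x i))\<^sup>2)) \<longlonglongrightarrow> 0" using to0 by simp
  moreover have "(\<lambda>n. nsq f - \<omega> * (\<Sum>i\<in>pN n. (norm (cf x i))\<^sup>2)) \<longlonglongrightarrow> nsq f - \<omega> * (norm x)\<^sup>2"
    by (intro tendsto_intros part)
  ultimately have "nsq f = \<omega> * (norm x)\<^sup>2" using LIMSEQ_unique by fastforce
  with fL2 hat to0 show ?thesis by (intro that) (auto simp: S_def)
qed

end

context l2_interval begin

subsection \<open>Uniqueness of Fourier coefficients\<close>

definition zero_coeffs :: "(real \<Rightarrow> 'h::complex_hilbert) \<Rightarrow> bool"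
  where "zero_coeffs f \<longleftrightarrow> f \<in> L2 \<omega> \<and> (\<forall>n. fc f n = 0)"

text \<open>Multiplication by a real polynomial in \<open>(cos, sin)\<close> preserves the class of functions all of whose
  Fourier coefficients vanish, since multiplication by an exponential only shifts the coefficients.\<close>

lemma zero_coeffs_polynomial:
  fixes f :: "real \<Rightarrow> 'h::complex_hilbert"
  assumes "real_polynomial_function (g :: complex \<Rightarrow> real)"
  shows "zero_coeffs f \<Longrightarrow> zero_coeffs (\<lambda>s. g (ee 1 s) *\<^sub>R f s)"
  using assms
proof (induction g arbitrary: f rule: real_polynomial_function.induct)
  case (linear g)
  have f: "f \<in> L2 \<omega>" "\<And>n. fc f n = 0" using linear.prems by (auto simp: zero_coeffs_def)
  define a where "a = (of_real (g 1) - \<i> * of_real (g \<i>)) / 2"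
  define b where "b = (of_real (g 1) + \<i> * of_real (g \<i>)) / 2"
  have "complex_of_real (g z) = a * z + b * cnj z" for z
  proof -
    have z: "z = Re z *\<^sub>R 1 + Im z *\<^sub>R \<i>" by (simp add: complex_eq_iff)
    have "g z = Re z * g 1 + Im z * g \<i>"
      by (subst z) (simp add: linear_add[OF bounded_linear.linear[OF linear.hyps]] linear_scale[OF bounded_linear.linear[OF linear.hyps]])
    then show ?thesis by (simp add: a_def b_def complex_eq_iff field_simps)
  qed
  then have g: "g (ee 1 s) *\<^sub>R f s = a *\<^sub>C (ee 1 s *\<^sub>C f s) + b *\<^sub>C (ee (- 1) s *\<^sub>C f s)" for s
    by (simp add: scaleC_of_real[symmetric] scaleC_add_left scaleC_scaleC cnj_ee)
  note L = L2_scaleC[OF L2_ee[OF f(1), of 1], of a] L2_scaleC[OF L2_ee[OF f(1), of "- 1"], of b]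
  show ?case unfolding g zero_coeffs_def
    using f L by (auto intro!: L2_add simp: fc_add fc_scaleC L2_ee fc_ee)
next
  case (const c)
  then have f: "f \<in> L2 \<omega>" "\<And>n. fc f n = 0" by (auto simp: zero_coeffs_def)
  show ?case
    using L2_scaleC[OF f(1), of "of_real c"] fc_scaleC[OF f(1), of "of_real c"] f
    by (simp add: zero_coeffs_def scaleC_of_real)
next
  case (add g1 g2)
  from add.IH[OF add.prems] show ?case
    using fc_add[of "\<lambda>s. g1 (ee 1 s) *\<^sub>R f s" "\<lambda>s. g2 (ee 1 s) *\<^sub>R f s"]
    by (auto simp: zero_coeffs_def scaleR_add_left intro: L2_add)
next
  case (mult g1 g2)
  from mult.IH(1)[OF mult.IH(2)[OF mult.prems]] show ?case by simp
qed

lemma ee_1_image: "ee 1 ` {0..\<omega>} = sphere 0 1"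
proof
  show "ee 1 ` {0..\<omega>} \<subseteq> sphere 0 1" by auto
  show "sphere 0 1 \<subseteq> ee 1 ` {0..\<omega>}"
  proof
    fix z :: complex assume "z \<in> sphere 0 1"
    then have "z = exp (\<i> * of_real (Arg2pi z))" using Arg2pi_eq[of z] by simp
    moreover have "2 * pi * (\<omega> * Arg2pi z / (2 * pi)) / \<omega> = Arg2pi z" using omega_pos by simp
    ultimately have "z = ee 1 (\<omega> * Arg2pi z / (2 * pi))" by (simp add: ee_def)
    moreover have "\<omega> * Arg2pi z / (2 * pi) \<in> {0..\<omega>}"
      using Arg2pi_ge_0[of z] Arg2pi_lt_2pi[of z] omega_pos by (auto simp: divide_le_eq)
    ultimately show "z \<in> ee 1 ` {0..\<omega>}" by blast
  qed
qed

lemma ee_1_inj: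
  assumes "s \<in> {0..\<omega>}" "t \<in> {0..\<omega>}" "ee 1 s = ee 1 t" shows "s = t \<or> {s, t} = {0, \<omega>}"
proof -
  obtain n :: int where n: "\<i> * of_real (2 * pi * s / \<omega>) = \<i> * of_real (2 * pi * t / \<omega>) + of_int (2 * n) * of_real pi * \<i>"
    using assms(3) by (auto simp: ee_def exp_eq)
  then have "2 * pi * s / \<omega> = 2 * pi * t / \<omega> + 2 * of_int n * pi"
    by (auto dest!: arg_cong[of _ _ Im])
  then have "pi * (2 * s) = pi * (2 * (t + of_int n * \<omega>))" using omega_pos by (simp add: field_simps)
  then have st: "s = t + of_int n * \<omega>" by simp
  have "of_int n * \<omega> \<le> 1 * \<omega>" "- 1 * \<omega> \<le> of_int n * \<omega>" using st assms by auto
  then have "real_of_int n \<le> 1" "- 1 \<le> real_of_int n" using omega_pos by (simp_all only: mult_le_cancel_right_pos)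
  then have "n = 0 \<or> n = 1 \<or> n = - 1" by linarith
  then show ?thesis using st assms by auto
qed

text \<open>The inverse of the winding \<open>s \<mapsto> ee 1 s\<close> is not continuous, but the transported function has the compact graph
  that is the image of \<open>[0,\<omega>]\<close>, and a function with closed graph and compact range is continuous.\<close>

lemma continuous_on_circle_function:
  fixes h :: "real \<Rightarrow> real"
  assumes h: "continuous_on {0..\<omega>} h" "h 0 = h \<omega>"
  obtains F where "continuous_on (sphere 0 1) F" "\<And>s. s \<in> {0..\<omega>} \<Longrightarrow> F (ee 1 s) = h s"
proof -
  define F where "F = (\<lambda>z. h (SOME s. s \<in> {0..\<omega>} \<and> ee 1 s = z))"
  have F: "F (ee 1 s) = h s" if s: "s \<in> {0..\<omega>}" for s
  proof -
    define t where "t = (SOME t. t \<in> {0..\<omega>} \<and> ee 1 t = ee 1 s)"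
    have "t \<in> {0..\<omega>} \<and> ee 1 t = ee 1 s" unfolding t_def by (rule someI[of _ s]) (use s in simp)
    then have "t = s \<or> {t, s} = {0, \<omega>}" using ee_1_inj s by blast
    then have "h t = h s" using h(2) by (auto simp: doubleton_eq_iff)
    then show ?thesis by (simp add: F_def t_def)
  qed
  have "(\<lambda>z. (z, F z)) ` sphere 0 1 = (\<lambda>s. (ee 1 s, h s)) ` {0..\<omega>}"
    unfolding ee_1_image[symmetric] image_image using F by (intro image_cong) auto
  then have "compact ((\<lambda>z. (z, F z)) ` sphere 0 1)"
    by (simp add: compact_continuous_image continuous_on_Pair continuous_ee h)
  moreover have "F \<in> sphere 0 1 \<rightarrow> h ` {0..\<omega>}" unfolding ee_1_image[symmetric] using F by auto
  moreover have "compact (h ` {0..\<omega>})" by (intro compact_continuous_image h compact_Icc)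
  ultimately have "continuous_on (sphere 0 1) F"
    by (intro continuous_from_closed_graph[of "h ` {0..\<omega>}"] compact_imp_closed)
  then show ?thesis using that F by blast
qed

lemma L2_mult_real:
  fixes f :: "real \<Rightarrow> 'h::complex_hilbert"
  assumes f: "f \<in> L2 \<omega>" and c: "continuous_on UNIV c" "\<And>s. \<bar>c s\<bar> \<le> C" shows "(\<lambda>s. c s *\<^sub>R f s) \<in> L2 \<omega>"
  using L2_mult[of "\<lambda>s. of_real (c s)" C f \<omega>] assms omega_pos by (simp add: scaleC_of_real continuous_intros)

text \<open>The Stone--Weierstrass theorem on the unit circle extends the vanishing from trigonometric polynomials to all
  continuous test functions.\<close>

lemma zero_coeffs_periodic_test:
  fixes f :: "real \<Rightarrow> 'h::complex_hilbert" and h :: "real \<Rightarrow> real"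
  assumes f: "zero_coeffs f" and h: "continuous_on UNIV h" "h 0 = 0" "h \<omega> = 0"
  shows "(\<lambda>s. h s *\<^sub>R f s) integrable_on {0..\<omega>}" "integral {0..\<omega>} (\<lambda>s. h s *\<^sub>R f s) = 0"
proof -
  have fL2: "f \<in> L2 \<omega>" using f by (simp add: zero_coeffs_def)
  obtain F where F: "continuous_on (sphere 0 1) F" "\<And>s. s \<in> {0..\<omega>} \<Longrightarrow> F (ee 1 s) = h s"
    using continuous_on_circle_function[of h] h continuous_on_subset[OF h(1)] by auto
  have nf: "(\<lambda>s. norm (f s)) integrable_on {0..\<omega>}"
    by (rule square_integrable_imp_norm_integrable(1)[OF L2D(1)[OF fL2] L2D(2)[OF fL2]])
  define K where "K = integral {0..\<omega>} (\<lambda>s. norm (f s))"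
  have K: "K \<ge> 0" unfolding K_def by (rule integral_nonneg[OF nf]) auto
  let ?c = "\<lambda>s. max 0 (min \<omega> s)"
  have clamp: "?c s \<in> {0..\<omega>}" for s using omega_pos by auto
  have cont: "continuous_on UNIV (\<lambda>s. h (?c s))"
    by (rule continuous_on_compose2[OF h(1)]) (auto intro!: continuous_intros)
  have "bounded (h ` {0..\<omega>})" by (intro compact_imp_bounded compact_continuous_image continuous_on_subset[OF h(1)]) auto
  then obtain C where "\<forall>x\<in>h ` {0..\<omega>}. norm x \<le> C" by (auto simp: bounded_iff)
  then have C: "\<And>s. s \<in> {0..\<omega>} \<Longrightarrow> \<bar>h s\<bar> \<le> C" by auto
  have "(\<lambda>s. h (?c s) *\<^sub>R f s) \<in> L2 \<omega>" by (rule L2_mult_real[OF fL2 cont, where C = C]) (use C[OF clamp] in simp)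
  then have "(\<lambda>s. h (?c s) *\<^sub>R f s) integrable_on {0..\<omega>}" by (rule L2_integrable)
  then show hi: "(\<lambda>s. h s *\<^sub>R f s) integrable_on {0..\<omega>}"
    by (rule integrable_eq) auto
  have "norm (integral {0..\<omega>} (\<lambda>s. h s *\<^sub>R f s)) \<le> e" if e: "e > 0" for e
  proof -
    have e': "e / (K + 1) > 0" using e K by simp
    obtain g where g: "real_polynomial_function g" "\<And>z. z \<in> sphere 0 1 \<Longrightarrow> \<bar>F z - g z\<bar> < e / (K + 1)"
      using Stone_Weierstrass_real_polynomial_function[OF compact_sphere F(1) e'] by blast
    have gz: "zero_coeffs (\<lambda>s. g (ee 1 s) *\<^sub>R f s)" by (rule zero_coeffs_polynomial[OF g(1) f])
    then have gL2: "(\<lambda>s. g (ee 1 s) *\<^sub>R f s) \<in> L2 \<omega>" by (simp add: zero_coeffs_def)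
    have "fc (\<lambda>s. g (ee 1 s) *\<^sub>R f s) 0 = 0" using gz by (simp add: zero_coeffs_def)
    then have g0: "integral {0..\<omega>} (\<lambda>s. g (ee 1 s) *\<^sub>R f s) = 0" using omega_pos by (simp add: fc_eq)
    have "integral {0..\<omega>} (\<lambda>s. h s *\<^sub>R f s) = integral {0..\<omega>} (\<lambda>s. h s *\<^sub>R f s - g (ee 1 s) *\<^sub>R f s)"
      using integral_diff[OF hi L2_integrable[OF gL2]] g0 by simp
    also have "norm \<dots> \<le> integral {0..\<omega>} (\<lambda>s. e / (K + 1) * norm (f s))"
    proof (rule integral_norm_bound_integral)
      show "(\<lambda>s. h s *\<^sub>R f s - g (ee 1 s) *\<^sub>R f s) integrable_on {0..\<omega>}"
        by (rule integrable_diff[OF hi L2_integrable[OF gL2]])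
      show "(\<lambda>s. e / (K + 1) * norm (f s)) integrable_on {0..\<omega>}" by (rule integrable_on_mult_right[OF nf])
      fix s assume s: "s \<in> {0..\<omega>}"
      have "\<bar>h s - g (ee 1 s)\<bar> \<le> e / (K + 1)" using g(2)[of "ee 1 s"] F(2)[OF s] by simp
      then show "norm (h s *\<^sub>R f s - g (ee 1 s) *\<^sub>R f s) \<le> e / (K + 1) * norm (f s)"
        by (simp only: scaleR_diff_left[symmetric] norm_scaleR real_norm_def) (rule mult_right_mono, simp_all)
    qed
    also have "\<dots> = e / (K + 1) * K" by (simp add: K_def)
    also have "\<dots> \<le> e" using e K by (simp add: field_simps)
    finally show ?thesis .
  qed
  then have "norm (integral {0..\<omega>} (\<lambda>s. h s *\<^sub>R f s)) \<le> 0" by (rule field_le_epsilon[of _ 0, simplified])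
  then show "integral {0..\<omega>} (\<lambda>s. h s *\<^sub>R f s) = 0" by simp
qed

text \<open>The scalar function \<open>\<psi> = Re \<langle>f, v\<rangle>\<close> is orthogonal to all test functions, among which it can be approximated in
  square mean.\<close>

lemma zero_coeffs_weakly_zero:
  fixes f :: "real \<Rightarrow> 'h::complex_hilbert"
  assumes f: "zero_coeffs f"
  shows "negligible {s \<in> {0..\<omega>}. Re (cinner (f s) v) \<noteq> 0}"
proof -
  let ?I = "{0..\<omega>}"
  have fL2: "f \<in> L2 \<omega>" using f by (simp add: zero_coeffs_def)
  define \<psi> where "\<psi> = (\<lambda>s. Re (cinner (f s) v))"
  have bl: "bounded_linear (\<lambda>u :: 'h. Re (cinner u v))"
    by (rule bounded_linear_compose[OF bounded_linear_Re cinner_cb.bounded_linear_left])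
  have "continuous_on UNIV (\<lambda>p :: 'h \<times> 'h. Re (cinner (fst p) v))"
    by (intro bounded_linear.continuous_on[OF bl] continuous_intros)
  then have m: "\<psi> measurable_on ?I"
    using measurable_on_combine2[OF L2D(1)[OF fL2] L2D(1)[OF fL2], of "\<lambda>p. Re (cinner (fst p) v)"] by (simp add: \<psi>_def)
  have i: "(\<lambda>s. (norm (\<psi> s))\<^sup>2) integrable_on ?I"
  proof (rule integrable_dominated[OF borel_measurable_norm_square[OF m]])
    show "(\<lambda>s. (norm v)\<^sup>2 * (norm (f s))\<^sup>2) integrable_on ?I" by (intro integrable_on_mult_right L2D fL2)
    fix s
    have "norm (\<psi> s) \<le> norm v * norm (f s)"
      using abs_Re_le_cmod[of "cinner (f s) v"] norm_cinner_le[of "f s" v] by (simp add: \<psi>_def mult.commute)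
    then have "(norm (\<psi> s))\<^sup>2 \<le> (norm v * norm (f s))\<^sup>2" by (rule power_mono) simp
    then show "\<bar>(norm (\<psi> s))\<^sup>2\<bar> \<le> (norm v)\<^sup>2 * (norm (f s))\<^sup>2" by (simp add: power_mult_distrib)
  qed
  have "integral ?I (\<lambda>s. (norm (\<psi> s))\<^sup>2) \<le> e" if e: "e > 0" for e
  proof -
    obtain h where h: "continuous_on UNIV h" "h 0 = 0" "h \<omega> = 0"
      "(\<lambda>s. (norm (\<psi> s - h s))\<^sup>2) integrable_on ?I" "integral ?I (\<lambda>s. (norm (\<psi> s - h s))\<^sup>2) < e"
      using continuous_square_approx[OF omega_pos m i e] by blast
    note t = zero_coeffs_periodic_test[OF f h(1-3)]
    have "((\<lambda>s. Re (cinner (h s *\<^sub>R f s) v)) has_integral 0) ?I"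
      using has_integral_linear[OF integrable_integral[OF t(1)] bl] by (simp add: t(2) o_def)
    then have h0: "((\<lambda>s. h s * \<psi> s) has_integral 0) ?I" by (simp add: \<psi>_def cinner_scaleR_left)
    \<comment> \<open>\<open>\<psi>\<^sup>2 \<le> 2 h \<psi> + (\<psi> - h)\<^sup>2\<close> pointwise, and \<open>h \<psi>\<close> integrates to zero.\<close>
    have "((\<lambda>s. 2 * (h s * \<psi> s) + (norm (\<psi> s - h s))\<^sup>2) has_integral (2 * 0 + integral ?I (\<lambda>s. (norm (\<psi> s - h s))\<^sup>2))) ?I"
      by (intro has_integral_add has_integral_mult_right h0 integrable_integral h(4))
    then have "integral ?I (\<lambda>s. (norm (\<psi> s))\<^sup>2) \<le> 2 * 0 + integral ?I (\<lambda>s. (norm (\<psi> s - h s))\<^sup>2)"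
      by (rule has_integral_le[OF integrable_integral[OF i]]) (simp add: power2_eq_square algebra_simps)
    then show ?thesis using h(5) by simp
  qed
  then have "integral ?I (\<lambda>s. (norm (\<psi> s))\<^sup>2) \<le> 0" by (rule field_le_epsilon[of _ 0, simplified])
  then have "negligible {s \<in> ?I. (norm (\<psi> s))\<^sup>2 \<noteq> 0}" by (intro has_integral_zero_negligible[OF i]) auto
  then show ?thesis by (simp add: \<psi>_def)
qed

text \<open>A strongly measurable function is almost everywhere a limit of continuous functions \<open>g n\<close>, so testing
  against the countably many vectors \<open>g n q\<close>, \<open>q\<close> rational, suffices.\<close>

lemma zero_coeffs_imp_zero:
  fixes f :: "real \<Rightarrow> 'h::complex_hilbert"
  assumes f: "zero_coeffs f" shows "L2_eq \<omega> f (\<lambda>s. 0)"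
proof -
  have "f measurable_on {0..\<omega>}" using f by (auto simp: zero_coeffs_def dest: L2D)
  then obtain N g where g: "negligible N" "\<And>n. continuous_on UNIV (g n)"
    "\<And>x. x \<notin> N \<Longrightarrow> (\<lambda>n. g n x) \<longlonglongrightarrow> (if x \<in> {0..\<omega>} then f x else 0)" unfolding measurable_on_def by blast
  define Z where "Z = (\<Union>p\<in>UNIV \<times> \<rat>. {s \<in> {0..\<omega>}. Re (cinner (f s) (g (fst p) (snd p))) \<noteq> 0})"
  have "negligible Z" unfolding Z_def
  proof (rule negligible_countable_Union)
    show "countable ((\<lambda>p. {s \<in> {0..\<omega>}. Re (cinner (f s) (g (fst p) (snd p))) \<noteq> 0}) ` ((UNIV :: nat set) \<times> \<rat>))"
      by (intro countable_image countable_SIGMA countable_rat) auto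
  qed (use zero_coeffs_weakly_zero[OF f] in blast)
  then have NZ: "negligible (N \<union> Z)" using g(1) by simp
  have "f s = 0" if s: "s \<in> {0..\<omega>}" "s \<notin> N \<union> Z" for s
  proof -
    have c: "continuous_on UNIV (\<lambda>t. Re (cinner (f s) (g n t)))" for n
      by (intro continuous_intros bounded_linear.continuous_on[OF cinner_cb.bounded_linear_right] g(2))
    have "Re (cinner (f s) (g n t)) = 0" for n t
    proof -
      have "\<exists>q\<in>\<rat>. t < q \<and> q < t + 1 / real (Suc i)" for i by (rule Rats_dense_in_real) simp
      then obtain q where q: "\<And>i. q i \<in> \<rat>" "\<And>i. t < q i" "\<And>i. q i < t + 1 / real (Suc i)" by metis
      have "(\<lambda>i. t + 1 / real (Suc i)) \<longlonglongrightarrow> t + 0" by (intro tendsto_intros LIMSEQ_Suc lim_1_over_n)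
      then have lim: "(\<lambda>i. t + 1 / real (Suc i)) \<longlonglongrightarrow> t" by simp
      have "q \<longlonglongrightarrow> t"
      proof (rule tendsto_sandwich[OF _ _ tendsto_const lim])
        show "\<forall>\<^sub>F i in sequentially. t \<le> q i" using q(2) by (intro always_eventually allI less_imp_le)
        show "\<forall>\<^sub>F i in sequentially. q i \<le> t + 1 / real (Suc i)" using q(3) by (intro always_eventually allI less_imp_le)
      qed
      then have "(\<lambda>i. Re (cinner (f s) (g n (q i)))) \<longlonglongrightarrow> Re (cinner (f s) (g n t))"
        using c[of n] by (intro isCont_tendsto_compose[of t "\<lambda>t. Re (cinner (f s) (g n t))"]) (auto simp: continuous_on_eq_continuous_at)
      moreover have "Re (cinner (f s) (g n (q i))) = 0" for i
        using s q(1)[of i] unfolding Z_def by fastforce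
      ultimately show ?thesis by (simp add: LIMSEQ_const_iff)
    qed
    moreover have "(\<lambda>n. Re (cinner (f s) (g n s))) \<longlonglongrightarrow> Re (cinner (f s) (f s))"
      using g(3)[of s] s by (intro tendsto_Re cinner_cb.tendsto tendsto_const) auto
    ultimately have "Re (cinner (f s) (f s)) = 0" by (simp add: LIMSEQ_const_iff)
    then show ?thesis by (simp add: cinner_self)
  qed
  then have "{s \<in> {0..\<omega>}. f s \<noteq> 0} \<subseteq> N \<union> Z" by blast
  then show ?thesis unfolding L2_eq_def using negligible_subset[OF NZ] by blast
qed

subsection \<open>The isomorphism with \<open>\<ell>\<^sup>2(\<int>,H)\<close>\<close>

lemma L2_eq_trans:
  assumes "L2_eq \<omega> f g" "L2_eq \<omega> g h" shows "L2_eq \<omega> f h"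
proof -
  have "{s \<in> {0..\<omega>}. f s \<noteq> h s} \<subseteq> {s \<in> {0..\<omega>}. f s \<noteq> g s} \<union> {s \<in> {0..\<omega>}. g s \<noteq> h s}" by auto
  then show ?thesis using negligible_subset[OF negligible_Un] assms unfolding L2_eq_def by blast
qed

lemma hat_cong: "L2_eq \<omega> f g \<Longrightarrow> hat f = hat g"
  unfolding hat_def using fc_cong[of f g] by presburger

lemma hat_add: "f \<in> L2 \<omega> \<Longrightarrow> g \<in> L2 \<omega> \<Longrightarrow> hat (\<lambda>s. f s + g s) = hat f + hat g"
  by (rule ell2_eqI) (simp add: cf_hat L2_add fc_add)
lemma hat_diff: "f \<in> L2 \<omega> \<Longrightarrow> g \<in> L2 \<omega> \<Longrightarrow> hat (\<lambda>s. f s - g s) = hat f - hat g"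
  by (rule ell2_eqI) (simp add: cf_hat L2_diff fc_diff)
lemma hat_scaleC: "f \<in> L2 \<omega> \<Longrightarrow> hat (\<lambda>s. c *\<^sub>C f s) = c *\<^sub>C hat f"
  by (rule ell2_eqI) (simp add: cf_hat L2_scaleC fc_scaleC)
lemma hat_zero: "hat (\<lambda>s. 0) = 0" by (rule ell2_eqI) (simp add: cf_hat)
lemma hat_sum: "(\<And>i. i \<in> F \<Longrightarrow> f i \<in> L2 \<omega>) \<Longrightarrow> hat (\<lambda>s. \<Sum>i\<in>F. f i s) = (\<Sum>i\<in>F. hat (f i))"
  by (induction F rule: infinite_finite_induct) (auto simp: hat_add L2_sum hat_zero)

lemma L2_eq_iff_hat:
  assumes f: "f \<in> L2 \<omega>" and g: "g \<in> L2 \<omega>" shows "L2_eq \<omega> f g \<longleftrightarrow> hat f = hat g"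
proof
  assume "hat f = hat g"
  then have "hat (\<lambda>s. f s - g s) = 0" by (simp add: hat_diff f g)
  then have "zero_coeffs (\<lambda>s. f s - g s)"
    using fun_cong[OF cf_hat(1)[OF L2_diff[OF f g]], symmetric] by (simp add: zero_coeffs_def L2_diff f g)
  from zero_coeffs_imp_zero[OF this] show "L2_eq \<omega> f g" by (simp add: L2_eq_def)
qed (rule hat_cong)

lemma nsq_cong: "L2_eq \<omega> f g \<Longrightarrow> nsq f = nsq g"
  unfolding nsq_def L2_eq_def by (rule integral_spike) auto

lemma parseval: assumes f: "f \<in> L2 \<omega>" shows "nsq f = \<omega> * (norm (hat f))\<^sup>2"
proof -
  obtain g where g: "g \<in> L2 \<omega>" "hat g = hat f" "nsq g = \<omega> * (norm (hat f))\<^sup>2" using riesz_fischer[of "hat f"] by blast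
  then have "L2_eq \<omega> f g" using L2_eq_iff_hat[OF f g(1)] by simp
  then show ?thesis using nsq_cong g(3) by metis
qed

lemma L2_norm_hat: "f \<in> L2 \<omega> \<Longrightarrow> L2_norm \<omega> f = norm (hat f)"
  using omega_pos by (simp add: L2_norm_eq parseval)

text \<open>The real part follows from the norm identity by polarisation, the imaginary part by replacing \<open>g\<close> with \<open>\<i> g\<close>.\<close>

lemma L2_inner_hat:
  assumes f: "f \<in> L2 \<omega>" and g: "g \<in> L2 \<omega>" shows "L2_inner \<omega> f g = cinner (hat f) (hat g)"
proof -
  have re: "Re (L2_inner \<omega> f g) = Re (cinner (hat f) (hat g))" if f: "f \<in> L2 \<omega>" and g: "g \<in> L2 \<omega>" for f g :: "real \<Rightarrow> 'a"
  proof -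
    have "\<omega> * (norm (hat f - hat g))\<^sup>2 = \<omega> * (norm (hat f))\<^sup>2 - 2 * Re (integral {0..\<omega>} (\<lambda>s. cinner (f s) (g s))) + \<omega> * (norm (hat g))\<^sup>2"
      using nsq_diff[OF f g] by (simp add: parseval f g L2_diff hat_diff)
    then have "\<omega> * Re (cinner (hat f) (hat g)) = Re (integral {0..\<omega>} (\<lambda>s. cinner (f s) (g s)))"
      unfolding norm_diff_square by (simp add: algebra_simps)
    then show ?thesis using omega_pos by (simp add: L2_inner_def field_simps)
  qed
  have "L2_inner \<omega> f (\<lambda>s. \<i> *\<^sub>C g s) = - \<i> * L2_inner \<omega> f g"
    using integral_linear[OF inner_integrable[OF f g] bounded_linear_mult_right[of "- \<i>"]]
    by (simp add: L2_inner_def cinner_scaleC_right o_def)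
  then have "Im (L2_inner \<omega> f g) = Im (cinner (hat f) (hat g))"
    using re[OF f L2_scaleC[OF g, of \<i>]] by (simp add: hat_scaleC g cinner_scaleC_right)
  with re[OF f g] show ?thesis by (simp add: complex_eq_iff)
qed

definition synth :: "(int, 'h::complex_hilbert) ell2 \<Rightarrow> real \<Rightarrow> 'h"
  where "synth x = (SOME f. f \<in> L2 \<omega> \<and> hat f = x)"

lemma synth [simp]: "synth x \<in> L2 \<omega>" "hat (synth x) = x"
proof -
  have "\<exists>f. f \<in> L2 \<omega> \<and> hat f = x" using riesz_fischer[of x] by blast
  then have "synth x \<in> L2 \<omega> \<and> hat (synth x) = x" unfolding synth_def by (rule someI_ex)
  then show "synth x \<in> L2 \<omega>" "hat (synth x) = x" by auto
qed

definition lift :: "((int, 'h::complex_hilbert) ell2 \<Rightarrow> (int, 'h) ell2) \<Rightarrow> 'h op"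
  where "lift A f = synth (A (hat f))"

lemma lift [simp]: "lift A f \<in> L2 \<omega>" "hat (lift A f) = A (hat f)" by (simp_all add: lift_def)

definition Esub :: "int set \<Rightarrow> (real \<Rightarrow> 'h::complex_hilbert) set" where "Esub S = {f \<in> L2 \<omega>. hat f \<in> supp S}"

lemma Esub_UNIV: "Esub UNIV = L2 \<omega>" by (simp add: Esub_def)

text \<open>The values of an operator matter only up to almost everywhere equality, so operators are compared with
  maps of sequences through the coefficients of their values.\<close>

definition represents :: "int set \<Rightarrow> 'h::complex_hilbert op \<Rightarrow> ((int, 'h) ell2 \<Rightarrow> (int, 'h) ell2) \<Rightarrow> bool"
  where "represents S X A \<longleftrightarrow> (\<forall>f\<in>Esub S. X f \<in> L2 \<omega> \<and> hat (X f) = A (hat f))"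

lemma represents_lift: "represents S (lift A) A" by (simp add: represents_def)

lemma bounded_opI:
  fixes X :: "'h::complex_hilbert op" and A :: "(int, 'h) ell2 \<Rightarrow> (int, 'h) ell2"
  assumes A: "bounded_linear A" "complex_homogeneous A" "\<And>x. x \<in> supp S \<Longrightarrow> A x \<in> supp S"
    and X: "represents S X A"
  shows "bounded_op \<omega> (Esub S) X"
proof -
  interpret A: bounded_linear A by fact
  obtain K where K: "\<And>x. norm (A x) \<le> norm x * K" using A.bounded by blast
  have XE: "X f \<in> L2 \<omega>" "hat (X f) = A (hat f)" "f \<in> L2 \<omega>" "hat f \<in> supp S" if "f \<in> Esub S" for f
    using X that by (auto simp: represents_def Esub_def)
  have plus: "(\<lambda>s. f s + g s) \<in> Esub S" if "f \<in> Esub S" "g \<in> Esub S" for f g :: "real \<Rightarrow> 'h"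
    using that by (simp add: Esub_def L2_add hat_add supp_add)
  have scale: "(\<lambda>s. c *\<^sub>C f s) \<in> Esub S" if "f \<in> Esub S" for c and f :: "real \<Rightarrow> 'h"
    using that by (simp add: Esub_def L2_scaleC hat_scaleC supp_scaleC)
  show ?thesis unfolding bounded_op_def
  proof (intro conjI ballI allI exI[of _ K])
    fix f :: "real \<Rightarrow> 'h" assume f: "f \<in> Esub S"
    show "X f \<in> Esub S" using XE[OF f] A(3) by (simp add: Esub_def)
    show "L2_norm \<omega> (X f) \<le> K * L2_norm \<omega> f" using K[of "hat f"] XE[OF f] by (simp add: L2_norm_hat mult.commute)
    show "L2_eq \<omega> (X (\<lambda>s. c *\<^sub>C f s)) (\<lambda>s. c *\<^sub>C X f s)" for c
      using XE[OF f] XE[OF scale[OF f, of c]] complex_homogeneousD[OF A(2)]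
      by (subst L2_eq_iff_hat) (simp_all add: L2_scaleC hat_scaleC)
    fix g :: "real \<Rightarrow> 'h" assume g: "g \<in> Esub S"
    show "L2_eq \<omega> (X (\<lambda>s. f s + g s)) (\<lambda>s. X f s + X g s)"
      using XE[OF f] XE[OF g] XE[OF plus[OF f g]] by (subst L2_eq_iff_hat) (simp_all add: L2_add hat_add A.add)
  qed
qed

text \<open>A bounded operator respects almost everywhere equality, since it maps null functions to null functions; hence it
  induces a map of Fourier coefficients.  Precomposition with \<open>pr S\<close> extends this map to the whole sequence space.\<close>

lemma bounded_opE:
  assumes R: "bounded_op \<omega> (Esub S) (R :: 'h::complex_hilbert op)"
  obtains A where "bounded_linear A" "complex_homogeneous A" "\<And>x. A x \<in> supp S" "represents S R A"
proof -
  have RE: "R f \<in> L2 \<omega>" "hat (R f) \<in> supp S" if "f \<in> Esub S" for f using R that by (auto simp: bounded_op_def Esub_def)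
  obtain C where C: "\<And>f. f \<in> Esub S \<Longrightarrow> L2_norm \<omega> (R f) \<le> C * L2_norm \<omega> f" using R unfolding bounded_op_def by blast
  have plus: "(\<lambda>s. f s + g s) \<in> Esub S" if "f \<in> Esub S" "g \<in> Esub S" for f g :: "real \<Rightarrow> 'h"
    using that by (simp add: Esub_def L2_add hat_add supp_add)
  have scale: "(\<lambda>s. c *\<^sub>C f s) \<in> Esub S" if "f \<in> Esub S" for c and f :: "real \<Rightarrow> 'h"
    using that by (simp add: Esub_def L2_scaleC hat_scaleC supp_scaleC)
  have minus: "(\<lambda>s. f s - g s) \<in> Esub S" if "f \<in> Esub S" "g \<in> Esub S" for f g :: "real \<Rightarrow> 'h"
    using that by (simp add: Esub_def L2_diff hat_diff supp_diff)
  have Radd: "hat (R (\<lambda>s. f s + g s)) = hat (R f) + hat (R g)" if "f \<in> Esub S" "g \<in> Esub S" for f g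
  proof -
    have "L2_eq \<omega> (R (\<lambda>s. f s + g s)) (\<lambda>s. R f s + R g s)" using R that by (auto simp: bounded_op_def)
    from hat_cong[OF this] show ?thesis using RE that by (simp add: hat_add)
  qed
  have Rscale: "hat (R (\<lambda>s. c *\<^sub>C f s)) = c *\<^sub>C hat (R f)" if "f \<in> Esub S" for c f
  proof -
    have "L2_eq \<omega> (R (\<lambda>s. c *\<^sub>C f s)) (\<lambda>s. c *\<^sub>C R f s)" using R that by (auto simp: bounded_op_def)
    from hat_cong[OF this] show ?thesis using RE that by (simp add: hat_scaleC)
  qed
  have Rcong: "hat (R f) = hat (R g)" if f: "f \<in> Esub S" and g: "g \<in> Esub S" and fg: "hat f = hat g" for f g
  proof -
    let ?d = "\<lambda>s. f s - g s"
    have d: "?d \<in> Esub S" by (rule minus[OF f g])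
    have "hat ?d = 0" using f g fg by (simp add: Esub_def hat_diff)
    then have "L2_norm \<omega> (R ?d) \<le> 0" using C[OF d] d by (simp add: L2_norm_hat Esub_def)
    then have "hat (R ?d) = 0" using RE[OF d] by (simp add: L2_norm_hat)
    then show ?thesis using Radd[OF g d] by simp
  qed
  define A where "A = (\<lambda>x. hat (R (synth (pr S x))))"
  have E: "synth (pr S x) \<in> Esub S" for x by (simp add: Esub_def)
  have rep: "hat (R f) = A (hat f)" if f: "f \<in> Esub S" for f
    unfolding A_def by (rule Rcong[OF f E]) (use f in \<open>simp add: Esub_def pr_supp\<close>)
  have Ahom: "A (c *\<^sub>C x) = c *\<^sub>C A x" for c x
  proof -
    have "A (c *\<^sub>C x) = hat (R (\<lambda>s. c *\<^sub>C synth (pr S x) s))"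
      unfolding A_def by (rule Rcong[OF E scale[OF E]]) (auto intro!: ell2_eqI simp: hat_scaleC)
    then show ?thesis by (simp add: Rscale[OF E] A_def)
  qed
  have Abd: "norm (A x) \<le> norm x * \<bar>C\<bar>" for x
  proof -
    have "norm (A x) \<le> C * norm (pr S x)" using C[OF E, of x] RE[OF E, of x] by (simp add: A_def L2_norm_hat)
    also have "\<dots> \<le> \<bar>C\<bar> * norm x"
      by (intro mult_mono norm_ell2_mono) auto
    finally show ?thesis by (simp add: mult.commute)
  qed
  have "bounded_linear A"
  proof (rule bounded_linear_intro[OF _ _ Abd])
    fix x y and c :: real
    have "A (x + y) = hat (R (\<lambda>s. synth (pr S x) s + synth (pr S y) s))"
      unfolding A_def by (rule Rcong[OF E plus[OF E E]]) (auto intro!: ell2_eqI simp: hat_add)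
    then show "A (x + y) = A x + A y" by (simp add: Radd[OF E E] A_def)
    show "A (c *\<^sub>R x) = c *\<^sub>R A x" using Ahom[of "of_real c" x] by (simp add: scaleC_of_real)
  qed
  then show ?thesis
    using that[of A] Ahom RE(2)[OF E] rep RE(1) by (auto simp: complex_homogeneous_def represents_def A_def)
qed

definition lift_graph :: "((int, 'h::complex_hilbert) ell2 \<times> (int, 'h) ell2) set \<Rightarrow> 'h graph"
  where "lift_graph g = {(x, z). x \<in> L2 \<omega> \<and> z \<in> L2 \<omega> \<and> (hat x, hat z) \<in> g}"

lemma is_resolvent_lift:
  fixes A :: "(int, 'h::complex_hilbert) ell2 \<Rightarrow> (int, 'h) ell2"
  assumes A: "gres S g z A"
  shows "is_resolvent \<omega> (Esub S) (restriction (lift_graph g) (Esub S)) z (lift A)"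
  unfolding is_resolvent_def
proof (intro conjI ballI)
  show "bounded_op \<omega> (Esub S) (lift A)"
    by (rule bounded_opI[OF _ _ _ represents_lift]) (use A in \<open>auto simp: gres_def\<close>)
  fix f :: "real \<Rightarrow> 'h" assume "f \<in> Esub S"
  then have f: "f \<in> L2 \<omega>" "hat f \<in> supp S" by (auto simp: Esub_def)
  have "A (hat f) \<in> supp S" "(A (hat f), z *\<^sub>C A (hat f) - hat f) \<in> g" using A f by (auto simp: gres_def)
  then show "(lift A f, \<lambda>s. z *\<^sub>C lift A f s - f s) \<in> restriction (lift_graph g) (Esub S)"
    using f by (simp add: restriction_def lift_graph_def Esub_def L2_diff L2_scaleC hat_diff hat_scaleC supp_diff supp_scaleC)
next
  fix p assume p: "p \<in> restriction (lift_graph g) (Esub S)"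
  obtain x y where xy: "p = (x, y)" by (cases p)
  have h: "x \<in> L2 \<omega>" "y \<in> L2 \<omega>" "(hat x, hat y) \<in> g" "hat x \<in> supp S" "hat y \<in> supp S"
    using p by (auto simp: xy restriction_def lift_graph_def Esub_def)
  then have "L2_eq \<omega> (lift A (\<lambda>s. z *\<^sub>C x s - y s)) x"
    using gresD[OF A h(3-5)] by (simp add: L2_eq_iff_hat L2_diff L2_scaleC hat_diff hat_scaleC)
  then show "case p of (x, y) \<Rightarrow> L2_eq \<omega> (lift A (\<lambda>s. z *\<^sub>C x s - y s)) x" by (simp add: xy)
qed

lemma gres_of_resolvent:
  fixes R :: "'h::complex_hilbert op"
  assumes R: "is_resolvent \<omega> (Esub S) (restriction (lift_graph g) (Esub S)) z R"
  shows "\<exists>A. gres S g z A"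
proof -
  obtain A where A: "bounded_linear A" "complex_homogeneous A" "\<And>x. A x \<in> supp S" "represents S R A"
    using R unfolding is_resolvent_def by (elim conjE) (rule bounded_opE, assumption, blast)
  have E: "synth x \<in> Esub S" if "x \<in> supp S" for x :: "(int, 'h) ell2" using that by (simp add: Esub_def)
  have "gres S g z A" unfolding gres_def
  proof (intro conjI ballI)
    fix x :: "(int, 'h) ell2" assume x: "x \<in> supp S"
    have "(R (synth x), \<lambda>s. z *\<^sub>C R (synth x) s - synth x s) \<in> restriction (lift_graph g) (Esub S)"
      using R E[OF x] unfolding is_resolvent_def by blast
    then have "(hat (R (synth x)), hat (\<lambda>s. z *\<^sub>C R (synth x) s - synth x s)) \<in> g" by (simp add: restriction_def lift_graph_def)
    then show "(A x, z *\<^sub>C A x - x) \<in> g"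
      using A(4) E[OF x] by (simp add: represents_def hat_diff hat_scaleC L2_scaleC)
  next
    fix p assume p: "p \<in> g"
    obtain x y where xy: "p = (x, y)" by (cases p)
    have "A (z *\<^sub>C x - y) = x" if s: "x \<in> supp S" "y \<in> supp S"
    proof -
      have "(synth x, synth y) \<in> restriction (lift_graph g) (Esub S)"
        using p E[OF s(1)] E[OF s(2)] by (simp add: xy restriction_def lift_graph_def)
      then have "L2_eq \<omega> (R (\<lambda>s. z *\<^sub>C synth x s - synth y s)) (synth x)"
        using R unfolding is_resolvent_def by blast
      from hat_cong[OF this] have "hat (R (\<lambda>s. z *\<^sub>C synth x s - synth y s)) = x" by simp
      moreover have "(\<lambda>s. z *\<^sub>C synth x s - synth y s) \<in> Esub S"
        using s by (simp add: Esub_def L2_diff L2_scaleC hat_diff hat_scaleC supp_diff supp_scaleC)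
      ultimately show ?thesis using A(4) by (simp add: represents_def hat_diff hat_scaleC L2_scaleC)
    qed
    then show "case p of (x, y) \<Rightarrow> x \<in> supp S \<longrightarrow> y \<in> supp S \<longrightarrow> A (z *\<^sub>C x - y) = x" by (simp add: xy)
  qed (use A in auto)
  then show ?thesis by blast
qed

lemma spectrum_restriction: "spectrum \<omega> (Esub S) (restriction (lift_graph g) (Esub S)) = gspec S g"
  unfolding spectrum_def gspec_def using is_resolvent_lift gres_of_resolvent by blast

lemma restriction_L2: "restriction (lift_graph g) (L2 \<omega>) = lift_graph g"
  by (auto simp: restriction_def lift_graph_def)

lemma spectrum_L2: "spectrum \<omega> (L2 \<omega>) (lift_graph g) = gspec UNIV g"
  using spectrum_restriction[of UNIV g] by (simp add: Esub_UNIV restriction_L2)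

subsection \<open>Fourier projections and the norm of \<open>\<SS>\<^sub>2\<close>\<close>

lemma P_one_eq: "P_one \<omega> l f = (\<lambda>s. ee l s *\<^sub>C fc f l)" by (simp add: P_one_def ee_def)

lemma P_one:
  assumes f: "f \<in> L2 \<omega>" shows "P_one \<omega> l f \<in> L2 \<omega>" "hat (P_one \<omega> l f) = pr {l} (hat f)"
proof -
  show *: "P_one \<omega> l f \<in> L2 \<omega>" unfolding P_one_eq by (intro L2_ee L2_continuous continuous_intros)
  show "hat (P_one \<omega> l f) = pr {l} (hat f)"
    by (rule ell2_eqI) (use * in \<open>auto simp: cf_hat f P_one_eq fc_ee fc_const\<close>)
qed

lemma P_upto:
  assumes f: "f \<in> L2 \<omega>" shows "P_upto \<omega> m f \<in> L2 \<omega>" "hat (P_upto \<omega> m f) = pr {l. \<bar>l\<bar> \<le> int m} (hat f)"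
proof -
  have fin: "finite {l. \<bar>l\<bar> \<le> int m}" by (rule finite_subset[of _ "{- int m..int m}"]) auto
  show *: "P_upto \<omega> m f \<in> L2 \<omega>" unfolding P_upto_def by (intro L2_sum P_one f)
  have "hat (P_upto \<omega> m f) = (\<Sum>l\<in>{l. \<bar>l\<bar> \<le> int m}. pr {l} (hat f))"
    unfolding P_upto_def by (subst hat_sum) (auto simp: P_one f)
  also have "\<dots> = pr {l. \<bar>l\<bar> \<le> int m} (hat f)" by (rule sum_pr_singletons[OF fin])
  finally show "hat (P_upto \<omega> m f) = pr {l. \<bar>l\<bar> \<le> int m} (hat f)" .
qed

lemma L2_image_projection:
  fixes P :: "'h::complex_hilbert op"
  assumes P: "\<And>f. f \<in> L2 \<omega> \<Longrightarrow> P f \<in> L2 \<omega>" "\<And>f. f \<in> L2 \<omega> \<Longrightarrow> hat (P f) = pr S (hat f)"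
  shows "L2_image \<omega> P (L2 \<omega>) = Esub S"
proof
  show "L2_image \<omega> P (L2 \<omega>) \<subseteq> Esub S"
  proof
    fix f :: "real \<Rightarrow> 'h" assume "f \<in> L2_image \<omega> P (L2 \<omega>)"
    then obtain x where x: "f \<in> L2 \<omega>" "x \<in> L2 \<omega>" "L2_eq \<omega> f (P x)" by (auto simp: L2_image_def)
    then show "f \<in> Esub S" using hat_cong[OF x(3)] by (simp add: Esub_def P)
  qed
  show "Esub S \<subseteq> L2_image \<omega> P (L2 \<omega>)"
  proof
    fix f :: "real \<Rightarrow> 'h" assume "f \<in> Esub S"
    then have f: "f \<in> L2 \<omega>" "hat f \<in> supp S" by (auto simp: Esub_def)
    then have "L2_eq \<omega> f (P f)" by (simp add: L2_eq_iff_hat P pr_supp)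
    then show "f \<in> L2_image \<omega> P (L2 \<omega>)" using f by (auto simp: L2_image_def)
  qed
qed

lemma H_sub_eq: "H_sub \<omega> l = Esub {l}"
  unfolding H_sub_def by (rule L2_image_projection) (auto simp: P_one)
lemma H_upto_eq: "H_upto \<omega> m = Esub {l. \<bar>l\<bar> \<le> int m}"
  unfolding H_upto_def by (rule L2_image_projection) (auto simp: P_upto)

lemma pr_singleton: "pr {l} x = single l (cf x l)"
  by (rule ell2_eqI) (simp add: cf_single)

lemma norm_single: "norm (single l h) \<le> norm h"
proof (rule norm_ell2_leI)
  fix F :: "'a set" assume F: "finite F"
  have "(\<Sum>i\<in>F. (norm (cf (single l h) i))\<^sup>2) = (\<Sum>i\<in>F. if i = l then (norm h)\<^sup>2 else 0)"
    by (rule sum.cong) (auto simp: cf_single)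
  then show "L2_set (\<lambda>i. norm (cf (single l h) i)) F \<le> norm h" using F by (simp add: L2_set_def sum.delta)
qed

lemma op_norm_block:
  assumes X: "represents UNIV X (mv M)"
  shows "0 \<le> op_norm \<omega> (P_one \<omega> j \<circ> X \<circ> P_one \<omega> l)" "op_norm \<omega> (P_one \<omega> j \<circ> X \<circ> P_one \<omega> l) \<le> norm (cf M (j, l))"
proof -
  let ?Y = "P_one \<omega> j \<circ> X \<circ> P_one \<omega> l"
  have X': "X f \<in> L2 \<omega>" "hat (X f) = mv M (hat f)" if "f \<in> L2 \<omega>" for f using X that by (auto simp: represents_def Esub_UNIV)
  have le: "L2_norm \<omega> (?Y f) \<le> norm (cf M (j, l))" if f: "f \<in> {f \<in> L2 \<omega>. L2_norm \<omega> f \<le> 1}" for f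
  proof -
    have fL: "f \<in> L2 \<omega>" "norm (hat f) \<le> 1" using f by (auto simp: L2_norm_hat)
    have "L2_norm \<omega> (?Y f) = norm (pr {j} (mv M (pr {l} (hat f))))"
      by (simp add: L2_norm_hat P_one X' fL)
    also have "\<dots> \<le> norm (cf M (j, l) (cf (hat f) l))"
      unfolding pr_singleton cf_mv_single by (rule norm_single)
    also have "\<dots> \<le> norm (cf M (j, l)) * 1"
      by (rule order_trans[OF norm_blinfun]) (intro mult_left_mono order_trans[OF norm_cf_le fL(2)], simp)
    finally show ?thesis by simp
  qed
  have z: "(\<lambda>s. 0) \<in> {f \<in> L2 \<omega>. L2_norm \<omega> f \<le> 1}" by (simp add: L2_norm_hat hat_zero)
  show "op_norm \<omega> ?Y \<le> norm (cf M (j, l))" unfolding op_norm_def by (rule cSUP_least) (use z le in blast)+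
  have "0 \<le> L2_norm \<omega> (?Y (\<lambda>s. 0))" by (simp add: L2_norm_hat P_one X')
  also have "\<dots> \<le> op_norm \<omega> ?Y"
    unfolding op_norm_def by (rule cSUP_upper[OF z bdd_aboveI2[OF le]])
  finally show "0 \<le> op_norm \<omega> ?Y" .
qed

text \<open>The blocks of \<open>X\<close> with respect to the Fourier projections are the entries of \<open>M\<close>.\<close>

lemma S2_matrix:
  assumes M: "clinear_matrix M" and X: "represents UNIV X (mv M)"
  shows "X \<in> S2 \<omega>" "S2_norm \<omega> X \<le> norm M"
proof -
  let ?o = "\<lambda>(j, l). (op_norm \<omega> (P_one \<omega> j \<circ> X \<circ> P_one \<omega> l))\<^sup>2"
  have le: "?o p \<le> (norm (cf M p))\<^sup>2" for p
    by (cases p) (auto intro!: power_mono op_norm_block X)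
  have s: "?o summable_on UNIV" by (rule summable_on_comparison_test[OF cf_square_summable[of M] le]) auto
  have "bounded_op \<omega> (Esub UNIV) X"
    by (rule bounded_opI[OF mv.bounded_linear_right _ _ X]) (use M clinear_matrix_iff in auto)
  then show "X \<in> S2 \<omega>" using s by (simp add: S2_def Esub_UNIV)
  have "infsum ?o UNIV \<le> (norm M)\<^sup>2"
    unfolding norm_ell2_square by (intro infsum_mono s cf_square_summable le)
  then show "S2_norm \<omega> X \<le> norm M" unfolding S2_norm_def by (intro real_le_lsqrt) (auto intro!: infsum_nonneg)
qed

end

section \<open>Absolutely convergent Fourier series and the Sobolev space\<close>

context l2_interval begin

lemma partial_sums_converge:
  assumes f: "f \<in> L2 \<omega>" shows "(\<lambda>N. nsq (\<lambda>s. f s - trig (pN N) (fc f) s)) \<longlonglongrightarrow> 0"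
proof -
  obtain g where g: "g \<in> L2 \<omega>" "hat g = hat f" "(\<lambda>N. nsq (\<lambda>s. g s - trig (pN N) (cf (hat f)) s)) \<longlonglongrightarrow> 0"
    using riesz_fischer[of "hat f"] by blast
  have fg: "L2_eq \<omega> f g" using g f by (simp add: L2_eq_iff_hat)
  have "nsq (\<lambda>s. g s - trig (pN N) (cf (hat f)) s) = nsq (\<lambda>s. f s - trig (pN N) (fc f) s)" for N
  proof (rule nsq_cong)
    have "{s \<in> {0..\<omega>}. g s - trig (pN N) (cf (hat f)) s \<noteq> f s - trig (pN N) (fc f) s} = {s \<in> {0..\<omega>}. f s \<noteq> g s}"
      by (auto simp: cf_hat(1)[OF f])
    then show "L2_eq \<omega> (\<lambda>s. g s - trig (pN N) (cf (hat f)) s) (\<lambda>s. f s - trig (pN N) (fc f) s)"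
      using fg by (simp only: L2_eq_def)
  qed
  then show ?thesis using g(3) by simp
qed

text \<open>Fourier series may be integrated term by term: the mean of \<open>\<parallel>f - S\<^sub>N\<parallel>\<close> is controlled by its square mean.\<close>

lemma integral_fourier_series:
  fixes f :: "real \<Rightarrow> 'h::complex_hilbert"
  assumes f: "f \<in> L2 \<omega>" and t: "t \<in> {0..\<omega>}"
  shows "(\<lambda>N. \<Sum>n\<in>pN N. integral {0..t} (ee n) *\<^sub>C fc f n) \<longlonglongrightarrow> integral {0..t} f"
proof (rule LIMSEQ_I)
  fix e :: real assume e: "e > 0"
  define \<eta> where "\<eta> = e / \<omega>"
  have \<eta>: "\<eta> > 0" using e omega_pos by (simp add: \<eta>_def)
  have "\<forall>\<^sub>F N in sequentially. nsq (\<lambda>s. f s - trig (pN N) (fc f) s) < e * \<eta>"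
    by (rule order_tendstoD(2)[OF partial_sums_converge[OF f]]) (use e \<eta> in simp)
  then obtain N0 where N0: "\<And>N. N \<ge> N0 \<Longrightarrow> nsq (\<lambda>s. f s - trig (pN N) (fc f) s) < e * \<eta>"
    by (auto simp: eventually_sequentially)
  have "norm ((\<Sum>n\<in>pN N. integral {0..t} (ee n) *\<^sub>C fc f n) - integral {0..t} f) < e" if N: "N \<ge> N0" for N
  proof -
    let ?S = "trig (pN N) (fc f)"
    let ?d = "\<lambda>s. f s - ?S s"
    have d: "?d \<in> L2 \<omega>" by (rule L2_diff[OF f L2_trig])
    have sub: "{0..t} \<subseteq> {0..\<omega>}" using t by auto
    have ee: "(ee n has_integral integral {0..t} (ee n)) {0..t}" for n
      by (rule integrable_integral[OF integrable_continuous_real[OF continuous_ee]])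
    have summand: "((\<lambda>s. ee n s *\<^sub>C fc f n) has_integral (integral {0..t} (ee n) *\<^sub>C fc f n)) {0..t}" for n
      using has_integral_linear[OF ee scaleC.bounded_linear_left[of "fc f n"]] by (simp add: o_def)
    have S: "(?S has_integral (\<Sum>n\<in>pN N. integral {0..t} (ee n) *\<^sub>C fc f n)) {0..t}"
      unfolding trig_def[abs_def] by (intro has_integral_sum summand) auto
    have fi: "f integrable_on {0..t}" by (rule integrable_on_subinterval[OF L2_integrable[OF f] sub])
    have nd: "(\<lambda>s. norm (?d s)) integrable_on {0..\<omega>}"
      by (rule square_integrable_imp_norm_integrable(1)[OF L2D(1)[OF d] L2D(2)[OF d]])
    have "(?d has_integral (integral {0..t} f - (\<Sum>n\<in>pN N. integral {0..t} (ee n) *\<^sub>C fc f n))) {0..t}"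
      by (intro has_integral_diff S integrable_integral fi)
    then have "integral {0..t} ?d = integral {0..t} f - (\<Sum>n\<in>pN N. integral {0..t} (ee n) *\<^sub>C fc f n)" "?d integrable_on {0..t}"
      by (auto intro: integral_unique)
    then have "norm ((\<Sum>n\<in>pN N. integral {0..t} (ee n) *\<^sub>C fc f n) - integral {0..t} f) = norm (integral {0..t} ?d)"
      by (simp add: norm_minus_commute)
    also have "\<dots> \<le> integral {0..t} (\<lambda>s. norm (?d s))"
      by (rule integral_norm_bound_integral[OF \<open>?d integrable_on {0..t}\<close> integrable_on_subinterval[OF nd sub]]) simp
    also have "\<dots> \<le> integral {0..\<omega>} (\<lambda>s. norm (?d s))"
      by (intro integral_subset_le sub nd integrable_on_subinterval[OF nd sub]) auto
    also have "\<dots> \<le> (\<eta> * (\<omega> - 0) + integral {0..\<omega>} (\<lambda>s. (norm (?d s))\<^sup>2) / \<eta>) / 2"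
      by (rule square_integrable_imp_norm_integrable(2)[OF L2D(1)[OF d] L2D(2)[OF d] \<eta>]) (use omega_pos in simp)
    also have "\<dots> < (e + e) / 2"
    proof -
      have "nsq ?d / \<eta> < e" using N0[OF N] \<eta> by (simp add: pos_divide_less_eq)
      then show ?thesis using omega_pos by (simp add: \<eta>_def nsq_def)
    qed
    finally show ?thesis by simp
  qed
  then show "\<exists>N0. \<forall>N\<ge>N0. norm ((\<Sum>n\<in>pN N. integral {0..t} (ee n) *\<^sub>C fc f n) - integral {0..t} f) < e" by blast
qed

definition ser :: "(int, 'h::complex_hilbert) ell2 \<Rightarrow> real \<Rightarrow> 'h" where "ser x s = (\<Sum>\<^sub>\<infinity>n. ee n s *\<^sub>C cf x n)"

lemma ser_uniform:
  assumes "(\<lambda>n. norm (cf x n)) summable_on UNIV"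
  shows "uniform_limit UNIV (\<lambda>F. trig F (cf x)) (ser x) (finite_subsets_at_top UNIV)"
  using Weierstrass_m_test_general[of UNIV UNIV "\<lambda>n s. ee n s *\<^sub>C cf x n", OF _ assms]
  by (simp add: norm_scaleC trig_def[abs_def] ser_def[abs_def])

lemma continuous_ser:
  assumes "(\<lambda>n. norm (cf x n)) summable_on UNIV" shows "continuous_on UNIV (ser x)"
  by (rule uniform_limit_theorem[OF _ ser_uniform[OF assms]]) (auto intro!: always_eventually continuous_trig)

lemma ser_partial_sums:
  assumes "(\<lambda>n. norm (cf x n)) summable_on UNIV"
  shows "(\<lambda>N. trig (pN N) (cf x) s) \<longlonglongrightarrow> ser x s"
proof -
  have "((\<lambda>n. ee n s *\<^sub>C cf x n) has_sum ser x s) UNIV"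
    using tendsto_uniform_limitI[OF ser_uniform[OF assms], of s] by (simp add: has_sum_def trig_def)
  from has_sum_symmetric_partial_sums[OF this] show ?thesis by (simp add: trig_def)
qed

lemma hat_ser:
  assumes x: "(\<lambda>n. norm (cf x n)) summable_on UNIV" shows "ser x \<in> L2 \<omega>" "hat (ser x) = x"
proof -
  show L: "ser x \<in> L2 \<omega>" by (rule L2_continuous[OF continuous_ser[OF x]])
  show "hat (ser x) = x"
  proof (rule ell2_eqI)
    fix m
    have "norm (fc (ser x) m - cf x m) \<le> e" if e: "e > 0" for e
    proof -
      have "\<forall>\<^sub>F F in finite_subsets_at_top UNIV. \<forall>s\<in>UNIV. dist (trig F (cf x) s) (ser x s) < e"
        using ser_uniform[OF x] e by (simp add: uniform_limit_iff)
      then obtain F0 where F0: "finite F0" "\<And>F s. finite F \<Longrightarrow> F0 \<subseteq> F \<Longrightarrow> dist (trig F (cf x) s) (ser x s) < e"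
        unfolding eventually_finite_subsets_at_top by auto
      let ?F = "insert m F0"
      let ?d = "\<lambda>s. ser x s - trig ?F (cf x) s"
      have d: "?d \<in> L2 \<omega>" by (rule L2_diff[OF L L2_trig])
      have bd: "(norm (?d s))\<^sup>2 \<le> e\<^sup>2" for s
      proof (rule power_mono)
        have "F0 \<subseteq> ?F" by auto
          then show "norm (?d s) \<le> e" using F0(2)[of ?F s] F0(1) by (simp add: subset_insertI dist_norm norm_minus_commute)
      qed simp
      have "nsq ?d \<le> integral {0..\<omega>} (\<lambda>s. e\<^sup>2)"
        unfolding nsq_def by (rule integral_le[OF L2D(2)[OF d]]) (use bd in auto)
      then have "nsq ?d / \<omega> \<le> e\<^sup>2" using omega_pos by (simp add: divide_le_eq mult.commute)
      then have "(norm (fc ?d m))\<^sup>2 \<le> e\<^sup>2" using fc_le[OF d, of m] by linarith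
      then have "norm (fc ?d m) \<le> e" by (rule power2_le_imp_le) (use e in simp)
      then show ?thesis using F0(1) by (simp add: fc_diff[OF L] fc_trig)
    qed
    then have "norm (fc (ser x) m - cf x m) \<le> 0" by (rule field_le_epsilon[of _ 0, simplified])
    then show "cf (hat (ser x)) m = cf x m" by (simp add: cf_hat(1)[OF L])
  qed
qed

text \<open>\<open>\<parallel>x\<^sub>n\<parallel> = (1 / |\<lambda>\<^sub>n|) (|\<lambda>\<^sub>n| \<parallel>x\<^sub>n\<parallel>)\<close> is a product of two square-summable families.\<close>

lemma in_dom_abs_summable:
  assumes "in_dom r0 x" shows "(\<lambda>n. norm (cf x n)) summable_on UNIV"
proof -
  have "(\<lambda>n. norm (cf x n)) summable_on (UNIV - {0})"
  proof (rule summable_on_comparison_test)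
    have "(\<lambda>n. (1 / real_of_int n)\<^sup>2 * (1 / r0)\<^sup>2 + (norm ((\<i> * of_real (lam r0 n)) *\<^sub>C cf x n))\<^sup>2) summable_on UNIV"
      using assms summable_inverse_square_int unfolding in_dom_def by (intro summable_on_add summable_on_cmult_left) (auto simp: power_divide)
    then show "(\<lambda>n. (1 / real_of_int n)\<^sup>2 * (1 / r0)\<^sup>2 + (norm ((\<i> * of_real (lam r0 n)) *\<^sub>C cf x n))\<^sup>2) summable_on UNIV - {0}"
      by (rule summable_on_subset_banach) simp
    fix n :: int assume n: "n \<in> UNIV - {0}"
    define a where "a = \<bar>1 / (r0 * of_int n)\<bar>"
    define b where "b = \<bar>r0 * of_int n\<bar> * norm (cf x n)"
    have ab: "a * b = norm (cf x n)" using n omega_pos by (simp add: a_def b_def abs_mult)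
    have a2: "a\<^sup>2 = (1 / real_of_int n)\<^sup>2 * (1 / r0)\<^sup>2" by (simp add: a_def power_mult_distrib power_divide)
    have b2: "b = norm ((\<i> * of_real (lam r0 n)) *\<^sub>C cf x n)" unfolding b_def norm_scaleC norm_mult norm_of_real lam_def by simp
    have "0 \<le> (a - b)\<^sup>2" by simp
    then have "a * b + a * b \<le> a\<^sup>2 + b\<^sup>2" by (simp add: power2_eq_square algebra_simps)
    moreover have "a * b \<ge> 0" by (simp add: a_def b_def)
    ultimately have "norm (cf x n) \<le> a\<^sup>2 + b\<^sup>2" using ab by linarith
    then show "norm (cf x n) \<le> (1 / real_of_int n)\<^sup>2 * (1 / r0)\<^sup>2 + (norm ((\<i> * of_real (lam r0 n)) *\<^sub>C cf x n))\<^sup>2"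
      by (simp only: a2 b2)
  qed simp
  then have "(\<lambda>n. norm (cf x n)) summable_on insert 0 (UNIV - {0})" by (subst summable_on_insert_iff)
  then show ?thesis by (simp add: insert_absorb)
qed

lemma L2_eq_pointwise: "(\<And>s. s \<in> {0..\<omega>} \<Longrightarrow> f s = g s) \<Longrightarrow> L2_eq \<omega> f g"
  unfolding L2_eq_def by (rule negligible_subset[of "{}"]) auto

lemma integral_ee_lam:
  assumes "0 \<le> t" shows "integral {0..t} (ee n) * (\<i> * of_real (lam r0 n)) = (if n = 0 then 0 else ee n t - 1)"
  using integral_unique[OF has_integral_ee[OF assms, of n]] r0_pos by (auto simp: lam_def)

text \<open>Integrating the Fourier series of \<open>y'\<close> term by term, the factor \<open>i \<lambda>\<^sub>n\<close> cancels against the integral of the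
  exponential.\<close>

lemma W21_of_in_dom:
  fixes x :: "(int, 'h::complex_hilbert) ell2"
  assumes x: "in_dom r0 x" and y': "y' \<in> L2 \<omega>" "\<And>j. cf (hat y') j = (\<i> * of_real (lam r0 j)) *\<^sub>C cf x j"
  shows "W21 \<omega> (ser x) y'" "ser x 0 = ser x \<omega>"
proof -
  note ax = in_dom_abs_summable[OF x]
  have fc: "fc y' j = (\<i> * of_real (lam r0 j)) *\<^sub>C cf x j" for j using y'(2)[of j] by (simp add: cf_hat(1)[OF y'(1)])
  show "ser x 0 = ser x \<omega>" by (simp add: ser_def)
  have "(y' has_integral (ser x t - ser x 0)) {0..t}" if t: "t \<in> {0..\<omega>}" for t
  proof -
    have "(\<Sum>n\<in>pN N. integral {0..t} (ee n) *\<^sub>C fc y' n) = trig (pN N) (cf x) t - trig (pN N) (cf x) 0" for N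
      using t unfolding trig_def sum_subtractf[symmetric]
      by (intro sum.cong) (auto simp: fc scaleC_scaleC integral_ee_lam scaleC.diff_left)
    then have "(\<lambda>N. trig (pN N) (cf x) t - trig (pN N) (cf x) 0) \<longlonglongrightarrow> integral {0..t} y'"
      using integral_fourier_series[OF y'(1) t] by simp
    moreover have "(\<lambda>N. trig (pN N) (cf x) t - trig (pN N) (cf x) 0) \<longlonglongrightarrow> ser x t - ser x 0"
      by (intro tendsto_diff ser_partial_sums ax)
    ultimately have "integral {0..t} y' = ser x t - ser x 0" by (rule LIMSEQ_unique)
    moreover have "y' integrable_on {0..t}"
      by (rule integrable_on_subinterval[OF L2_integrable[OF y'(1)]]) (use t in auto)
    ultimately show ?thesis using integrable_integral by fastforce
  qed
  then show "W21 \<omega> (ser x) y'" using y'(1) continuous_on_subset[OF continuous_ser[OF ax]] by (simp add: W21_def)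
qed

text \<open>The periodicity of \<open>y\<close> makes the mean value of \<open>y'\<close> vanish, so the coefficients of \<open>y'\<close> can be divided by
  \<open>i \<lambda>\<^sub>n\<close>.  The resulting series is an antiderivative of \<open>y'\<close> and differs from \<open>y\<close> by a constant.\<close>

lemma W21_coefficients:
  fixes y :: "real \<Rightarrow> 'h::complex_hilbert"
  assumes W: "W21 \<omega> y y'" and per: "y 0 = y \<omega>"
  obtains x where "in_dom r0 x" "\<And>j. cf (hat y') j = (\<i> * of_real (lam r0 j)) *\<^sub>C cf x j" "\<And>s. s \<in> {0..\<omega>} \<Longrightarrow> y s = ser x s"
proof -
  have y': "y' \<in> L2 \<omega>" and int: "\<And>t. t \<in> {0..\<omega>} \<Longrightarrow> integral {0..t} y' = y t - y 0"
    using W by (auto simp: W21_def intro!: integral_unique)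
  have c0: "fc y' 0 = 0" using int[of \<omega>] per omega_pos by (simp add: fc_eq)
  define a where "a = (\<lambda>n. (1 / (\<i> * of_real (lam r0 n))) *\<^sub>C fc y' n)"
  have a: "(\<i> * of_real (lam r0 n)) *\<^sub>C a n = fc y' n" for n
    using r0_pos c0 by (cases "n = 0") (auto simp: a_def lam_def scaleC_scaleC)
  have an: "norm (a n) \<le> 1 / r0 * norm (cf (hat y') n)" for n
  proof (cases "n = 0")
    case False
    then have "1 \<le> \<bar>real_of_int n\<bar>" by linarith
    then have "cmod (1 / (\<i> * of_real (lam r0 n))) \<le> 1 / r0"
      using False omega_pos by (simp add: norm_divide norm_mult lam_def abs_mult divide_simps)
    then show ?thesis by (simp add: a_def norm_scaleC cf_hat(1)[OF y'] mult_right_mono del: divide_divide_eq_right times_divide_eq_left)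
  qed (use omega_pos in \<open>simp add: a_def c0\<close>)
  define x0 where "x0 = Ell2 a"
  have x0: "cf x0 n = a n" for n unfolding x0_def using Ell2_dominated(1)[OF an] by simp
  have dom0: "in_dom r0 x0" unfolding in_dom_def x0 a using cf_square_summable[of "hat y'"] by (simp add: cf_hat(1)[OF y'])
  define x where "x = x0 + single 0 (y 0 - ser x0 0)"
  have x: "(\<i> * of_real (lam r0 j)) *\<^sub>C cf x j = fc y' j" for j
    using a[of j] c0 by (cases "j = 0") (simp_all add: x_def cf_single x0 scaleC_add_right lam_def)
  have dom: "in_dom r0 x" unfolding in_dom_def x using cf_square_summable[of "hat y'"] by (simp add: cf_hat(1)[OF y'])
  have tr: "trig (pN N) (cf x) s = trig (pN N) (cf x0) s + (y 0 - ser x0 0)" for N s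
  proof -
    have "trig (pN N) (cf x) s = (\<Sum>n\<in>pN N. ee n s *\<^sub>C cf x0 n + (if n = 0 then y 0 - ser x0 0 else 0))"
      unfolding trig_def by (rule sum.cong) (auto simp: x_def cf_single scaleC_add_right scaleC_one)
    then show ?thesis by (simp add: sum.distrib trig_def)
  qed
  have "y s = ser x s" if s: "s \<in> {0..\<omega>}" for s
  proof -
    have "W21 \<omega> (ser x0) y'" by (rule W21_of_in_dom(1)[OF dom0 y']) (simp add: x0 a cf_hat(1)[OF y'])
    then have "integral {0..s} y' = ser x0 s - ser x0 0" using s by (auto simp: W21_def intro!: integral_unique)
    then have "y s = ser x0 s + (y 0 - ser x0 0)" using int[OF s] by (simp add: algebra_simps)
    moreover have "(\<lambda>N. trig (pN N) (cf x) s) \<longlonglongrightarrow> ser x0 s + (y 0 - ser x0 0)"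
      unfolding tr by (intro tendsto_intros ser_partial_sums in_dom_abs_summable dom0)
    ultimately show ?thesis using ser_partial_sums[OF in_dom_abs_summable[OF dom], of s] LIMSEQ_unique by metis
  qed
  with dom x show ?thesis by (intro that) (simp_all add: cf_hat(1)[OF y'])
qed

lemma L0_graph_eq:
  "L0_graph \<omega> = lift_graph {(x :: (int, 'h::complex_hilbert) ell2, z). \<forall>j. cf z j = (\<i> * of_real (lam r0 j)) *\<^sub>C cf x j}"
proof (intro equalityI subsetI)
  fix p :: "(real \<Rightarrow> 'h) \<times> (real \<Rightarrow> 'h)" assume "p \<in> L0_graph \<omega>"
  then obtain x z y y' where p: "p = (x, z)" "x \<in> L2 \<omega>" "z \<in> L2 \<omega>" "W21 \<omega> y y'" "y 0 = y \<omega>" "L2_eq \<omega> x y" "L2_eq \<omega> z y'"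
    unfolding L0_graph_def by blast
  obtain \<xi> where \<xi>: "in_dom r0 \<xi>" "\<And>j. cf (hat y') j = (\<i> * of_real (lam r0 j)) *\<^sub>C cf \<xi> j" "\<And>s. s \<in> {0..\<omega>} \<Longrightarrow> y s = ser \<xi> s"
    using W21_coefficients[OF p(4,5)] by metis
  have "hat x = \<xi>"
    using hat_cong[OF p(6)] hat_cong[OF L2_eq_pointwise[of y "ser \<xi>"]] \<xi>(3) hat_ser(2)[OF in_dom_abs_summable[OF \<xi>(1)]] by simp
  then show "p \<in> lift_graph {(x, z). \<forall>j. cf z j = (\<i> * of_real (lam r0 j)) *\<^sub>C cf x j}"
    using p \<xi>(2) hat_cong[OF p(7)] by (simp add: lift_graph_def)
next
  fix p :: "(real \<Rightarrow> 'h) \<times> (real \<Rightarrow> 'h)"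
  assume "p \<in> lift_graph {(x, z). \<forall>j. cf z j = (\<i> * of_real (lam r0 j)) *\<^sub>C cf x j}"
  then obtain x z where p: "p = (x, z)" "x \<in> L2 \<omega>" "z \<in> L2 \<omega>" "\<And>j. cf (hat z) j = (\<i> * of_real (lam r0 j)) *\<^sub>C cf (hat x) j"
    by (auto simp: lift_graph_def)
  have d: "in_dom r0 (hat x)" using cf_square_summable[of "hat z"] by (simp add: in_dom_def p(4))
  have "L2_eq \<omega> x (ser (hat x))" using p hat_ser[OF in_dom_abs_summable[OF d]] by (simp add: L2_eq_iff_hat)
  then show "p \<in> L0_graph \<omega>" unfolding L0_graph_def p(1)
    using p(2,3) W21_of_in_dom[OF d p(3,4)] L2_eq_refl by blast
qed

end

section \<open>Multiplication by an operator-valued potential\<close>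

text \<open>A family of \<open>L\<^sup>2\<close> functions depending linearly on a parameter depends on it boundedly as soon as it does so
  for every fixed argument: the sublevel sets of the square mean are closed by Fatou's lemma, and by Baire's
  theorem one of them contains a ball.\<close>

lemma (in l2_interval) square_mean_bounded:
  fixes V :: "real \<Rightarrow> ('h::complex_hilbert \<Rightarrow>\<^sub>L 'h)"
  assumes V: "\<And>x. (\<lambda>s. blinfun_apply (V s) x) \<in> L2 \<omega>"
  obtains e C where "e > 0" "\<And>h. norm h < e \<Longrightarrow> nsq (\<lambda>s. blinfun_apply (V s) h) \<le> C"
proof -
  define A where "A = (\<lambda>m :: nat. {h. nsq (\<lambda>s. blinfun_apply (V s) h) \<le> real m})"
  have "closed (A m)" for m
  proof (unfold closed_sequential_limits, intro allI impI)
    fix f h assume f: "(\<forall>n. f n \<in> A m) \<and> f \<longlonglongrightarrow> h"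
    have "integral {0..\<omega>} (\<lambda>s. (norm (blinfun_apply (V s) h))\<^sup>2) \<le> real m"
    proof (rule fatou_integral(2)[where N = "{}" and \<phi> = "\<lambda>n s. (norm (blinfun_apply (V s) (f n)))\<^sup>2"])
      show "(\<lambda>s. (norm (blinfun_apply (V s) (f n)))\<^sup>2) integrable_on {0..\<omega>}" for n by (rule L2D[OF V])
      show "\<forall>\<^sub>F n in sequentially. integral {0..\<omega>} (\<lambda>s. (norm (blinfun_apply (V s) (f n)))\<^sup>2) \<le> real m"
        using f by (simp add: A_def nsq_def)
      show "(\<lambda>s. (norm (blinfun_apply (V s) h))\<^sup>2) \<in> borel_measurable (lebesgue_on {0..\<omega>})"
        by (rule borel_measurable_norm_square[OF L2D(1)[OF V]])
      show "(\<lambda>n. (norm (blinfun_apply (V s) (f n)))\<^sup>2) \<longlonglongrightarrow> (norm (blinfun_apply (V s) h))\<^sup>2" for s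
        using f by (intro tendsto_intros) auto
    qed auto
    then show "h \<in> A m" by (simp add: A_def nsq_def)
  qed
  moreover have "\<Union>(range A) = UNIV"
    using real_arch_simple by (auto simp: A_def)
  moreover have "euclidean interior_of \<Union>(range A) = {}" if "\<And>m. interior (A m) = {}"
    by (rule Baire_category_alt)
      (use that \<open>\<And>m. closed (A m)\<close> in \<open>auto simp: completely_metrizable_space_euclidean\<close>)
  ultimately have "\<exists>m. interior (A m) \<noteq> {}" by fastforce
  then obtain m h0 where "h0 \<in> interior (A m)" by blast
  then obtain e where e: "e > 0" "ball h0 e \<subseteq> A m" by (auto simp: mem_interior)
  have "nsq (\<lambda>s. blinfun_apply (V s) h) \<le> 2 * real m + 2 * real m" if h: "norm h < e" for h
  proof -
    have "h0 \<in> A m" "h0 + h \<in> A m" using e h by (auto simp: dist_norm subset_iff)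
    have "nsq (\<lambda>s. blinfun_apply (V s) h) \<le> integral {0..\<omega>} (\<lambda>s. 2 * (norm (blinfun_apply (V s) (h0 + h)))\<^sup>2 + 2 * (norm (blinfun_apply (V s) h0))\<^sup>2)"
      unfolding nsq_def
    proof (rule integral_le)
      show "(\<lambda>s. (norm (blinfun_apply (V s) h))\<^sup>2) integrable_on {0..\<omega>}" by (rule L2D[OF V])
      show "(\<lambda>s. 2 * (norm (blinfun_apply (V s) (h0 + h)))\<^sup>2 + 2 * (norm (blinfun_apply (V s) h0))\<^sup>2) integrable_on {0..\<omega>}"
        by (intro integrable_add integrable_on_mult_right L2D V)
      fix s
      show "(norm (blinfun_apply (V s) h))\<^sup>2 \<le> 2 * (norm (blinfun_apply (V s) (h0 + h)))\<^sup>2 + 2 * (norm (blinfun_apply (V s) h0))\<^sup>2"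
        using square_norm_add_le[of "blinfun_apply (V s) (h0 + h)" "- blinfun_apply (V s) h0"] by (simp add: blinfun.add_right)
    qed
    also have "\<dots> = 2 * nsq (\<lambda>s. blinfun_apply (V s) (h0 + h)) + 2 * nsq (\<lambda>s. blinfun_apply (V s) h0)"
      unfolding nsq_def by (subst integral_add) (auto intro!: integrable_on_mult_right L2D V)
    finally show ?thesis using \<open>h0 \<in> A m\<close> \<open>h0 + h \<in> A m\<close> by (simp add: A_def)
  qed
  with e(1) show ?thesis using that by blast
qed

locale hill_potential = l2_interval +
  fixes V :: "real \<Rightarrow> ('h::complex_hilbert \<Rightarrow>\<^sub>L 'h)"
  assumes V_hom: "\<And>s. s \<in> {0..\<omega>} \<Longrightarrow> complex_homogeneous (blinfun_apply (V s))"
    and V_L2: "\<And>x. (\<lambda>s. blinfun_apply (V s) x) \<in> L2 \<omega>"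
    and V_hat_summable: "(\<lambda>n. (norm (V_hat \<omega> V n))\<^sup>2) summable_on UNIV"
    and V_hat_product_summable:
      "(\<lambda>(j, l). (norm (\<Sum>\<^sub>\<infinity>n\<in>UNIV - {l}.
           (1 / real_of_int (l - n)) *\<^sub>R (V_hat \<omega> V (j + n) o\<^sub>L V_hat \<omega> V (l + n))))\<^sup>2)
         summable_on UNIV"
begin

lemma V_hat_apply: "blinfun_apply (V_hat \<omega> V n) h = fc (\<lambda>s. blinfun_apply (V s) h) n"
proof -
  let ?F = "\<lambda>h. fc (\<lambda>s. blinfun_apply (V s) h) n"
  have lin: "linear ?F"
  proof (rule linearI)
    show "?F (x + y) = ?F x + ?F y" for x y by (simp add: blinfun.add_right fc_add V_L2)
    show "?F (c *\<^sub>R x) = c *\<^sub>R ?F x" for c x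
      using fc_scaleC[OF V_L2, of "of_real c" x n] by (simp add: blinfun.scaleR_right scaleC_of_real)
  qed
  obtain e C where e: "e > 0" "\<And>h. norm h < e \<Longrightarrow> nsq (\<lambda>s. blinfun_apply (V s) h) \<le> C"
    using square_mean_bounded[of V] V_L2 by blast
  have small: "norm (?F h) \<le> sqrt (C / \<omega>)" if "norm h < e" for h
    using fc_le[OF V_L2, of h n] divide_right_mono[OF e(2)[OF that], of \<omega>] omega_pos by (intro real_le_rsqrt) linarith
  have "norm (?F h) \<le> norm h * (sqrt (C / \<omega>) * 2 / e)" for h
  proof (cases "h = 0")
    case False
    define c where "c = e / (2 * norm h)"
    have c: "c > 0" using False e by (simp add: c_def)
    have "norm (?F (c *\<^sub>R h)) \<le> sqrt (C / \<omega>)" by (rule small) (use False e in \<open>simp add: c_def\<close>)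
    then have "c * norm (?F h) \<le> sqrt (C / \<omega>)" using c by (simp add: linear_scale[OF lin])
    then have "norm (?F h) \<le> sqrt (C / \<omega>) / c" using c by (simp add: pos_le_divide_eq mult.commute)
    then show ?thesis using False e by (simp add: c_def field_simps)
  qed (use linear_0[OF lin] in simp)
  then have "bounded_linear ?F" by (intro bounded_linear_intro[where f = ?F and K = "sqrt (C / \<omega>) * 2 / e"]) (auto simp: linear_add[OF lin] linear_scale[OF lin])
  then show ?thesis by (simp add: V_hat_def bounded_linear_Blinfun_apply)
qed

sublocale hankel_potential r0 "V_hat \<omega> V"
proof
  show "r0 > 0" by (rule r0_pos)
  show "complex_homogeneous (blinfun_apply (V_hat \<omega> V n))" for n
    unfolding complex_homogeneous_def
  proof (intro allI)
    fix c x
    have "fc (\<lambda>s. blinfun_apply (V s) (c *\<^sub>C x)) n = fc (\<lambda>s. c *\<^sub>C blinfun_apply (V s) x) n"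
      by (rule fc_cong, rule L2_eq_pointwise) (use V_hom in \<open>simp add: complex_homogeneous_def\<close>)
    then show "blinfun_apply (V_hat \<omega> V n) (c *\<^sub>C x) = c *\<^sub>C blinfun_apply (V_hat \<omega> V n) x"
      by (simp add: V_hat_apply fc_scaleC V_L2)
  qed
qed (fact V_hat_summable V_hat_product_summable)+

lemma norm_hat_V: "norm (hat (\<lambda>s. blinfun_apply (V s) h)) \<le> norm vv * norm h"
proof -
  have "norm (fc (\<lambda>s. blinfun_apply (V s) h) n) \<le> norm h * norm (cf vv n)" for n
    using norm_blinfun[of "V_hat \<omega> V n" h] by (simp add: V_hat_apply cf_vv mult.commute)
  from Ell2_dominated(2)[OF this] show ?thesis by (simp add: hat_def mult.commute)
qed

text \<open>The Fourier coefficients of \<open>s \<mapsto> V(s) y(\<omega> - s)\<close> for an absolutely convergent Fourier series \<open>y\<close>.  The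
  partial sums converge pointwise to the product and in \<open>L\<^sup>2\<close> to the function with the expected coefficients;
  by Fatou's lemma the two limits agree.\<close>

lemma multiplication_coefficients:
  assumes x: "(\<lambda>n. norm (cf x n)) summable_on UNIV"
  shows "(\<lambda>s. blinfun_apply (V s) (ser x (\<omega> - s))) \<in> L2 \<omega>"
    and "cf (hat (\<lambda>s. blinfun_apply (V s) (ser x (\<omega> - s)))) j = dot blinfun_apply (vrow j) x"
proof -
  define u where "u = (\<lambda>n s. ee (- n) s *\<^sub>C blinfun_apply (V s) (cf x n))"
  have uL2: "u n \<in> L2 \<omega>" for n unfolding u_def by (rule L2_ee[OF V_L2])
  have cfu: "cf (hat (u n)) j = blinfun_apply (V_hat \<omega> V (j + n)) (cf x n)" for n j
    unfolding cf_hat(1)[OF uL2] unfolding u_def by (simp add: fc_ee V_hat_apply)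
  have nu: "norm (hat (u n)) \<le> norm vv * norm (cf x n)" for n
  proof -
    have "nsq (u n) = nsq (\<lambda>s. blinfun_apply (V s) (cf x n))" by (simp add: u_def nsq_def norm_scaleC)
    then have "norm (hat (u n)) = norm (hat (\<lambda>s. blinfun_apply (V s) (cf x n)))"
      by (metis L2_norm_eq L2_norm_hat V_L2 uL2)
    then show ?thesis using norm_hat_V by simp
  qed
  have "(\<lambda>n. norm (hat (u n))) summable_on UNIV"
    by (rule summable_on_comparison_test[OF summable_on_cmult_right[OF x, of "norm vv"] nu]) simp
  then have "(\<lambda>n. hat (u n)) summable_on UNIV" by (rule abs_summable_summable)
  then obtain \<zeta> where \<zeta>: "((\<lambda>n. hat (u n)) has_sum \<zeta>) UNIV" by (auto simp: summable_on_def)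
  have cf\<zeta>: "cf \<zeta> j = dot blinfun_apply (vrow j) x" for j
  proof -
    have "((\<lambda>n. cf (hat (u n)) j) has_sum cf \<zeta> j) UNIV"
      using has_sum_bounded_linear[OF bounded_linear_cf[of j] \<zeta>] by (simp add: o_def)
    then have "cf \<zeta> j = (\<Sum>\<^sub>\<infinity>n. cf (hat (u n)) j)" by (simp add: infsumI)
    then show ?thesis by (simp add: dot_def cfu)
  qed
  define f where "f = (\<lambda>s. blinfun_apply (V s) (ser x (\<omega> - s)))"
  define S where "S = (\<lambda>N s. \<Sum>n\<in>pN N. u n s)"
  have SL2: "S N \<in> L2 \<omega>" for N unfolding S_def by (intro L2_sum uL2)
  have S_lim: "(\<lambda>N. S N s) \<longlonglongrightarrow> f s" if s: "s \<in> {0..\<omega>}" for s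
  proof -
    have "S N s = blinfun_apply (V s) (trig (pN N) (cf x) (\<omega> - s))" for N
      using V_hom[OF s] by (simp add: S_def u_def trig_def blinfun.sum_right ee_reflect complex_homogeneous_def)
    then show ?thesis unfolding f_def using ser_partial_sums[OF x, of "\<omega> - s"] by (auto intro!: tendsto_intros)
  qed
  let ?z = "synth \<zeta>"
  have dL2: "(\<lambda>s. S N s - ?z s) \<in> L2 \<omega>" for N by (intro L2_diff SL2 synth)
  have "(\<lambda>N. \<Sum>n\<in>pN N. hat (u n)) \<longlonglongrightarrow> \<zeta>" by (rule has_sum_symmetric_partial_sums[OF \<zeta>])
  then have "(\<lambda>N. hat (S N)) \<longlonglongrightarrow> \<zeta>" by (simp add: S_def hat_sum uL2)
  then have "(\<lambda>N. \<omega> * (norm (hat (S N) - \<zeta>))\<^sup>2) \<longlonglongrightarrow> \<omega> * (norm (\<zeta> - \<zeta>))\<^sup>2" by (intro tendsto_intros)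
  then have nz: "(\<lambda>N. nsq (\<lambda>s. S N s - ?z s)) \<longlonglongrightarrow> 0" by (simp add: parseval[OF dL2] hat_diff SL2)
  let ?\<psi> = "\<lambda>s. (norm (f s - ?z s))\<^sup>2"
  have lim\<psi>: "(\<lambda>N. (norm (S N s - ?z s))\<^sup>2) \<longlonglongrightarrow> ?\<psi> s" if "s \<in> {0..\<omega>}" for s by (intro tendsto_intros S_lim that)
  have m: "?\<psi> \<in> borel_measurable (lebesgue_on {0..\<omega>})"
    by (rule borel_measurable_LIMSEQ_real[OF lim\<psi>]) (auto intro: borel_measurable_norm_square[OF L2D(1)[OF dL2]])
  have F: "?\<psi> integrable_on {0..\<omega>} \<and> integral {0..\<omega>} ?\<psi> \<le> e" if e: "e > 0" for e
  proof -
    have ev: "\<forall>\<^sub>F N in sequentially. integral {0..\<omega>} (\<lambda>s. (norm (S N s - ?z s))\<^sup>2) \<le> e"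
      using order_tendstoD(2)[OF nz e] unfolding nsq_def by (rule eventually_mono) simp
    show ?thesis using fatou_integral[OF L2D(2)[OF dL2] _ ev m _ negligible_empty] lim\<psi> by auto
  qed
  have "integral {0..\<omega>} ?\<psi> \<le> 0" by (rule field_le_epsilon[of _ 0, simplified]) (use F in blast)
  then have "negligible {s \<in> {0..\<omega>}. ?\<psi> s \<noteq> 0}" using F[of 1] by (intro has_integral_zero_negligible) auto
  then have eq: "L2_eq \<omega> f ?z" by (simp add: L2_eq_def)
  show "(\<lambda>s. blinfun_apply (V s) (ser x (\<omega> - s))) \<in> L2 \<omega>"
    using L2_cong[OF synth(1) L2_eq_sym[OF eq]] by (simp add: f_def)
  show "cf (hat (\<lambda>s. blinfun_apply (V s) (ser x (\<omega> - s)))) j = dot blinfun_apply (vrow j) x"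
    using hat_cong[OF eq] by (simp add: f_def cf\<zeta>)
qed

lemma V_graph_eq:
  "V_graph \<omega> V = lift_graph {(x, z). in_dom r0 x \<and> (\<forall>j. cf z j = dot blinfun_apply (vrow j) x)}"
proof (intro equalityI subsetI)
  fix p assume "p \<in> V_graph \<omega> V"
  then obtain x z y y' where p: "p = (x, z)" "x \<in> L2 \<omega>" "z \<in> L2 \<omega>" "W21 \<omega> y y'" "y 0 = y \<omega>" "L2_eq \<omega> x y"
    "L2_eq \<omega> z (\<lambda>s. blinfun_apply (V s) (y (\<omega> - s)))"
    unfolding V_graph_def by blast
  obtain \<xi> where \<xi>: "in_dom r0 \<xi>" "\<And>s. s \<in> {0..\<omega>} \<Longrightarrow> y s = ser \<xi> s"
    using W21_coefficients[OF p(4,5)] by metis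
  have "hat x = \<xi>"
    using hat_cong[OF p(6)] hat_cong[OF L2_eq_pointwise[of y "ser \<xi>"]] \<xi>(2) hat_ser(2)[OF in_dom_abs_summable[OF \<xi>(1)]] by simp
  moreover have "L2_eq \<omega> (\<lambda>s. blinfun_apply (V s) (y (\<omega> - s))) (\<lambda>s. blinfun_apply (V s) (ser \<xi> (\<omega> - s)))"
    by (rule L2_eq_pointwise) (simp add: \<xi>(2))
  from hat_cong[OF L2_eq_trans[OF p(7) this]]
  have "cf (hat z) j = dot blinfun_apply (vrow j) \<xi>" for j
    by (simp add: multiplication_coefficients(2)[OF in_dom_abs_summable[OF \<xi>(1)]])
  ultimately show "p \<in> lift_graph {(x, z). in_dom r0 x \<and> (\<forall>j. cf z j = dot blinfun_apply (vrow j) x)}"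
    using p \<xi>(1) by (simp add: lift_graph_def)
next
  fix p assume "p \<in> lift_graph {(x, z). in_dom r0 x \<and> (\<forall>j. cf z j = dot blinfun_apply (vrow j) x)}"
  then obtain x z where p: "p = (x, z)" "x \<in> L2 \<omega>" "z \<in> L2 \<omega>" "in_dom r0 (hat x)" "\<And>j. cf (hat z) j = dot blinfun_apply (vrow j) (hat x)"
    by (auto simp: lift_graph_def)
  note ax = in_dom_abs_summable[OF p(4)]
  have x: "L2_eq \<omega> x (ser (hat x))" using p hat_ser[OF ax] by (simp add: L2_eq_iff_hat)
  have z: "L2_eq \<omega> z (\<lambda>s. blinfun_apply (V s) (ser (hat x) (\<omega> - s)))"
    using multiplication_coefficients[OF ax] p(3,5) by (subst L2_eq_iff_hat) (auto intro: ell2_eqI)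
  define u where "u = Ell2 (\<lambda>j. (\<i> * of_real (lam r0 j)) *\<^sub>C cf (hat x) j)"
  have "cf u j = (\<i> * of_real (lam r0 j)) *\<^sub>C cf (hat x) j" for j
    unfolding u_def by (subst cf_Ell2) (use p(4) in \<open>auto simp: in_dom_def\<close>)
  then have "W21 \<omega> (ser (hat x)) (synth u)" "ser (hat x) 0 = ser (hat x) \<omega>"
    using W21_of_in_dom[OF p(4), of "synth u"] by simp_all
  then show "p \<in> V_graph \<omega> V" unfolding V_graph_def p(1) using p(2,3) x z by blast
qed

lemma L_graph_eq:
  "L_graph \<omega> V = lift_graph {(x, y). in_dom r0 x \<and> (x, y) \<in> diag_minus r0 (\<lambda>x j. dot blinfun_apply (vrow j) x)}"
proof (intro equalityI subsetI)
  fix p assume "p \<in> L_graph \<omega> V"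
  then obtain x z a b where p: "p = (x, z)" "z \<in> L2 \<omega>" "(x, a) \<in> L0_graph \<omega>" "(x, b) \<in> V_graph \<omega> V" "L2_eq \<omega> z (\<lambda>s. a s - b s)"
    unfolding L_graph_def graph_diff_def by blast
  then show "p \<in> lift_graph {(x, y). in_dom r0 x \<and> (x, y) \<in> diag_minus r0 (\<lambda>x j. dot blinfun_apply (vrow j) x)}"
    using hat_cong[OF p(5)] by (auto simp: L0_graph_eq V_graph_eq lift_graph_def diag_minus_def hat_diff)
next
  fix p assume "p \<in> lift_graph {(x, y). in_dom r0 x \<and> (x, y) \<in> diag_minus r0 (\<lambda>x j. dot blinfun_apply (vrow j) x)}"
  then obtain x z where p: "p = (x, z)" "x \<in> L2 \<omega>" "z \<in> L2 \<omega>" "in_dom r0 (hat x)"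
    "\<And>j. cf (hat z) j = (\<i> * of_real (lam r0 j)) *\<^sub>C cf (hat x) j - dot blinfun_apply (vrow j) (hat x)"
    by (auto simp: lift_graph_def diag_minus_def)
  define u where "u = Ell2 (\<lambda>j. (\<i> * of_real (lam r0 j)) *\<^sub>C cf (hat x) j)"
  have u: "cf u j = (\<i> * of_real (lam r0 j)) *\<^sub>C cf (hat x) j" for j
    unfolding u_def by (subst cf_Ell2) (use p(4) in \<open>auto simp: in_dom_def\<close>)
  have "(x, synth u) \<in> L0_graph \<omega>" using p u by (simp add: L0_graph_eq lift_graph_def)
  moreover have "(x, synth (u - hat z)) \<in> V_graph \<omega> V" using p u by (simp add: V_graph_eq lift_graph_def)
  moreover have "L2_eq \<omega> z (\<lambda>s. synth u s - synth (u - hat z) s)"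
    using p by (simp add: L2_eq_iff_hat L2_diff hat_diff)
  ultimately show "p \<in> L_graph \<omega> V" unfolding L_graph_def graph_diff_def p(1) using p(3) by blast
qed

end

context l2_interval begin

lemma op_graph_lift: "op_graph \<omega> (lift A) = lift_graph {(x, y). y = A x}"
  by (auto simp: op_graph_def lift_graph_def L2_eq_iff_hat)

lemma graph_diff_lift:
  "graph_diff \<omega> (L0_graph \<omega>) (op_graph \<omega> (lift A)) = lift_graph (diag_minus r0 (\<lambda>x. cf (A x)))"
proof (intro equalityI subsetI)
  fix p assume "p \<in> graph_diff \<omega> (L0_graph \<omega>) (op_graph \<omega> (lift A))"
  then obtain x z a b where p: "p = (x, z)" "z \<in> L2 \<omega>" "(x, a) \<in> L0_graph \<omega>" "(x, b) \<in> op_graph \<omega> (lift A)" "L2_eq \<omega> z (\<lambda>s. a s - b s)"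
    unfolding graph_diff_def by blast
  then show "p \<in> lift_graph (diag_minus r0 (\<lambda>x. cf (A x)))"
    using hat_cong[OF p(5)] by (auto simp: L0_graph_eq op_graph_lift lift_graph_def diag_minus_def hat_diff)
next
  fix p assume "p \<in> lift_graph (diag_minus r0 (\<lambda>x. cf (A x)))"
  then obtain x z where p: "p = (x, z)" "x \<in> L2 \<omega>" "z \<in> L2 \<omega>"
    "\<And>j. cf (hat z) j = (\<i> * of_real (lam r0 j)) *\<^sub>C cf (hat x) j - cf (A (hat x)) j"
    by (auto simp: lift_graph_def diag_minus_def)
  have "(x, synth (hat z + A (hat x))) \<in> L0_graph \<omega>" using p by (simp add: L0_graph_eq lift_graph_def)
  moreover have "(x, lift A x) \<in> op_graph \<omega> (lift A)" using p by (simp add: op_graph_lift lift_graph_def)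
  moreover have "L2_eq \<omega> z (\<lambda>s. synth (hat z + A (hat x)) s - lift A x s)"
    using p by (simp add: L2_eq_iff_hat L2_diff hat_diff)
  ultimately show "p \<in> graph_diff \<omega> (L0_graph \<omega>) (op_graph \<omega> (lift A))" unfolding graph_diff_def p(1) using p(3) by blast
qed

end

section \<open>Similarity, spectrum and spectral projections\<close>

lemma diag_minus_Domain:
  fixes A :: "(int, 'h::complex_hilbert) ell2 \<Rightarrow> (int, 'h) ell2"
  shows "Domain (diag_minus r (\<lambda>x. cf (A x))) = {x. in_dom r x}"
proof (intro equalityI subsetI)
  fix x :: "(int, 'h) ell2" assume "x \<in> Domain (diag_minus r (\<lambda>x. cf (A x)))"
  then obtain y where "\<And>j. cf y j = (\<i> * of_real (lam r j)) *\<^sub>C cf x j - cf (A x) j" by (auto simp: diag_minus_def)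
  then have "(\<i> * of_real (lam r j)) *\<^sub>C cf x j = cf (y + A x) j" for j by simp
  then show "x \<in> {x. in_dom r x}" using cf_square_summable[of "y + A x"] by (simp only: in_dom_def mem_Collect_eq)
next
  fix x :: "(int, 'h) ell2" assume "x \<in> {x. in_dom r x}"
  then have s: "(\<lambda>j. (norm ((\<i> * of_real (lam r j)) *\<^sub>C cf x j))\<^sup>2) summable_on UNIV" by (simp add: in_dom_def)
  have "(x, Ell2 (\<lambda>j. (\<i> * of_real (lam r j)) *\<^sub>C cf x j) - A x) \<in> diag_minus r (\<lambda>x. cf (A x))"
    unfolding diag_minus_def using cf_Ell2[OF s] by simp
  then show "x \<in> Domain (diag_minus r (\<lambda>x. cf (A x)))" by (rule DomainI)
qed

lemma pr_disjoint_sum: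
  assumes "finite F" "S \<inter> F = {}" shows "pr S x + (\<Sum>l\<in>F. pr {l} x) = pr (S \<union> F) x"
  unfolding sum_pr_singletons[OF assms(1)] by (rule ell2_eqI) (use assms(2) in auto)

text \<open>The matrix of \<open>W P - P W\<close> for the coordinate projection \<open>P\<close> onto \<open>S\<close> (\<open>mv_commutator_matrix\<close>).\<close>

definition commutator_matrix :: "int set \<Rightarrow> (int \<times> int, 'h::complex_hilbert \<Rightarrow>\<^sub>L 'h) ell2 \<Rightarrow> (int \<times> int, 'h \<Rightarrow>\<^sub>L 'h) ell2"
  where "commutator_matrix S = wt (\<lambda>(j, l). (if l \<in> S then 1 else 0) - (if j \<in> S then 1 else 0))"

lemma bounded_symbol_commutator:
  "bounded_symbol (\<lambda>(j, l). (if l \<in> S then 1 else 0) - (if j \<in> S then 1 else 0))"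
  by (rule bounded_symbolI[of _ 1]) auto

lemma cf_commutator_matrix:
  "cf (commutator_matrix S M) (j, l) = scalar_blinfun ((if l \<in> S then 1 else 0) - (if j \<in> S then 1 else 0)) o\<^sub>L cf M (j, l)"
  unfolding commutator_matrix_def by (simp add: cf_wt[OF bounded_symbol_commutator])

lemma mv_commutator_matrix: "mv (commutator_matrix S M) x = mv M (pr S x) - pr S (mv M x)"
proof (rule ell2_eqI)
  fix j
  have "cf (mv (commutator_matrix S M) x) j = dot blinfun_apply (mrow M j) (pr S x - (if j \<in> S then x else 0))"
    unfolding cf_mv dot_def
    by (rule infsum_cong) (auto simp: cf_mrow cf_commutator_matrix blinfun.diff_right blinfun.minus_right scaleC_one scaleC.minus_left)
  also have "\<dots> = cf (mv M (pr S x) - pr S (mv M x)) j"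
    by (simp add: cf_mv apply_dot.diff_right apply_dot.zero_right)
  finally show "cf (mv (commutator_matrix S M) x) j = cf (mv M (pr S x) - pr S (mv M x)) j" .
qed

text \<open>An entry of the commutator is an entry of \<open>M\<close> up to sign or zero, and it is zero once its row and column
  both belong to \<open>S n\<close>.\<close>

lemma commutator_matrix_tendsto_0:
  assumes "\<And>j. \<forall>\<^sub>F n in sequentially. j \<in> S n"
  shows "(\<lambda>n. commutator_matrix (S n) M) \<longlonglongrightarrow> 0"
proof (rule ell2_dominated_tendsto_0[where Y = M and C = 1])
  let ?a = "\<lambda>n p. cmod ((if snd p \<in> S n then 1 else 0) - (if fst p \<in> S n then 1 else 0))"
  show "norm (cf (commutator_matrix (S n) M) p) \<le> ?a n p * norm (cf M p)" for n p
    by (cases p) (simp only: cf_commutator_matrix fst_conv snd_conv norm_scalar_compose_le)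
  show "0 \<le> ?a n p \<and> ?a n p \<le> 1" for n p by auto
  show "(\<lambda>n. ?a n p) \<longlonglongrightarrow> 0" for p
    by (rule tendsto_eventually) (use eventually_conj[OF assms[of "fst p"] assms[of "snd p"]] in eventually_elim, simp)
qed

locale reduced_hill_potential = hill_potential \<omega> V + B: block_operator "2 * pi / \<omega>" k D
  for \<omega> :: real and V :: "real \<Rightarrow> ('h::complex_hilbert \<Rightarrow>\<^sub>L 'h)" and k and D :: "(int \<times> int, 'h \<Rightarrow>\<^sub>L 'h) ell2" +
  fixes M M' :: "(int \<times> int, 'h \<Rightarrow>\<^sub>L 'h) ell2"
  assumes M_lin: "clinear_matrix M" "clinear_matrix M'"
    and M_inv: "\<And>x. (x + mv M' x) + mv M (x + mv M' x) = x" "\<And>x. (x + mv M x) + mv M' (x + mv M x) = x"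
    and M_sim: "\<forall>(x, y) \<in> diag_minus r0 (\<lambda>x. cf (mv D x)). (x + mv M x, y + mv M y) \<in> diag_minus r0 (\<lambda>x j. dot blinfun_apply (vrow j) x)"
    and M_dom: "\<forall>x. in_dom r0 (x + mv M x) \<longleftrightarrow> in_dom r0 x"
begin

definition T where "T x = x + mv M x"
definition T' where "T' x = x + mv M' x"

lemma T_inv [simp]: "T (T' x) = x" "T' (T x) = x" unfolding T_def T'_def by (rule M_inv)+

lemma T_bounded: "bounded_linear T" "bounded_linear T'"
  unfolding T_def[abs_def] T'_def[abs_def] by (intro bounded_linear_add bounded_linear_ident mv.bounded_linear_right)+

lemma T_hom: "complex_homogeneous T" "complex_homogeneous T'"
  using M_lin unfolding T_def[abs_def] T'_def[abs_def] clinear_matrix_iff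
  by (auto simp: complex_homogeneous_def scaleC_add_right)

definition gL where "gL = {(x, y). in_dom r0 x \<and> (x, y) \<in> diag_minus r0 (\<lambda>x j. dot blinfun_apply (vrow j) x)}"

lemma Domain_gD: "Domain B.gD = {x. in_dom r0 x}" unfolding B.gD_def by (rule diag_minus_Domain)

text \<open>The intertwining relation alone gives the inclusion of the transported graph; the converse holds because the
  similarity maps no vector from outside the domain of \<open>\<Lambda>\<close> into it.\<close>

lemma gL_eq: "gL = (\<lambda>(x, y). (T x, T y)) ` B.gD"
proof (intro equalityI subsetI)
  fix p assume "p \<in> (\<lambda>(x, y). (T x, T y)) ` B.gD"
  then obtain x y where p: "p = (T x, T y)" "(x, y) \<in> B.gD" by auto
  then have "in_dom r0 x" using Domain_gD by blast
  then show "p \<in> gL" using p M_sim M_dom by (auto simp: gL_def T_def B.gD_def)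
next
  fix p assume "p \<in> gL"
  then obtain u w where p: "p = (u, w)" "in_dom r0 u" "(u, w) \<in> diag_minus r0 (\<lambda>x j. dot blinfun_apply (vrow j) x)"
    by (auto simp: gL_def)
  define x where "x = T' u"
  have u: "u = T x" by (simp add: x_def)
  then have "in_dom r0 x" using p(2) M_dom by (simp add: T_def)
  then obtain y where y: "(x, y) \<in> B.gD" using Domain_gD by blast
  then have "(u, T y) \<in> diag_minus r0 (\<lambda>x j. dot blinfun_apply (vrow j) x)" using M_sim by (auto simp: u T_def B.gD_def)
  then have "w = T y" using p(3) by (intro ell2_eqI) (simp add: diag_minus_def)
  then show "p \<in> (\<lambda>(x, y). (T x, T y)) ` B.gD" using y by (auto simp: p(1) u)
qed

lemma L_graph_lift: "L_graph \<omega> V = lift_graph gL" by (simp add: L_graph_eq gL_def)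

lemma Sb_0: "B.Sb 0 = {l. \<bar>l\<bar> \<le> int k}" by (auto simp: B.Sb_def blk_def)
lemma Sb_outer: "\<bar>l\<bar> > int k \<Longrightarrow> B.Sb l = {l}" by (auto simp: B.Sb_def blk_def)

lemma spectrum_L: "spectrum \<omega> (L2 \<omega>) (L_graph \<omega> V) = (\<Union>b\<in>B.blocks. gspec (B.Sb b) B.gD)"
  unfolding L_graph_lift spectrum_L2 gL_eq B.gspec_blocks[symmetric]
  by (rule gspec_similarity[OF T_bounded(1) T_hom(1) T_bounded(2) T_hom(2)]) simp_all

lemma similar: 
  assumes U: "represents UNIV U T"
  shows "continuously_invertible \<omega> U" "similar_via \<omega> (L_graph \<omega> V) (lift_graph B.gD) U"
proof -
  have U': "U f \<in> L2 \<omega>" "hat (U f) = T (hat f)" if "f \<in> L2 \<omega>" for f using U that by (auto simp: represents_def Esub_UNIV)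
  show ci: "continuously_invertible \<omega> U" unfolding continuously_invertible_def
  proof (intro conjI exI[of _ "lift T'"] ballI)
    show "bounded_op \<omega> (L2 \<omega>) U"
      using bounded_opI[OF T_bounded(1) T_hom(1) _ U] by (simp add: Esub_UNIV)
    show "bounded_op \<omega> (L2 \<omega>) (lift T')"
      using bounded_opI[OF T_bounded(2) T_hom(2) _ represents_lift, of UNIV] by (simp add: Esub_UNIV)
    fix f :: "real \<Rightarrow> 'h" assume "f \<in> L2 \<omega>"
    then show "L2_eq \<omega> (lift T' (U f)) f" "L2_eq \<omega> (U (lift T' f)) f" by (simp_all add: L2_eq_iff_hat U')
  qed
  have "L2_image \<omega> U (Domain (lift_graph B.gD)) = Domain (lift_graph gL)"
  proof (intro equalityI subsetI)
    fix f assume "f \<in> L2_image \<omega> U (Domain (lift_graph B.gD))"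
    then obtain x y where f: "f \<in> L2 \<omega>" "L2_eq \<omega> f (U x)" "x \<in> L2 \<omega>" "y \<in> L2 \<omega>" "(hat x, hat y) \<in> B.gD"
      by (auto simp: L2_image_def lift_graph_def)
    then have "(f, lift T y) \<in> lift_graph gL"
      using hat_cong[OF f(2)] by (auto simp: lift_graph_def gL_eq U')
    then show "f \<in> Domain (lift_graph gL)" by (rule DomainI)
  next
    fix f assume "f \<in> Domain (lift_graph gL)"
    then obtain x y where f: "f \<in> L2 \<omega>" "hat f = T x" "(x, y) \<in> B.gD" by (auto simp: lift_graph_def gL_eq)
    then have "(synth x, synth y) \<in> lift_graph B.gD" by (simp add: lift_graph_def)
    moreover have "L2_eq \<omega> f (U (synth x))" using f by (simp add: L2_eq_iff_hat U')
    ultimately show "f \<in> L2_image \<omega> U (Domain (lift_graph B.gD))" using f(1) unfolding L2_image_def by blast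
  qed
  then show "similar_via \<omega> (L_graph \<omega> V) (lift_graph B.gD) U"
    unfolding similar_via_def L_graph_lift using ci by (auto simp: lift_graph_def gL_eq U')
qed

definition Q where "Q b = lift (\<lambda>x. T (pr (B.Sb b) (T' x)))"

text \<open>The resolvent of \<open>L\<close> is the conjugate of that of the block-diagonal operator, and the conjugation commutes with
  the weak contour integral.\<close>

lemma spectral_projection:
  assumes b: "b \<in> B.blocks"
  shows "is_spectral_projection \<omega> (L_graph \<omega> V) (gspec (B.Sb b) B.gD) (Q b)"
  unfolding is_spectral_projection_def
proof (intro conjI)
  let ?g = "circlepath (B.ctr b) (B.rad b)"
  let ?R = "\<lambda>z. lift (\<lambda>x. T (B.Res UNIV z (T' x)))"
  have "bounded_op \<omega> (Esub UNIV) (Q b)" unfolding Q_def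
  proof (rule bounded_opI[OF _ _ _ represents_lift])
    show "bounded_linear (\<lambda>x. T (pr (B.Sb b) (T' x)))"
      by (rule bounded_linear_compose[OF T_bounded(1) bounded_linear_compose[OF bounded_linear_pr T_bounded(2)]])
    show "complex_homogeneous (\<lambda>x. T (pr (B.Sb b) (T' x)))"
      by (rule complex_homogeneous_compose[OF T_hom(1) complex_homogeneous_compose[OF complex_homogeneous_pr T_hom(2)]])
  qed simp
  then show "bounded_op \<omega> (L2 \<omega>) (Q b)" by (simp add: Esub_UNIV)
  have sp: "spectrum \<omega> (L2 \<omega>) (L_graph \<omega> V) = gspec UNIV B.gD" by (simp add: spectrum_L B.gspec_blocks)
  show "gspec (B.Sb b) B.gD \<subseteq> spectrum \<omega> (L2 \<omega>) (L_graph \<omega> V)" using b unfolding spectrum_L by blast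
  show "compact (gspec (B.Sb b) B.gD)" by (rule B.compact_gspec_block[OF b])
  show "closed (spectrum \<omega> (L2 \<omega>) (L_graph \<omega> V) - gspec (B.Sb b) B.gD)" unfolding sp by (rule B.closed_gspec_rest[OF b])
  have image: "path_image ?g = sphere (B.ctr b) (B.rad b)" using B.rad_pos[of b] by simp
  have res: "is_resolvent \<omega> (L2 \<omega>) (L_graph \<omega> V) z (?R z)" if z: "z \<in> path_image ?g" for z
  proof -
    have "cmod (z - B.ctr b) = B.rad b" using z B.rad_pos[of b] by (simp add: image dist_norm norm_minus_commute)
    then have "gres UNIV B.gD z (B.Res UNIV z)"
      by (intro B.gres_Res B.saturated_UNIV B.good_on_circle[OF b])
    then have "gres UNIV gL z (\<lambda>x. T (B.Res UNIV z (T' x)))"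
      unfolding gL_eq by (intro gres_similarity[OF T_bounded(1) T_hom(1) T_bounded(2) T_hom(2)]) simp_all
    from is_resolvent_lift[OF this] show ?thesis by (simp add: Esub_UNIV restriction_L2 L_graph_lift)
  qed
  have inside: "winding_number ?g z = 1" if "z \<in> gspec (B.Sb b) B.gD" for z
    using that B.gspec_block_subset[OF b] by (intro winding_number_circlepath) (auto simp: dist_norm norm_minus_commute)
  have outside: "winding_number ?g z = 0" if z: "z \<in> spectrum \<omega> (L2 \<omega>) (L_graph \<omega> V) - gspec (B.Sb b) B.gD" for z
  proof (rule winding_number_zero_outside)
    obtain b' where "b' \<in> B.blocks" "z \<in> gspec (B.Sb b') B.gD" "b' \<noteq> b" using z unfolding spectrum_L by blast
    then show "z \<notin> cball (B.ctr b) (B.rad b)" using B.gspec_other_block[OF b] by blast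
    show "path_image ?g \<subseteq> cball (B.ctr b) (B.rad b)" using B.rad_pos[of b] by (simp add: image sphere_cball)
  qed simp_all
  have formula: "L2_inner \<omega> (Q b f) g = 1 / (2 * of_real pi * \<i>) * contour_integral ?g (\<lambda>z. L2_inner \<omega> (?R z f) g)"
    if f: "f \<in> L2 \<omega>" and g: "g \<in> L2 \<omega>" for f g :: "real \<Rightarrow> 'h"
  proof -
    let ?\<phi> = "\<lambda>x. cinner (T x) (hat g)"
    have "bounded_linear ?\<phi>" by (rule bounded_linear_compose[OF cinner_cb.bounded_linear_left T_bounded(1)])
    moreover have "?\<phi> (c *\<^sub>C x) = c * ?\<phi> x" for c x
      by (simp add: complex_homogeneousD[OF T_hom(1)] cinner_scaleC_left)
    ultimately have "((\<lambda>z. ?\<phi> (B.Res UNIV z (T' (hat f)))) has_contour_integral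
        (2 * of_real pi * \<i> * ?\<phi> (pr (B.Sb b) (T' (hat f))))) ?g"
      by (rule B.block_contour_integral[OF b])
    from contour_integral_unique[OF this] show ?thesis by (simp add: L2_inner_hat g Q_def)
  qed
  show "\<exists>\<Gamma> R.
        (\<forall>\<gamma>\<in>set \<Gamma>. valid_path \<gamma> \<and> pathfinish \<gamma> = pathstart \<gamma> \<and>
            (\<forall>z\<in>path_image \<gamma>. is_resolvent \<omega> (L2 \<omega>) (L_graph \<omega> V) z (R z))) \<and>
        (\<forall>z\<in>gspec (B.Sb b) B.gD. (\<Sum>\<gamma>\<leftarrow>\<Gamma>. winding_number \<gamma> z) = 1) \<and>
        (\<forall>z\<in>spectrum \<omega> (L2 \<omega>) (L_graph \<omega> V) - gspec (B.Sb b) B.gD. (\<Sum>\<gamma>\<leftarrow>\<Gamma>. winding_number \<gamma> z) = 0) \<and>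
        (\<forall>f\<in>L2 \<omega>. \<forall>g\<in>L2 \<omega>. L2_inner \<omega> (Q b f) g =
            1 / (2 * of_real pi * \<i>) *
              (\<Sum>\<gamma>\<leftarrow>\<Gamma>. contour_integral \<gamma> (\<lambda>z. L2_inner \<omega> (R z f) g)))"
  proof (intro exI conjI ballI)
    show "\<gamma> \<in> set [?g] \<Longrightarrow> valid_path \<gamma>" "\<gamma> \<in> set [?g] \<Longrightarrow> pathfinish \<gamma> = pathstart \<gamma>" for \<gamma> by auto
    show "\<gamma> \<in> set [?g] \<Longrightarrow> z \<in> path_image \<gamma> \<Longrightarrow> is_resolvent \<omega> (L2 \<omega>) (L_graph \<omega> V) z (?R z)" for \<gamma> z
      using res by (metis empty_iff empty_set set_ConsD)
    show "z \<in> gspec (B.Sb b) B.gD \<Longrightarrow> (\<Sum>\<gamma>\<leftarrow>[?g]. winding_number \<gamma> z) = 1" for z by (simp add: inside)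
    show "z \<in> spectrum \<omega> (L2 \<omega>) (L_graph \<omega> V) - gspec (B.Sb b) B.gD \<Longrightarrow> (\<Sum>\<gamma>\<leftarrow>[?g]. winding_number \<gamma> z) = 0" for z
      using outside by simp
    show "f \<in> L2 \<omega> \<Longrightarrow> g \<in> L2 \<omega> \<Longrightarrow> L2_inner \<omega> (Q b f) g = 1 / (2 * of_real pi * \<i>) *
              (\<Sum>\<gamma>\<leftarrow>[?g]. contour_integral \<gamma> (\<lambda>z. L2_inner \<omega> (?R z f) g))" for f g
      using formula by simp
  qed
qed

definition outer :: "nat \<Rightarrow> int set" where "outer n = {l. int k < \<bar>l\<bar> \<and> \<bar>l\<bar> \<le> int n}"

lemma finite_outer: "finite (outer n)"
  unfolding outer_def by (rule finite_subset[of _ "{- int n..int n}"]) auto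

definition defect :: "nat \<Rightarrow> 'h op" where
  "defect n = (\<lambda>x s. Q 0 x s + (\<Sum>l\<in>outer n. Q l x s) - P_upto \<omega> k x s - (\<Sum>l\<in>outer n. P_one \<omega> l x s))"

definition defect_matrix :: "nat \<Rightarrow> (int \<times> int, 'h \<Rightarrow>\<^sub>L 'h) ell2" where
  "defect_matrix n = (let K = commutator_matrix (B.Sb 0 \<union> outer n) M in K + mm K M')"

text \<open>\<open>(I + M) P (I + M)\<^sup>-\<^sup>1 - P = (M P - P M) (I + M)\<^sup>-\<^sup>1\<close>, and the last factor is \<open>I + M'\<close>.\<close>

lemma represents_defect: "represents UNIV (defect n) (mv (defect_matrix n))"
  unfolding represents_def Esub_UNIV
proof
  fix f :: "real \<Rightarrow> 'h" assume f: "f \<in> L2 \<omega>"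
  let ?S = "B.Sb 0 \<union> outer n" and ?x = "hat f"
  have QL: "Q l f \<in> L2 \<omega>" for l by (simp add: Q_def)
  have sumQ: "(\<lambda>s. \<Sum>l\<in>outer n. Q l f s) \<in> L2 \<omega>" and sumP: "(\<lambda>s. \<Sum>l\<in>outer n. P_one \<omega> l f s) \<in> L2 \<omega>"
    by (intro L2_sum QL P_one f)+
  note PL = P_upto(1)[OF f, of k] and L1 = L2_add[OF QL[of 0] sumQ]
  note L2 = L2_diff[OF L1 PL]
  have L: "defect n f \<in> L2 \<omega>" unfolding defect_def by (rule L2_diff[OF L2 sumP])
  interpret T: bounded_linear T by (rule T_bounded)
  have "hat (\<lambda>s. \<Sum>l\<in>outer n. Q l f s) = (\<Sum>l\<in>outer n. T (pr {l} (T' ?x)))"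
    by (subst hat_sum[OF QL]) (auto simp: Q_def Sb_outer outer_def intro!: sum.cong)
  moreover have "hat (\<lambda>s. \<Sum>l\<in>outer n. P_one \<omega> l f s) = (\<Sum>l\<in>outer n. pr {l} ?x)"
    by (subst hat_sum) (auto simp: P_one f)
  ultimately have "hat (defect n f) = T (pr (B.Sb 0) (T' ?x)) + (\<Sum>l\<in>outer n. T (pr {l} (T' ?x))) - pr (B.Sb 0) ?x - (\<Sum>l\<in>outer n. pr {l} ?x)"
    unfolding defect_def hat_diff[OF L2 sumP] hat_diff[OF L1 PL] hat_add[OF QL sumQ] by (simp add: P_upto f Q_def Sb_0)
  also have "\<dots> = T (pr (B.Sb 0) (T' ?x) + (\<Sum>l\<in>outer n. pr {l} (T' ?x))) - (pr (B.Sb 0) ?x + (\<Sum>l\<in>outer n. pr {l} ?x))"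
    by (simp add: T.add T.sum)
  also have "\<dots> = T (pr ?S (T' ?x)) - pr ?S (T (T' ?x))"
    by (subst (1 2) pr_disjoint_sum) (auto simp: finite_outer, auto simp: Sb_0 outer_def)
  also have "\<dots> = mv (commutator_matrix ?S M) (T' ?x)"
    by (rule ell2_eqI) (simp add: T_def mv_commutator_matrix)
  also have "\<dots> = mv (defect_matrix n) ?x"
    by (simp add: T'_def defect_matrix_def Let_def mv.add_left mv.add_right mv_mm)
  finally show "defect n f \<in> L2 \<omega> \<and> hat (defect n f) = mv (defect_matrix n) ?x" using L by simp
qed

lemma clinear_defect_matrix: "clinear_matrix (defect_matrix n)"
  unfolding defect_matrix_def Let_def commutator_matrix_def
  by (intro clinear_matrix_add clinear_matrix_mm clinear_matrix_wt bounded_symbol_commutator M_lin)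

lemma defect_S2: "defect n \<in> S2 \<omega>"
  by (rule S2_matrix(1)[OF clinear_defect_matrix represents_defect])

lemma defect_tendsto_0: "(\<lambda>n. S2_norm \<omega> (defect n)) \<longlonglongrightarrow> 0"
proof (rule tendsto_sandwich[OF _ _ tendsto_const])
  have "(\<lambda>n. commutator_matrix (B.Sb 0 \<union> outer n) M) \<longlonglongrightarrow> 0"
  proof (rule commutator_matrix_tendsto_0)
    fix j
    show "\<forall>\<^sub>F n in sequentially. j \<in> B.Sb 0 \<union> outer n"
      by (rule eventually_sequentiallyI[of "nat \<bar>j\<bar>"]) (auto simp: Sb_0 outer_def)
  qed
  then have "defect_matrix \<longlonglongrightarrow> 0 + mm 0 M'"
    unfolding defect_matrix_def[abs_def] Let_def by (intro tendsto_add mm.tendsto tendsto_const)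
  then show "(\<lambda>n. norm (defect_matrix n)) \<longlonglongrightarrow> 0" by (simp add: mm.zero_left tendsto_norm_zero_iff)
  show "\<forall>\<^sub>F n in sequentially. 0 \<le> S2_norm \<omega> (defect n)"
    by (auto simp: S2_norm_def intro!: always_eventually infsum_nonneg)
  show "\<forall>\<^sub>F n in sequentially. S2_norm \<omega> (defect n) \<le> norm (defect_matrix n)"
    by (intro always_eventually allI S2_matrix(2)[OF clinear_defect_matrix represents_defect])
qed

end

theorem theorem2p9:
  fixes \<omega> :: real and V :: "real \<Rightarrow> ('h::complex_hilbert \<Rightarrow>\<^sub>L 'h)"
  assumes omega_pos: "\<omega> > 0"
    and V_complex_linear: "\<And>s. s \<in> {0..\<omega>} \<Longrightarrow> complex_homogeneous (blinfun_apply (V s))"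
    and V_measurable: "\<And>x. (\<lambda>s. blinfun_apply (V s) x) measurable_on {0..\<omega>}"
    and V_L2: "\<And>x. (\<lambda>s. blinfun_apply (V s) x) \<in> L2 \<omega>"
    and V_hat_summable: "(\<lambda>n. (norm (V_hat \<omega> V n))\<^sup>2) summable_on UNIV"
    and V_hat_product_summable:
      "(\<lambda>(j, l). (norm (\<Sum>\<^sub>\<infinity>n\<in>UNIV - {l}.
           (1 / real_of_int (l - n)) *\<^sub>R (V_hat \<omega> V (j + n) o\<^sub>L V_hat \<omega> V (l + n))))\<^sup>2)
         summable_on UNIV"
  shows "\<exists>(k::nat) (U :: 'h op) (W :: 'h op) (V\<^sub>0 :: 'h op) (\<sigma>\<^sub>k :: complex set) (\<sigma> :: int \<Rightarrow> complex set)
            (Q\<^sub>k :: 'h op) (Q :: int \<Rightarrow> 'h op).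
      U = (\<lambda>x s. x s + W x s) \<and> W \<in> S2 \<omega> \<and> continuously_invertible \<omega> U \<and>
      V\<^sub>0 \<in> S2 \<omega> \<and>
      invariant_subspace V\<^sub>0 (H_upto \<omega> k) \<and>
      (\<forall>l. \<bar>l\<bar> > int k \<longrightarrow> invariant_subspace V\<^sub>0 (H_sub \<omega> l)) \<and>
      similar_via \<omega> (L_graph \<omega> V) (graph_diff \<omega> (L0_graph \<omega>) (op_graph \<omega> V\<^sub>0)) U \<and>
      \<sigma>\<^sub>k = spectrum \<omega> (H_upto \<omega> k)
              (restriction (graph_diff \<omega> (L0_graph \<omega>) (op_graph \<omega> V\<^sub>0)) (H_upto \<omega> k)) \<and>
      (\<forall>l. \<bar>l\<bar> > int k \<longrightarrow>
         \<sigma> l = spectrum \<omega> (H_sub \<omega> l) (restriction (op_graph \<omega> V\<^sub>0) (H_sub \<omega> l))) \<and>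
      spectrum \<omega> (L2 \<omega>) (L_graph \<omega> V) =
        \<sigma>\<^sub>k \<union> (\<Union>l\<in>{l. \<bar>l\<bar> > int k}. (\<lambda>\<mu>. \<i> * of_real (2 * pi * of_int l / \<omega>) - \<mu>) ` \<sigma> l) \<and>
      is_spectral_projection \<omega> (L_graph \<omega> V) \<sigma>\<^sub>k Q\<^sub>k \<and>
      (\<forall>l. \<bar>l\<bar> > int k \<longrightarrow>
         is_spectral_projection \<omega> (L_graph \<omega> V)
           ((\<lambda>\<mu>. \<i> * of_real (2 * pi * of_int l / \<omega>) - \<mu>) ` \<sigma> l) (Q l)) \<and>
      (let D = (\<lambda>(n::nat) x s.
             Q\<^sub>k x s + (\<Sum>l | int k < \<bar>l\<bar> \<and> \<bar>l\<bar> \<le> int n. Q l x s)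
             - P_upto \<omega> k x s - (\<Sum>l | int k < \<bar>l\<bar> \<and> \<bar>l\<bar> \<le> int n. P_one \<omega> l x s))
       in (\<forall>n. D n \<in> S2 \<omega>) \<and> (\<lambda>n. S2_norm \<omega> (D n)) \<longlonglongrightarrow> 0)"
proof -
  interpret hill_potential \<omega> V
    by unfold_locales (use assms in auto)
  obtain k M M' D where M: "clinear_matrix M" "clinear_matrix M'" and D: "clinear_matrix D"
    "\<And>j l. blk k j \<noteq> blk k l \<Longrightarrow> cf D (j, l) = 0" "norm (rw (wa k) D) \<le> r0 / 2"
    and inv: "\<And>x. (x + mv M' x) + mv M (x + mv M' x) = x" "\<And>x. (x + mv M x) + mv M' (x + mv M x) = x"
    and sim: "\<forall>(x, y) \<in> diag_minus r0 (\<lambda>x. cf (mv D x)). (x + mv M x, y + mv M y) \<in> diag_minus r0 (\<lambda>x j. dot blinfun_apply (vrow j) x)"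
    and dom: "\<forall>x. in_dom r0 (x + mv M x) \<longleftrightarrow> in_dom r0 x"
    by (rule block_diagonalization, rule that; assumption)
  interpret B: block_operator r0 k D
    using r0_pos D by unfold_locales
  interpret reduced_hill_potential \<omega> V k D M M'
    using M inv sim dom by unfold_locales
  define V0 where "V0 = lift (mv D)"
  define W where "W = lift (mv M)"
  define U where "U = (\<lambda>(x :: real \<Rightarrow> 'h) s. x s + W x s)"
  define \<sigma>k where "\<sigma>k = gspec (B.Sb 0) B.gD"
  define \<sigma> where "\<sigma> = (\<lambda>l. gspec {l} {(x, y). y = mv D x})"
  have repU: "represents UNIV U T"
    by (simp add: represents_def Esub_UNIV U_def W_def T_def L2_add hat_add)
  have S2: "W \<in> S2 \<omega>" "V0 \<in> S2 \<omega>"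
    unfolding W_def V0_def using S2_matrix(1)[OF _ represents_lift] M(1) D(1) by blast+
  have T0: "graph_diff \<omega> (L0_graph \<omega>) (op_graph \<omega> V0) = lift_graph B.gD"
    unfolding V0_def B.gD_def by (rule graph_diff_lift)
  have V0_inv: "invariant_subspace V0 (Esub (B.Sb b))" for b
    using B.mv_D_supp[OF B.saturated_Sb] by (auto simp: invariant_subspace_def Esub_def V0_def)
  have Hk: "H_upto \<omega> k = (Esub (B.Sb 0) :: (real \<Rightarrow> 'h) set)" by (simp add: H_upto_eq Sb_0)
  have \<sigma>k_eq: "\<sigma>k = spectrum \<omega> (H_upto \<omega> k) (restriction (graph_diff \<omega> (L0_graph \<omega>) (op_graph \<omega> V0)) (H_upto \<omega> k))"
    unfolding T0 Hk spectrum_restriction \<sigma>k_def ..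
  have \<sigma>_eq: "\<sigma> l = spectrum \<omega> (H_sub \<omega> l) (restriction (op_graph \<omega> V0) (H_sub \<omega> l))" for l
    unfolding V0_def op_graph_lift H_sub_eq spectrum_restriction \<sigma>_def ..
  have lam: "\<i> * of_real (lam r0 l) = \<i> * of_real (2 * pi * of_int l / \<omega>)" for l
    by (simp add: lam_def)
  have outer_spec: "gspec (B.Sb l) B.gD = (\<lambda>\<mu>. \<i> * of_real (2 * pi * of_int l / \<omega>) - \<mu>) ` \<sigma> l" if "\<bar>l\<bar> > int k" for l
    unfolding Sb_outer[OF that] B.gspec_singleton[OF that] lam \<sigma>_def ..
  have blocks: "0 \<in> B.blocks" "\<And>l. \<bar>l\<bar> > int k \<Longrightarrow> l \<in> B.blocks" "B.blocks = insert 0 {l. \<bar>l\<bar> > int k}"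
    by (auto simp: B.blocks_def)
  have "spectrum \<omega> (L2 \<omega>) (L_graph \<omega> V) = \<sigma>k \<union> (\<Union>l\<in>{l. \<bar>l\<bar> > int k}. gspec (B.Sb l) B.gD)"
    unfolding spectrum_L blocks(3) \<sigma>k_def by simp
  also have "\<dots> = \<sigma>k \<union> (\<Union>l\<in>{l. \<bar>l\<bar> > int k}. (\<lambda>\<mu>. \<i> * of_real (2 * pi * of_int l / \<omega>) - \<mu>) ` \<sigma> l)"
    using outer_spec by simp
  finally have spec: "spectrum \<omega> (L2 \<omega>) (L_graph \<omega> V) = \<sigma>k \<union> (\<Union>l\<in>{l. \<bar>l\<bar> > int k}. (\<lambda>\<mu>. \<i> * of_real (2 * pi * of_int l / \<omega>) - \<mu>) ` \<sigma> l)" .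
  have proj: "is_spectral_projection \<omega> (L_graph \<omega> V) ((\<lambda>\<mu>. \<i> * of_real (2 * pi * of_int l / \<omega>) - \<mu>) ` \<sigma> l) (Q l)" if "\<bar>l\<bar> > int k" for l
    using spectral_projection[OF blocks(2)[OF that]] that by (simp only: outer_spec)
  have proj0: "is_spectral_projection \<omega> (L_graph \<omega> V) \<sigma>k (Q 0)"
    using spectral_projection[OF blocks(1)] by (simp only: \<sigma>k_def)
  show ?thesis
  proof (intro exI conjI allI impI)
    show "U = (\<lambda>x s. x s + W x s)" by (rule U_def)
    show "W \<in> S2 \<omega>" "V0 \<in> S2 \<omega>" by (fact S2)+
    show "continuously_invertible \<omega> U" by (rule similar(1)[OF repU])
    show "invariant_subspace V0 (H_upto \<omega> k)" unfolding Hk by (rule V0_inv)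
    show "invariant_subspace V0 (H_sub \<omega> l)" if "\<bar>l\<bar> > int k" for l
      using V0_inv[of l] by (simp add: H_sub_eq Sb_outer[OF that])
    show "similar_via \<omega> (L_graph \<omega> V) (graph_diff \<omega> (L0_graph \<omega>) (op_graph \<omega> V0)) U"
      unfolding T0 by (rule similar(2)[OF repU])
    show "let D = (\<lambda>(n::nat) x s.
             Q 0 x s + (\<Sum>l | int k < \<bar>l\<bar> \<and> \<bar>l\<bar> \<le> int n. Q l x s)
             - P_upto \<omega> k x s - (\<Sum>l | int k < \<bar>l\<bar> \<and> \<bar>l\<bar> \<le> int n. P_one \<omega> l x s))
       in (\<forall>n. D n \<in> S2 \<omega>) \<and> (\<lambda>n. S2_norm \<omega> (D n)) \<longlonglongrightarrow> 0"
      unfolding Let_def using defect_S2 defect_tendsto_0 by (simp only: defect_def outer_def) blast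
    show "\<sigma>k = spectrum \<omega> (H_upto \<omega> k) (restriction (graph_diff \<omega> (L0_graph \<omega>) (op_graph \<omega> V0)) (H_upto \<omega> k))"
      by (rule \<sigma>k_eq)
    show "\<sigma> l = spectrum \<omega> (H_sub \<omega> l) (restriction (op_graph \<omega> V0) (H_sub \<omega> l))" for l by (rule \<sigma>_eq)
    show "is_spectral_projection \<omega> (L_graph \<omega> V) \<sigma>k (Q 0)" by (rule proj0)
  qed (fact spec, fact proj)
qed

end
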